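(* In $\mathsf{THS}$: (1) There exists a thin class which is a field of real numbers. (2) In every field of real numbers the prime subfield (which is isomorphic to the field $\mathbb{SQ}$ of standard rationals) is dense. (3) Any two fields of real numbers are isomorphic.
   Context: $\mathsf{THS}$ is a first-order theory in the language with the single binary predicate $\in$; its objects are classes; sets are classes that are members of classes. Axioms: (Ext) extensionality for classes; (Class) comprehension $\exists Y\forall y(y\in Y\leftrightarrow\Phi(y,\vec X))$ for arbitrary formulas $\Phi$, $y$ ranging over sets; (Set) $\emptyset$ and $x\cup\{y\}$ are sets; (Ind) induction $\varphi(\emptyset)\wedge\forall x,y(\varphi(x)\wedge\varphi(y)\to\varphi(x\cup\{y\}))\to\forall x\varphi(x)$ for set formulas $\varphi$ (formulas with quantifiers over sets only and no class variables). A class $X$ is small iff every subclass of it is a set; thin iff each of its subsets is small. (Thin) thin classes are subclasses of sets; (Comp) for thin $X$ and a set $u\subseteq\bigcup X$ there is a set $x\subseteq X$ with $u\subseteq\bigcup x$; (Exp) for every thin $X$ there is thin $P$ with $\forall y\exists p\in P(y\cap X=p\cap X)$; (Choice) a class with thin domain has a function subclass with the same domain; (DC) dependent choices along the class $\mathbb{SN}$ (the smallest class containing $\emptyset$ closed under $n\mapsto n\cup\{n\}$) for arbitrary formulas; (T) transfer of set formulas to the class $\mathbb{S}$ of standard sets (the smallest class containing $\emptyset$ closed under $(a,b)\mapsto a\cup\{b\}$). Natural numbers are transitive sets linearly ordered by $\in$; $\mathbb{Q}$ is the field of rationals built from them (as reduced fractions of integers), and $\mathbb{SQ}=\mathbb{Q}\cap\mathbb{S}$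 is its subfield of standard elements. A field of real numbers is a class $\langle R;+,\cdot,\le\rangle$ satisfying the axioms of a linearly ordered field and the completeness property: every bounded above subclass of $R$ has a supremum. *)

theory Defs
  imports "HOL-Algebra.Subrings"
begin

text \<open>
  A model of the theory is a type \<open>'a\<close> of classes with a binary relation \<open>mem\<close>, and a claim made
  ``in the theory'' is a claim about all models. The axiom schemas range over first-order
  formulas, so these are given by an explicit syntax. Quantifiers over classes always range over
  \<open>'a\<close>; a set of type \<open>'a set\<close> below is a collection that is first-order definable over the model,
  and \<open>the_class\<close> turns it into the element of \<open>'a\<close> that it is the extension of.
\<close>

datatype fm =
    FMem nat nat
  | FEq nat nat
  | FNot fm
  | FAnd fm fm
  | FAll nat fm

text \<open>
  Satisfaction with all quantifiers restricted to \<open>D\<close>: class formulas are evaluated with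
  \<open>D = UNIV\<close>, set formulas with \<open>D\<close> the collection of sets, and the relativization of a set
  formula to the standard sets with \<open>D\<close> the collection of standard sets.
\<close>

primrec sat :: "('a \<Rightarrow> 'a \<Rightarrow> bool) \<Rightarrow> 'a set \<Rightarrow> (nat \<Rightarrow> 'a) \<Rightarrow> fm \<Rightarrow> bool" where
  "sat mem D v (FMem i j) \<longleftrightarrow> mem (v i) (v j)"
| "sat mem D v (FEq i j) \<longleftrightarrow> v i = v j"
| "sat mem D v (FNot \<phi>) \<longleftrightarrow> \<not> sat mem D v \<phi>"
| "sat mem D v (FAnd \<phi> \<psi>) \<longleftrightarrow> sat mem D v \<phi> \<and> sat mem D v \<psi>"
| "sat mem D v (FAll i \<phi>) \<longleftrightarrow> (\<forall>x\<in>D. sat mem D (v(i := x)) \<phi>)"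

record 'a ofield =
  Carr :: 'a
  Add :: 'a
  Mul :: 'a
  Leq :: 'a

context
  fixes mem :: "'a \<Rightarrow> 'a \<Rightarrow> bool" (infix "\<epsilon>" 50)
begin

subsection \<open>Classes, sets, pairs and functions\<close>

definition elts :: "'a \<Rightarrow> 'a set" where
  "elts X = {x. x \<epsilon> X}"

definition the_class :: "'a set \<Rightarrow> 'a" where
  "the_class A = (THE X. elts X = A)"

definition Sets :: "'a set" where
  "Sets = {x. \<exists>X. x \<epsilon> X}"

definition empty :: 'a where
  "empty = the_class {}"

definition adjoin :: "'a \<Rightarrow> 'a \<Rightarrow> 'a" where
  "adjoin x y = the_class (insert y (elts x))"

definition succ :: "'a \<Rightarrow> 'a" where
  "succ n = adjoin n n"

definition pair :: "'a \<Rightarrow> 'a \<Rightarrow> 'a" where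
  "pair x y = the_class {the_class {x}, the_class {x, y}}"

definition dom_of :: "'a \<Rightarrow> 'a set" where
  "dom_of F = {x \<in> Sets. \<exists>y\<in>Sets. pair x y \<epsilon> F}"

definition is_function :: "'a \<Rightarrow> bool" where
  "is_function F \<longleftrightarrow>
     (\<forall>p\<in>elts F. \<exists>x\<in>Sets. \<exists>y\<in>Sets. p = pair x y) \<and>
     (\<forall>x\<in>Sets. \<forall>y\<in>Sets. \<forall>z\<in>Sets. pair x y \<epsilon> F \<and> pair x z \<epsilon> F \<longrightarrow> y = z)"

definition app :: "'a \<Rightarrow> 'a \<Rightarrow> 'a" where
  "app F x = (THE y. y \<in> Sets \<and> pair x y \<epsilon> F)"

subsection \<open>The axioms\<close>

definition small :: "'a \<Rightarrow> bool" where
  "small X \<longleftrightarrow> (\<forall>Y. elts Y \<subseteq> elts X \<longrightarrow> Y \<in> Sets)"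

definition thin :: "'a \<Rightarrow> bool" where
  "thin X \<longleftrightarrow> (\<forall>x\<in>Sets. elts x \<subseteq> elts X \<longrightarrow> small x)"

definition std_nats :: "'a set" where
  "std_nats = \<Inter> {elts X | X. empty \<epsilon> X \<and> (\<forall>n\<in>elts X. succ n \<epsilon> X)}"

definition std_sets :: "'a set" where
  "std_sets = \<Inter> {elts X | X. empty \<epsilon> X \<and> (\<forall>a\<in>elts X. \<forall>b\<in>elts X. adjoin a b \<epsilon> X)}"

definition ax_Ext :: bool where
  "ax_Ext \<longleftrightarrow> (\<forall>X Y. elts X = elts Y \<longrightarrow> X = Y)"

definition ax_Class :: bool where
  "ax_Class \<longleftrightarrow> (\<forall>\<phi> v. \<exists>Y. \<forall>y\<in>Sets. y \<epsilon> Y \<longleftrightarrow> sat mem UNIV (v(0 := y)) \<phi>)"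

definition ax_Set :: bool where
  "ax_Set \<longleftrightarrow>
     (\<exists>e\<in>Sets. elts e = {}) \<and>
     (\<forall>x\<in>Sets. \<forall>y\<in>Sets. \<exists>w\<in>Sets. elts w = insert y (elts x))"

definition ax_Ind :: bool where
  "ax_Ind \<longleftrightarrow> (\<forall>\<phi> v. range v \<subseteq> Sets \<longrightarrow>
     sat mem Sets (v(0 := empty)) \<phi> \<and>
     (\<forall>x\<in>Sets. \<forall>y\<in>Sets. sat mem Sets (v(0 := x)) \<phi> \<and> sat mem Sets (v(0 := y)) \<phi>
        \<longrightarrow> sat mem Sets (v(0 := adjoin x y)) \<phi>) \<longrightarrow>
     (\<forall>x\<in>Sets. sat mem Sets (v(0 := x)) \<phi>))"

definition ax_Thin :: bool where
  "ax_Thin \<longleftrightarrow> (\<forall>X. thin X \<longrightarrow> (\<exists>u\<in>Sets. elts X \<subseteq> elts u))"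

definition ax_Comp :: bool where
  "ax_Comp \<longleftrightarrow> (\<forall>X. \<forall>u\<in>Sets. thin X \<and> elts u \<subseteq> (\<Union>y\<in>elts X. elts y) \<longrightarrow>
     (\<exists>x\<in>Sets. elts x \<subseteq> elts X \<and> elts u \<subseteq> (\<Union>y\<in>elts x. elts y)))"

definition ax_Exp :: bool where
  "ax_Exp \<longleftrightarrow> (\<forall>X. thin X \<longrightarrow>
     (\<exists>P. thin P \<and> (\<forall>y\<in>Sets. \<exists>p\<in>elts P. elts y \<inter> elts X = elts p \<inter> elts X)))"

definition ax_Choice :: bool where
  "ax_Choice \<longleftrightarrow> (\<forall>X D. elts D = dom_of X \<and> thin D \<longrightarrow>
     (\<exists>F. is_function F \<and> elts F \<subseteq> elts X \<and> dom_of F = dom_of X))"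

definition ax_DC :: bool where
  "ax_DC \<longleftrightarrow> (\<forall>\<phi> v.
     (\<forall>x\<in>Sets. \<exists>y\<in>Sets. sat mem UNIV (v(0 := x, 1 := y)) \<phi>) \<longrightarrow>
     (\<forall>x\<in>Sets. \<exists>F. is_function F \<and> dom_of F = std_nats \<and> app F empty = x \<and>
        (\<forall>n\<in>std_nats. sat mem UNIV (v(0 := app F n, 1 := app F (succ n))) \<phi>)))"

definition ax_T :: bool where
  "ax_T \<longleftrightarrow> (\<forall>\<phi> v. range v \<subseteq> std_sets \<longrightarrow> (sat mem std_sets v \<phi> \<longleftrightarrow> sat mem Sets v \<phi>))"

definition THS :: bool where
  "THS \<longleftrightarrow> ax_Ext \<and> ax_Class \<and> ax_Set \<and> ax_Ind \<and> ax_Thin \<and> ax_Comp \<and> ax_Exp \<and>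
     ax_Choice \<and> ax_DC \<and> ax_T"

subsection \<open>Ordered fields\<close>

text \<open>The operations are classes of pairs \<open>\<langle>\<langle>x, y\<rangle>, z\<rangle>\<close>, the order is a class of pairs \<open>\<langle>x, y\<rangle>\<close>.\<close>

definition fadd :: "'a ofield \<Rightarrow> 'a \<Rightarrow> 'a \<Rightarrow> 'a" where
  "fadd K x y = app (Add K) (pair x y)"

definition fmul :: "'a ofield \<Rightarrow> 'a \<Rightarrow> 'a \<Rightarrow> 'a" where
  "fmul K x y = app (Mul K) (pair x y)"

definition fle :: "'a ofield \<Rightarrow> 'a \<Rightarrow> 'a \<Rightarrow> bool" where
  "fle K x y \<longleftrightarrow> pair x y \<epsilon> Leq K"

definition ring_of :: "'a ofield \<Rightarrow> 'a ring" where
  "ring_of K = \<lparr>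
     carrier = elts (Carr K),
     monoid.mult = fmul K,
     one = (THE e. e \<epsilon> Carr K \<and> (\<forall>x\<in>elts (Carr K). fmul K e x = x)),
     zero = (THE e. e \<epsilon> Carr K \<and> (\<forall>x\<in>elts (Carr K). fadd K e x = x)),
     add = fadd K\<rparr>"

definition is_binop :: "'a \<Rightarrow> 'a \<Rightarrow> bool" where
  "is_binop R F \<longleftrightarrow> is_function F \<and> dom_of F = {pair x y | x y. x \<epsilon> R \<and> y \<epsilon> R} \<and>
     (\<forall>x\<in>elts R. \<forall>y\<in>elts R. app F (pair x y) \<epsilon> R)"

definition ordered_field :: "'a ofield \<Rightarrow> bool" where
  "ordered_field K \<longleftrightarrow>
     is_binop (Carr K) (Add K) \<and> is_binop (Carr K) (Mul K) \<and>
     elts (Leq K) \<subseteq> {pair x y | x y. x \<epsilon> Carr K \<and> y \<epsilon> Carr K} \<and>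
     field (ring_of K) \<and>
     linear_order_on (elts (Carr K)) {(x, y). x \<epsilon> Carr K \<and> y \<epsilon> Carr K \<and> fle K x y} \<and>
     (\<forall>x\<in>elts (Carr K). \<forall>y\<in>elts (Carr K). \<forall>z\<in>elts (Carr K).
        fle K x y \<longrightarrow> fle K (fadd K x z) (fadd K y z)) \<and>
     (\<forall>x\<in>elts (Carr K). \<forall>y\<in>elts (Carr K).
        fle K (zero (ring_of K)) x \<and> fle K (zero (ring_of K)) y
          \<longrightarrow> fle K (zero (ring_of K)) (fmul K x y))"

definition is_upper_bound :: "'a ofield \<Rightarrow> 'a \<Rightarrow> 'a \<Rightarrow> bool" where
  "is_upper_bound K X b \<longleftrightarrow> b \<epsilon> Carr K \<and> (\<forall>x\<in>elts X. fle K x b)"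

definition is_supremum :: "'a ofield \<Rightarrow> 'a \<Rightarrow> 'a \<Rightarrow> bool" where
  "is_supremum K X s \<longleftrightarrow> is_upper_bound K X s \<and> (\<forall>b. is_upper_bound K X b \<longrightarrow> fle K s b)"

text \<open>The subclass is required to be nonempty: the empty class has no supremum in any ordered field.\<close>

definition real_field :: "'a ofield \<Rightarrow> bool" where
  "real_field K \<longleftrightarrow> ordered_field K \<and>
     (\<forall>X. elts X \<subseteq> elts (Carr K) \<and> elts X \<noteq> {} \<and> (\<exists>b. is_upper_bound K X b)
        \<longrightarrow> (\<exists>s. is_supremum K X s))"

definition substructure :: "'a ofield \<Rightarrow> 'a \<Rightarrow> 'a ofield" where
  "substructure K P = \<lparr>
     Carr = P,
     Add = the_class {pair (pair x y) (fadd K x y) | x y. x \<epsilon> P \<and> y \<epsilon> P},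
     Mul = the_class {pair (pair x y) (fmul K x y) | x y. x \<epsilon> P \<and> y \<epsilon> P},
     Leq = the_class {pair x y | x y. x \<epsilon> P \<and> y \<epsilon> P \<and> fle K x y}\<rparr>"

definition prime_subfield :: "'a ofield \<Rightarrow> 'a \<Rightarrow> bool" where
  "prime_subfield K P \<longleftrightarrow> subfield (elts P) (ring_of K) \<and>
     (\<forall>Q. subfield (elts Q) (ring_of K) \<longrightarrow> elts P \<subseteq> elts Q)"

definition dense_in :: "'a ofield \<Rightarrow> 'a \<Rightarrow> bool" where
  "dense_in K P \<longleftrightarrow>
     (\<forall>x\<in>elts (Carr K). \<forall>y\<in>elts (Carr K). fle K x y \<and> x \<noteq> y \<longrightarrow>
        (\<exists>q\<in>elts P. fle K x q \<and> x \<noteq> q \<and> fle K q y \<and> q \<noteq> y))"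

definition isomorphic :: "'a ofield \<Rightarrow> 'a ofield \<Rightarrow> bool" where
  "isomorphic K L \<longleftrightarrow> (\<exists>F. is_function F \<and> dom_of F = elts (Carr K) \<and>
     bij_betw (app F) (elts (Carr K)) (elts (Carr L)) \<and>
     (\<forall>x\<in>elts (Carr K). \<forall>y\<in>elts (Carr K).
        app F (fadd K x y) = fadd L (app F x) (app F y) \<and>
        app F (fmul K x y) = fmul L (app F x) (app F y) \<and>
        (fle K x y \<longleftrightarrow> fle L (app F x) (app F y))))"

subsection \<open>Numbers\<close>

definition naturals :: "'a set" where
  "naturals = {n \<in> Sets. (\<forall>x\<in>elts n. elts x \<subseteq> elts n) \<and>
     strict_linear_order_on (elts n) {(x, y). x \<epsilon> n \<and> y \<epsilon> n \<and> x \<epsilon> y}}"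

text \<open>The value at \<open>n\<close> of the sequence starting with \<open>a\<close> and continued by \<open>G\<close>, computed by a set function.\<close>

definition nrec :: "'a \<Rightarrow> ('a \<Rightarrow> 'a) \<Rightarrow> 'a \<Rightarrow> 'a" where
  "nrec a G n = (THE k. \<exists>f\<in>Sets. is_function f \<and> dom_of f = elts (succ n) \<and> app f empty = a \<and>
     (\<forall>i\<in>elts n. app f (succ i) = G (app f i)) \<and> app f n = k)"

definition nadd :: "'a \<Rightarrow> 'a \<Rightarrow> 'a" where
  "nadd m n = nrec m succ n"

definition nmul :: "'a \<Rightarrow> 'a \<Rightarrow> 'a" where
  "nmul m n = nrec empty (\<lambda>x. nadd x m) n"

definition nle :: "'a \<Rightarrow> 'a \<Rightarrow> bool" where
  "nle m n \<longleftrightarrow> m \<epsilon> n \<or> m = n"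

definition pfst :: "'a \<Rightarrow> 'a" where
  "pfst p = (THE x. x \<in> Sets \<and> (\<exists>y\<in>Sets. p = pair x y))"

definition psnd :: "'a \<Rightarrow> 'a" where
  "psnd p = (THE y. y \<in> Sets \<and> (\<exists>x\<in>Sets. p = pair x y))"

text \<open>
  The pair \<open>\<langle>m, n\<rangle>\<close> with \<open>m = 0\<close> or \<open>n = 0\<close> codes the integer \<open>m - n\<close>;
  \<open>zdiff a b\<close> is the code of \<open>a - b\<close> for arbitrary \<open>a\<close>, \<open>b\<close>.
\<close>

definition integers :: "'a set" where
  "integers = {pair m n | m n. m \<in> naturals \<and> n \<in> naturals \<and> (m = empty \<or> n = empty)}"

definition zdiff :: "'a \<Rightarrow> 'a \<Rightarrow> 'a" where
  "zdiff a b = (THE z. z \<in> integers \<and> nadd a (psnd z) = nadd b (pfst z))"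

definition zadd :: "'a \<Rightarrow> 'a \<Rightarrow> 'a" where
  "zadd z w = zdiff (nadd (pfst z) (pfst w)) (nadd (psnd z) (psnd w))"

definition zmul :: "'a \<Rightarrow> 'a \<Rightarrow> 'a" where
  "zmul z w = zdiff (nadd (nmul (pfst z) (pfst w)) (nmul (psnd z) (psnd w)))
                    (nadd (nmul (pfst z) (psnd w)) (nmul (psnd z) (pfst w)))"

definition zle :: "'a \<Rightarrow> 'a \<Rightarrow> bool" where
  "zle z w \<longleftrightarrow> nle (nadd (pfst z) (psnd w)) (nadd (pfst w) (psnd z))"

definition pos_integers :: "'a set" where
  "pos_integers = {pair n empty | n. n \<in> naturals \<and> n \<noteq> empty}"

text \<open>Coprimality: the only common divisors are \<open>1\<close> and \<open>-1\<close>.\<close>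

definition zcoprime :: "'a \<Rightarrow> 'a \<Rightarrow> bool" where
  "zcoprime z d \<longleftrightarrow> (\<forall>c\<in>integers. (\<exists>w\<in>integers. z = zmul c w) \<and> (\<exists>w\<in>integers. d = zmul c w) \<longrightarrow>
     c = pair (succ empty) empty \<or> c = pair empty (succ empty))"

text \<open>
  The pair \<open>\<langle>z, d\<rangle>\<close> codes the reduced fraction \<open>z / d\<close> with positive denominator;
  \<open>qfrac z d\<close> is the code of \<open>z / d\<close> for an arbitrary integer \<open>z\<close> and positive \<open>d\<close>.
\<close>

definition fractions :: "'a set" where
  "fractions = {pair z d | z d. z \<in> integers \<and> d \<in> pos_integers \<and> zcoprime z d}"

definition qfrac :: "'a \<Rightarrow> 'a \<Rightarrow> 'a" where
  "qfrac z d = (THE q. q \<in> fractions \<and> zmul z (psnd q) = zmul (pfst q) d)"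

definition qadd :: "'a \<Rightarrow> 'a \<Rightarrow> 'a" where
  "qadd p q = qfrac (zadd (zmul (pfst p) (psnd q)) (zmul (pfst q) (psnd p)))
                    (zmul (psnd p) (psnd q))"

definition qmul :: "'a \<Rightarrow> 'a \<Rightarrow> 'a" where
  "qmul p q = qfrac (zmul (pfst p) (pfst q)) (zmul (psnd p) (psnd q))"

definition qle :: "'a \<Rightarrow> 'a \<Rightarrow> bool" where
  "qle p q \<longleftrightarrow> zle (zmul (pfst p) (psnd q)) (zmul (pfst q) (psnd p))"

definition rationals :: "'a ofield" where
  "rationals = \<lparr>
     Carr = the_class fractions,
     Add = the_class {pair (pair p q) (qadd p q) | p q. p \<in> fractions \<and> q \<in> fractions},
     Mul = the_class {pair (pair p q) (qmul p q) | p q. p \<in> fractions \<and> q \<in> fractions},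
     Leq = the_class {pair p q | p q. p \<in> fractions \<and> q \<in> fractions \<and> qle p q}\<rparr>"

definition std_rationals :: "'a ofield" where
  "std_rationals = substructure rationals (the_class (fractions \<inter> std_sets))"

end

end

theory Submission
  imports Defs
begin

text \<open>
  A real number is coded by the cut that a bounded element of the nonstandard field of rationals
  makes in the standard rationals. The standard rationals form a thin class, so (Exp) provides a thin
  class of codes for all cuts. Two bounded rationals make the same cut iff their difference is
  infinitesimal, hence the field operations pass from rationals to codes. For completeness, let
  \<open>Y\<close> be the class of standard rationals that lie below some element of a bounded class of reals.
  Any small set of standard rationals is separated by its largest element in \<open>Y\<close>, and
  compactness, a consequence of (Comp), yields a single rational that separates \<open>Y\<close> from its
  complement; the cut it makes is the supremum.

  Conversely, completeness makes a field of real numbers Archimedean. Hence its prime field, which consists of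
  the quotients of differences of standard naturals, is dense, and two such fields are isomorphic
  by relating elements that make the same cut in the rationals.
\<close>

section \<open>Definable predicates\<close>

definition mix :: "(nat \<Rightarrow> 'b) \<Rightarrow> (nat \<Rightarrow> 'b) \<Rightarrow> nat \<Rightarrow> 'b" where
  "mix v p n = (if even n then v (n div 2) else p (n div 2))"

primrec ren :: "(nat \<Rightarrow> nat) \<Rightarrow> fm \<Rightarrow> fm" where
  "ren f (FMem i j) = FMem (f i) (f j)"
| "ren f (FEq i j) = FEq (f i) (f j)"
| "ren f (FNot \<phi>) = FNot (ren f \<phi>)"
| "ren f (FAnd \<phi> \<psi>) = FAnd (ren f \<phi>) (ren f \<psi>)"
| "ren f (FAll i \<phi>) = FAll (f i) (ren f \<phi>)"

lemma sat_ren: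
  assumes "inj f"
  shows "sat mem D v (ren f \<phi>) = sat mem D (\<lambda>n. v (f n)) \<phi>"
proof (induction \<phi> arbitrary: v)
  case (FAll i \<phi>)
  have "(\<lambda>n. (v(f i := x)) (f n)) = (\<lambda>n. v (f n))(i := x)" for x
    using assms by (auto simp: inj_def)
  then show ?case using FAll by simp
qed auto

primrec relativize :: "fm \<Rightarrow> fm" where
  "relativize (FMem i j) = FMem i j"
| "relativize (FEq i j) = FEq i j"
| "relativize (FNot \<phi>) = FNot (relativize \<phi>)"
| "relativize (FAnd \<phi> \<psi>) = FAnd (relativize \<phi>) (relativize \<psi>)"
| "relativize (FAll i \<phi>) = FAll i (FNot (FAnd (FNot (FAll (Suc i) (FNot (FMem i (Suc i))))) (FNot (relativize \<phi>))))"

lemma sat_relativize: "sat mem UNIV v (relativize \<phi>) = sat mem (Sets mem) v \<phi>"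
  by (induction \<phi> arbitrary: v) (auto simp: Sets_def)

locale ths =
  fixes mem :: "'a \<Rightarrow> 'a \<Rightarrow> bool"  (infix "\<epsilon>" 50)
  assumes THS: "THS mem"
begin

abbreviation "\<S> \<equiv> Sets mem"
abbreviation "el \<equiv> elts mem"
abbreviation "cls \<equiv> the_class mem"
abbreviation "emp \<equiv> empty mem"
abbreviation "adj \<equiv> adjoin mem"
abbreviation "suc \<equiv> succ mem"
abbreviation "pr \<equiv> pair mem"

lemma axExt: "el X = el Y \<Longrightarrow> X = Y"
  using THS by (auto simp: THS_def ax_Ext_def)

lemma in_el [simp]: "x \<in> el X \<longleftrightarrow> x \<epsilon> X"
  by (simp add: elts_def)

lemma el_S: "x \<epsilon> X \<Longrightarrow> x \<in> \<S>"
  by (auto simp: Sets_def)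

lemma el_sub_S: "el X \<subseteq> \<S>"
  by (auto intro: el_S)

lemma cls_el [simp]: "cls (el X) = X"
  unfolding the_class_def by (rule the_equality) (auto intro: axExt)

definition is_class :: "'a set \<Rightarrow> bool" where
  "is_class A \<longleftrightarrow> (\<exists>X. el X = A)"

lemma is_class_el [simp]: "is_class (el X)"
  by (auto simp: is_class_def)

lemma el_cls: "is_class A \<Longrightarrow> el (cls A) = A"
  by (auto simp: is_class_def)

lemma is_class_sub_S: "is_class A \<Longrightarrow> A \<subseteq> \<S>"
  by (auto simp: is_class_def intro: el_S)

definition is_set :: "'a set \<Rightarrow> bool" where
  "is_set A \<longleftrightarrow> (\<exists>x\<in>\<S>. el x = A)"

lemma is_set_el [intro]: "x \<in> \<S> \<Longrightarrow> is_set (el x)"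
  by (auto simp: is_set_def)

lemma is_set_class: "is_set A \<Longrightarrow> is_class A"
  by (auto simp: is_class_def is_set_def)

lemma cls_S [intro]: "is_set A \<Longrightarrow> cls A \<in> \<S>"
  by (auto simp: is_set_def)

lemma is_set_empty [intro]: "is_set {}"
  using THS unfolding THS_def ax_Set_def is_set_def by blast

lemma is_set_insert: "is_set A \<Longrightarrow> y \<in> \<S> \<Longrightarrow> is_set (insert y A)"
  using THS unfolding THS_def ax_Set_def is_set_def by blast

lemma emp_S [simp]: "emp \<in> \<S>"
  unfolding empty_def by (intro cls_S is_set_empty)

lemma el_emp [simp]: "el emp = {}"
  unfolding empty_def by (intro el_cls is_set_class is_set_empty)

lemma not_in_emp [simp]: "\<not> x \<epsilon> emp"
  using el_emp by (auto simp: elts_def)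

lemma adj_S [simp]: "x \<in> \<S> \<Longrightarrow> y \<in> \<S> \<Longrightarrow> adj x y \<in> \<S>"
  unfolding adjoin_def by (intro cls_S is_set_insert is_set_el)

lemma el_adj: "x \<in> \<S> \<Longrightarrow> y \<in> \<S> \<Longrightarrow> el (adj x y) = insert y (el x)"
  unfolding adjoin_def by (intro el_cls is_set_class is_set_insert is_set_el)

lemma in_adj: "x \<in> \<S> \<Longrightarrow> y \<in> \<S> \<Longrightarrow> t \<epsilon> adj x y \<longleftrightarrow> t = y \<or> t \<epsilon> x"
  using el_adj[of x y] by (auto simp: elts_def)

lemma adj_absorb: "x \<in> \<S> \<Longrightarrow> y \<epsilon> x \<Longrightarrow> adj x y = x"
  by (rule axExt) (auto simp: el_adj el_S)

lemma suc_S [simp]: "x \<in> \<S> \<Longrightarrow> suc x \<in> \<S>"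
  by (simp add: succ_def)

lemma in_suc: "n \<in> \<S> \<Longrightarrow> k \<epsilon> suc n \<longleftrightarrow> k = n \<or> k \<epsilon> n"
  by (simp add: succ_def in_adj)

lemma set_ext: "(\<And>t. t \<in> \<S> \<Longrightarrow> t \<epsilon> x \<longleftrightarrow> t \<epsilon> y) \<Longrightarrow> x = y"
  by (rule axExt) (auto intro: el_S simp: elts_def)

lemma is_set_single: "x \<in> \<S> \<Longrightarrow> is_set {x}"
  by (intro is_set_insert is_set_empty)

lemma is_set_double: "x \<in> \<S> \<Longrightarrow> y \<in> \<S> \<Longrightarrow> is_set {x, y}"
  by (intro is_set_insert is_set_empty)

lemma el_single: "x \<in> \<S> \<Longrightarrow> el (cls {x}) = {x}"
  by (intro el_cls is_set_class is_set_single)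

lemma el_double: "x \<in> \<S> \<Longrightarrow> y \<in> \<S> \<Longrightarrow> el (cls {x, y}) = {x, y}"
  by (intro el_cls is_set_class is_set_double)

lemma el_pr: "x \<in> \<S> \<Longrightarrow> y \<in> \<S> \<Longrightarrow> el (pr x y) = {cls {x}, cls {x, y}}"
  unfolding pair_def by (intro el_double cls_S is_set_single is_set_double)

lemma pr_S [simp]: "x \<in> \<S> \<Longrightarrow> y \<in> \<S> \<Longrightarrow> pr x y \<in> \<S>"
  unfolding pair_def by (intro cls_S is_set_single is_set_double)

lemma pr_inj:
  assumes "x \<in> \<S>" "y \<in> \<S>" "x' \<in> \<S>" "y' \<in> \<S>"
  shows "pr x y = pr x' y' \<longleftrightarrow> x = x' \<and> y = y'"
proof
  assume "pr x y = pr x' y'"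
  then have "{cls {x}, cls {x, y}} = {cls {x'}, cls {x', y'}}"
    using el_pr assms by metis
  then have "el ` {cls {x}, cls {x, y}} = el ` {cls {x'}, cls {x', y'}}" by simp
  then have "{{x}, {x, y}} = {{x'}, {x', y'}}"
    using assms by (simp add: el_single el_double)
  then show "x = x' \<and> y = y'" by (auto simp: doubleton_eq_iff)
qed auto

text \<open>
  \<open>dfn b P\<close>: the predicate \<open>P\<close> of an assignment of sets to variables is given by a formula with
  quantifiers over sets; the parameters may be classes if \<open>b\<close> holds and must be sets otherwise.
  Variables sit at the even, parameters at the odd positions of the assignment.
\<close>

definition par :: "bool \<Rightarrow> 'a set" where
  "par b = (if b then UNIV else \<S>)"

definition dfn :: "bool \<Rightarrow> ((nat \<Rightarrow> 'a) \<Rightarrow> bool) \<Rightarrow> bool" where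
  "dfn b P \<longleftrightarrow> (\<exists>\<phi> p. range p \<subseteq> par b \<and>
     (\<forall>v. range v \<subseteq> \<S> \<longrightarrow> (P v \<longleftrightarrow> sat mem \<S> (mix v p) \<phi>)))"

definition dterm :: "bool \<Rightarrow> ((nat \<Rightarrow> 'a) \<Rightarrow> 'a) \<Rightarrow> bool" where
  "dterm b t \<longleftrightarrow> (\<forall>v. range v \<subseteq> \<S> \<longrightarrow> t v \<in> \<S>) \<and> dfn b (\<lambda>v. v 0 = t (\<lambda>n. v (Suc n)))"

lemma par_True [simp]: "x \<in> par True"
  by (simp add: par_def)

lemma S_par [simp]: "x \<in> \<S> \<Longrightarrow> x \<in> par b"
  by (simp add: par_def)

lemma envS: "range v \<subseteq> \<S> \<Longrightarrow> v (n::nat) \<in> \<S>"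
  by auto

lemma dfn_cong: "(\<And>v. range v \<subseteq> \<S> \<Longrightarrow> P v = Q v) \<Longrightarrow> dfn b P = dfn b Q"
  by (simp add: dfn_def cong: conj_cong)

lemma dfn_back:
  assumes "dfn b P" "\<And>v. range v \<subseteq> \<S> \<Longrightarrow> P v = Q v"
  shows "dfn b Q"
  using assms(1) dfn_cong[of P Q b, OF assms(2)] by simp

lemma inj_mix:
  fixes f g :: "nat \<Rightarrow> nat"
  assumes "inj f" "inj g"
  shows "inj (\<lambda>k. if even k then 2 * f (k div 2) else 2 * g (k div 2) + 1)" (is "inj ?h")
proof (rule injI)
  fix i j assume eq: "?h i = ?h j"
  then have par: "even i = even j" by (auto split: if_splits) presburger+
  then have "i div 2 = j div 2"
    using eq assms by (cases "even i") (simp_all add: inj_eq)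
  with par show "i = j" by (metis mult_div_mod_eq parity_cases)
qed

lemma dfn_rename:
  assumes f: "inj f" and "dfn b P"
  shows "dfn b (\<lambda>v. P (\<lambda>n. v (f n)))"
proof -
  obtain \<phi> p where p: "range p \<subseteq> par b"
    and P: "\<And>v. range v \<subseteq> \<S> \<Longrightarrow> P v = sat mem \<S> (mix v p) \<phi>"
    using assms(2) unfolding dfn_def by auto
  define g where "g = (\<lambda>k. if even k then 2 * f (k div 2) else 2 * (k div 2) + 1)"
  have "inj g" unfolding g_def by (rule inj_mix[OF f, of "\<lambda>k. k", simplified])
  moreover have "(\<lambda>n. mix v p (g n)) = mix (\<lambda>n. v (f n)) p" for v
    by (auto simp: mix_def g_def)
  moreover have "range (\<lambda>n. v (f n)) \<subseteq> \<S>" if "range v \<subseteq> \<S>" for v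
    using that by auto
  ultimately have "\<forall>v. range v \<subseteq> \<S> \<longrightarrow> (P (\<lambda>n. v (f n)) = sat mem \<S> (mix v p) (ren g \<phi>))"
    using P by (simp add: sat_ren)
  then show ?thesis using p unfolding dfn_def by blast
qed

named_theorems dfn_intros

lemma dfn_not [dfn_intros]: "dfn b P \<Longrightarrow> dfn b (\<lambda>v. \<not> P v)"
proof -
  assume "dfn b P"
  then obtain \<phi> p where "range p \<subseteq> par b" "\<And>v. range v \<subseteq> \<S> \<Longrightarrow> P v = sat mem \<S> (mix v p) \<phi>"
    unfolding dfn_def by auto
  then show "dfn b (\<lambda>v. \<not> P v)" unfolding dfn_def
    by (intro exI[of _ "FNot \<phi>"] exI[of _ p]) simp
qed

lemma dfn_conj [dfn_intros]:
  assumes "dfn b P" "dfn b Q"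
  shows "dfn b (\<lambda>v. P v \<and> Q v)"
proof -
  obtain \<phi> p where p: "range p \<subseteq> par b" "\<And>v. range v \<subseteq> \<S> \<Longrightarrow> P v = sat mem \<S> (mix v p) \<phi>"
    using assms(1) unfolding dfn_def by auto
  obtain \<psi> q where q: "range q \<subseteq> par b" "\<And>v. range v \<subseteq> \<S> \<Longrightarrow> Q v = sat mem \<S> (mix v q) \<psi>"
    using assms(2) unfolding dfn_def by auto
  define f :: "nat \<Rightarrow> nat" where
    "f = (\<lambda>k. if even k then 2 * (k div 2) else 2 * (2 * (k div 2)) + 1)"
  define g :: "nat \<Rightarrow> nat" where
    "g = (\<lambda>k. if even k then 2 * (k div 2) else 2 * (2 * (k div 2) + 1) + 1)"
  have "inj f" unfolding f_def
    by (rule inj_mix[of "\<lambda>k. k" "\<lambda>k. 2 * k"]) (auto simp: inj_def)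
  moreover have "inj g" unfolding g_def
    by (rule inj_mix[of "\<lambda>k. k" "\<lambda>k. 2 * k + 1"]) (auto simp: inj_def)
  moreover have "(\<lambda>n. mix v (mix p q) (f n)) = mix v p" for v
    by (rule ext) (auto simp: mix_def f_def elim!: oddE)
  moreover have "(\<lambda>n. mix v (mix p q) (g n)) = mix v q" for v
    by (rule ext) (auto simp: mix_def g_def elim!: oddE)
  ultimately have "\<forall>v. range v \<subseteq> \<S> \<longrightarrow>
      ((P v \<and> Q v) = sat mem \<S> (mix v (mix p q)) (FAnd (ren f \<phi>) (ren g \<psi>)))"
    using p q by (simp add: sat_ren)
  moreover have "range (mix p q) \<subseteq> par b" using p q by (auto simp: mix_def)
  ultimately show ?thesis unfolding dfn_def by blast
qed

lemma dfn_disj [dfn_intros]: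
  assumes "dfn b P" "dfn b Q"
  shows "dfn b (\<lambda>v. P v \<or> Q v)"
proof -
  have "dfn b (\<lambda>v. \<not> (\<not> P v \<and> \<not> Q v))" by (intro dfn_intros assms)
  then show ?thesis by (rule dfn_back) auto
qed

lemma dfn_imp [dfn_intros]:
  assumes "dfn b P" "dfn b Q"
  shows "dfn b (\<lambda>v. P v \<longrightarrow> Q v)"
proof -
  have "dfn b (\<lambda>v. \<not> P v \<or> Q v)" by (intro dfn_intros assms)
  then show ?thesis by (rule dfn_back) auto
qed

lemma dfn_iff [dfn_intros]:
  assumes "dfn b P" "dfn b Q"
  shows "dfn b (\<lambda>v. P v \<longleftrightarrow> Q v)"
proof -
  have "dfn b (\<lambda>v. (P v \<longrightarrow> Q v) \<and> (Q v \<longrightarrow> P v))" by (intro dfn_intros assms)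
  then show ?thesis by (rule dfn_back) auto
qed

lemma dfn_all [dfn_intros]:
  assumes "dfn b (\<lambda>v. P (v 0) (\<lambda>n. v (Suc n)))"
  shows "dfn b (\<lambda>v. \<forall>x\<in>\<S>. P x v)"
proof -
  obtain \<phi> p where p: "range p \<subseteq> par b"
    and P: "\<And>v. range v \<subseteq> \<S> \<Longrightarrow> P (v 0) (\<lambda>n. v (Suc n)) = sat mem \<S> (mix v p) \<phi>"
    using assms unfolding dfn_def by auto
  define q where "q n = p (n - 1)" for n
  define f where "f k = (if k = 0 then 1 else if even k then k - 2 else k + 2)" for k :: nat
  have "inj f" by (rule injI) (simp add: f_def split: if_splits, presburger+)
  moreover have "(\<lambda>n. ((mix v q)(1 := x)) (f n)) = mix (case_nat x v) p" for v x
  proof (rule ext)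
    fix n show "((mix v q)(1 := x)) (f n) = mix (case_nat x v) p n"
    proof (cases "even n")
      case True
      then obtain k where "n = 2 * k" by blast
      then show ?thesis by (cases k) (auto simp: f_def mix_def)
    qed (auto simp: f_def mix_def q_def elim!: oddE)
  qed
  moreover have "P x v = sat mem \<S> (mix (case_nat x v) p) \<phi>"
    if "range v \<subseteq> \<S>" "x \<in> \<S>" for v x
  proof -
    have "range (case_nat x v) \<subseteq> \<S>" using that by (auto split: nat.splits simp: envS)
    from P[OF this] show ?thesis by simp
  qed
  ultimately have "\<forall>v. range v \<subseteq> \<S> \<longrightarrow>
      ((\<forall>x\<in>\<S>. P x v) = sat mem \<S> (mix v q) (FAll 1 (ren f \<phi>)))"
    by (simp add: sat_ren del: fun_upd_apply)
  moreover have "range q \<subseteq> par b" using p by (auto simp: q_def)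
  ultimately show ?thesis unfolding dfn_def by blast
qed

lemma dfn_ex [dfn_intros]:
  assumes "dfn b (\<lambda>v. P (v 0) (\<lambda>n. v (Suc n)))"
  shows "dfn b (\<lambda>v. \<exists>x\<in>\<S>. P x v)"
proof -
  have "dfn b (\<lambda>v. \<not> (\<forall>x\<in>\<S>. \<not> P x v))" by (intro dfn_intros assms)
  then show ?thesis by (rule dfn_back) auto
qed

lemma dfn_var_mem: "dfn b (\<lambda>v. v i \<epsilon> v j)" and dfn_var_eq: "dfn b (\<lambda>v. v i = v j)"
proof -
  have "range (\<lambda>_::nat. emp) \<subseteq> par b" by auto
  then show "dfn b (\<lambda>v. v i \<epsilon> v j)" "dfn b (\<lambda>v. v i = v j)" unfolding dfn_def
    by (intro exI[of _ "FMem (2*i) (2*j)"] exI[of _ "\<lambda>_. emp"], simp add: mix_def)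
      (intro exI[of _ "FEq (2*i) (2*j)"] exI[of _ "\<lambda>_. emp"], simp add: mix_def)
qed

lemma dfn_mem_const: "X \<in> par b \<Longrightarrow> dfn b (\<lambda>v. v i \<epsilon> X)"
  and dfn_eq_const: "X \<in> par b \<Longrightarrow> dfn b (\<lambda>v. v i = X)"
proof -
  assume X: "X \<in> par b"
  show "dfn b (\<lambda>v. v i \<epsilon> X)" "dfn b (\<lambda>v. v i = X)" unfolding dfn_def
    by (intro exI[of _ "FMem (2*i) 1"] exI[of _ "\<lambda>_. X"], use X in \<open>auto simp: mix_def\<close>)
      (intro exI[of _ "FEq (2*i) 1"] exI[of _ "\<lambda>_. X"], use X in \<open>auto simp: mix_def\<close>)
qed

lemma dfn_const [dfn_intros]: "dfn b (\<lambda>v. c)"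
proof (cases c)
  case True
  then show ?thesis using dfn_var_eq[of b 0 0] by simp
next
  case False
  then show ?thesis using dfn_not[OF dfn_var_eq[of b 0 0]] by simp
qed

lemma dterm_var [dfn_intros]: "dterm b (\<lambda>v. v i)"
  unfolding dterm_def using dfn_var_eq by auto

lemma dterm_const [dfn_intros]: "c \<in> \<S> \<Longrightarrow> dterm b (\<lambda>v. c)"
  unfolding dterm_def using dfn_eq_const by auto

lemma dtermD: "dterm b t \<Longrightarrow> range v \<subseteq> \<S> \<Longrightarrow> t v \<in> \<S>"
  by (simp add: dterm_def)

lemma dterm_shift: "dterm b t \<Longrightarrow> dterm b (\<lambda>v. t (\<lambda>n. v (Suc n)))"
proof -
  assume t: "dterm b t"
  have "inj (\<lambda>n::nat. case n of 0 \<Rightarrow> 0 | Suc n \<Rightarrow> Suc (Suc n))"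
    by (auto simp: inj_def split: nat.splits)
  moreover have "dfn b (\<lambda>v. v 0 = t (\<lambda>n. v (Suc n)))" using t by (simp add: dterm_def)
  ultimately have "dfn b (\<lambda>v. v 0 = t (\<lambda>n. v (Suc (Suc n))))"
    by (drule_tac dfn_rename) auto
  moreover have "t (\<lambda>n. v (Suc n)) \<in> \<S>" if "range v \<subseteq> \<S>" for v
  proof -
    have "range (\<lambda>n. v (Suc n)) \<subseteq> \<S>" using that by auto
    then show ?thesis using t by (simp add: dterm_def)
  qed
  ultimately show ?thesis by (simp add: dterm_def)
qed

lemma dfn_subst:
  assumes P: "dfn b (\<lambda>v. P (v 0) (\<lambda>n. v (Suc n)))" and t: "dterm b t"
  shows "dfn b (\<lambda>v. P (t v) v)"
proof -
  have "dfn b (\<lambda>v. \<exists>x\<in>\<S>. x = t v \<and> P x v)"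
    by (intro dfn_intros P) (use t in \<open>simp add: dterm_def\<close>)
  then show ?thesis
    by (subst dfn_cong[where Q = "\<lambda>v. \<exists>x\<in>\<S>. x = t v \<and> P x v"]) (auto dest: dtermD[OF t])
qed

lemma dfn_subst2:
  assumes P: "dfn b (\<lambda>v. P (v 0) (v 1) (\<lambda>n. v (Suc (Suc n))))" and t: "dterm b t" and s: "dterm b s"
  shows "dfn b (\<lambda>v. P (t v) (s v) v)"
proof (rule dfn_subst[OF _ t])
  let ?sw = "\<lambda>n::nat. if n = 0 then 1 else if n = 1 then 0 else n"
  have "inj ?sw" by (auto simp: inj_def)
  from dfn_rename[OF this P]
  have "dfn b (\<lambda>v. P (v 1) (v 0) (\<lambda>n. v (Suc (Suc n))))" by simp
  then show "dfn b (\<lambda>v. P (v 0) (s (\<lambda>n. v (Suc n))) (\<lambda>n. v (Suc n)))"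
    using dfn_subst[where P = "\<lambda>x v. P (v 0) x (\<lambda>n. v (Suc n))" and t = "\<lambda>v. s (\<lambda>n. v (Suc n))"]
      dterm_shift[OF s] by simp
qed

lemma dfn_subst3:
  assumes P: "dfn b (\<lambda>v. P (v 0) (v 1) (v 2))" and t: "dterm b t" and s: "dterm b s" and r: "dterm b r"
  shows "dfn b (\<lambda>v. P (t v) (s v) (r v))"
proof (rule dfn_subst2[OF _ t s])
  let ?rot = "\<lambda>n::nat. if n = 0 then 1 else if n = 1 then 2 else if n = 2 then 0 else n"
  have "inj ?rot" by (auto simp: inj_def)
  from dfn_rename[OF this P]
  have "dfn b (\<lambda>v. P (v 1) (v 2) (v 0))" by (simp add: numeral_2_eq_2)
  then show "dfn b (\<lambda>v. P (v 0) (v 1) (r (\<lambda>n. v (Suc (Suc n)))))"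
    using dfn_subst[where P = "\<lambda>x v. P (v 0) (v 1) x" and t = "\<lambda>v. r (\<lambda>n. v (Suc (Suc n)))"]
      dterm_shift[OF dterm_shift[OF r]] by (simp add: numeral_2_eq_2)
qed

lemma dterm_subst2:
  assumes f: "dterm b (\<lambda>v. f (v 0) (v 1))" and t: "dterm b t" and s: "dterm b s"
  shows "dterm b (\<lambda>v. f (t v) (s v))"
proof -
  have S: "f x y \<in> \<S>" if "x \<in> \<S>" "y \<in> \<S>" for x y
    using dtermD[OF f, of "\<lambda>n. if n = 0 then x else y"] that by auto
  have "dfn b (\<lambda>v. v 0 = f (v 1) (v 2))"
    using f by (simp add: dterm_def numeral_2_eq_2)
  from dfn_subst3[of b "\<lambda>x y z. x = f y z", OF this dterm_var dterm_shift[OF t] dterm_shift[OF s]]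
  show ?thesis using S dtermD[OF t] dtermD[OF s] by (simp add: dterm_def)
qed

lemma dterm_subst1:
  assumes f: "dterm b (\<lambda>v. f (v 0))" and t: "dterm b t"
  shows "dterm b (\<lambda>v. f (t v))"
  using dterm_subst2[of b "\<lambda>x y. f x" t t] f t by simp

lemma dfn_mem [dfn_intros]: "dterm b t \<Longrightarrow> dterm b s \<Longrightarrow> dfn b (\<lambda>v. t v \<epsilon> s v)"
  by (rule dfn_subst2[of b "\<lambda>x y v. x \<epsilon> y"]) (auto intro: dfn_var_mem)

lemma dfn_eq [dfn_intros]: "dterm b t \<Longrightarrow> dterm b s \<Longrightarrow> dfn b (\<lambda>v. t v = s v)"
  by (rule dfn_subst2[of b "\<lambda>x y v. x = y"]) (auto intro: dfn_var_eq)

lemma dfn_mem_class [dfn_intros]: "X \<in> par b \<Longrightarrow> dterm b t \<Longrightarrow> dfn b (\<lambda>v. t v \<epsilon> X)"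
  by (rule dfn_subst[of b "\<lambda>x v. x \<epsilon> X"]) (auto intro: dfn_mem_const)

lemma dfn_in_class [dfn_intros]: "is_class A \<Longrightarrow> dterm True t \<Longrightarrow> dfn True (\<lambda>v. t v \<in> A)"
  using dfn_mem_class[of "cls A" True t] el_cls[of A] in_el[of _ "cls A"] by simp

lemma dfn_in_S [dfn_intros]: "dterm b t \<Longrightarrow> dfn b (\<lambda>v. t v \<in> \<S>)"
  by (subst dfn_cong[where Q = "\<lambda>v. True"]) (auto dest: dtermD intro: dfn_const)

lemma dfn_ball [dfn_intros]:
  assumes "dterm b t" "dfn b (\<lambda>v. P (v 0) (\<lambda>n. v (Suc n)))"
  shows "dfn b (\<lambda>v. \<forall>x\<in>el (t v). P x v)"
proof -
  have "dfn b (\<lambda>v. \<forall>x\<in>\<S>. x \<epsilon> t v \<longrightarrow> P x v)"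
    by (intro dfn_intros dterm_shift assms)
  then show ?thesis by (rule dfn_back) (auto simp: Ball_def intro: el_S)
qed

lemma dfn_bex [dfn_intros]:
  assumes "dterm b t" "dfn b (\<lambda>v. P (v 0) (\<lambda>n. v (Suc n)))"
  shows "dfn b (\<lambda>v. \<exists>x\<in>el (t v). P x v)"
proof -
  have "dfn b (\<lambda>v. \<not> (\<forall>x\<in>el (t v). \<not> P x v))" by (intro dfn_intros assms)
  then show ?thesis by (rule dfn_back) auto
qed

lemma dfn_ball_class [dfn_intros]:
  assumes "is_class A" "dfn True (\<lambda>v. P (v 0) (\<lambda>n. v (Suc n)))"
  shows "dfn True (\<lambda>v. \<forall>x\<in>A. P x v)"
proof -
  have "dfn True (\<lambda>v. \<forall>x\<in>\<S>. x \<in> A \<longrightarrow> P x v)"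
    by (intro dfn_intros dterm_shift assms)
  then show ?thesis
    by (rule dfn_back) (use is_class_sub_S[OF assms(1)] in \<open>auto simp: Ball_def\<close>)
qed

lemma dfn_bex_class [dfn_intros]:
  assumes "is_class A" "dfn True (\<lambda>v. P (v 0) (\<lambda>n. v (Suc n)))"
  shows "dfn True (\<lambda>v. \<exists>x\<in>A. P x v)"
proof -
  have "dfn True (\<lambda>v. \<not> (\<forall>x\<in>A. \<not> P x v))" by (intro dfn_intros assms)
  then show ?thesis by (rule dfn_back) auto
qed

lemma dfn_subset [dfn_intros]:
  assumes "dterm b t" "dterm b s"
  shows "dfn b (\<lambda>v. el (t v) \<subseteq> el (s v))"
proof -
  have "dfn b (\<lambda>v. \<forall>x\<in>el (t v). x \<epsilon> s v)"
    by (intro dfn_intros dterm_shift assms)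
  then show ?thesis by (rule dfn_back) (auto simp: Ball_def elts_def)
qed

lemma dterm_adj [dfn_intros]:
  assumes "dterm b t" "dterm b s"
  shows "dterm b (\<lambda>v. adj (t v) (s v))"
proof (rule dterm_subst2[OF _ assms])
  have "dfn b (\<lambda>v. \<forall>x\<in>\<S>. x \<epsilon> v 0 \<longleftrightarrow> x = v 2 \<or> x \<epsilon> v 1)"
    by (intro dfn_intros)
  moreover have "v 0 = adj (v 1) (v 2) \<longleftrightarrow> (\<forall>x\<in>\<S>. x \<epsilon> v 0 \<longleftrightarrow> x = v 2 \<or> x \<epsilon> v 1)"
    if "range v \<subseteq> \<S>" for v :: "nat \<Rightarrow> 'a"
  proof -
    have "v 1 \<in> \<S>" "v 2 \<in> \<S>" using that by auto
    then show ?thesis using set_ext[of "v 0" "adj (v 1) (v 2)"] by (auto simp: in_adj)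
  qed
  ultimately have "dfn b (\<lambda>v. v 0 = adj (v 1) (v 2))"
    by (subst dfn_cong) auto
  then show "dterm b (\<lambda>v. adj (v 0) (v 1))"
    unfolding dterm_def by (auto simp: numeral_2_eq_2 envS)
qed

lemma dterm_suc [dfn_intros]: "dterm b t \<Longrightarrow> dterm b (\<lambda>v. suc (t v))"
  unfolding succ_def by (intro dfn_intros)

lemma pr_adj: "x \<in> \<S> \<Longrightarrow> y \<in> \<S> \<Longrightarrow> pr x y = adj (adj emp (adj emp x)) (adj (adj emp x) y)"
proof -
  assume S: "x \<in> \<S>" "y \<in> \<S>"
  have "cls {x} = adj emp x" "cls {x, y} = adj (adj emp x) y"
    by (rule axExt; use S in \<open>auto simp: el_single el_double el_adj\<close>)+
  then show ?thesis by (intro axExt) (use S in \<open>auto simp: el_pr el_adj\<close>)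
qed

lemma dterm_pr [dfn_intros]:
  assumes "dterm b t" "dterm b s"
  shows "dterm b (\<lambda>v. pr (t v) (s v))"
proof (rule dterm_subst2[OF _ assms])
  have "dterm b (\<lambda>v. adj (adj emp (adj emp (v 0))) (adj (adj emp (v 0)) (v 1)))"
    by (intro dfn_intros emp_S)
  moreover have "dfn b (\<lambda>v. v 0 = pr (v 1) (v 2)) =
     dfn b (\<lambda>v. v 0 = adj (adj emp (adj emp (v 1))) (adj (adj emp (v 1)) (v 2)))"
    by (rule dfn_cong) (auto simp: pr_adj envS)
  ultimately show "dterm b (\<lambda>v. pr (v 0) (v 1))"
    unfolding dterm_def by (auto simp: numeral_2_eq_2 envS)
qed

lemma mix_upd: "(mix v p)(0 := y) = mix (v(0 := y)) p"
proof (rule ext)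
  fix n
  show "((mix v p)(0 := y)) n = mix (v(0 := y)) p n"
  proof (cases "n = 0")
    case False
    then have "n div 2 = 0 \<Longrightarrow> odd n" by presburger
    with False show ?thesis by (auto simp: mix_def)
  qed (simp add: mix_def)
qed

lemma env_upd: "y \<in> \<S> \<Longrightarrow> range ((\<lambda>_::nat. emp)(0 := y)) \<subseteq> \<S>"
  by auto

lemma comprehension:
  assumes "dfn True (\<lambda>v. P (v 0))"
  shows "is_class {x \<in> \<S>. P x}"
proof -
  obtain \<phi> p where P: "\<And>v. range v \<subseteq> \<S> \<Longrightarrow> P (v 0) = sat mem \<S> (mix v p) \<phi>"
    using assms unfolding dfn_def by auto
  have "ax_Class mem" using THS by (simp add: THS_def)
  then obtain Y where Y: "\<forall>y\<in>\<S>. y \<epsilon> Y \<longleftrightarrow> sat mem UNIV ((mix (\<lambda>_. emp) p)(0 := y)) (relativize \<phi>)"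
    unfolding ax_Class_def by blast
  have "(mix (\<lambda>_. emp) p)(0 := y) = mix ((\<lambda>_. emp)(0 := y)) p" for y
    by (rule mix_upd)
  then have "\<forall>y\<in>\<S>. y \<epsilon> Y \<longleftrightarrow> P y"
    using Y P[OF env_upd] by (simp add: sat_relativize)
  then have "el Y = {x \<in> \<S>. P x}" using el_S by auto
  then show ?thesis by (auto simp: is_class_def)
qed

lemma set_induct:
  assumes P: "dfn False (\<lambda>v. P (v 0))" and "x \<in> \<S>" "P emp"
    and step: "\<And>x y. x \<in> \<S> \<Longrightarrow> y \<in> \<S> \<Longrightarrow> P x \<Longrightarrow> P y \<Longrightarrow> P (adj x y)"
  shows "P x"
proof -
  obtain \<phi> p where p: "range p \<subseteq> \<S>" and P: "\<And>v. range v \<subseteq> \<S> \<Longrightarrow> P (v 0) = sat mem \<S> (mix v p) \<phi>"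
    using P unfolding dfn_def par_def by auto
  define w where "w = mix (\<lambda>_. emp) p"
  have "range w \<subseteq> \<S>" using p by (auto simp: w_def mix_def)
  moreover have "w(0 := y) = mix ((\<lambda>_. emp)(0 := y)) p" for y
    unfolding w_def by (rule mix_upd)
  then have *: "sat mem \<S> (w(0 := y)) \<phi> = P y" if "y \<in> \<S>" for y
    using P[OF env_upd[OF that]] by simp
  moreover have "ax_Ind mem" using THS by (simp add: THS_def)
  ultimately have "sat mem \<S> (w(0 := emp)) \<phi> \<and> (\<forall>x\<in>\<S>. \<forall>y\<in>\<S>.
      sat mem \<S> (w(0 := x)) \<phi> \<and> sat mem \<S> (w(0 := y)) \<phi> \<longrightarrow> sat mem \<S> (w(0 := adj x y)) \<phi>)
      \<longrightarrow> (\<forall>x\<in>\<S>. sat mem \<S> (w(0 := x)) \<phi>)"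
    unfolding ax_Ind_def by blast
  then show ?thesis using * assms(2,3) step by auto
qed

lemma el_induct:
  assumes P: "dfn False (\<lambda>v. P (v 0))" and x: "x \<in> \<S>"
    and step: "\<And>x. x \<in> \<S> \<Longrightarrow> (\<And>y. y \<epsilon> x \<Longrightarrow> P y) \<Longrightarrow> P x"
  shows "P x"
proof -
  have "P x \<and> (\<forall>y\<in>el x. P y)"
  proof (rule set_induct[of "\<lambda>x. P x \<and> (\<forall>y\<in>el x. P y)", OF _ x])
    have "dfn False (\<lambda>v. P (v 0))" by fact
    then show "dfn False (\<lambda>v. P (v 0) \<and> (\<forall>y\<in>el (v 0). P y))"
      by (intro dfn_intros)
    show "P emp \<and> (\<forall>y\<in>el emp. P y)" using step[of emp] by simp
    fix x y assume *: "x \<in> \<S>" "y \<in> \<S>" "P x \<and> (\<forall>y\<in>el x. P y)" "P y \<and> (\<forall>y\<in>el y. P y)"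
    then have "\<And>t. t \<epsilon> adj x y \<Longrightarrow> P t" by (auto simp: in_adj)
    then show "P (adj x y) \<and> (\<forall>y\<in>el (adj x y). P y)" using step * by simp
  qed
  then show ?thesis by simp
qed

lemma separation:
  assumes P: "dfn False (\<lambda>v. P (v 0))" and x: "is_set A"
  shows "is_set {y \<in> A. P y}"
proof -
  obtain x where x: "x \<in> \<S>" and A: "A = el x" using assms(2) by (auto simp: is_set_def)
  have "\<exists>w\<in>\<S>. \<forall>t\<in>\<S>. t \<epsilon> w \<longleftrightarrow> t \<epsilon> x \<and> P t"
  proof (rule set_induct[of "\<lambda>x. \<exists>w\<in>\<S>. \<forall>t\<in>\<S>. t \<epsilon> w \<longleftrightarrow> t \<epsilon> x \<and> P t", OF _ x])
    show "dfn False (\<lambda>v. \<exists>w\<in>\<S>. \<forall>t\<in>\<S>. t \<epsilon> w \<longleftrightarrow> t \<epsilon> v 0 \<and> P t)"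
      by (intro dfn_intros P)
    show "\<exists>w\<in>\<S>. \<forall>t\<in>\<S>. t \<epsilon> w \<longleftrightarrow> t \<epsilon> emp \<and> P t"
      by (rule bexI[of _ emp]) auto
    fix x y assume *: "x \<in> \<S>" "y \<in> \<S>" "\<exists>w\<in>\<S>. \<forall>t\<in>\<S>. t \<epsilon> w \<longleftrightarrow> t \<epsilon> x \<and> P t"
    then obtain w where w: "w \<in> \<S>" "\<forall>t\<in>\<S>. t \<epsilon> w \<longleftrightarrow> t \<epsilon> x \<and> P t" by blast
    show "\<exists>w\<in>\<S>. \<forall>t\<in>\<S>. t \<epsilon> w \<longleftrightarrow> t \<epsilon> adj x y \<and> P t"
    proof (cases "P y")
      case True
      then show ?thesis using w * by (intro bexI[of _ "adj w y"]) (auto simp: in_adj)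
    next
      case False
      then show ?thesis using w * by (intro bexI[of _ w]) (auto simp: in_adj)
    qed
  qed
  then obtain w where w: "w \<in> \<S>" "\<forall>t\<in>\<S>. t \<epsilon> w \<longleftrightarrow> t \<epsilon> x \<and> P t" by blast
  then have "el w = {y \<in> A. P y}" using A el_S by auto
  then show ?thesis using w by (auto simp: is_set_def)
qed

section \<open>Sets\<close>

lemma is_setE:
  assumes "is_set A" obtains x where "x \<in> \<S>" "el x = A"
  using assms by (auto simp: is_set_def)

lemma is_setI: "\<exists>w\<in>\<S>. \<forall>t\<in>\<S>. t \<epsilon> w \<longleftrightarrow> Q t \<Longrightarrow> is_set {t \<in> \<S>. Q t}"
proof -
  assume "\<exists>w\<in>\<S>. \<forall>t\<in>\<S>. t \<epsilon> w \<longleftrightarrow> Q t"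
  then obtain w where "w \<in> \<S>" "\<forall>t\<in>\<S>. t \<epsilon> w \<longleftrightarrow> Q t" by blast
  then show ?thesis using el_S unfolding is_set_def by (intro bexI[of _ w]) auto
qed

lemma nonempty_el: "x \<noteq> emp \<Longrightarrow> \<exists>a. a \<epsilon> x"
  using axExt[of x emp] by (auto simp: set_eq_iff)

lemma replacement:
  assumes f: "dterm False (\<lambda>v. f (v 0))" and A: "is_set A"
  shows "is_set (f ` A)"
proof -
  obtain x where x: "x \<in> \<S>" and A: "A = el x" using A by (auto simp: is_set_def)
  have fS: "f y \<in> \<S>" if "y \<in> \<S>" for y using dtermD[OF f, of "\<lambda>_. y"] that by auto
  have df: "\<And>t. dterm False t \<Longrightarrow> dterm False (\<lambda>v. f (t v))" by (rule dterm_subst1[OF f])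
  have "\<exists>w\<in>\<S>. \<forall>t\<in>\<S>. t \<epsilon> w \<longleftrightarrow> (\<exists>y\<in>el x. t = f y)"
  proof (rule set_induct[of "\<lambda>x. \<exists>w\<in>\<S>. \<forall>t\<in>\<S>. t \<epsilon> w \<longleftrightarrow> (\<exists>y\<in>el x. t = f y)", OF _ x])
    show "dfn False (\<lambda>v. \<exists>w\<in>\<S>. \<forall>t\<in>\<S>. t \<epsilon> w \<longleftrightarrow> (\<exists>y\<in>el (v 0). t = f y))"
      by (intro dfn_intros df)
    show "\<exists>w\<in>\<S>. \<forall>t\<in>\<S>. t \<epsilon> w \<longleftrightarrow> (\<exists>y\<in>el emp. t = f y)" by (rule bexI[of _ emp]) auto
    fix x y assume *: "x \<in> \<S>" "y \<in> \<S>" "\<exists>w\<in>\<S>. \<forall>t\<in>\<S>. t \<epsilon> w \<longleftrightarrow> (\<exists>y\<in>el x. t = f y)"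
    then obtain w where "w \<in> \<S>" "\<forall>t\<in>\<S>. t \<epsilon> w \<longleftrightarrow> (\<exists>y\<in>el x. t = f y)" by blast
    then show "\<exists>w\<in>\<S>. \<forall>t\<in>\<S>. t \<epsilon> w \<longleftrightarrow> (\<exists>y\<in>el (adj x y). t = f y)"
      using * fS by (intro bexI[of _ "adj w (f y)"]) (auto simp: in_adj el_adj)
  qed
  then obtain w where "w \<in> \<S>" "\<forall>t\<in>\<S>. t \<epsilon> w \<longleftrightarrow> (\<exists>y\<in>el x. t = f y)" by blast
  then have "el w = f ` A" using fS el_S A by (auto simp: image_iff)
  then show ?thesis using \<open>w \<in> \<S>\<close> by (auto simp: is_set_def)
qed

lemma is_set_Un:
  assumes "is_set A" "is_set B"
  shows "is_set (A \<union> B)"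
proof -
  obtain x y where x: "x \<in> \<S>" "A = el x" and y: "y \<in> \<S>" "B = el y"
    using assms by (auto simp: is_set_def)
  have "\<exists>w\<in>\<S>. \<forall>t\<in>\<S>. t \<epsilon> w \<longleftrightarrow> t \<epsilon> x \<or> t \<epsilon> y"
  proof (rule set_induct[of "\<lambda>x. \<exists>w\<in>\<S>. \<forall>t\<in>\<S>. t \<epsilon> w \<longleftrightarrow> t \<epsilon> x \<or> t \<epsilon> y", OF _ x(1)])
    show "dfn False (\<lambda>v. \<exists>w\<in>\<S>. \<forall>t\<in>\<S>. t \<epsilon> w \<longleftrightarrow> t \<epsilon> v 0 \<or> t \<epsilon> y)"
      by (intro dfn_intros y)
    show "\<exists>w\<in>\<S>. \<forall>t\<in>\<S>. t \<epsilon> w \<longleftrightarrow> t \<epsilon> emp \<or> t \<epsilon> y" using y by auto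
    fix x a assume *: "x \<in> \<S>" "a \<in> \<S>" "\<exists>w\<in>\<S>. \<forall>t\<in>\<S>. t \<epsilon> w \<longleftrightarrow> t \<epsilon> x \<or> t \<epsilon> y"
    then obtain w where "w \<in> \<S>" "\<forall>t\<in>\<S>. t \<epsilon> w \<longleftrightarrow> t \<epsilon> x \<or> t \<epsilon> y" by blast
    then show "\<exists>w\<in>\<S>. \<forall>t\<in>\<S>. t \<epsilon> w \<longleftrightarrow> t \<epsilon> adj x a \<or> t \<epsilon> y"
      using * by (intro bexI[of _ "adj w a"]) (auto simp: in_adj)
  qed
  then obtain w where "w \<in> \<S>" "\<forall>t\<in>\<S>. t \<epsilon> w \<longleftrightarrow> t \<epsilon> x \<or> t \<epsilon> y" by blast
  moreover from this have "el w = A \<union> B" using x y el_S by auto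
  ultimately show ?thesis by (auto simp: is_set_def)
qed

lemma is_set_Union:
  assumes x: "x \<in> \<S>"
  shows "is_set (\<Union>y\<in>el x. el y)"
proof -
  have "\<exists>w\<in>\<S>. \<forall>t\<in>\<S>. t \<epsilon> w \<longleftrightarrow> (\<exists>y\<in>el x. t \<epsilon> y)"
  proof (rule set_induct[of "\<lambda>x. \<exists>w\<in>\<S>. \<forall>t\<in>\<S>. t \<epsilon> w \<longleftrightarrow> (\<exists>y\<in>el x. t \<epsilon> y)", OF _ x])
    show "dfn False (\<lambda>v. \<exists>w\<in>\<S>. \<forall>t\<in>\<S>. t \<epsilon> w \<longleftrightarrow> (\<exists>y\<in>el (v 0). t \<epsilon> y))"
      by (intro dfn_intros)
    show "\<exists>w\<in>\<S>. \<forall>t\<in>\<S>. t \<epsilon> w \<longleftrightarrow> (\<exists>y\<in>el emp. t \<epsilon> y)" by (rule bexI[of _ emp]) auto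
    fix x a assume *: "x \<in> \<S>" "a \<in> \<S>" "\<exists>w\<in>\<S>. \<forall>t\<in>\<S>. t \<epsilon> w \<longleftrightarrow> (\<exists>y\<in>el x. t \<epsilon> y)"
    then obtain w where w: "w \<in> \<S>" "\<forall>t\<in>\<S>. t \<epsilon> w \<longleftrightarrow> (\<exists>y\<in>el x. t \<epsilon> y)" by blast
    have "is_set (el w \<union> el a)" using w * by (intro is_set_Un) auto
    then obtain w' where "w' \<in> \<S>" "el w' = el w \<union> el a" by (auto simp: is_set_def)
    then have "\<forall>t\<in>\<S>. t \<epsilon> w' \<longleftrightarrow> (\<exists>y\<in>el (adj x a). t \<epsilon> y)"
      using w * in_el[of _ w'] by (simp add: el_adj) (auto simp: elts_def)
    then show "\<exists>w\<in>\<S>. \<forall>t\<in>\<S>. t \<epsilon> w \<longleftrightarrow> (\<exists>y\<in>el (adj x a). t \<epsilon> y)"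
      using \<open>w' \<in> \<S>\<close> by blast
  qed
  then have "is_set {t \<in> \<S>. \<exists>y\<in>el x. t \<epsilon> y}" by (rule is_setI)
  then show ?thesis by (rule back_subst[of is_set]) (auto intro: el_S)
qed

lemma is_set_Pow:
  assumes x: "x \<in> \<S>"
  shows "is_set {y \<in> \<S>. el y \<subseteq> el x}"
proof -
  have "\<exists>w\<in>\<S>. \<forall>y\<in>\<S>. y \<epsilon> w \<longleftrightarrow> el y \<subseteq> el x"
  proof (rule set_induct[of "\<lambda>x. \<exists>w\<in>\<S>. \<forall>y\<in>\<S>. y \<epsilon> w \<longleftrightarrow> el y \<subseteq> el x", OF _ x])
    show "dfn False (\<lambda>v. \<exists>w\<in>\<S>. \<forall>y\<in>\<S>. y \<epsilon> w \<longleftrightarrow> el y \<subseteq> el (v 0))"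
      by (intro dfn_intros)
    have "el y = {} \<longleftrightarrow> y = emp" for y by (auto intro: axExt)
    then show "\<exists>w\<in>\<S>. \<forall>y\<in>\<S>. y \<epsilon> w \<longleftrightarrow> el y \<subseteq> el emp"
      by (intro bexI[of _ "adj emp emp"]) (auto simp: in_adj)
    fix x a assume *: "x \<in> \<S>" "a \<in> \<S>" "\<exists>w\<in>\<S>. \<forall>y\<in>\<S>. y \<epsilon> w \<longleftrightarrow> el y \<subseteq> el x"
    then obtain w where w: "w \<in> \<S>" "\<forall>y\<in>\<S>. y \<epsilon> w \<longleftrightarrow> el y \<subseteq> el x" by blast
    have "dterm False (\<lambda>v. adj (v 0) a)" using * by (intro dfn_intros)
    from is_set_Un[OF is_set_el[OF w(1)] replacement[OF this is_set_el[OF w(1)]]]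
    obtain w' where w': "w' \<in> \<S>" "el w' = el w \<union> (\<lambda>y. adj y a) ` el w" by (rule is_setE)
    have "y \<epsilon> w' \<longleftrightarrow> el y \<subseteq> el (adj x a)" if y: "y \<in> \<S>" for y
    proof
      assume "y \<epsilon> w'"
      then consider "y \<epsilon> w" | z where "z \<epsilon> w" "y = adj z a" using w'(2) in_el[of y w'] by auto
      then show "el y \<subseteq> el (adj x a)"
      proof cases
        case (2 z)
        then have "z \<in> \<S>" "el z \<subseteq> el x" using w el_S by blast+
        then show ?thesis using 2 * by (auto simp: el_adj simp del: in_el)
      qed (use w y * in \<open>auto simp: el_adj simp del: in_el\<close>)
    next
      assume sub: "el y \<subseteq> el (adj x a)"
      have "dfn False (\<lambda>v. v 0 \<noteq> a)" using * by (intro dfn_intros)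
      from separation[OF this is_set_el[OF y]]
      obtain z where z: "z \<in> \<S>" "el z = {t \<in> el y. t \<noteq> a}" by (rule is_setE)
      have "z \<epsilon> w" using w z sub * by (auto simp: el_adj)
      moreover have "y = z \<or> y = adj z a"
        using z * by (cases "a \<epsilon> y") (auto intro!: axExt simp: el_adj)
      ultimately have "y \<in> el w'" unfolding w'(2) by auto
      then show "y \<epsilon> w'" by simp
    qed
    then show "\<exists>w\<in>\<S>. \<forall>y\<in>\<S>. y \<epsilon> w \<longleftrightarrow> el y \<subseteq> el (adj x a)" using w' by blast
  qed
  then obtain w where "w \<in> \<S>" "\<forall>y\<in>\<S>. y \<epsilon> w \<longleftrightarrow> el y \<subseteq> el x" by blast
  moreover from this have "el w = {y \<in> \<S>. el y \<subseteq> el x}" using el_S by auto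
  ultimately show ?thesis by (auto simp: is_set_def)
qed

definition field_of :: "'a \<Rightarrow> 'a set" where
  "field_of z = (\<Union>p\<in>(\<Union>y\<in>el z. el y). el p)"

lemma is_set_field_of: "z \<in> \<S> \<Longrightarrow> is_set (field_of z)"
proof -
  assume "z \<in> \<S>"
  then obtain w where "w \<in> \<S>" "el w = (\<Union>y\<in>el z. el y)"
    using is_setE[OF is_set_Union] by metis
  then show ?thesis unfolding field_of_def using is_set_Union by metis
qed

lemma field_of_pr:
  assumes "x \<in> \<S>" "y \<in> \<S>" "pr x y \<epsilon> z"
  shows "x \<in> field_of z" "y \<in> field_of z"
proof -
  have "cls {x, y} \<in> el (pr x y)" using assms by (simp add: el_pr del: in_el)
  moreover have "x \<in> el (cls {x, y})" "y \<in> el (cls {x, y})"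
    using assms by (simp_all add: el_double del: in_el)
  ultimately have "\<exists>q\<in>el z. \<exists>c\<in>el q. x \<epsilon> c \<and> y \<epsilon> c"
    using assms(3) by (intro bexI[of _ "pr x y"] bexI[of _ "cls {x, y}"]) auto
  then show "x \<in> field_of z" "y \<in> field_of z"
    unfolding field_of_def by auto
qed

lemma is_set_dom: "z \<in> \<S> \<Longrightarrow> is_set {x \<in> \<S>. \<exists>y\<in>\<S>. pr x y \<epsilon> z}"
proof -
  assume z: "z \<in> \<S>"
  have "dfn False (\<lambda>v. \<exists>y\<in>\<S>. pr (v 0) y \<epsilon> z)" by (intro dfn_intros z)
  from separation[OF this is_set_field_of[OF z]]
  show ?thesis
    by (rule back_subst[of is_set]) (use is_class_sub_S[OF is_set_class[OF is_set_field_of[OF z]]] in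
      \<open>auto dest: field_of_pr\<close>)
qed

lemma is_set_ran: "z \<in> \<S> \<Longrightarrow> is_set {y \<in> \<S>. \<exists>x\<in>\<S>. pr x y \<epsilon> z}"
proof -
  assume z: "z \<in> \<S>"
  have "dfn False (\<lambda>v. \<exists>x\<in>\<S>. pr x (v 0) \<epsilon> z)" by (intro dfn_intros z)
  from separation[OF this is_set_field_of[OF z]]
  show ?thesis
    by (rule back_subst[of is_set]) (use is_class_sub_S[OF is_set_class[OF is_set_field_of[OF z]]] in
      \<open>auto dest: field_of_pr\<close>)
qed

lemma minimal_subset:
  assumes x: "x \<in> \<S>" and "x \<noteq> emp"
  shows "\<exists>y\<in>el x. \<forall>z\<in>el x. \<not> el z \<subset> el y"
proof -
  have "x = emp \<or> (\<exists>y\<in>el x. \<forall>z\<in>el x. el z \<subseteq> el y \<longrightarrow> el y \<subseteq> el z)"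
  proof (rule set_induct[of "\<lambda>x. x = emp \<or> (\<exists>y\<in>el x. \<forall>z\<in>el x. el z \<subseteq> el y \<longrightarrow> el y \<subseteq> el z)", OF _ x])
    show "dfn False (\<lambda>v. v 0 = emp \<or> (\<exists>y\<in>el (v 0). \<forall>z\<in>el (v 0). el z \<subseteq> el y \<longrightarrow> el y \<subseteq> el z))"
      by (intro dfn_intros emp_S)
    fix x a assume *: "x \<in> \<S>" "a \<in> \<S>" "x = emp \<or> (\<exists>y\<in>el x. \<forall>z\<in>el x. el z \<subseteq> el y \<longrightarrow> el y \<subseteq> el z)"
    show "adj x a = emp \<or> (\<exists>y\<in>el (adj x a). \<forall>z\<in>el (adj x a). el z \<subseteq> el y \<longrightarrow> el y \<subseteq> el z)"
    proof (cases "x = emp")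
      case False
      then obtain y where y: "y \<epsilon> x" "\<And>z. z \<epsilon> x \<Longrightarrow> el z \<subseteq> el y \<Longrightarrow> el y \<subseteq> el z" using * by auto
      show ?thesis
      proof (cases "el a \<subset> el y")
        case True
        then have "el a \<subseteq> el z" if "z \<epsilon> x" "el z \<subseteq> el a" for z using that y(2)[of z] by blast
        then show ?thesis using * by (intro disjI2 bexI[of _ a]) (simp_all add: el_adj)
      next
        case False
        then have "el y \<subseteq> el z" if "z \<epsilon> adj x a" "el z \<subseteq> el y" for z
          using that y(2)[of z] * by (cases "z = a") (auto simp: in_adj psubset_eq)
        then show ?thesis using * y by (intro disjI2 bexI[of _ y]) (simp_all add: in_adj)
      qed
    qed (use * in \<open>auto simp: el_adj\<close>)
  qed simp
  then show ?thesis using assms by auto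
qed

section \<open>Small and thin classes\<close>

text \<open>
  Every set \<open>x\<close> has a hyperfinite chain \<open>c\<close> of subsets that ends in \<open>x\<close> and grows by one element
  \<open>a\<close>, a top of \<open>y\<close>, at each step. If \<open>x\<close> is small then any class of tops is a set, so that
  an induction along \<open>c\<close> may use arbitrary class formulas.
\<close>

definition top_of :: "'a \<Rightarrow> 'a \<Rightarrow> 'a \<Rightarrow> bool" where
  "top_of c a y \<longleftrightarrow> (\<exists>y'\<in>\<S>. y = adj y' a \<and> \<not> a \<epsilon> y' \<and> (y' = emp \<or> y' \<epsilon> c))"

definition chain_to :: "'a \<Rightarrow> 'a \<Rightarrow> bool" where
  "chain_to c x \<longleftrightarrow> (\<forall>y\<in>el c. el y \<subseteq> el x) \<and> (x = emp \<or> x \<epsilon> c) \<and>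
     (\<forall>y\<in>el c. \<exists>a\<in>\<S>. top_of c a y) \<and>
     (\<forall>a\<in>\<S>. \<forall>y\<in>el c. \<forall>z\<in>el c. top_of c a y \<and> top_of c a z \<longrightarrow> y = z)"

lemma chain_to_sub: "chain_to c x \<Longrightarrow> y \<epsilon> c \<Longrightarrow> el y \<subseteq> el x"
  and chain_to_top: "chain_to c x \<Longrightarrow> y \<epsilon> c \<Longrightarrow> \<exists>a\<in>\<S>. top_of c a y"
  and chain_to_inj: "chain_to c x \<Longrightarrow> y \<epsilon> c \<Longrightarrow> z \<epsilon> c \<Longrightarrow> a \<in> \<S> \<Longrightarrow> top_of c a y \<Longrightarrow> top_of c a z \<Longrightarrow> y = z"
  unfolding chain_to_def by (simp_all, blast?)

lemma ex_chain_to: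
  assumes x: "x \<in> \<S>"
  shows "\<exists>c\<in>\<S>. chain_to c x"
proof (rule set_induct[of "\<lambda>x. \<exists>c\<in>\<S>. chain_to c x", OF _ x])
  show "dfn False (\<lambda>v. \<exists>c\<in>\<S>. chain_to c (v 0))"
    unfolding chain_to_def top_of_def by (intro dfn_intros emp_S)
  show "\<exists>c\<in>\<S>. chain_to c emp"
    by (rule bexI[of _ emp]) (auto simp: chain_to_def)
  fix x a assume *: "x \<in> \<S>" "a \<in> \<S>" "\<exists>c\<in>\<S>. chain_to c x"
  show "\<exists>c\<in>\<S>. chain_to c (adj x a)"
  proof (cases "a \<epsilon> x")
    case True
    then show ?thesis using * by (simp add: adj_absorb)
  next
    case a: False
    obtain c where c: "c \<in> \<S>" "chain_to c x" using * by blast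
    define w where "w = adj x a"
    have w: "w \<in> \<S>" "el w = insert a (el x)" using * by (auto simp: w_def el_adj)
    define d where "d = adj c w"
    have d: "d \<in> \<S>" "el d = insert w (el c)" using c w by (auto simp: d_def el_adj)
    have ind: "t \<epsilon> d \<longleftrightarrow> t = w \<or> t \<epsilon> c" for t using d(2) in_el[of t d] by auto
    have sub: "el y \<subseteq> el x" if "y \<epsilon> c" for y using chain_to_sub[OF c(2) that] .
    have top_w: "b = a" if "top_of d b w" "b \<in> \<S>" for b
    proof -
      from that obtain y where y: "y \<in> \<S>" "w = adj y b" "\<not> b \<epsilon> y" "y = emp \<or> y \<epsilon> d"
        by (auto simp: top_of_def)
      have "b \<epsilon> adj y b" using y that by (simp add: in_adj)
      then have "y \<noteq> w" using y by auto
      then have "el y \<subseteq> el x" using y sub ind by auto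
      then have "\<not> a \<epsilon> y" using a by (auto simp: subset_iff)
      moreover have "a \<epsilon> adj y b" using y(2) w(2) in_el[of a w] by auto
      ultimately show ?thesis using y that by (simp add: in_adj)
    qed
    have top_c: "top_of c b y \<and> b \<epsilon> x" if "top_of d b y" "y \<epsilon> c" "b \<in> \<S>" for b y
    proof -
      from that obtain z where z: "z \<in> \<S>" "y = adj z b" "\<not> b \<epsilon> z" "z = emp \<or> z \<epsilon> d"
        by (auto simp: top_of_def)
      have yx: "el y \<subseteq> el x" using sub that by blast
      then have "b \<epsilon> x" "el z \<subseteq> el x" using z that by (auto simp: el_adj)
      moreover from this have "z \<noteq> w" using a w(2) by auto
      ultimately show ?thesis using z ind unfolding top_of_def by auto
    qed
    have mono: "top_of c b y \<Longrightarrow> top_of d b y" for b y using ind unfolding top_of_def by blast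
    have "top_of d a w" using * a c unfolding top_of_def w_def
      by (intro bexI[of _ x]) (auto simp: chain_to_def ind)
    then have top: "\<exists>b\<in>\<S>. top_of d b y" if "y \<epsilon> d" for y
      using that mono chain_to_top[OF c(2), of y] *(2) unfolding ind by blast
    have inj: "y = z" if "b \<in> \<S>" "y \<epsilon> d" "z \<epsilon> d" "top_of d b y" "top_of d b z" for b y z
      using that top_w[of b] top_c[of b y] top_c[of b z] a chain_to_inj[OF c(2)] unfolding ind
      by blast
    have "el y \<subseteq> el w" if "y \<epsilon> d" for y using that sub w(2) unfolding ind by blast
    with top inj have "chain_to d w" unfolding chain_to_def by (auto simp: ind)
    then show ?thesis using d unfolding w_def by blast
  qed
qed

lemma small_S: "small mem x \<Longrightarrow> x \<in> \<S>"
  by (auto simp: small_def)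

lemma smallD: "small mem x \<Longrightarrow> is_class A \<Longrightarrow> A \<subseteq> el x \<Longrightarrow> is_set A"
  by (auto simp: small_def is_set_def is_class_def)

lemma smallI: "(\<And>A. is_class A \<Longrightarrow> A \<subseteq> el x \<Longrightarrow> is_set A) \<Longrightarrow> small mem x"
  unfolding small_def using axExt by (metis is_class_el is_set_def)

lemma small_subset: "small mem x \<Longrightarrow> el y \<subseteq> el x \<Longrightarrow> small mem y"
  unfolding small_def by auto

lemma small_induct:
  assumes P: "dfn True (\<lambda>v. P (v 0))" and x: "small mem x" and "P emp"
    and step: "\<And>y a. y \<in> \<S> \<Longrightarrow> el y \<subseteq> el x \<Longrightarrow> a \<epsilon> x \<Longrightarrow> P y \<Longrightarrow> P (adj y a)"
  shows "P x"
proof -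
  have xS: "x \<in> \<S>" using x by (rule small_S)
  obtain c where c: "c \<in> \<S>" "chain_to c x" using ex_chain_to[OF xS] by blast
  have P': "\<And>t. dterm True t \<Longrightarrow> dfn True (\<lambda>v. P (t v))"
    by (rule dfn_subst[of True "\<lambda>x v. P x"]) (use P in auto)
  have "dfn True (\<lambda>v. v 0 \<epsilon> x \<and> (\<exists>y\<in>el c. top_of c (v 0) y \<and> \<not> P y))"
    unfolding top_of_def by (intro dfn_intros P' c par_True emp_S)
  from comprehension[OF this]
  have "is_set {a \<in> \<S>. a \<epsilon> x \<and> (\<exists>y\<in>el c. top_of c a y \<and> \<not> P y)}"
    by (intro smallD[OF x]) auto
  then obtain E where E: "E \<in> \<S>" "el E = {a \<in> \<S>. a \<epsilon> x \<and> (\<exists>y\<in>el c. top_of c a y \<and> \<not> P y)}"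
    by (auto simp: is_set_def)
  have inE: "a \<epsilon> E \<longleftrightarrow> a \<in> \<S> \<and> a \<epsilon> x \<and> (\<exists>y\<in>el c. top_of c a y \<and> \<not> P y)" for a
    using E(2) in_el[of a E] by auto
  have topx: "a \<epsilon> x" if "top_of c a y" "y \<epsilon> c" "a \<in> \<S>" for a y
  proof -
    have "a \<epsilon> y" using that by (auto simp: top_of_def in_adj)
    then show ?thesis using c that by (auto simp: chain_to_def subset_iff)
  qed
  have "E = emp"
  proof (rule ccontr)
    have "dfn False (\<lambda>v. \<exists>a\<in>el E. top_of c a (v 0))"
      unfolding top_of_def by (intro dfn_intros E c emp_S)
    from separation[OF this is_set_el[OF c(1)]]
    obtain e where e: "e \<in> \<S>" "el e = {y \<in> el c. \<exists>a\<in>el E. top_of c a y}"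
      by (rule is_setE)
    have ine: "y \<epsilon> e \<longleftrightarrow> y \<epsilon> c \<and> (\<exists>a\<in>el E. top_of c a y)" for y
      using e(2) in_el[of y e] by auto
    assume "E \<noteq> emp"
    then obtain a where "a \<epsilon> E" using nonempty_el by blast
    then have "e \<noteq> emp" using inE ine by (metis in_el not_in_emp)
    from minimal_subset[OF e(1) this] obtain y where
      y: "y \<epsilon> e" "\<And>z. z \<epsilon> e \<Longrightarrow> \<not> el z \<subset> el y" by auto
    obtain a where a: "a \<epsilon> E" "top_of c a y" using y ine by auto
    have aS: "a \<in> \<S>" using a inE by blast
    obtain y' where y': "y' \<in> \<S>" "y = adj y' a" "\<not> a \<epsilon> y'" "y' = emp \<or> y' \<epsilon> c"
      using a unfolding top_of_def by blast
    have yc: "y \<epsilon> c" using y ine by blast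
    have "P y'"
    proof (cases "y' = emp")
      case False
      then have y'c: "y' \<epsilon> c" using y' by blast
      then obtain b where b: "b \<in> \<S>" "top_of c b y'" using chain_to_top[OF c(2)] by blast
      have "el y' \<subset> el y" using y' aS by (auto simp: el_adj)
      then have "\<not> y' \<epsilon> e" using y by blast
      then have "\<not> b \<epsilon> E" using ine y'c b by auto
      then show ?thesis using inE b topx[OF b(2) y'c] y'c by auto
    qed (use \<open>P emp\<close> in simp)
    moreover have "el y' \<subseteq> el x" using y' chain_to_sub[OF c(2) yc] aS by (auto simp: el_adj subset_iff)
    ultimately have "P y" using y' step topx[OF a(2) yc aS] by blast
    moreover obtain z where "z \<epsilon> c" "top_of c a z" "\<not> P z" using a inE by auto
    ultimately show False using chain_to_inj[OF c(2)] a yc aS by blast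
  qed
  show "P x"
  proof (cases "x = emp")
    case False
    then have xc: "x \<epsilon> c" using c by (simp add: chain_to_def)
    then obtain b where b: "b \<in> \<S>" "top_of c b x" using chain_to_top[OF c(2)] by blast
    then have "\<not> b \<epsilon> E" using \<open>E = emp\<close> by simp
    then show ?thesis using inE b topx[OF b(2) xc] xc by auto
  qed (use \<open>P emp\<close> in simp)
qed

definition thin_class :: "'a set \<Rightarrow> bool" where
  "thin_class A \<longleftrightarrow> is_class A \<and> (\<forall>x\<in>\<S>. el x \<subseteq> A \<longrightarrow> small mem x)"

lemma thin_iff: "thin mem X \<longleftrightarrow> thin_class (el X)"
  by (simp add: thin_def thin_class_def)

lemma thin_classD: "thin_class A \<Longrightarrow> x \<in> \<S> \<Longrightarrow> el x \<subseteq> A \<Longrightarrow> small mem x"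
  by (simp add: thin_class_def)

lemma thin_class_class: "thin_class A \<Longrightarrow> is_class A"
  by (simp add: thin_class_def)

lemma thin_class_subset: "thin_class A \<Longrightarrow> is_class B \<Longrightarrow> B \<subseteq> A \<Longrightarrow> thin_class B"
  by (auto simp: thin_class_def)

lemma dfn2: "dfn b (\<lambda>v. B (v 0) (v 1)) \<Longrightarrow> dterm b t \<Longrightarrow> dterm b s \<Longrightarrow> dfn b (\<lambda>v. B (t v) (s v))"
  by (rule dfn_subst2[of b "\<lambda>x y v. B x y"])

lemma small_image:
  assumes R: "dfn True (\<lambda>v. R (v 0) (v 1))" and x: "small mem x"
    and func: "\<And>i y z. i \<epsilon> x \<Longrightarrow> y \<in> \<S> \<Longrightarrow> z \<in> \<S> \<Longrightarrow> R i y \<Longrightarrow> R i z \<Longrightarrow> y = z"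
  shows "is_set {y \<in> \<S>. \<exists>i\<in>el x. R i y}"
proof -
  have "el x \<subseteq> el x \<longrightarrow> (\<exists>w\<in>\<S>. \<forall>t\<in>\<S>. t \<epsilon> w \<longleftrightarrow> (\<exists>i\<in>el x. R i t))"
  proof (rule small_induct[of "\<lambda>x'. el x' \<subseteq> el x \<longrightarrow> (\<exists>w\<in>\<S>. \<forall>t\<in>\<S>. t \<epsilon> w \<longleftrightarrow> (\<exists>i\<in>el x'. R i t))", OF _ x])
    show "dfn True (\<lambda>v. el (v 0) \<subseteq> el x \<longrightarrow> (\<exists>w\<in>\<S>. \<forall>t\<in>\<S>. t \<epsilon> w \<longleftrightarrow> (\<exists>i\<in>el (v 0). R i t)))"
      by (intro dfn_intros dfn2[OF R] small_S[OF x])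
    show "el emp \<subseteq> el x \<longrightarrow> (\<exists>w\<in>\<S>. \<forall>t\<in>\<S>. t \<epsilon> w \<longleftrightarrow> (\<exists>i\<in>el emp. R i t))"
      by (auto intro!: bexI[of _ emp])
    fix x' i assume *: "x' \<in> \<S>" "el x' \<subseteq> el x" "i \<epsilon> x"
      "el x' \<subseteq> el x \<longrightarrow> (\<exists>w\<in>\<S>. \<forall>t\<in>\<S>. t \<epsilon> w \<longleftrightarrow> (\<exists>i\<in>el x'. R i t))"
    then obtain w where w: "w \<in> \<S>" "\<forall>t\<in>\<S>. t \<epsilon> w \<longleftrightarrow> (\<exists>i\<in>el x'. R i t)" by blast
    have iS: "i \<in> \<S>" using * el_S by blast
    show "el (adj x' i) \<subseteq> el x \<longrightarrow> (\<exists>w\<in>\<S>. \<forall>t\<in>\<S>. t \<epsilon> w \<longleftrightarrow> (\<exists>i\<in>el (adj x' i). R i t))"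
    proof (cases "\<exists>y\<in>\<S>. R i y")
      case True
      then obtain y where y: "y \<in> \<S>" "R i y" by blast
      have "R i t \<longleftrightarrow> t = y" if "t \<in> \<S>" for t using func[OF \<open>i \<epsilon> x\<close> that y(1)] y(2) by blast
      then have "\<forall>t\<in>\<S>. t \<epsilon> adj w y \<longleftrightarrow> (\<exists>i\<in>el (adj x' i). R i t)"
        using w(2) by (simp add: in_adj[OF w(1) y(1)] el_adj[OF *(1) iS])
      then show ?thesis using w y adj_S by blast
    next
      case False
      then show ?thesis using w * iS by (auto simp: el_adj intro!: bexI[of _ w])
    qed
  qed
  then obtain w where "w \<in> \<S>" "\<forall>t\<in>\<S>. t \<epsilon> w \<longleftrightarrow> (\<exists>i\<in>el x. R i t)" by blast
  moreover from this have "el w = {y \<in> \<S>. \<exists>i\<in>el x. R i y}" using el_S by auto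
  ultimately show ?thesis by (auto simp: is_set_def)
qed

text \<open>
  Comprehension for thin families in the form of a compactness principle. Axiom (Comp) is applied
  to the thin class of the sets \<open>{(a, 0) | B i a} \<union> {(i, 1)}\<close>, where the
  second component is a tag that makes the indexing injective.
\<close>

lemma thin_cover:
  assumes A: "thin_class A" and u: "u \<in> \<S>" and B: "dfn True (\<lambda>v. B (v 0) (v 1))"
    and sets: "\<And>i. i \<in> A \<Longrightarrow> is_set {a \<in> el u. B i a}"
    and cov: "\<And>a. a \<epsilon> u \<Longrightarrow> \<exists>i\<in>A. B i a"
  shows "\<exists>x\<in>\<S>. el x \<subseteq> A \<and> (\<forall>a\<in>el u. \<exists>i\<in>el x. B i a)"
proof -
  define T where "T = adj emp emp"
  have T: "T \<in> \<S>" "T \<noteq> emp" unfolding T_def using in_adj[of emp emp emp] by auto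
  note clA = thin_class_class[OF A]
  have AS: "A \<subseteq> \<S>" by (rule is_class_sub_S[OF clA])
  define cd where "cd i w \<longleftrightarrow> (\<forall>t\<in>\<S>. t \<epsilon> w \<longleftrightarrow> (\<exists>a\<in>el u. B i a \<and> t = pr a emp) \<or> t = pr i T)" for i w
  have ex_cd: "\<exists>w\<in>\<S>. cd i w" if i: "i \<in> A" for i
  proof -
    have d: "dterm False (\<lambda>v. pr (v 0) emp)" by (intro dfn_intros emp_S)
    have "pr i T \<in> \<S>" using i AS T by auto
    from is_set_insert[OF replacement[OF d sets[OF i]] this]
    obtain w where w: "w \<in> \<S>" "el w = insert (pr i T) ((\<lambda>a. pr a emp) ` {a \<in> el u. B i a})"
      by (rule is_setE)
    have "cd i w" unfolding cd_def
    proof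
      fix t show "t \<epsilon> w \<longleftrightarrow> (\<exists>a\<in>el u. B i a \<and> t = pr a emp) \<or> t = pr i T"
        using w(2) in_el[of t w] by auto
    qed
    then show ?thesis using w by blast
  qed
  have tag: "pr j T \<epsilon> w \<longleftrightarrow> j = i" if "cd i w" "i \<in> \<S>" "j \<in> \<S>" for i j w
  proof -
    have "pr j T \<noteq> pr a emp" if "a \<epsilon> u" for a
      using that \<open>j \<in> \<S>\<close> T by (auto simp: pr_inj el_S)
    then show ?thesis using that T unfolding cd_def by (auto simp: pr_inj)
  qed
  define W where "W = {w \<in> \<S>. \<exists>i\<in>A. cd i w}"
  have clW: "is_class W" unfolding W_def cd_def
    by (rule comprehension) (intro dfn_intros clA dfn2[OF B] u emp_S T)
  have idx: "is_set {i \<in> \<S>. \<exists>w\<in>el z. pr i T \<epsilon> w}" if z: "z \<in> \<S>" for z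
  proof -
    obtain U where U: "U \<in> \<S>" "el U = (\<Union>w\<in>el z. el w)" by (rule is_setE[OF is_set_Union[OF z]])
    have "dfn False (\<lambda>v. pr (v 0) T \<epsilon> U)" by (intro dfn_intros U T)
    from separation[OF this is_set_dom[OF U(1)]]
    show ?thesis
    proof (rule back_subst[of is_set])
      have "pr i T \<epsilon> U \<longleftrightarrow> (\<exists>w\<in>el z. pr i T \<epsilon> w)" for i using U(2) in_el[of "pr i T" U] by auto
      then show "{y \<in> {x \<in> \<S>. \<exists>y\<in>\<S>. pr x y \<epsilon> U}. pr y T \<epsilon> U} = {i \<in> \<S>. \<exists>w\<in>el z. pr i T \<epsilon> w}"
        using T by auto
    qed
  qed
  have idxA: "{i \<in> \<S>. \<exists>w\<in>el z. pr i T \<epsilon> w} \<subseteq> A" if "el z \<subseteq> W" for z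
    using that tag AS unfolding W_def by blast
  have "thin_class W" unfolding thin_class_def
  proof (intro conjI ballI impI clW smallI)
    fix z Y assume z: "z \<in> \<S>" "el z \<subseteq> W" and Y: "is_class Y" "Y \<subseteq> el z"
    obtain I where I: "I \<in> \<S>" "el I = {i \<in> \<S>. \<exists>w\<in>el z. pr i T \<epsilon> w}"
      by (rule is_setE[OF idx[OF z(1)]])
    have sI: "small mem I" using thin_classD[OF A I(1)] idxA[OF z(2)] I(2) by simp
    have "is_class {i \<in> \<S>. \<exists>w\<in>Y. pr i T \<epsilon> w}"
      by (rule comprehension) (intro dfn_intros Y T)
    moreover have "{i \<in> \<S>. \<exists>w\<in>Y. pr i T \<epsilon> w} \<subseteq> el I" unfolding I(2) using Y by auto
    ultimately have "is_set {i \<in> \<S>. \<exists>w\<in>Y. pr i T \<epsilon> w}" by (rule smallD[OF sI])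
    then obtain J where J: "J \<in> \<S>" "el J = {i \<in> \<S>. \<exists>w\<in>Y. pr i T \<epsilon> w}"
      by (rule is_setE)
    have inJ: "i \<epsilon> J \<longleftrightarrow> i \<in> \<S> \<and> (\<exists>w\<in>Y. pr i T \<epsilon> w)" for i using J(2) in_el[of i J] by auto
    have "dfn False (\<lambda>v. \<exists>i\<in>el J. pr i T \<epsilon> v 0)" by (intro dfn_intros J T)
    from separation[OF this is_set_el[OF z(1)]]
    have "is_set {w \<in> el z. \<exists>i\<in>el J. pr i T \<epsilon> w}" .
    also have "{w \<in> el z. \<exists>i\<in>el J. pr i T \<epsilon> w} = Y"
    proof (intro Set.set_eqI iffI)
      fix w assume "w \<in> {w \<in> el z. \<exists>i\<in>el J. pr i T \<epsilon> w}"
      then obtain i w' where i: "w \<epsilon> z" "i \<in> \<S>" "pr i T \<epsilon> w" "w' \<in> Y" "pr i T \<epsilon> w'" using inJ by auto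
      then have "w \<in> W" "w' \<in> W" using z Y by auto
      then obtain k k' where k: "k \<in> A" "cd k w" "k' \<in> A" "cd k' w'" "w \<in> \<S>" "w' \<in> \<S>" unfolding W_def by auto
      then have "k = i" "k' = i" using tag i AS by blast+
      then have "w = w'" using k unfolding cd_def by (intro set_ext) auto
      then show "w \<in> Y" using i by simp
    next
      fix w assume w: "w \<in> Y"
      then have "w \<in> W" using z Y by auto
      then obtain k where k: "k \<in> A" "cd k w" "w \<in> \<S>" unfolding W_def by auto
      then have "pr k T \<epsilon> w" "k \<in> \<S>" using tag AS by blast+
      moreover from this have "k \<in> el J" using inJ w by auto
      ultimately show "w \<in> {w \<in> el z. \<exists>i\<in>el J. pr i T \<epsilon> w}" using w Y by blast
    qed
    finally show "is_set Y" .
  qed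
  then have W: "thin mem (cls W)" "el (cls W) = W" by (auto simp: thin_iff el_cls clW)
  have "dterm False (\<lambda>v. pr (v 0) emp)" by (intro dfn_intros emp_S)
  from replacement[OF this is_set_el[OF u]]
  obtain u' where u': "u' \<in> \<S>" "el u' = (\<lambda>a. pr a emp) ` el u" by (rule is_setE)
  have covW: "\<exists>w\<in>W. pr a emp \<epsilon> w" if a: "a \<epsilon> u" for a
  proof -
    obtain i where i: "i \<in> A" "B i a" using cov[OF a] by auto
    then obtain w where w: "w \<in> \<S>" "cd i w" using ex_cd by auto
    have "pr a emp \<in> \<S>" using el_S[OF a] by simp
    then have "pr a emp \<epsilon> w" using w(2) i(2) in_el a unfolding cd_def by blast
    then show ?thesis using w i unfolding W_def by auto
  qed
  have "el u' \<subseteq> (\<Union>y\<in>el (cls W). el y)"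
    unfolding u'(2) W(2) using covW by auto
  moreover have "ax_Comp mem" using THS by (simp add: THS_def)
  ultimately obtain z where z: "z \<in> \<S>" "el z \<subseteq> W" "el u' \<subseteq> (\<Union>y\<in>el z. el y)"
    unfolding ax_Comp_def using W u'(1) by metis
  obtain I where I: "I \<in> \<S>" "el I = {i \<in> \<S>. \<exists>w\<in>el z. pr i T \<epsilon> w}"
    by (rule is_setE[OF idx[OF z(1)]])
  have "\<exists>i\<in>el I. B i a" if a: "a \<epsilon> u" for a
  proof -
    have "pr a emp \<in> el u'" unfolding u'(2) using a by auto
    then obtain w where w: "w \<epsilon> z" "pr a emp \<epsilon> w" using z by auto
    then obtain i where i: "i \<in> A" "cd i w" using z unfolding W_def by auto
    have aS: "a \<in> \<S>" "i \<in> \<S>" using el_S[OF a] i AS by auto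
    then have "pr a emp \<noteq> pr i T" using T by (simp add: pr_inj)
    moreover have "pr a emp = pr b emp \<Longrightarrow> a = b" if "b \<epsilon> u" for b
      using that aS by (simp add: pr_inj el_S)
    ultimately have "B i a" using i(2) w(2) aS unfolding cd_def by auto
    moreover have "pr i T \<epsilon> w" using tag[OF i(2)] aS by blast
    then have "i \<in> el I" unfolding I(2) using aS w in_el by blast
    ultimately show ?thesis by blast
  qed
  then show ?thesis using I idxA[OF z(2)] by (intro bexI[of _ I]) auto
qed

lemma thin_compact:
  assumes A: "thin_class A" and u: "u \<in> \<S>" and B: "dfn True (\<lambda>v. B (v 0) (v 1))"
    and sets: "\<And>i. i \<in> A \<Longrightarrow> is_set {a \<in> el u. B i a}"
    and fin: "\<And>x. small mem x \<Longrightarrow> el x \<subseteq> A \<Longrightarrow> \<exists>a\<in>el u. \<forall>i\<in>el x. B i a"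
  shows "\<exists>a\<in>el u. \<forall>i\<in>A. B i a"
proof (rule ccontr)
  assume neg: "\<not> ?thesis"
  have "\<exists>x\<in>\<S>. el x \<subseteq> A \<and> (\<forall>a\<in>el u. \<exists>i\<in>el x. \<not> B i a)"
  proof (rule thin_cover[OF A u])
    show "dfn True (\<lambda>v. \<not> B (v 0) (v 1))" by (intro dfn_intros B)
    fix i assume "i \<in> A"
    from sets[OF this] obtain w where w: "w \<in> \<S>" "el w = {a \<in> el u. B i a}" by (rule is_setE)
    have "dfn False (\<lambda>v. \<not> v 0 \<epsilon> w)" by (intro dfn_intros w)
    from separation[OF this is_set_el[OF u]]
    show "is_set {a \<in> el u. \<not> B i a}"
    proof (rule back_subst[of is_set])
      show "{y \<in> el u. \<not> y \<epsilon> w} = {a \<in> el u. \<not> B i a}"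
        using w(2) in_el[of _ w] by auto
    qed
  qed (use neg in auto)
  then show False using fin thin_classD[OF A] by fastforce
qed

lemma thin_image:
  assumes A: "thin_class A" and R: "dfn True (\<lambda>v. R (v 0) (v 1))"
    and func: "\<And>i y z. i \<in> A \<Longrightarrow> y \<in> \<S> \<Longrightarrow> z \<in> \<S> \<Longrightarrow> R i y \<Longrightarrow> R i z \<Longrightarrow> y = z"
  shows "thin_class {y \<in> \<S>. \<exists>i\<in>A. R i y}"
  unfolding thin_class_def
proof (intro conjI ballI impI)
  note clA = thin_class_class[OF A]
  have AS: "A \<subseteq> \<S>" by (rule is_class_sub_S[OF clA])
  show "is_class {y \<in> \<S>. \<exists>i\<in>A. R i y}"
    by (rule comprehension) (intro dfn_intros clA dfn2[OF R])
  fix z assume z: "z \<in> \<S>" "el z \<subseteq> {y \<in> \<S>. \<exists>i\<in>A. R i y}"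
  have "\<exists>x\<in>\<S>. el x \<subseteq> A \<and> (\<forall>a\<in>el z. \<exists>i\<in>el x. R i a)"
  proof (rule thin_cover[OF A z(1) R])
    fix i assume i: "i \<in> A"
    show "is_set {a \<in> el z. R i a}"
    proof (cases "\<exists>a\<in>el z. R i a")
      case True
      then obtain a where a: "a \<epsilon> z" "R i a" by auto
      then have "{a \<in> el z. R i a} = {a}" using func[OF i] el_S by auto
      then show ?thesis using is_set_single[OF el_S[OF a(1)]] by (simp only:)
    next
      case False
      then have "{a \<in> el z. R i a} = {}" by auto
      then show ?thesis using is_set_empty by (simp only:)
    qed
  qed (use z in auto)
  then obtain x where x: "x \<in> \<S>" "el x \<subseteq> A" "\<forall>a\<in>el z. \<exists>i\<in>el x. R i a" by blast
  have sx: "small mem x" using thin_classD[OF A x(1,2)] .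
  show "small mem z"
  proof (rule smallI)
    fix Y assume Y: "is_class Y" "Y \<subseteq> el z"
    have "is_set {y \<in> \<S>. \<exists>i\<in>el x. R i y \<and> y \<in> Y}"
      by (rule small_image[OF _ sx]) (use func x in \<open>auto intro!: dfn_intros dfn2[OF R] Y\<close>)
    also have "{y \<in> \<S>. \<exists>i\<in>el x. R i y \<and> y \<in> Y} = Y" using Y x el_S by fastforce
    finally show "is_set Y" .
  qed
qed

lemma thin_times:
  assumes A: "thin_class A" and B: "thin_class B"
  shows "thin_class {p \<in> \<S>. \<exists>a\<in>A. \<exists>b\<in>B. p = pr a b}"
  unfolding thin_class_def
proof (intro conjI ballI impI smallI)
  note clA = thin_class_class[OF A] and clB = thin_class_class[OF B]
  have AS: "A \<subseteq> \<S>" "B \<subseteq> \<S>" using is_class_sub_S clA clB by auto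
  show "is_class {p \<in> \<S>. \<exists>a\<in>A. \<exists>b\<in>B. p = pr a b}"
    by (rule comprehension) (intro dfn_intros clA clB)
  fix z Y assume z: "z \<in> \<S>" "el z \<subseteq> {p \<in> \<S>. \<exists>a\<in>A. \<exists>b\<in>B. p = pr a b}" and Y: "is_class Y" "Y \<subseteq> el z"
  obtain x where x: "x \<in> \<S>" "el x = {x \<in> \<S>. \<exists>y\<in>\<S>. pr x y \<epsilon> z}" by (rule is_setE[OF is_set_dom[OF z(1)]])
  obtain y where y: "y \<in> \<S>" "el y = {y \<in> \<S>. \<exists>x\<in>\<S>. pr x y \<epsilon> z}" by (rule is_setE[OF is_set_ran[OF z(1)]])
  have zp: "\<exists>a\<in>A. \<exists>b\<in>B. p = pr a b" if "p \<epsilon> z" for p using z that by auto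
  have "el x \<subseteq> A"
  proof
    fix a assume "a \<in> el x"
    then obtain b where b: "a \<in> \<S>" "b \<in> \<S>" "pr a b \<epsilon> z" unfolding x(2) by auto
    from zp[OF this(3)] show "a \<in> A" using b AS by (auto simp: pr_inj subset_iff)
  qed
  then have sx: "small mem x" using thin_classD[OF A x(1)] by simp
  have "el y \<subseteq> B"
  proof
    fix b assume "b \<in> el y"
    then obtain a where b: "a \<in> \<S>" "b \<in> \<S>" "pr a b \<epsilon> z" unfolding y(2) by auto
    from zp[OF this(3)] show "b \<in> B" using b AS by (auto simp: pr_inj subset_iff)
  qed
  then have sy: "small mem y" using thin_classD[OF B y(1)] by simp
  have row: "is_set {b \<in> \<S>. pr a b \<in> Y}" if "a \<in> \<S>" for a
  proof (rule smallD[OF sy])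
    show "is_class {b \<in> \<S>. pr a b \<in> Y}"
      by (rule comprehension) (intro dfn_intros Y that)
    show "{b \<in> \<S>. pr a b \<in> Y} \<subseteq> el y" unfolding y(2) using that Y(2) in_el by blast
  qed
  have "\<exists>w\<in>\<S>. \<forall>t\<in>\<S>. t \<epsilon> w \<longleftrightarrow> t \<in> Y \<and> (\<exists>a\<in>el x. \<exists>b\<in>\<S>. t = pr a b)"
  proof (rule small_induct[of "\<lambda>x. \<exists>w\<in>\<S>. \<forall>t\<in>\<S>. t \<epsilon> w \<longleftrightarrow> t \<in> Y \<and> (\<exists>a\<in>el x. \<exists>b\<in>\<S>. t = pr a b)", OF _ sx])
    show "dfn True (\<lambda>v. \<exists>w\<in>\<S>. \<forall>t\<in>\<S>. t \<epsilon> w \<longleftrightarrow> t \<in> Y \<and> (\<exists>a\<in>el (v 0). \<exists>b\<in>\<S>. t = pr a b))"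
      by (intro dfn_intros Y)
    show "\<exists>w\<in>\<S>. \<forall>t\<in>\<S>. t \<epsilon> w \<longleftrightarrow> t \<in> Y \<and> (\<exists>a\<in>el emp. \<exists>b\<in>\<S>. t = pr a b)"
      by (rule bexI[of _ emp]) auto
    fix x' c assume *: "x' \<in> \<S>" "el x' \<subseteq> el x" "c \<epsilon> x"
      "\<exists>w\<in>\<S>. \<forall>t\<in>\<S>. t \<epsilon> w \<longleftrightarrow> t \<in> Y \<and> (\<exists>a\<in>el x'. \<exists>b\<in>\<S>. t = pr a b)"
    then obtain w where w: "w \<in> \<S>" "\<forall>t\<in>\<S>. t \<epsilon> w \<longleftrightarrow> t \<in> Y \<and> (\<exists>a\<in>el x'. \<exists>b\<in>\<S>. t = pr a b)" by blast
    have cS: "c \<in> \<S>" using * el_S by blast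
    have "dterm False (\<lambda>v. pr c (v 0))" by (intro dfn_intros cS)
    from is_set_Un[OF is_set_el[OF w(1)] replacement[OF this row[OF cS]]]
    obtain w' where w': "w' \<in> \<S>" "el w' = el w \<union> (\<lambda>b. pr c b) ` {b \<in> \<S>. pr c b \<in> Y}" by (rule is_setE)
    have "\<forall>t\<in>\<S>. t \<epsilon> w' \<longleftrightarrow> t \<in> Y \<and> (\<exists>a\<in>el (adj x' c). \<exists>b\<in>\<S>. t = pr a b)"
    proof
      fix t assume "t \<in> \<S>"
      then show "t \<epsilon> w' \<longleftrightarrow> t \<in> Y \<and> (\<exists>a\<in>el (adj x' c). \<exists>b\<in>\<S>. t = pr a b)"
        using w'(2) in_el[of t w'] w * cS by (auto simp: el_adj)
    qed
    then show "\<exists>w\<in>\<S>. \<forall>t\<in>\<S>. t \<epsilon> w \<longleftrightarrow> t \<in> Y \<and> (\<exists>a\<in>el (adj x' c). \<exists>b\<in>\<S>. t = pr a b)"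
      using w' by blast
  qed
  then obtain w where w: "w \<in> \<S>" "\<forall>t\<in>\<S>. t \<epsilon> w \<longleftrightarrow> t \<in> Y \<and> (\<exists>a\<in>el x. \<exists>b\<in>\<S>. t = pr a b)" by blast
  have "t \<in> Y \<Longrightarrow> t \<in> \<S> \<and> (\<exists>a\<in>el x. \<exists>b\<in>\<S>. t = pr a b)" for t
  proof -
    assume "t \<in> Y"
    then have "t \<epsilon> z" using Y by auto
    from zp[OF this] obtain a b where ab: "a \<in> A" "b \<in> B" "t = pr a b" by auto
    then have "a \<in> el x" unfolding x(2) using \<open>t \<epsilon> z\<close> AS by auto
    moreover have "b \<in> \<S>" "t \<in> \<S>" using ab AS el_S[OF \<open>t \<epsilon> z\<close>] by auto
    ultimately show ?thesis using ab by blast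
  qed
  then have "el w = Y" using w el_S by auto
  then show "is_set Y" using w by (auto simp: is_set_def)
qed

lemma thin_subset_set: "thin_class A \<Longrightarrow> \<exists>u\<in>\<S>. A \<subseteq> el u"
  using THS unfolding THS_def ax_Thin_def thin_iff thin_class_def is_class_def by metis

lemma thin_trace:
  assumes A: "thin_class A" and Y: "is_class Y" "Y \<subseteq> A"
  shows "\<exists>y\<in>\<S>. el y \<inter> A = Y"
proof -
  obtain u0 where u0: "u0 \<in> \<S>" "A \<subseteq> el u0" using thin_subset_set[OF A] by blast
  obtain u where u: "u \<in> \<S>" "el u = {y \<in> \<S>. el y \<subseteq> el u0}" by (rule is_setE[OF is_set_Pow[OF u0(1)]])
  have AS: "A \<subseteq> \<S>" by (rule is_class_sub_S[OF thin_class_class[OF A]])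
  have "\<exists>y\<in>el u. \<forall>i\<in>A. i \<epsilon> y \<longleftrightarrow> i \<in> Y"
  proof (rule thin_compact[OF A u(1)])
    show "dfn True (\<lambda>v. v 0 \<epsilon> v 1 \<longleftrightarrow> v 0 \<in> Y)" by (intro dfn_intros Y)
    fix i assume "i \<in> A"
    then have "dfn False (\<lambda>v. i \<epsilon> v 0 \<longleftrightarrow> i \<in> Y)" using AS by (intro dfn_intros) auto
    from separation[OF this is_set_el[OF u(1)]] show "is_set {y \<in> el u. i \<epsilon> y \<longleftrightarrow> i \<in> Y}" .
  next
    fix x assume x: "small mem x" "el x \<subseteq> A"
    have "is_class {i \<in> \<S>. i \<epsilon> x \<and> i \<in> Y}" by (rule comprehension) (intro dfn_intros Y par_True)
    then have "is_set {i \<in> \<S>. i \<epsilon> x \<and> i \<in> Y}" by (rule smallD[OF x(1)]) auto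
    then obtain y where y: "y \<in> \<S>" "el y = {i \<in> \<S>. i \<epsilon> x \<and> i \<in> Y}" by (rule is_setE)
    have "y \<in> el u" unfolding u(2) using y u0 Y by auto
    moreover have "i \<epsilon> y \<longleftrightarrow> i \<in> Y" if "i \<epsilon> x" for i using y(2) in_el[of i y] that el_S by auto
    ultimately show "\<exists>y\<in>el u. \<forall>i\<in>el x. i \<epsilon> y \<longleftrightarrow> i \<in> Y" using in_el by blast
  qed
  then obtain y where "y \<epsilon> u" "\<forall>i\<in>A. i \<epsilon> y \<longleftrightarrow> i \<in> Y" by auto
  then show ?thesis using Y el_S by (intro bexI[of _ y]) auto
qed

text \<open>
  Axiom (Exp) yields a thin class \<open>P\<close> that meets every trace on \<open>A\<close>, but possibly
  several times. Codes with the same trace are identified by intersecting them with a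
  set \<open>w \<supseteq> A\<close> so close to \<open>A\<close> that all of them agree on it.
\<close>

lemma thin_power:
  assumes A: "thin_class A" and "A \<noteq> {}"
  obtains R where "thin_class R" "\<And>y. y \<in> \<S> \<Longrightarrow> \<exists>!r. r \<in> R \<and> el r \<inter> A = el y \<inter> A"
proof -
  note clA = thin_class_class[OF A]
  have AS: "A \<subseteq> \<S>" by (rule is_class_sub_S[OF clA])
  have "thin mem (cls A)" using A clA by (simp add: thin_iff el_cls)
  moreover have "ax_Exp mem" using THS by (simp add: THS_def)
  ultimately obtain P0 where "thin mem P0" "\<forall>y\<in>\<S>. \<exists>p\<in>el P0. el y \<inter> el (cls A) = el p \<inter> el (cls A)"
    unfolding ax_Exp_def by blast
  then obtain P where P: "thin_class P" "\<And>y. y \<in> \<S> \<Longrightarrow> \<exists>p\<in>P. el y \<inter> A = el p \<inter> A"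
    using clA by (auto simp: thin_iff el_cls)
  note clP = thin_class_class[OF P(1)]
  have PS: "P \<subseteq> \<S>" by (rule is_class_sub_S[OF clP])
  obtain u0 where u0: "u0 \<in> \<S>" "A \<subseteq> el u0" using thin_subset_set[OF A] by blast
  obtain u where u: "u \<in> \<S>" "el u = {y \<in> \<S>. el y \<subseteq> el u0}" by (rule is_setE[OF is_set_Pow[OF u0(1)]])
  define I where "I = {i \<in> \<S>. \<exists>q\<in>A. \<exists>s\<in>{s \<in> \<S>. \<exists>p\<in>P. \<exists>p'\<in>P. s = pr p p'}. i = pr q s}"
  have I: "thin_class I" unfolding I_def by (intro thin_times A P)
  define C where "C i w \<longleftrightarrow> (\<forall>q\<in>\<S>. \<forall>p\<in>\<S>. \<forall>p'\<in>\<S>. i = pr q (pr p p') \<longrightarrow>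
     q \<epsilon> w \<and> ((\<forall>t\<in>A. t \<epsilon> p \<longleftrightarrow> t \<epsilon> p') \<longrightarrow> (\<forall>t\<in>el w. t \<epsilon> p \<longleftrightarrow> t \<epsilon> p')))" for i w
  have C_pr: "C (pr q (pr p p')) w \<longleftrightarrow>
     q \<epsilon> w \<and> ((\<forall>t\<in>A. t \<epsilon> p \<longleftrightarrow> t \<epsilon> p') \<longrightarrow> (\<forall>t\<in>el w. t \<epsilon> p \<longleftrightarrow> t \<epsilon> p'))"
    if "q \<in> \<S>" "p \<in> \<S>" "p' \<in> \<S>" for q p p' w
    using that unfolding C_def by (auto simp: pr_inj)
  have "\<exists>w\<in>el u. \<forall>i\<in>I. C i w"
  proof (rule thin_compact[OF I u(1)])
    show "dfn True (\<lambda>v. C (v 0) (v 1))" unfolding C_def by (intro dfn_intros clA)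
    fix i assume "i \<in> I"
    then obtain q p p' where i: "q \<in> \<S>" "p \<in> \<S>" "p' \<in> \<S>" "i = pr q (pr p p')"
      using AS PS unfolding I_def by blast
    have "dfn False (\<lambda>v. q \<epsilon> v 0 \<and> ((\<forall>t\<in>A. t \<epsilon> p \<longleftrightarrow> t \<epsilon> p') \<longrightarrow> (\<forall>t\<in>el (v 0). t \<epsilon> p \<longleftrightarrow> t \<epsilon> p')))"
      by (intro dfn_conj dfn_imp dfn_const dfn_intros i)
    from separation[OF this is_set_el[OF u(1)]] show "is_set {w \<in> el u. C i w}"
      using i by (simp add: C_pr)
  next
    fix x assume x: "small mem x" "el x \<subseteq> I"
    obtain w where w: "w \<in> \<S>" "el w = {q \<in> \<S>. \<exists>s\<in>\<S>. pr q s \<epsilon> x}"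
      by (rule is_setE[OF is_set_dom[OF small_S[OF x(1)]]])
    have wA: "el w \<subseteq> A"
    proof
      fix q assume "q \<in> el w"
      then obtain s where s: "q \<in> \<S>" "s \<in> \<S>" "pr q s \<epsilon> x" unfolding w(2) by auto
      then have "pr q s \<in> I" using x by auto
      then show "q \<in> A" using s AS unfolding I_def by (auto simp: pr_inj subset_iff)
    qed
    have "C i w" if "i \<epsilon> x" for i
    proof -
      have "i \<in> I" using that x by auto
      then obtain q p p' where i: "q \<in> \<S>" "p \<in> \<S>" "p' \<in> \<S>" "i = pr q (pr p p')"
        using AS PS unfolding I_def by blast
      then have "q \<in> el w" unfolding w(2) using that by auto
      then show ?thesis using i wA by (auto simp: C_pr)
    qed
    moreover have "w \<in> el u" unfolding u(2) using wA u0 w(1) by auto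
    ultimately show "\<exists>w\<in>el u. \<forall>i\<in>el x. C i w" using in_el by blast
  qed
  then obtain w where w: "w \<epsilon> u" "\<And>i. i \<in> I \<Longrightarrow> C i w" by auto
  have wS: "w \<in> \<S>" using w el_S by blast
  have Iin: "pr q (pr p p') \<in> I" if "q \<in> A" "p \<in> P" "p' \<in> P" for q p p'
  proof -
    have "q \<in> \<S>" "p \<in> \<S>" "p' \<in> \<S>" using that AS PS by auto
    then show ?thesis using that pr_S unfolding I_def by blast
  qed
  obtain p0 where p0: "p0 \<in> P" using P(2)[OF emp_S] by auto
  have Aw: "A \<subseteq> el w" using w(2)[OF Iin[OF _ p0 p0]] C_pr AS PS p0 by (auto simp: subset_iff)
  define F where "F p r \<longleftrightarrow> (\<forall>t\<in>\<S>. t \<epsilon> r \<longleftrightarrow> t \<epsilon> p \<and> t \<epsilon> w)" for p r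
  have F_fun: "r = r'" if "F p r" "F p r'" for p r r' using that unfolding F_def by (intro set_ext) auto
  define R where "R = {r \<in> \<S>. \<exists>p\<in>P. F p r}"
  have "thin_class R" unfolding R_def
  proof (rule thin_image[OF P(1)])
    show "dfn True (\<lambda>v. F (v 0) (v 1))" unfolding F_def by (intro dfn_intros wS)
  qed (use F_fun in blast)
  moreover have "\<exists>!r. r \<in> R \<and> el r \<inter> A = el y \<inter> A" if y: "y \<in> \<S>" for y
  proof -
    obtain p where p: "p \<in> P" "el y \<inter> A = el p \<inter> A" using P(2)[OF y] by auto
    have "p \<in> \<S>" using p PS by auto
    have "dfn False (\<lambda>v. v 0 \<epsilon> w)" by (intro dfn_intros wS)
    from separation[OF this is_set_el[OF \<open>p \<in> \<S>\<close>]]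
    obtain r where r: "r \<in> \<S>" "el r = {t \<in> el p. t \<epsilon> w}" by (rule is_setE)
    have "F p r" unfolding F_def using r(2) in_el[of _ r] by auto
    then have rR: "r \<in> R" using p r unfolding R_def by auto
    have rA: "el r \<inter> A = el y \<inter> A" unfolding r(2) p(2) using Aw by auto
    have uniq: "r' = r" if r': "r' \<in> R" "el r' \<inter> A = el y \<inter> A" for r'
    proof -
      obtain p' where p': "p' \<in> P" "F p' r'" using r' unfolding R_def by auto
      have "t \<epsilon> r' \<longleftrightarrow> t \<epsilon> p'" if "t \<in> A" for t
        using p'(2) that AS Aw unfolding F_def by (auto simp: subset_iff)
      then have *: "\<forall>t\<in>A. t \<epsilon> p \<longleftrightarrow> t \<epsilon> p'" using r'(2) p(2) by (auto simp: set_eq_iff)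
      show ?thesis
      proof -
        obtain q where "q \<in> A" using assms(2) by auto
        with w(2)[OF Iin[OF this p(1) p'(1)]] * have "\<forall>t\<in>el w. t \<epsilon> p \<longleftrightarrow> t \<epsilon> p'"
          using C_pr AS PS p p' by (auto simp: subset_iff)
        then show ?thesis using p' \<open>F p r\<close> unfolding F_def by (intro set_ext) auto
      qed
    qed
    show ?thesis
    proof (rule ex1I)
      show "r \<in> R \<and> el r \<inter> A = el y \<inter> A" using rR rA by (rule conjI)
      show "r' = r" if "r' \<in> R \<and> el r' \<inter> A = el y \<inter> A" for r'
        using uniq[OF conjunct1[OF that] conjunct2[OF that]] .
    qed
  qed
  ultimately show ?thesis by (rule that)
qed

lemma bex_el [simp]: "(\<exists>x\<in>el X. P x) \<longleftrightarrow> (\<exists>x. x \<epsilon> X \<and> P x)"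
  and ball_el [simp]: "(\<forall>x\<in>el X. P x) \<longleftrightarrow> (\<forall>x. x \<epsilon> X \<longrightarrow> P x)"
  by auto

section \<open>Natural numbers\<close>

abbreviation "\<N> \<equiv> naturals mem"
abbreviation "SN \<equiv> std_nats mem"

lemma N_iff: "n \<in> \<N> \<longleftrightarrow> n \<in> \<S> \<and> (\<forall>x. x \<epsilon> n \<longrightarrow> el x \<subseteq> el n) \<and>
   (\<forall>x y z. x \<epsilon> n \<and> y \<epsilon> n \<and> z \<epsilon> n \<and> x \<epsilon> y \<and> y \<epsilon> z \<longrightarrow> x \<epsilon> z) \<and>
   (\<forall>x. x \<epsilon> n \<longrightarrow> \<not> x \<epsilon> x) \<and> (\<forall>x y. x \<epsilon> n \<and> y \<epsilon> n \<and> x \<noteq> y \<longrightarrow> x \<epsilon> y \<or> y \<epsilon> x)"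
proof -
  have "trans {(x, y). x \<epsilon> n \<and> y \<epsilon> n \<and> x \<epsilon> y} \<longleftrightarrow>
      (\<forall>x y z. x \<epsilon> n \<and> y \<epsilon> n \<and> z \<epsilon> n \<and> x \<epsilon> y \<and> y \<epsilon> z \<longrightarrow> x \<epsilon> z)"
    unfolding trans_def by blast
  moreover have "irrefl {(x, y). x \<epsilon> n \<and> y \<epsilon> n \<and> x \<epsilon> y} \<longleftrightarrow> (\<forall>x. x \<epsilon> n \<longrightarrow> \<not> x \<epsilon> x)"
    unfolding irrefl_def by blast
  moreover have "total_on (el n) {(x, y). x \<epsilon> n \<and> y \<epsilon> n \<and> x \<epsilon> y} \<longleftrightarrow>
      (\<forall>x y. x \<epsilon> n \<and> y \<epsilon> n \<and> x \<noteq> y \<longrightarrow> x \<epsilon> y \<or> y \<epsilon> x)"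
    unfolding total_on_def by (simp only: ball_el) blast
  ultimately show ?thesis
    unfolding naturals_def strict_linear_order_on_def by (simp only: mem_Collect_eq ball_el)
qed

lemma N_S [simp]: "n \<in> \<N> \<Longrightarrow> n \<in> \<S>"
  by (simp add: N_iff)

lemma dfn_N [dfn_intros]:
  assumes "dterm b t"
  shows "dfn b (\<lambda>v. t v \<in> \<N>)"
proof (rule dfn_subst[of b "\<lambda>x v. x \<in> \<N>", OF _ assms])
  have "dfn b (\<lambda>v. v 0 \<in> \<S> \<and> (\<forall>x\<in>\<S>. x \<epsilon> v 0 \<longrightarrow> el x \<subseteq> el (v 0)) \<and>
   (\<forall>x\<in>\<S>. \<forall>y\<in>\<S>. \<forall>z\<in>\<S>. x \<epsilon> v 0 \<and> y \<epsilon> v 0 \<and> z \<epsilon> v 0 \<and> x \<epsilon> y \<and> y \<epsilon> z \<longrightarrow> x \<epsilon> z) \<and>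
   (\<forall>x\<in>\<S>. x \<epsilon> v 0 \<longrightarrow> \<not> x \<epsilon> x) \<and> (\<forall>x\<in>\<S>. \<forall>y\<in>\<S>. x \<epsilon> v 0 \<and> y \<epsilon> v 0 \<and> x \<noteq> y \<longrightarrow> x \<epsilon> y \<or> y \<epsilon> x))"
    by (intro dfn_intros)
  then show "dfn b (\<lambda>v. v 0 \<in> \<N>)"
    by (rule dfn_back) (unfold N_iff, meson el_S)
qed

lemma N_trans: "n \<in> \<N> \<Longrightarrow> x \<epsilon> y \<Longrightarrow> y \<epsilon> n \<Longrightarrow> x \<epsilon> n"
  unfolding N_iff using in_el by blast

lemma N_irrefl: "n \<in> \<N> \<Longrightarrow> \<not> n \<epsilon> n"
  unfolding N_iff by blast

lemma N_el: "n \<in> \<N> \<Longrightarrow> k \<epsilon> n \<Longrightarrow> k \<in> \<N>"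
proof -
  assume n: "n \<in> \<N>" and k: "k \<epsilon> n"
  then have sub: "\<And>x. x \<epsilon> k \<Longrightarrow> x \<epsilon> n" using N_trans by blast
  have tr: "\<And>x y z. x \<epsilon> n \<Longrightarrow> y \<epsilon> n \<Longrightarrow> z \<epsilon> n \<Longrightarrow> x \<epsilon> y \<Longrightarrow> y \<epsilon> z \<Longrightarrow> x \<epsilon> z"
    and tot: "\<And>x y. x \<epsilon> n \<Longrightarrow> y \<epsilon> n \<Longrightarrow> x \<noteq> y \<Longrightarrow> x \<epsilon> y \<or> y \<epsilon> x" and irr: "\<And>x. x \<epsilon> n \<Longrightarrow> \<not> x \<epsilon> x"
    using n unfolding N_iff by blast+
  show "k \<in> \<N>" unfolding N_iff
  proof (intro conjI allI impI)
    show "k \<in> \<S>" using el_S[OF k] .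
    show "el x \<subseteq> el k" if "x \<epsilon> k" for x
    proof
      fix y assume "y \<in> el x"
      then show "y \<in> el k" using tr[of y x k] sub[OF that] that k N_trans[OF n, of y x] by simp
    qed
    show "x \<epsilon> z" if "x \<epsilon> k \<and> y \<epsilon> k \<and> z \<epsilon> k \<and> x \<epsilon> y \<and> y \<epsilon> z" for x y z
      using that tr[of x y z] sub by blast
    show "\<not> x \<epsilon> x" if "x \<epsilon> k" for x using that irr sub by blast
    show "x \<epsilon> y \<or> y \<epsilon> x" if "x \<epsilon> k \<and> y \<epsilon> k \<and> x \<noteq> y" for x y using that tot sub by blast
  qed
qed

lemma emp_N [simp]: "emp \<in> \<N>"
  unfolding N_iff by simp

lemma suc_N [simp]: "n \<in> \<N> \<Longrightarrow> suc n \<in> \<N>"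
proof -
  assume n: "n \<in> \<N>"
  have i: "\<And>k. k \<epsilon> suc n \<longleftrightarrow> k = n \<or> k \<epsilon> n" using n by (simp add: in_suc)
  have tr: "\<And>x y z. x \<epsilon> n \<Longrightarrow> y \<epsilon> n \<Longrightarrow> z \<epsilon> n \<Longrightarrow> x \<epsilon> y \<Longrightarrow> y \<epsilon> z \<Longrightarrow> x \<epsilon> z"
    and tot: "\<And>x y. x \<epsilon> n \<Longrightarrow> y \<epsilon> n \<Longrightarrow> x \<noteq> y \<Longrightarrow> x \<epsilon> y \<or> y \<epsilon> x" and irr: "\<And>x. x \<epsilon> n \<Longrightarrow> \<not> x \<epsilon> x"
    using n unfolding N_iff by blast+
  note nn = N_irrefl[OF n] and t = N_trans[OF n]
  show ?thesis unfolding N_iff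
  proof (intro conjI allI impI)
    show "suc n \<in> \<S>" using n by simp
    show "el x \<subseteq> el (suc n)" if "x \<epsilon> suc n" for x using that t unfolding i by (auto simp: i)
    show "x \<epsilon> z" if "x \<epsilon> suc n \<and> y \<epsilon> suc n \<and> z \<epsilon> suc n \<and> x \<epsilon> y \<and> y \<epsilon> z" for x y z
      using that nn t tr unfolding i by metis
    show "\<not> x \<epsilon> x" if "x \<epsilon> suc n" for x using that nn irr unfolding i by metis
    show "x \<epsilon> y \<or> y \<epsilon> x" if "x \<epsilon> suc n \<and> y \<epsilon> suc n \<and> x \<noteq> y" for x y
      using that tot unfolding i by metis
  qed
qed

lemma in_suc_self: "n \<in> \<N> \<Longrightarrow> n \<epsilon> suc n"
  by (simp add: in_suc)

lemma suc_neq [simp]: "n \<in> \<N> \<Longrightarrow> suc n \<noteq> emp" "n \<in> \<N> \<Longrightarrow> emp \<noteq> suc n"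
  using in_suc_self by (metis not_in_emp)+

lemma suc_inj: "m \<in> \<N> \<Longrightarrow> n \<in> \<N> \<Longrightarrow> suc m = suc n \<longleftrightarrow> m = n"
  by (metis N_irrefl N_trans N_S in_suc)

lemma N_cases:
  assumes n: "n \<in> \<N>"
  obtains "n = emp" | m where "m \<in> \<N>" "n = suc m"
proof (cases "n = emp")
  case False
  have tot: "\<And>x y. x \<epsilon> n \<Longrightarrow> y \<epsilon> n \<Longrightarrow> x \<noteq> y \<Longrightarrow> x \<epsilon> y \<or> y \<epsilon> x"
    and tr: "\<And>x y z. x \<epsilon> n \<Longrightarrow> y \<epsilon> n \<Longrightarrow> z \<epsilon> n \<Longrightarrow> x \<epsilon> y \<Longrightarrow> y \<epsilon> z \<Longrightarrow> x \<epsilon> z"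
    using n unfolding N_iff by blast+
  have "el n \<subseteq> el n \<longrightarrow> n = emp \<or> (\<exists>m\<in>el n. \<forall>k\<in>el n. k = m \<or> k \<epsilon> m)"
  proof (rule set_induct[of "\<lambda>x. el x \<subseteq> el n \<longrightarrow> x = emp \<or> (\<exists>m\<in>el x. \<forall>k\<in>el x. k = m \<or> k \<epsilon> m)"])
    show "dfn False (\<lambda>v. el (v 0) \<subseteq> el n \<longrightarrow> v 0 = emp \<or> (\<exists>m\<in>el (v 0). \<forall>k\<in>el (v 0). k = m \<or> k \<epsilon> m))"
      by (intro dfn_intros emp_S N_S n)
    fix x y assume *: "x \<in> \<S>" "y \<in> \<S>" "el x \<subseteq> el n \<longrightarrow> x = emp \<or> (\<exists>m\<in>el x. \<forall>k\<in>el x. k = m \<or> k \<epsilon> m)"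
    show "el (adj x y) \<subseteq> el n \<longrightarrow> adj x y = emp \<or> (\<exists>m\<in>el (adj x y). \<forall>k\<in>el (adj x y). k = m \<or> k \<epsilon> m)"
    proof
      assume sub: "el (adj x y) \<subseteq> el n"
      then have sub': "\<And>t. t \<epsilon> x \<Longrightarrow> t \<epsilon> n" "y \<epsilon> n" using * by (auto simp: el_adj)
      show "adj x y = emp \<or> (\<exists>m\<in>el (adj x y). \<forall>k\<in>el (adj x y). k = m \<or> k \<epsilon> m)"
      proof (cases "x = emp")
        case False
        then obtain m where m: "m \<epsilon> x" "\<And>k. k \<epsilon> x \<Longrightarrow> k = m \<or> k \<epsilon> m" using * sub' by auto
        show ?thesis
        proof (cases "m \<epsilon> y")
          case True
          then have "k \<epsilon> y" if "k \<epsilon> x" for k using that m sub' tr by metis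
          then show ?thesis using * by (auto simp: in_adj)
        next
          case False
          then have "y = m \<or> y \<epsilon> m" using tot m sub' by blast
          then show ?thesis using * m by (auto simp: in_adj)
        qed
      qed (use * in \<open>auto simp: in_adj\<close>)
    qed
  qed (use n in auto)
  then obtain m where m: "m \<epsilon> n" "\<And>k. k \<epsilon> n \<Longrightarrow> k = m \<or> k \<epsilon> m" using False by auto
  have "n = suc m" using m el_S[OF m(1)] N_trans[OF n] by (intro set_ext) (auto simp: in_suc)
  then show ?thesis using that N_el[OF n m(1)] by blast
qed (use that in blast)

lemma N_induct:
  assumes P: "dfn False (\<lambda>v. P (v 0))" and n: "n \<in> \<N>" and "P emp"
    and step: "\<And>m. m \<in> \<N> \<Longrightarrow> P m \<Longrightarrow> P (suc m)"
  shows "P n"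
proof -
  have P': "\<And>t. dterm False t \<Longrightarrow> dfn False (\<lambda>v. P (t v))"
    by (rule dfn_subst[of False "\<lambda>x v. P x"]) (use P in auto)
  have "n \<in> \<N> \<longrightarrow> P n"
  proof (rule el_induct[of "\<lambda>n. n \<in> \<N> \<longrightarrow> P n"])
    show "dfn False (\<lambda>v. v 0 \<in> \<N> \<longrightarrow> P (v 0))" by (intro dfn_intros P')
    fix x assume x: "x \<in> \<S>" "\<And>y. y \<epsilon> x \<Longrightarrow> y \<in> \<N> \<longrightarrow> P y"
    show "x \<in> \<N> \<longrightarrow> P x"
    proof
      assume "x \<in> \<N>"
      then show "P x"
        by (cases rule: N_cases) (use assms(3) step x in_suc_self in auto)
    qed
  qed (use n in simp)
  then show ?thesis using n by blast
qed

lemma N_least: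
  assumes P: "dfn False (\<lambda>v. P (v 0))" and n: "n \<in> \<N>" "P n"
  obtains m where "m \<in> \<N>" "P m" "\<And>k. k \<epsilon> m \<Longrightarrow> \<not> P k"
proof -
  have P': "\<And>t. dterm False t \<Longrightarrow> dfn False (\<lambda>v. P (t v))"
    by (rule dfn_subst[of False "\<lambda>x v. P x"]) (use P in auto)
  have "n \<in> \<N> \<and> P n \<longrightarrow> (\<exists>m\<in>\<S>. m \<in> \<N> \<and> P m \<and> (\<forall>k\<in>\<S>. k \<epsilon> m \<longrightarrow> \<not> P k))"
  proof (rule el_induct[of "\<lambda>n. n \<in> \<N> \<and> P n \<longrightarrow> (\<exists>m\<in>\<S>. m \<in> \<N> \<and> P m \<and> (\<forall>k\<in>\<S>. k \<epsilon> m \<longrightarrow> \<not> P k))"])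
    show "dfn False (\<lambda>v. v 0 \<in> \<N> \<and> P (v 0) \<longrightarrow> (\<exists>m\<in>\<S>. m \<in> \<N> \<and> P m \<and> (\<forall>k\<in>\<S>. k \<epsilon> m \<longrightarrow> \<not> P k)))"
      by (intro dfn_intros P')
    show "n \<in> \<S>" using n by simp
    fix x assume x: "x \<in> \<S>" and IH: "\<And>y. y \<epsilon> x \<Longrightarrow>
      y \<in> \<N> \<and> P y \<longrightarrow> (\<exists>m\<in>\<S>. m \<in> \<N> \<and> P m \<and> (\<forall>k\<in>\<S>. k \<epsilon> m \<longrightarrow> \<not> P k))"
    show "x \<in> \<N> \<and> P x \<longrightarrow> (\<exists>m\<in>\<S>. m \<in> \<N> \<and> P m \<and> (\<forall>k\<in>\<S>. k \<epsilon> m \<longrightarrow> \<not> P k))"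
    proof
      assume P: "x \<in> \<N> \<and> P x"
      show "\<exists>m\<in>\<S>. m \<in> \<N> \<and> P m \<and> (\<forall>k\<in>\<S>. k \<epsilon> m \<longrightarrow> \<not> P k)"
      proof (cases "\<exists>k. k \<epsilon> x \<and> P k")
        case True
        then obtain k where "k \<epsilon> x" "P k" by blast
        then show ?thesis using IH[of k] N_el[of x k] P by simp
      next
        case False
        then show ?thesis using P x by (intro bexI[of _ x]) auto
      qed
    qed
  qed
  then show ?thesis using that n el_S by blast
qed

lemma N_emp_least: "n \<in> \<N> \<Longrightarrow> n = emp \<or> emp \<epsilon> n"
  by (rule N_induct[of "\<lambda>n. n = emp \<or> emp \<epsilon> n"]) (intro dfn_intros emp_S | auto simp: in_suc)+

lemma N_suc_le: "m \<in> \<N> \<Longrightarrow> n \<in> \<N> \<Longrightarrow> m \<epsilon> n \<Longrightarrow> suc m = n \<or> suc m \<epsilon> n"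
proof -
  assume m: "m \<in> \<N>" and n: "n \<in> \<N>" "m \<epsilon> n"
  have "m \<epsilon> n \<longrightarrow> suc m = n \<or> suc m \<epsilon> n"
    by (rule N_induct[of "\<lambda>n. m \<epsilon> n \<longrightarrow> suc m = n \<or> suc m \<epsilon> n", OF _ n(1)])
      (intro dfn_intros suc_S N_S m | use m in \<open>auto simp: in_suc\<close>)+
  then show ?thesis using n by blast
qed

lemma N_linear:
  assumes m: "m \<in> \<N>" and n: "n \<in> \<N>"
  shows "m \<epsilon> n \<or> m = n \<or> n \<epsilon> m"
proof (rule N_induct[of "\<lambda>n. m \<epsilon> n \<or> m = n \<or> n \<epsilon> m", OF _ n])
  show "dfn False (\<lambda>v. m \<epsilon> v 0 \<or> m = v 0 \<or> v 0 \<epsilon> m)" by (intro dfn_intros N_S m)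
  show "m \<epsilon> emp \<or> m = emp \<or> emp \<epsilon> m" using N_emp_least[OF m] by blast
  fix k assume k: "k \<in> \<N>" "m \<epsilon> k \<or> m = k \<or> k \<epsilon> m"
  then show "m \<epsilon> suc k \<or> m = suc k \<or> suc k \<epsilon> m"
    using N_suc_le[OF k(1) m] by (auto simp: in_suc)
qed

section \<open>Standard sets and standard natural numbers\<close>

definition "FEx i \<phi> = FNot (FAll i (FNot \<phi>))"
definition "FImp \<phi> \<psi> = FNot (FAnd \<phi> (FNot \<psi>))"
definition "FOr \<phi> \<psi> = FNot (FAnd (FNot \<phi>) (FNot \<psi>))"
definition "FIff \<phi> \<psi> = FAnd (FImp \<phi> \<psi>) (FImp \<psi> \<phi>)"

lemma sat_derived [simp]:
  "sat mem D v (FEx i \<phi>) \<longleftrightarrow> (\<exists>x\<in>D. sat mem D (v(i := x)) \<phi>)"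
  "sat mem D v (FImp \<phi> \<psi>) \<longleftrightarrow> (sat mem D v \<phi> \<longrightarrow> sat mem D v \<psi>)"
  "sat mem D v (FOr \<phi> \<psi>) \<longleftrightarrow> sat mem D v \<phi> \<or> sat mem D v \<psi>"
  "sat mem D v (FIff \<phi> \<psi>) \<longleftrightarrow> (sat mem D v \<phi> \<longleftrightarrow> sat mem D v \<psi>)"
  by (auto simp: FEx_def FImp_def FOr_def FIff_def)

lemma class_formula: "is_class {y \<in> \<S>. sat mem UNIV (v(0 := y)) \<phi>}"
proof -
  have "ax_Class mem" using THS by (simp add: THS_def)
  then obtain Y where "\<forall>y\<in>\<S>. y \<epsilon> Y \<longleftrightarrow> sat mem UNIV (v(0 := y)) \<phi>"
    unfolding ax_Class_def by blast
  then have "el Y = {y \<in> \<S>. sat mem UNIV (v(0 := y)) \<phi>}" using el_S by auto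
  then show ?thesis by (auto simp: is_class_def)
qed

lemma emp_in_iff: "(\<exists>e. (\<forall>t. \<not> t \<epsilon> e) \<and> e \<epsilon> X) \<longleftrightarrow> emp \<epsilon> X"
proof -
  have "(\<forall>t. \<not> t \<epsilon> e) \<longleftrightarrow> e = emp" for e using nonempty_el[of e] not_in_emp by auto
  then show ?thesis by simp
qed

lemma adj_in_iff:
  assumes "a \<in> \<S>" "b \<in> \<S>"
  shows "(\<exists>s. (\<forall>t. t \<epsilon> s \<longleftrightarrow> t \<epsilon> a \<or> t = b) \<and> s \<epsilon> X) \<longleftrightarrow> adj a b \<epsilon> X"
proof -
  have "(\<forall>t. t \<epsilon> s \<longleftrightarrow> t \<epsilon> a \<or> t = b) \<longleftrightarrow> s = adj a b" for s
    using assms set_ext[of s "adj a b"] by (auto simp: in_adj)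
  then show ?thesis by simp
qed

lemma is_class_S: "is_class \<S>"
proof -
  have "is_class {x \<in> \<S>. True}" by (rule comprehension) (rule dfn_const)
  then show ?thesis by simp
qed

definition "inductive_cl X \<longleftrightarrow> emp \<epsilon> X \<and> (\<forall>n. n \<epsilon> X \<longrightarrow> suc n \<epsilon> X)"
definition "adj_closed X \<longleftrightarrow> emp \<epsilon> X \<and> (\<forall>a b. a \<epsilon> X \<and> b \<epsilon> X \<longrightarrow> adj a b \<epsilon> X)"

lemma Inter_el: "\<Inter> {el X | X. Q X} = {y. \<forall>X. Q X \<longrightarrow> y \<epsilon> X}"
  by auto

lemma SN_eq: "SN = {y. \<forall>X. inductive_cl X \<longrightarrow> y \<epsilon> X}"
  unfolding std_nats_def Inter_el by (simp add: inductive_cl_def)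

lemma std_sets_eq: "std_sets mem = {y. \<forall>X. adj_closed X \<longrightarrow> y \<epsilon> X}"
  unfolding std_sets_def Inter_el by (simp add: adj_closed_def imp_conjL)

lemma is_class_SN: "is_class SN"
proof -
  let ?\<phi> = "FAll 1 (FImp (FAnd (FEx 2 (FAnd (FAll 3 (FNot (FMem 3 2))) (FMem 2 1)))
     (FAll 2 (FImp (FMem 2 1) (FEx 3 (FAnd (FAll 4 (FIff (FMem 4 3) (FOr (FMem 4 2) (FEq 4 2)))) (FMem 3 1)))))) (FMem 0 1))"
  have cl: "is_class {y \<in> \<S>. sat mem UNIV ((\<lambda>_. emp)(0 := y)) ?\<phi>}" by (rule class_formula)
  have eq: "sat mem UNIV ((\<lambda>_. emp)(0 := y)) ?\<phi> \<longleftrightarrow> (\<forall>X. inductive_cl X \<longrightarrow> y \<epsilon> X)" for y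
  proof -
    have "sat mem UNIV ((\<lambda>_. emp)(0 := y)) ?\<phi> \<longleftrightarrow> (\<forall>X. (\<exists>e. (\<forall>t. \<not> t \<epsilon> e) \<and> e \<epsilon> X) \<and>
      (\<forall>n. n \<epsilon> X \<longrightarrow> (\<exists>s. (\<forall>t. t \<epsilon> s \<longleftrightarrow> t \<epsilon> n \<or> t = n) \<and> s \<epsilon> X)) \<longrightarrow> y \<epsilon> X)"
      by (simp add: imp_conjL)
    also have "\<dots> \<longleftrightarrow> (\<forall>X. inductive_cl X \<longrightarrow> y \<epsilon> X)"
    proof -
      have "(\<forall>n. n \<epsilon> X \<longrightarrow> (\<exists>s. (\<forall>t. t \<epsilon> s \<longleftrightarrow> t \<epsilon> n \<or> t = n) \<and> s \<epsilon> X)) \<longleftrightarrow>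
          (\<forall>n. n \<epsilon> X \<longrightarrow> suc n \<epsilon> X)" for X
        unfolding succ_def by (intro iff_allI imp_cong refl adj_in_iff; erule el_S)
      then show ?thesis unfolding inductive_cl_def emp_in_iff by simp
    qed
    finally show ?thesis .
  qed
  from cl have "is_class {y \<in> \<S>. \<forall>X. inductive_cl X \<longrightarrow> y \<epsilon> X}" unfolding eq .
  also have "{y \<in> \<S>. \<forall>X. inductive_cl X \<longrightarrow> y \<epsilon> X} = SN"
  proof -
    obtain U where U: "el U = \<S>" using is_class_S by (auto simp: is_class_def)
    have i: "x \<epsilon> U \<longleftrightarrow> x \<in> \<S>" for x using in_el[of x U] U by simp
    have "inductive_cl U" unfolding inductive_cl_def i by simp
    then show ?thesis using i SN_eq by blast
  qed
  finally show ?thesis .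
qed

lemma is_class_std_sets: "is_class (std_sets mem)"
proof -
  let ?\<phi> = "FAll 1 (FImp (FAnd (FEx 2 (FAnd (FAll 3 (FNot (FMem 3 2))) (FMem 2 1)))
     (FAll 2 (FAll 5 (FImp (FAnd (FMem 2 1) (FMem 5 1)) (FEx 3 (FAnd (FAll 4 (FIff (FMem 4 3) (FOr (FMem 4 2) (FEq 4 5)))) (FMem 3 1))))))) (FMem 0 1))"
  have cl: "is_class {y \<in> \<S>. sat mem UNIV ((\<lambda>_. emp)(0 := y)) ?\<phi>}" by (rule class_formula)
  have eq: "sat mem UNIV ((\<lambda>_. emp)(0 := y)) ?\<phi> \<longleftrightarrow> (\<forall>X. adj_closed X \<longrightarrow> y \<epsilon> X)" for y
  proof -
    have "sat mem UNIV ((\<lambda>_. emp)(0 := y)) ?\<phi> \<longleftrightarrow> (\<forall>X. (\<exists>e. (\<forall>t. \<not> t \<epsilon> e) \<and> e \<epsilon> X) \<and>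
      (\<forall>a b. a \<epsilon> X \<and> b \<epsilon> X \<longrightarrow> (\<exists>s. (\<forall>t. t \<epsilon> s \<longleftrightarrow> t \<epsilon> a \<or> t = b) \<and> s \<epsilon> X)) \<longrightarrow> y \<epsilon> X)"
      by (simp add: imp_conjL)
    also have "\<dots> \<longleftrightarrow> (\<forall>X. adj_closed X \<longrightarrow> y \<epsilon> X)"
    proof -
      have "(\<forall>a b. a \<epsilon> X \<and> b \<epsilon> X \<longrightarrow> (\<exists>s. (\<forall>t. t \<epsilon> s \<longleftrightarrow> t \<epsilon> a \<or> t = b) \<and> s \<epsilon> X)) \<longleftrightarrow>
          (\<forall>a b. a \<epsilon> X \<and> b \<epsilon> X \<longrightarrow> adj a b \<epsilon> X)" for X
        by (intro iff_allI imp_cong refl adj_in_iff) (auto dest: el_S)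
      then show ?thesis unfolding adj_closed_def emp_in_iff by simp
    qed
    finally show ?thesis .
  qed
  from cl have "is_class {y \<in> \<S>. \<forall>X. adj_closed X \<longrightarrow> y \<epsilon> X}" unfolding eq .
  also have "{y \<in> \<S>. \<forall>X. adj_closed X \<longrightarrow> y \<epsilon> X} = std_sets mem"
  proof -
    obtain U where U: "el U = \<S>" using is_class_S by (auto simp: is_class_def)
    have i: "x \<epsilon> U \<longleftrightarrow> x \<in> \<S>" for x using in_el[of x U] U by simp
    have "adj_closed U" unfolding adj_closed_def i by simp
    then show ?thesis using i std_sets_eq by blast
  qed
  finally show ?thesis .
qed

lemma emp_SN [simp]: "emp \<in> SN"
  by (auto simp: std_nats_def)

lemma suc_SN [simp]: "n \<in> SN \<Longrightarrow> suc n \<in> SN"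
  by (auto simp: std_nats_def)

lemma SN_S [simp]: "n \<in> SN \<Longrightarrow> n \<in> \<S>"
  using is_class_sub_S[OF is_class_SN] by auto

lemma SN_induct:
  assumes P: "dfn True (\<lambda>v. P (v 0))" and n: "n \<in> SN" and "P emp"
    and step: "\<And>m. m \<in> SN \<Longrightarrow> P m \<Longrightarrow> P (suc m)"
  shows "P n"
proof -
  have "dfn True (\<lambda>v. v 0 \<in> SN \<and> P (v 0))" by (intro dfn_intros is_class_SN P)
  from comprehension[OF this] obtain X where X: "el X = {x \<in> \<S>. x \<in> SN \<and> P x}" by (auto simp: is_class_def)
  have i: "x \<epsilon> X \<longleftrightarrow> x \<in> SN \<and> P x" for x using X in_el[of x X] by auto
  have "inductive_cl X" unfolding inductive_cl_def i using assms(3) step emp_SN suc_SN by blast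
  then have "n \<epsilon> X" using n unfolding SN_eq by blast
  then show ?thesis using i by blast
qed

lemma SN_N [simp]: "n \<in> SN \<Longrightarrow> n \<in> \<N>"
  by (rule SN_induct[of "\<lambda>n. n \<in> \<N>"]) (intro dfn_intros | simp)+

lemma SN_el: "n \<in> SN \<Longrightarrow> k \<epsilon> n \<Longrightarrow> k \<in> SN"
proof -
  assume n: "n \<in> SN" and k: "k \<epsilon> n"
  have "\<forall>k\<in>el n. k \<in> SN"
    by (rule SN_induct[of "\<lambda>n. \<forall>k\<in>el n. k \<in> SN", OF _ n])
      (intro dfn_intros is_class_SN | auto simp: in_suc)+
  then show ?thesis using k by simp
qed

lemma SN_small: "n \<in> SN \<Longrightarrow> small mem n"
proof (rule smallI)
  fix A assume n: "n \<in> SN" and A: "is_class A" "A \<subseteq> el n"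
  have "\<exists>w\<in>\<S>. \<forall>t\<in>\<S>. t \<epsilon> w \<longleftrightarrow> t \<epsilon> n \<and> t \<in> A"
  proof (rule SN_induct[of "\<lambda>n. \<exists>w\<in>\<S>. \<forall>t\<in>\<S>. t \<epsilon> w \<longleftrightarrow> t \<epsilon> n \<and> t \<in> A", OF _ n])
    show "dfn True (\<lambda>v. \<exists>w\<in>\<S>. \<forall>t\<in>\<S>. t \<epsilon> w \<longleftrightarrow> t \<epsilon> v 0 \<and> t \<in> A)"
      by (intro dfn_intros A)
    show "\<exists>w\<in>\<S>. \<forall>t\<in>\<S>. t \<epsilon> w \<longleftrightarrow> t \<epsilon> emp \<and> t \<in> A" by (rule bexI[of _ emp]) auto
    fix m assume m: "m \<in> SN" "\<exists>w\<in>\<S>. \<forall>t\<in>\<S>. t \<epsilon> w \<longleftrightarrow> t \<epsilon> m \<and> t \<in> A"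
    then obtain w where w: "w \<in> \<S>" "\<forall>t\<in>\<S>. t \<epsilon> w \<longleftrightarrow> t \<epsilon> m \<and> t \<in> A" by blast
    show "\<exists>w\<in>\<S>. \<forall>t\<in>\<S>. t \<epsilon> w \<longleftrightarrow> t \<epsilon> suc m \<and> t \<in> A"
    proof (cases "m \<in> A")
      case True
      then show ?thesis using w m by (intro bexI[of _ "adj w m"]) (auto simp: in_adj in_suc)
    next
      case False
      then show ?thesis using w m by (intro bexI[of _ w]) (auto simp: in_suc)
    qed
  qed
  then have "is_set {t \<in> \<S>. t \<epsilon> n \<and> t \<in> A}" by (rule is_setI)
  then show "is_set A" by (rule back_subst[of is_set]) (use A el_S in auto)
qed

lemma SN_bounded:
  assumes x: "x \<in> \<S>" "el x \<subseteq> SN"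
  shows "\<exists>n\<in>SN. el x \<subseteq> el n"
proof -
  have "x = emp \<or> (\<exists>m. m \<epsilon> x \<and> (\<forall>k. k \<epsilon> x \<longrightarrow> k = m \<or> k \<epsilon> m))"
  proof -
    have "el x \<subseteq> \<N> \<longrightarrow> x = emp \<or> (\<exists>m\<in>el x. \<forall>k\<in>el x. k = m \<or> k \<epsilon> m)"
    proof (rule set_induct[of "\<lambda>x. el x \<subseteq> \<N> \<longrightarrow> x = emp \<or> (\<exists>m\<in>el x. \<forall>k\<in>el x. k = m \<or> k \<epsilon> m)", OF _ x(1)])
      have "dfn False (\<lambda>v. (\<forall>k\<in>el (v 0). k \<in> \<N>) \<longrightarrow> v 0 = emp \<or> (\<exists>m\<in>el (v 0). \<forall>k\<in>el (v 0). k = m \<or> k \<epsilon> m))"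
        by (intro dfn_intros emp_S)
      then show "dfn False (\<lambda>v. el (v 0) \<subseteq> \<N> \<longrightarrow> v 0 = emp \<or> (\<exists>m\<in>el (v 0). \<forall>k\<in>el (v 0). k = m \<or> k \<epsilon> m))"
        by (rule dfn_back) (simp add: subset_iff)
      fix x y assume *: "x \<in> \<S>" "y \<in> \<S>" "el x \<subseteq> \<N> \<longrightarrow> x = emp \<or> (\<exists>m\<in>el x. \<forall>k\<in>el x. k = m \<or> k \<epsilon> m)"
      show "el (adj x y) \<subseteq> \<N> \<longrightarrow> adj x y = emp \<or> (\<exists>m\<in>el (adj x y). \<forall>k\<in>el (adj x y). k = m \<or> k \<epsilon> m)"
      proof
        assume sub: "el (adj x y) \<subseteq> \<N>"
        then have sub': "\<And>t. t \<epsilon> x \<Longrightarrow> t \<in> \<N>" "y \<in> \<N>" using * by (auto simp: el_adj)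
        show "adj x y = emp \<or> (\<exists>m\<in>el (adj x y). \<forall>k\<in>el (adj x y). k = m \<or> k \<epsilon> m)"
        proof (cases "x = emp")
          case False
          then obtain m where m: "m \<epsilon> x" "\<And>k. k \<epsilon> x \<Longrightarrow> k = m \<or> k \<epsilon> m" using * sub' by auto
          show ?thesis
          proof (cases "m \<epsilon> y")
            case True
            then have "k \<epsilon> y" if "k \<epsilon> x" for k using that m sub' N_trans by metis
            then show ?thesis using * by (auto simp: in_adj)
          next
            case False
            then have "y = m \<or> y \<epsilon> m" using N_linear m sub' by blast
            then show ?thesis using * m by (auto simp: in_adj)
          qed
        qed (use * in \<open>auto simp: in_adj\<close>)
      qed
    qed simp
    then show ?thesis using x by auto
  qed
  then show ?thesis
  proof
    assume "\<exists>m. m \<epsilon> x \<and> (\<forall>k. k \<epsilon> x \<longrightarrow> k = m \<or> k \<epsilon> m)"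
    then obtain m where m: "m \<epsilon> x" "\<And>k. k \<epsilon> x \<Longrightarrow> k = m \<or> k \<epsilon> m" by blast
    then have "m \<in> SN" using x by auto
    then show ?thesis using m by (intro bexI[of _ "suc m"]) (auto simp: in_suc)
  next
    assume "x = emp"
    then show ?thesis by (intro bexI[of _ emp]) auto
  qed
qed

lemma thin_SN: "thin_class SN"
  unfolding thin_class_def
proof (intro conjI ballI impI is_class_SN)
  fix x assume "x \<in> \<S>" "el x \<subseteq> SN"
  from SN_bounded[OF this] obtain n where "n \<in> SN" "el x \<subseteq> el n" by blast
  then show "small mem x" using small_subset SN_small by blast
qed

lemma std_emp: "emp \<in> std_sets mem"
  and std_adj: "a \<in> std_sets mem \<Longrightarrow> b \<in> std_sets mem \<Longrightarrow> adj a b \<in> std_sets mem"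
  unfolding std_sets_eq adj_closed_def by blast+

lemma std_sets_induct:
  assumes P: "dfn True (\<lambda>v. P (v 0))" and x: "x \<in> std_sets mem" and "P emp"
    and step: "\<And>a b. a \<in> std_sets mem \<Longrightarrow> b \<in> std_sets mem \<Longrightarrow> P a \<Longrightarrow> P b \<Longrightarrow> P (adj a b)"
  shows "P x"
proof -
  have "dfn True (\<lambda>v. v 0 \<in> std_sets mem \<and> P (v 0))" by (intro dfn_intros is_class_std_sets P)
  from comprehension[OF this] obtain X where X: "el X = {x \<in> \<S>. x \<in> std_sets mem \<and> P x}" by (auto simp: is_class_def)
  have i: "x \<epsilon> X \<longleftrightarrow> x \<in> std_sets mem \<and> P x" for x
    using X in_el[of x X] is_class_sub_S[OF is_class_std_sets] by auto
  have "adj_closed X" unfolding adj_closed_def i using assms(3) step std_emp std_adj by blast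
  then have "x \<epsilon> X" using x unfolding std_sets_eq by blast
  then show ?thesis using i by blast
qed

lemma std_S: "a \<in> std_sets mem \<Longrightarrow> a \<in> \<S>"
  using is_class_sub_S[OF is_class_std_sets] by auto

lemma std_el: "x \<in> std_sets mem \<Longrightarrow> y \<epsilon> x \<Longrightarrow> y \<in> std_sets mem"
proof -
  assume x: "x \<in> std_sets mem" and y: "y \<epsilon> x"
  have "\<forall>k\<in>el x. k \<in> std_sets mem"
    by (rule std_sets_induct[of "\<lambda>x. \<forall>k\<in>el x. k \<in> std_sets mem", OF _ x])
      (intro dfn_intros is_class_std_sets | auto simp: in_adj std_S)+
  then show ?thesis using y by simp
qed

lemma std_pr: "x \<in> \<S> \<Longrightarrow> y \<in> \<S> \<Longrightarrow> pr x y \<in> std_sets mem \<longleftrightarrow> x \<in> std_sets mem \<and> y \<in> std_sets mem"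
proof
  assume S: "x \<in> \<S>" "y \<in> \<S>" and "pr x y \<in> std_sets mem"
  moreover have "cls {x, y} \<in> el (pr x y)" using S by (simp add: el_pr del: in_el)
  moreover have "x \<in> el (cls {x, y})" "y \<in> el (cls {x, y})" using S by (simp_all add: el_double del: in_el)
  ultimately show "x \<in> std_sets mem \<and> y \<in> std_sets mem" using std_el by (metis in_el)
qed (simp add: pr_adj std_adj std_emp std_S)

lemma SN_std: "n \<in> SN \<Longrightarrow> n \<in> std_sets mem"
  by (rule SN_induct[of "\<lambda>n. n \<in> std_sets mem"])
    (intro dfn_intros is_class_std_sets | simp add: std_emp succ_def std_adj)+

text \<open>A standard set contains only boundedly many standard numbers, hence not all of them.\<close>

lemma std_N_SN:
  assumes "n \<in> std_sets mem" "n \<in> \<N>"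
  shows "n \<in> SN"
proof (rule ccontr)
  have "\<exists>m\<in>SN. \<forall>k\<in>SN. k \<epsilon> n \<longrightarrow> k \<epsilon> m"
  proof (rule std_sets_induct[of "\<lambda>n. \<exists>m\<in>SN. \<forall>k\<in>SN. k \<epsilon> n \<longrightarrow> k \<epsilon> m", OF _ assms(1)])
    show "dfn True (\<lambda>v. \<exists>m\<in>SN. \<forall>k\<in>SN. k \<epsilon> v 0 \<longrightarrow> k \<epsilon> m)" by (intro dfn_intros is_class_SN)
    show "\<exists>m\<in>SN. \<forall>k\<in>SN. k \<epsilon> emp \<longrightarrow> k \<epsilon> m" by (rule bexI[of _ emp]) auto
    fix a b assume *: "a \<in> std_sets mem" "b \<in> std_sets mem" "\<exists>m\<in>SN. \<forall>k\<in>SN. k \<epsilon> a \<longrightarrow> k \<epsilon> m"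
    then obtain m where m: "m \<in> SN" "\<forall>k\<in>SN. k \<epsilon> a \<longrightarrow> k \<epsilon> m" by blast
    have i: "k \<epsilon> adj a b \<longleftrightarrow> k = b \<or> k \<epsilon> a" for k using * std_S by (simp add: in_adj)
    show "\<exists>m\<in>SN. \<forall>k\<in>SN. k \<epsilon> adj a b \<longrightarrow> k \<epsilon> m"
    proof (cases "b \<in> SN \<and> \<not> b \<epsilon> m")
      case True
      then have "m = b \<or> m \<epsilon> b" using N_linear[of b m] m by auto
      then have "\<forall>k\<in>SN. k \<epsilon> adj a b \<longrightarrow> k \<epsilon> suc b"
        using m True N_trans[of b] by (auto simp: i in_suc)
      then show ?thesis using True by (intro bexI[of _ "suc b"]) auto
    next
      case False
      then show ?thesis using m by (intro bexI[of _ m]) (auto simp: i)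
    qed
  qed
  then obtain m where m: "m \<in> SN" "\<forall>k\<in>SN. k \<epsilon> n \<longrightarrow> k \<epsilon> m" by blast
  assume "n \<notin> SN"
  then have "m \<epsilon> n" using N_linear[of m n] m SN_el[OF m(1)] assms by auto
  then show False using m N_irrefl[of m] by auto
qed

section \<open>Recursion on the natural numbers\<close>

lemma app_eq: "is_function mem f \<Longrightarrow> x \<in> \<S> \<Longrightarrow> y \<in> \<S> \<Longrightarrow> pr x y \<epsilon> f \<Longrightarrow> app mem f x = y"
  unfolding app_def is_function_def by (rule the_equality) blast+

lemma app_in:
  assumes "is_function mem f" "x \<in> dom_of mem f"
  shows "app mem f x \<in> \<S>" "pr x (app mem f x) \<epsilon> f"
proof -
  obtain y where "x \<in> \<S>" "y \<in> \<S>" "pr x y \<epsilon> f" using assms(2) by (auto simp: dom_of_def)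
  moreover from this have "app mem f x = y" using app_eq assms(1) by blast
  ultimately show "app mem f x \<in> \<S>" "pr x (app mem f x) \<epsilon> f" by simp_all
qed

definition rec_body :: "'a \<Rightarrow> ('a \<Rightarrow> 'a) \<Rightarrow> 'a \<Rightarrow> 'a \<Rightarrow> bool" where
  "rec_body a G f n \<longleftrightarrow> is_function mem f \<and> dom_of mem f = el (suc n) \<and> app mem f emp = a \<and>
     (\<forall>i\<in>el n. app mem f (suc i) = G (app mem f i))"

text \<open>The first-order version of \<open>rec_body\<close>: \<open>A\<close> bounds the values and \<open>H\<close> is the graph of \<open>G\<close>.\<close>

definition rec_fun :: "('a \<Rightarrow> bool) \<Rightarrow> ('a \<Rightarrow> 'a \<Rightarrow> bool) \<Rightarrow> 'a \<Rightarrow> 'a \<Rightarrow> 'a \<Rightarrow> bool" where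
  "rec_fun A H a f n \<longleftrightarrow> (\<forall>p\<in>el f. \<exists>i\<in>el (suc n). \<exists>y\<in>\<S>. p = pr i y) \<and>
     (\<forall>i\<in>el (suc n). \<exists>y\<in>\<S>. A y \<and> pr i y \<epsilon> f) \<and>
     (\<forall>i\<in>\<S>. \<forall>y\<in>\<S>. \<forall>z\<in>\<S>. pr i y \<epsilon> f \<and> pr i z \<epsilon> f \<longrightarrow> y = z) \<and> pr emp a \<epsilon> f \<and>
     (\<forall>i\<in>el n. \<forall>y\<in>\<S>. \<forall>z\<in>\<S>. pr i y \<epsilon> f \<and> pr (suc i) z \<epsilon> f \<longrightarrow> H y z)"

lemma rec_body_unique:
  assumes n: "n \<in> \<N>" and f: "f \<in> \<S>" "rec_body a G f n" and g: "g \<in> \<S>" "rec_body a G g n"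
    and i: "i \<epsilon> suc n"
  shows "app mem f i = app mem g i"
proof -
  have iff: "pr i y \<epsilon> h \<longleftrightarrow> y = app mem h i" if "rec_body a G h n" "i \<epsilon> suc n" "y \<in> \<S>" for h i y
  proof -
    have "is_function mem h" "i \<in> dom_of mem h" using that by (simp_all add: rec_body_def)
    then show ?thesis using app_in[of h i] app_eq[of h i y] that el_S[OF that(2)] by auto
  qed
  have S: "app mem h i \<in> \<S>" if "rec_body a G h n" "i \<epsilon> suc n" for h i
    using that app_in(1)[of h i] by (simp add: rec_body_def)
  have iN: "i \<in> \<N>" using N_el[OF suc_N[OF n] i] .
  have "i \<epsilon> suc n \<longrightarrow> (\<forall>y\<in>\<S>. pr i y \<epsilon> f \<longleftrightarrow> pr i y \<epsilon> g)"
  proof (rule N_induct[of "\<lambda>i. i \<epsilon> suc n \<longrightarrow> (\<forall>y\<in>\<S>. pr i y \<epsilon> f \<longleftrightarrow> pr i y \<epsilon> g)", OF _ iN])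
    show "dfn False (\<lambda>v. v 0 \<epsilon> suc n \<longrightarrow> (\<forall>y\<in>\<S>. pr (v 0) y \<epsilon> f \<longleftrightarrow> pr (v 0) y \<epsilon> g))"
      by (intro dfn_intros suc_S N_S n f g)
    show "emp \<epsilon> suc n \<longrightarrow> (\<forall>y\<in>\<S>. pr emp y \<epsilon> f \<longleftrightarrow> pr emp y \<epsilon> g)"
      using iff[OF f(2)] iff[OF g(2)] f(2) g(2) by (simp add: rec_body_def)
    fix m assume m: "m \<in> \<N>" "m \<epsilon> suc n \<longrightarrow> (\<forall>y\<in>\<S>. pr m y \<epsilon> f \<longleftrightarrow> pr m y \<epsilon> g)"
    show "suc m \<epsilon> suc n \<longrightarrow> (\<forall>y\<in>\<S>. pr (suc m) y \<epsilon> f \<longleftrightarrow> pr (suc m) y \<epsilon> g)"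
    proof
      assume sm: "suc m \<epsilon> suc n"
      have mn: "m \<epsilon> suc n" using N_trans[OF suc_N[OF n] in_suc_self[OF m(1)] sm] .
      have mn': "m \<epsilon> n"
      proof -
        have "suc m = n \<or> suc m \<epsilon> n" using sm n by (simp add: in_suc)
        then show ?thesis using in_suc_self[OF m(1)] N_trans[OF n] by blast
      qed
      have "app mem f m = app mem g m"
        using m(2) mn iff[OF f(2) mn S[OF f(2) mn]] iff[OF g(2) mn S[OF f(2) mn]] S[OF f(2) mn] by simp
      then have "app mem f (suc m) = app mem g (suc m)"
        using f(2) g(2) mn' by (simp add: rec_body_def)
      then show "\<forall>y\<in>\<S>. pr (suc m) y \<epsilon> f \<longleftrightarrow> pr (suc m) y \<epsilon> g"
        using iff[OF f(2) sm] iff[OF g(2) sm] by simp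
    qed
  qed
  then show ?thesis using i iff[OF f(2) i S[OF f(2) i]] iff[OF g(2) i S[OF f(2) i]] S[OF f(2) i] by simp
qed

end

locale nat_rec = ths mem for mem :: "'a \<Rightarrow> 'a \<Rightarrow> bool" (infix "\<epsilon>" 50) +
  fixes A :: "'a \<Rightarrow> bool" and H :: "'a \<Rightarrow> 'a \<Rightarrow> bool" and a :: 'a and G :: "'a \<Rightarrow> 'a" and b :: bool and N :: "'a set"
  assumes a: "A a" and AS: "\<And>y. A y \<Longrightarrow> y \<in> \<S>" and GA: "\<And>y. A y \<Longrightarrow> A (G y)"
    and dA: "dfn b (\<lambda>v. A (v 0))" and dH: "dfn b (\<lambda>v. H (v 0) (v 1))"
    and H: "\<And>y z. A y \<Longrightarrow> z \<in> \<S> \<Longrightarrow> H y z \<longleftrightarrow> z = G y"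
    and N: "\<And>n. n \<in> N \<Longrightarrow> n \<in> \<N>"
    and ind: "\<And>P n. dfn b (\<lambda>v. P (v 0)) \<Longrightarrow> n \<in> N \<Longrightarrow> P emp \<Longrightarrow>
      (\<And>m. m \<in> N \<Longrightarrow> P m \<Longrightarrow> P (suc m)) \<Longrightarrow> P n"
begin

lemma rec_fun_A: "n \<in> N \<Longrightarrow> rec_fun A H a f n \<Longrightarrow> y \<in> \<S> \<Longrightarrow> i \<in> \<S> \<Longrightarrow> pr i y \<epsilon> f \<Longrightarrow> i \<epsilon> suc n \<and> A y"
proof -
  assume n: "n \<in> N" and f: "rec_fun A H a f n" and y: "y \<in> \<S>" "i \<in> \<S>" "pr i y \<epsilon> f"
  then obtain j z where "j \<epsilon> suc n" "z \<in> \<S>" "pr i y = pr j z" unfolding rec_fun_def by auto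
  then have i: "i \<epsilon> suc n" using y el_S[of j] by (simp add: pr_inj)
  then obtain w where "w \<in> \<S>" "A w" "pr i w \<epsilon> f" using f unfolding rec_fun_def by auto
  then have "w = y" using f y unfolding rec_fun_def by blast
  then show ?thesis using i \<open>A w\<close> by simp
qed

lemma rec_fun_body: "n \<in> N \<Longrightarrow> f \<in> \<S> \<Longrightarrow> rec_fun A H a f n \<Longrightarrow> rec_body a G f n"
proof -
  assume n: "n \<in> N" and f: "f \<in> \<S>" "rec_fun A H a f n"
  have nS: "n \<in> \<S>" using N[OF n] by simp
  have fn: "is_function mem f" unfolding is_function_def
  proof (intro conjI ballI impI)
    fix p assume "p \<in> el f"
    then obtain i y where "i \<in> el (suc n)" "y \<in> \<S>" "p = pr i y" using f(2) unfolding rec_fun_def by blast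
    then show "\<exists>x\<in>\<S>. \<exists>y\<in>\<S>. p = pr x y" using el_sub_S by blast
  next
    fix x y z assume "x \<in> \<S>" "y \<in> \<S>" "z \<in> \<S>" "pr x y \<epsilon> f \<and> pr x z \<epsilon> f"
    then show "y = z" using f(2) unfolding rec_fun_def by blast
  qed
  have dom: "dom_of mem f = el (suc n)"
  proof
    show "dom_of mem f \<subseteq> el (suc n)" using rec_fun_A[OF n f(2)] unfolding dom_of_def by auto
    show "el (suc n) \<subseteq> dom_of mem f"
    proof
      fix i assume i: "i \<in> el (suc n)"
      then obtain y where "y \<in> \<S>" "pr i y \<epsilon> f" using f(2) unfolding rec_fun_def by blast
      then show "i \<in> dom_of mem f" using el_S[of i "suc n"] i unfolding dom_of_def by auto
    qed
  qed
  have "app mem f emp = a" using app_eq[OF fn emp_S AS[OF a]] f(2) unfolding rec_fun_def by blast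
  moreover have "app mem f (suc i) = G (app mem f i)" if i: "i \<epsilon> n" for i
  proof -
    have iS: "i \<in> \<S>" using el_S[OF i] .
    have i': "i \<epsilon> suc n" "suc i \<epsilon> suc n"
      using i N_suc_le[OF N_el[OF N[OF n] i] N[OF n] i] nS by (auto simp: in_suc)
    then have d: "i \<in> dom_of mem f" "suc i \<in> dom_of mem f" unfolding dom by simp_all
    note p = app_in[OF fn d(1)] and q = app_in[OF fn d(2)]
    have "H (app mem f i) (app mem f (suc i))" using f(2) i p q unfolding rec_fun_def by auto
    moreover have "A (app mem f i)" using rec_fun_A[OF n f(2) p(1) iS p(2)] by blast
    ultimately show ?thesis using H q(1) by blast
  qed
  ultimately show ?thesis using fn dom unfolding rec_body_def by simp
qed

lemma rec_fun_step:
  assumes n: "n \<in> N" and f: "f \<in> \<S>" "rec_fun A H a f n" and y: "y \<in> \<S>" "pr n y \<epsilon> f"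
  shows "adj f (pr (suc n) (G y)) \<in> \<S> \<and> rec_fun A H a (adj f (pr (suc n) (G y))) (suc n)"
proof -
  have nN: "n \<in> \<N>" and nS: "n \<in> \<S>" using N[OF n] by simp_all
  have Ay: "A y" using rec_fun_A[OF n f(2) y(1) nS y(2)] by blast
  have GS: "G y \<in> \<S>" using AS[OF GA[OF Ay]] .
  let ?g = "adj f (pr (suc n) (G y))"
  have pS: "pr (suc n) (G y) \<in> \<S>" using nS GS by simp
  have ing: "p \<epsilon> ?g \<longleftrightarrow> p = pr (suc n) (G y) \<or> p \<epsilon> f" for p using in_adj[OF f(1) pS] .
  have nss: "\<not> suc n \<epsilon> suc n" using N_irrefl[OF suc_N[OF nN]] .
  have prg: "pr i z \<epsilon> ?g \<longleftrightarrow> (i = suc n \<and> z = G y) \<or> (pr i z \<epsilon> f \<and> i \<epsilon> suc n)" if "i \<in> \<S>" "z \<in> \<S>" for i z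
    using that nS GS rec_fun_A[OF n f(2) that(2,1)] unfolding ing by (auto simp: pr_inj)
  have ssn: "i \<epsilon> suc (suc n) \<longleftrightarrow> i = suc n \<or> i \<epsilon> suc n" for i using nS by (simp add: in_suc)
  have "rec_fun A H a ?g (suc n)" unfolding rec_fun_def
  proof (intro conjI ballI impI)
    fix p assume "p \<in> el ?g"
    then consider "p = pr (suc n) (G y)" | "p \<epsilon> f" unfolding in_el ing by blast
    then show "\<exists>i\<in>el (suc (suc n)). \<exists>y\<in>\<S>. p = pr i y"
    proof cases
      case 1
      then show ?thesis using GS ssn by auto
    next
      case 2
      then obtain i z where "i \<epsilon> suc n" "z \<in> \<S>" "p = pr i z" using f(2) unfolding rec_fun_def by auto
      then show ?thesis using ssn by auto
    qed
  next
    fix i assume "i \<in> el (suc (suc n))"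
    then consider "i = suc n" | "i \<epsilon> suc n" using ssn by auto
    then show "\<exists>y\<in>\<S>. A y \<and> pr i y \<epsilon> ?g"
    proof cases
      case 1
      then show ?thesis using GS GA[OF Ay] ing by auto
    next
      case 2
      then obtain z where "z \<in> \<S>" "A z" "pr i z \<epsilon> f" using f(2) unfolding rec_fun_def by auto
      then show ?thesis using ing by auto
    qed
  next
    fix i w z assume *: "i \<in> \<S>" "w \<in> \<S>" "z \<in> \<S>" "pr i w \<epsilon> ?g \<and> pr i z \<epsilon> ?g"
    have "pr i w \<epsilon> f \<Longrightarrow> pr i z \<epsilon> f \<Longrightarrow> w = z" using f(2) * unfolding rec_fun_def by blast
    then show "w = z" using * nss unfolding prg[OF *(1,2)] prg[OF *(1,3)] by auto
  next
    show "pr emp a \<epsilon> ?g" using f(2) unfolding rec_fun_def ing by blast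
  next
    fix i w z assume *: "i \<in> el (suc n)" "w \<in> \<S>" "z \<in> \<S>" "pr i w \<epsilon> ?g \<and> pr (suc i) z \<epsilon> ?g"
    have iS: "i \<in> \<S>" "suc i \<in> \<S>" using * el_S[of i] by simp_all
    have iN: "i \<in> \<N>" using * N_el[OF suc_N[OF nN]] by simp
    have w: "pr i w \<epsilon> f" using * nss unfolding prg[OF iS(1) *(2)] by auto
    consider "i = n" | "i \<epsilon> n" using * nS by (auto simp: in_suc)
    then show "H w z"
    proof cases
      case 1
      have "w = y" using w y f(2) *(2) nS unfolding rec_fun_def 1 by blast
      moreover have "z = G y" using *(4) nss prg[OF iS(2) *(3)] 1 by blast
      ultimately show ?thesis using H[OF Ay GS] by simp
    next
      case 2
      then have "suc i \<noteq> suc n" using suc_inj[OF iN nN] N_irrefl[OF nN] by auto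
      then have "pr (suc i) z \<epsilon> f" using *(4) unfolding prg[OF iS(2) *(3)] by auto
      then show ?thesis using f(2) w 2 *(2,3) unfolding rec_fun_def by auto
    qed
  qed
  then show ?thesis using f(1) pS by simp
qed

lemma rec_fun_emp: "adj emp (pr emp a) \<in> \<S> \<and> rec_fun A H a (adj emp (pr emp a)) emp"
proof -
  have aS: "a \<in> \<S>" "pr emp a \<in> \<S>" using AS[OF a] by simp_all
  have i: "p \<epsilon> adj emp (pr emp a) \<longleftrightarrow> p = pr emp a" for p using in_adj[OF emp_S aS(2)] by simp
  have s: "k \<epsilon> suc emp \<longleftrightarrow> k = emp" for k by (simp add: in_suc)
  show ?thesis unfolding rec_fun_def bex_el ball_el i s using aS a by (auto simp: pr_inj)
qed

lemma rec_fun_ex: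
  assumes n: "n \<in> N"
  shows "\<exists>f\<in>\<S>. rec_fun A H a f n"
proof (rule ind[of "\<lambda>n. \<exists>f\<in>\<S>. rec_fun A H a f n", OF _ n])
  have dA': "\<And>t. dterm b t \<Longrightarrow> dfn b (\<lambda>v. A (t v))"
    by (rule dfn_subst[of b "\<lambda>x v. A x", OF dA])
  show "dfn b (\<lambda>v. \<exists>f\<in>\<S>. rec_fun A H a f (v 0))"
    unfolding rec_fun_def by (intro dfn_intros dA' dfn2[OF dH] AS[OF a] emp_S)
  show "\<exists>f\<in>\<S>. rec_fun A H a f emp" using rec_fun_emp by blast
  fix m assume m: "m \<in> N" "\<exists>f\<in>\<S>. rec_fun A H a f m"
  then obtain f where f: "f \<in> \<S>" "rec_fun A H a f m" by blast
  then obtain y where "y \<in> \<S>" "pr m y \<epsilon> f"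
    using in_suc_self[OF N[OF m(1)]] unfolding rec_fun_def by auto
  from rec_fun_step[OF m(1) f this] show "\<exists>f\<in>\<S>. rec_fun A H a f (suc m)" by blast
qed

lemma nrec_eq:
  assumes n: "n \<in> N" and f: "f \<in> \<S>" "rec_fun A H a f n" and y: "y \<in> \<S>" "pr n y \<epsilon> f"
  shows "nrec mem a G n = y"
proof -
  note bf = rec_fun_body[OF n f]
  have "app mem f n = y" using app_eq[of f n y] bf y N[OF n] unfolding rec_body_def by simp
  then show ?thesis
    unfolding nrec_def using bf f(1) rec_body_unique[OF N[OF n] f(1) bf _ _ in_suc_self[OF N[OF n]]]
    by (intro the_equality) (auto simp: rec_body_def)
qed

lemma nrec_iff:
  assumes n: "n \<in> N" and k: "k \<in> \<S>"
  shows "nrec mem a G n = k \<longleftrightarrow> (\<exists>f\<in>\<S>. rec_fun A H a f n \<and> pr n k \<epsilon> f)"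
proof
  assume eq: "nrec mem a G n = k"
  obtain f where f: "f \<in> \<S>" "rec_fun A H a f n" using rec_fun_ex[OF n] by blast
  then obtain y where y: "y \<in> \<S>" "pr n y \<epsilon> f"
    using in_suc_self[OF N[OF n]] unfolding rec_fun_def by auto
  then have "y = k" using nrec_eq[OF n f y] eq by simp
  then show "\<exists>f\<in>\<S>. rec_fun A H a f n \<and> pr n k \<epsilon> f" using f y by blast
qed (use nrec_eq[OF n _ _ k] in blast)

lemma nrec_A: "n \<in> N \<Longrightarrow> A (nrec mem a G n)"
proof -
  assume n: "n \<in> N"
  obtain f where f: "f \<in> \<S>" "rec_fun A H a f n" using rec_fun_ex[OF n] by blast
  then obtain y where y: "y \<in> \<S>" "A y" "pr n y \<epsilon> f"
    using in_suc_self[OF N[OF n]] unfolding rec_fun_def by auto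
  then show ?thesis using nrec_eq[OF n f y(1,3)] by simp
qed

lemma nrec_0: "emp \<in> N \<Longrightarrow> nrec mem a G emp = a"
proof -
  assume e: "emp \<in> N"
  have "pr emp a \<epsilon> adj emp (pr emp a)" using AS[OF a] by (simp add: in_adj)
  then show ?thesis using nrec_eq[OF e _ _ AS[OF a]] rec_fun_emp by blast
qed

lemma nrec_suc: "n \<in> N \<Longrightarrow> suc n \<in> N \<Longrightarrow> nrec mem a G (suc n) = G (nrec mem a G n)"
proof -
  assume n: "n \<in> N" "suc n \<in> N"
  obtain f where f: "f \<in> \<S>" "rec_fun A H a f n" using rec_fun_ex[OF n(1)] by blast
  then obtain y where y: "y \<in> \<S>" "A y" "pr n y \<epsilon> f"
    using in_suc_self[OF N[OF n(1)]] unfolding rec_fun_def by auto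
  have GS: "G y \<in> \<S>" using AS[OF GA[OF y(2)]] .
  have g: "adj f (pr (suc n) (G y)) \<in> \<S>" "rec_fun A H a (adj f (pr (suc n) (G y))) (suc n)"
    using rec_fun_step[OF n(1) f y(1,3)] by blast+
  have "pr (suc n) (G y) \<epsilon> adj f (pr (suc n) (G y))" using N[OF n(1)] GS f(1) by (simp add: in_adj)
  then have "nrec mem a G (suc n) = G y" using nrec_eq[OF n(2) g GS] by blast
  then show ?thesis using nrec_eq[OF n(1) f y(1,3)] by simp
qed

end

section \<open>Arithmetic\<close>

context ths begin

text \<open>Addition and multiplication are made total, with junk value \<open>emp\<close>, in order to be terms of formulas.\<close>

definition nplus :: "'a \<Rightarrow> 'a \<Rightarrow> 'a" (infixl "\<boxplus>" 65) where
  "m \<boxplus> n = (if m \<in> \<N> \<and> n \<in> \<N> then nadd mem m n else emp)"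

definition ntimes :: "'a \<Rightarrow> 'a \<Rightarrow> 'a" (infixl "\<boxtimes>" 70) where
  "m \<boxtimes> n = (if m \<in> \<N> \<and> n \<in> \<N> then nmul mem m n else emp)"

lemma nadd_facts:
  assumes m: "m \<in> \<N>"
  shows "nadd mem m emp = m" "n \<in> \<N> \<Longrightarrow> nadd mem m (suc n) = suc (nadd mem m n)"
    "n \<in> \<N> \<Longrightarrow> nadd mem m n \<in> \<N>"
    "n \<in> \<N> \<Longrightarrow> k \<in> \<S> \<Longrightarrow> nadd mem m n = k \<longleftrightarrow>
      (\<exists>f\<in>\<S>. rec_fun (\<lambda>y. y \<in> \<N>) (\<lambda>y z. z = suc y) m f n \<and> pr n k \<epsilon> f)"
proof -
  have dA: "dfn False (\<lambda>v. v 0 \<in> \<N>)" and dH: "dfn False (\<lambda>v. v (Suc 0) = suc (v 0))"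
    by (intro dfn_intros)+
  interpret R: nat_rec mem "\<lambda>y. y \<in> \<N>" "\<lambda>y z. z = suc y" m "suc" False "\<N>"
  proof (unfold_locales)
    fix P n assume "dfn False (\<lambda>v. P (v 0))" "n \<in> \<N>" "P emp" "\<And>m. m \<in> \<N> \<Longrightarrow> P m \<Longrightarrow> P (suc m)"
    then show "P n" by (rule N_induct)
  qed (simp_all add: m dA dH)
  show "nadd mem m emp = m" "n \<in> \<N> \<Longrightarrow> nadd mem m (suc n) = suc (nadd mem m n)"
    "n \<in> \<N> \<Longrightarrow> nadd mem m n \<in> \<N>"
    "n \<in> \<N> \<Longrightarrow> k \<in> \<S> \<Longrightarrow> nadd mem m n = k \<longleftrightarrow>
      (\<exists>f\<in>\<S>. rec_fun (\<lambda>y. y \<in> \<N>) (\<lambda>y z. z = suc y) m f n \<and> pr n k \<epsilon> f)"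
    unfolding nadd_def by (simp_all only: R.nrec_0 R.nrec_suc R.nrec_A R.nrec_iff emp_N suc_N)
qed

lemma nplus_eq: "m \<in> \<N> \<Longrightarrow> n \<in> \<N> \<Longrightarrow> m \<boxplus> n = nadd mem m n"
  by (simp add: nplus_def)

lemma nplus_N [simp]: "m \<boxplus> n \<in> \<N>"
  by (simp add: nplus_def nadd_facts)

lemma dterm_nplus [dfn_intros]:
  assumes "dterm b t" "dterm b s"
  shows "dterm b (\<lambda>v. t v \<boxplus> s v)"
proof (rule dterm_subst2[OF _ assms])
  have "dfn b (\<lambda>v. (v 1 \<in> \<N> \<and> v 2 \<in> \<N> \<and> (\<exists>f\<in>\<S>. rec_fun (\<lambda>y. y \<in> \<N>) (\<lambda>y z. z = suc y) (v 1) f (v 2) \<and> pr (v 2) (v 0) \<epsilon> f))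
     \<or> (\<not> (v 1 \<in> \<N> \<and> v 2 \<in> \<N>) \<and> v 0 = emp))"
    unfolding rec_fun_def by (intro dfn_intros emp_S)
  then have "dfn b (\<lambda>v. v 0 = v 1 \<boxplus> v 2)"
  proof (rule dfn_back)
    fix v :: "nat \<Rightarrow> 'a" assume v: "range v \<subseteq> \<S>"
    show "(v 1 \<in> \<N> \<and> v 2 \<in> \<N> \<and> (\<exists>f\<in>\<S>. rec_fun (\<lambda>y. y \<in> \<N>) (\<lambda>y z. z = suc y) (v 1) f (v 2) \<and> pr (v 2) (v 0) \<epsilon> f))
     \<or> (\<not> (v 1 \<in> \<N> \<and> v 2 \<in> \<N>) \<and> v 0 = emp) \<longleftrightarrow> v 0 = v 1 \<boxplus> v 2"
      using nadd_facts(4)[of "v 1" "v 2" "v 0"] envS[OF v, of 0] unfolding nplus_def by (cases "v 1 \<in> \<N> \<and> v 2 \<in> \<N>") auto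
  qed
  then show "dterm b (\<lambda>v. v 0 \<boxplus> v 1)"
    unfolding dterm_def by (simp add: numeral_2_eq_2)
qed

lemma plus_0 [simp]: "m \<in> \<N> \<Longrightarrow> m \<boxplus> emp = m"
  by (simp add: nplus_def nadd_facts)

lemma plus_suc [simp]: "m \<in> \<N> \<Longrightarrow> n \<in> \<N> \<Longrightarrow> m \<boxplus> suc n = suc (m \<boxplus> n)"
  by (simp add: nplus_def nadd_facts)

lemma nmul_facts:
  assumes m: "m \<in> \<N>"
  shows "nmul mem m emp = emp" "n \<in> \<N> \<Longrightarrow> nmul mem m (suc n) = nadd mem (nmul mem m n) m"
    "n \<in> \<N> \<Longrightarrow> nmul mem m n \<in> \<N>"
    "n \<in> \<N> \<Longrightarrow> k \<in> \<S> \<Longrightarrow> nmul mem m n = k \<longleftrightarrow>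
      (\<exists>f\<in>\<S>. rec_fun (\<lambda>y. y \<in> \<N>) (\<lambda>y z. z = y \<boxplus> m) emp f n \<and> pr n k \<epsilon> f)"
proof -
  have dA: "dfn False (\<lambda>v. v 0 \<in> \<N>)" and dH: "dfn False (\<lambda>v. v (Suc 0) = v 0 \<boxplus> m)"
    by (intro dfn_intros N_S m)+
  interpret R: nat_rec mem "\<lambda>y. y \<in> \<N>" "\<lambda>y z. z = y \<boxplus> m" emp "\<lambda>y. nadd mem y m" False "\<N>"
  proof (unfold_locales)
    fix P n assume "dfn False (\<lambda>v. P (v 0))" "n \<in> \<N>" "P emp" "\<And>m. m \<in> \<N> \<Longrightarrow> P m \<Longrightarrow> P (suc m)"
    then show "P n" by (rule N_induct)
  qed (simp_all add: m dA dH nplus_eq nadd_facts)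
  show "nmul mem m emp = emp" "n \<in> \<N> \<Longrightarrow> nmul mem m (suc n) = nadd mem (nmul mem m n) m"
    "n \<in> \<N> \<Longrightarrow> nmul mem m n \<in> \<N>"
    "n \<in> \<N> \<Longrightarrow> k \<in> \<S> \<Longrightarrow> nmul mem m n = k \<longleftrightarrow>
      (\<exists>f\<in>\<S>. rec_fun (\<lambda>y. y \<in> \<N>) (\<lambda>y z. z = y \<boxplus> m) emp f n \<and> pr n k \<epsilon> f)"
    unfolding nmul_def by (simp_all only: R.nrec_0 R.nrec_suc R.nrec_A R.nrec_iff emp_N suc_N)
qed

lemma ntimes_eq: "m \<in> \<N> \<Longrightarrow> n \<in> \<N> \<Longrightarrow> m \<boxtimes> n = nmul mem m n"
  by (simp add: ntimes_def)

lemma ntimes_N [simp]: "m \<boxtimes> n \<in> \<N>"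
  by (simp add: ntimes_def nmul_facts)

lemma dterm_ntimes [dfn_intros]:
  assumes "dterm b t" "dterm b s"
  shows "dterm b (\<lambda>v. t v \<boxtimes> s v)"
proof (rule dterm_subst2[OF _ assms])
  have "dfn b (\<lambda>v. (v 1 \<in> \<N> \<and> v 2 \<in> \<N> \<and> (\<exists>f\<in>\<S>. rec_fun (\<lambda>y. y \<in> \<N>) (\<lambda>y z. z = y \<boxplus> v 1) emp f (v 2) \<and> pr (v 2) (v 0) \<epsilon> f))
     \<or> (\<not> (v 1 \<in> \<N> \<and> v 2 \<in> \<N>) \<and> v 0 = emp))"
    unfolding rec_fun_def by (intro dfn_intros emp_S)
  then have "dfn b (\<lambda>v. v 0 = v 1 \<boxtimes> v 2)"
  proof (rule dfn_back)
    fix v :: "nat \<Rightarrow> 'a" assume v: "range v \<subseteq> \<S>"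
    show "(v 1 \<in> \<N> \<and> v 2 \<in> \<N> \<and> (\<exists>f\<in>\<S>. rec_fun (\<lambda>y. y \<in> \<N>) (\<lambda>y z. z = y \<boxplus> v 1) emp f (v 2) \<and> pr (v 2) (v 0) \<epsilon> f))
     \<or> (\<not> (v 1 \<in> \<N> \<and> v 2 \<in> \<N>) \<and> v 0 = emp) \<longleftrightarrow> v 0 = v 1 \<boxtimes> v 2"
      using nmul_facts(4)[of "v 1" "v 2" "v 0"] envS[OF v, of 0] unfolding ntimes_def by (cases "v 1 \<in> \<N> \<and> v 2 \<in> \<N>") auto
  qed
  then show "dterm b (\<lambda>v. v 0 \<boxtimes> v 1)"
    unfolding dterm_def by (simp add: numeral_2_eq_2)
qed

lemma times_0 [simp]: "m \<in> \<N> \<Longrightarrow> m \<boxtimes> emp = emp"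
  by (simp add: ntimes_def nmul_facts)

lemma times_suc [simp]: "m \<in> \<N> \<Longrightarrow> n \<in> \<N> \<Longrightarrow> m \<boxtimes> suc n = m \<boxtimes> n \<boxplus> m"
  by (simp add: ntimes_def nplus_def nmul_facts)

lemma N_eq_induct:
  assumes "dterm False (\<lambda>v. f (v 0))" "dterm False (\<lambda>v. g (v 0))" "n \<in> \<N>" "f emp = g emp"
    "\<And>m. m \<in> \<N> \<Longrightarrow> f m = g m \<Longrightarrow> f (suc m) = g (suc m)"
  shows "f n = g n"
  by (rule N_induct[of "\<lambda>n. f n = g n"]) (intro dfn_intros assms | use assms in blast)+

lemma plus_0_left [simp]: "n \<in> \<N> \<Longrightarrow> emp \<boxplus> n = n"
  by (rule N_eq_induct[of "\<lambda>n. emp \<boxplus> n" "\<lambda>n. n"]) (intro dfn_intros emp_S | simp)+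

lemma plus_suc_left [simp]:
  assumes m: "m \<in> \<N>" and n: "n \<in> \<N>"
  shows "suc m \<boxplus> n = suc (m \<boxplus> n)"
  by (rule N_eq_induct[of "\<lambda>n. suc m \<boxplus> n" "\<lambda>n. suc (m \<boxplus> n)", OF _ _ n])
    (intro dfn_intros suc_S N_S m | simp add: m)+

lemma plus_comm:
  assumes m: "m \<in> \<N>" and n: "n \<in> \<N>"
  shows "m \<boxplus> n = n \<boxplus> m"
  by (rule N_eq_induct[of "\<lambda>n. m \<boxplus> n" "\<lambda>n. n \<boxplus> m", OF _ _ n])
    (intro dfn_intros N_S m | simp add: m)+

lemma plus_assoc:
  assumes m: "m \<in> \<N>" and n: "n \<in> \<N>" and k: "k \<in> \<N>"
  shows "m \<boxplus> n \<boxplus> k = m \<boxplus> (n \<boxplus> k)"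
  by (rule N_eq_induct[of "\<lambda>k. m \<boxplus> n \<boxplus> k" "\<lambda>k. m \<boxplus> (n \<boxplus> k)", OF _ _ k])
    (intro dfn_intros N_S m n | simp add: m n)+

lemma plus_lcomm: "m \<in> \<N> \<Longrightarrow> n \<in> \<N> \<Longrightarrow> k \<in> \<N> \<Longrightarrow> m \<boxplus> (n \<boxplus> k) = n \<boxplus> (m \<boxplus> k)"
  by (metis plus_assoc plus_comm)

lemmas plus_ac = plus_assoc plus_comm plus_lcomm

lemma plus_cancel [simp]:
  assumes m: "m \<in> \<N>" and n: "n \<in> \<N>" and k: "k \<in> \<N>"
  shows "m \<boxplus> k = n \<boxplus> k \<longleftrightarrow> m = n" "k \<boxplus> m = k \<boxplus> n \<longleftrightarrow> m = n"
proof -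
  show *: "m \<boxplus> k = n \<boxplus> k \<longleftrightarrow> m = n"
    by (rule N_induct[of "\<lambda>k. m \<boxplus> k = n \<boxplus> k \<longleftrightarrow> m = n", OF _ k])
      (intro dfn_intros N_S m n | simp add: m n suc_inj)+
  then show "k \<boxplus> m = k \<boxplus> n \<longleftrightarrow> m = n" using assms by (simp add: plus_comm[of k])
qed

lemma plus_eq_0: "m \<in> \<N> \<Longrightarrow> n \<in> \<N> \<Longrightarrow> m \<boxplus> n = emp \<longleftrightarrow> m = emp \<and> n = emp"
  by (erule N_cases[of n]) simp_all

lemma times_0_left [simp]: "n \<in> \<N> \<Longrightarrow> emp \<boxtimes> n = emp"
  by (rule N_eq_induct[of "\<lambda>n. emp \<boxtimes> n" "\<lambda>n. emp"]) (intro dfn_intros emp_S | simp)+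

lemma times_suc_left [simp]:
  assumes m: "m \<in> \<N>" and n: "n \<in> \<N>"
  shows "suc m \<boxtimes> n = m \<boxtimes> n \<boxplus> n"
  by (rule N_eq_induct[of "\<lambda>n. suc m \<boxtimes> n" "\<lambda>n. m \<boxtimes> n \<boxplus> n", OF _ _ n])
    (intro dfn_intros suc_S N_S m | simp add: m plus_ac)+

lemma times_comm:
  assumes m: "m \<in> \<N>" and n: "n \<in> \<N>"
  shows "m \<boxtimes> n = n \<boxtimes> m"
  by (rule N_eq_induct[of "\<lambda>n. m \<boxtimes> n" "\<lambda>n. n \<boxtimes> m", OF _ _ n])
    (intro dfn_intros N_S m | simp add: m)+

lemma times_distrib:
  assumes m: "m \<in> \<N>" and n: "n \<in> \<N>" and k: "k \<in> \<N>"
  shows "m \<boxtimes> (n \<boxplus> k) = m \<boxtimes> n \<boxplus> m \<boxtimes> k"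
  by (rule N_eq_induct[of "\<lambda>k. m \<boxtimes> (n \<boxplus> k)" "\<lambda>k. m \<boxtimes> n \<boxplus> m \<boxtimes> k", OF _ _ k])
    (intro dfn_intros N_S m n | simp add: m n plus_ac)+

lemma times_distrib_right:
  "m \<in> \<N> \<Longrightarrow> n \<in> \<N> \<Longrightarrow> k \<in> \<N> \<Longrightarrow> (n \<boxplus> k) \<boxtimes> m = n \<boxtimes> m \<boxplus> k \<boxtimes> m"
  using times_distrib[of m n k] by (simp add: times_comm[of m])

lemma times_assoc:
  assumes m: "m \<in> \<N>" and n: "n \<in> \<N>" and k: "k \<in> \<N>"
  shows "m \<boxtimes> n \<boxtimes> k = m \<boxtimes> (n \<boxtimes> k)"
  by (rule N_eq_induct[of "\<lambda>k. m \<boxtimes> n \<boxtimes> k" "\<lambda>k. m \<boxtimes> (n \<boxtimes> k)", OF _ _ k])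
    (intro dfn_intros N_S m n | simp add: m n times_distrib)+

lemma times_lcomm: "m \<in> \<N> \<Longrightarrow> n \<in> \<N> \<Longrightarrow> k \<in> \<N> \<Longrightarrow> m \<boxtimes> (n \<boxtimes> k) = n \<boxtimes> (m \<boxtimes> k)"
  by (metis times_assoc times_comm)

lemmas times_ac = times_assoc times_comm times_lcomm
lemmas nat_simps = times_distrib times_distrib_right plus_ac times_ac

lemma times_eq_0: "m \<in> \<N> \<Longrightarrow> n \<in> \<N> \<Longrightarrow> m \<boxtimes> n = emp \<longleftrightarrow> m = emp \<or> n = emp"
  by (erule N_cases[of n]; erule N_cases[of m]) (simp_all add: plus_eq_0)

lemma nle_iff:
  assumes m: "m \<in> \<N>" and n: "n \<in> \<N>"
  shows "nle mem m n \<longleftrightarrow> (\<exists>k\<in>\<N>. n = m \<boxplus> k)"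
proof
  have "m \<epsilon> n \<or> m = n \<longrightarrow> (\<exists>k\<in>\<S>. k \<in> \<N> \<and> n = m \<boxplus> k)"
  proof (rule N_induct[of "\<lambda>n. m \<epsilon> n \<or> m = n \<longrightarrow> (\<exists>k\<in>\<S>. k \<in> \<N> \<and> n = m \<boxplus> k)", OF _ n])
    show "dfn False (\<lambda>v. m \<epsilon> v 0 \<or> m = v 0 \<longrightarrow> (\<exists>k\<in>\<S>. k \<in> \<N> \<and> v 0 = m \<boxplus> k))"
      by (intro dfn_intros N_S m)
    show "m \<epsilon> emp \<or> m = emp \<longrightarrow> (\<exists>k\<in>\<S>. k \<in> \<N> \<and> emp = m \<boxplus> k)"
      by (auto intro: bexI[of _ emp])
    fix j assume j: "j \<in> \<N>" "m \<epsilon> j \<or> m = j \<longrightarrow> (\<exists>k\<in>\<S>. k \<in> \<N> \<and> j = m \<boxplus> k)"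
    show "m \<epsilon> suc j \<or> m = suc j \<longrightarrow> (\<exists>k\<in>\<S>. k \<in> \<N> \<and> suc j = m \<boxplus> k)"
    proof
      assume "m \<epsilon> suc j \<or> m = suc j"
      then consider "m = suc j" | "m \<epsilon> j \<or> m = j" using j(1) by (auto simp: in_suc)
      then show "\<exists>k\<in>\<S>. k \<in> \<N> \<and> suc j = m \<boxplus> k"
      proof cases
        case 1
        then show ?thesis using j by (intro bexI[of _ emp]) simp_all
      next
        case 2
        then obtain k where "k \<in> \<N>" "j = m \<boxplus> k" using j by blast
        then show ?thesis using m by (intro bexI[of _ "suc k"]) simp_all
      qed
    qed
  qed
  then show "nle mem m n \<Longrightarrow> \<exists>k\<in>\<N>. n = m \<boxplus> k" unfolding nle_def by blast
  assume "\<exists>k\<in>\<N>. n = m \<boxplus> k"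
  then obtain k where k: "k \<in> \<N>" "n = m \<boxplus> k" by blast
  have "m \<epsilon> m \<boxplus> k \<or> m = m \<boxplus> k"
    by (rule N_induct[of "\<lambda>k. m \<epsilon> m \<boxplus> k \<or> m = m \<boxplus> k", OF _ k(1)])
      (intro dfn_intros N_S m | use m in \<open>auto simp: in_suc\<close>)+
  then show "nle mem m n" unfolding nle_def k(2) .
qed

lemma N_lt_plus: "m \<in> \<N> \<Longrightarrow> k \<in> \<N> \<Longrightarrow> k \<noteq> emp \<Longrightarrow> m \<epsilon> m \<boxplus> k"
  using nle_iff[of m "m \<boxplus> k"] plus_cancel(2)[of emp k m] unfolding nle_def by auto

lemma times_cancel:
  assumes m: "m \<in> \<N>" and n: "n \<in> \<N>" and k: "k \<in> \<N>" "k \<noteq> emp"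
  shows "m \<boxtimes> k = n \<boxtimes> k \<longleftrightarrow> m = n" "k \<boxtimes> m = k \<boxtimes> n \<longleftrightarrow> m = n"
proof -
  have le: "m = n" if h: "nle mem m n" "m \<boxtimes> k = n \<boxtimes> k" "m \<in> \<N>" "n \<in> \<N>" for m n
  proof -
    obtain d where d: "d \<in> \<N>" "n = m \<boxplus> d" using h nle_iff by blast
    then have "m \<boxtimes> k \<boxplus> emp = m \<boxtimes> k \<boxplus> d \<boxtimes> k" using h k by (simp add: times_distrib_right)
    then have "d \<boxtimes> k = emp" using h(3) d k by (simp del: plus_0)
    then show ?thesis using d k h(3) by (simp add: times_eq_0)
  qed
  have "nle mem m n \<or> nle mem n m" using N_linear[OF m n] unfolding nle_def by blast
  then show "m \<boxtimes> k = n \<boxtimes> k \<longleftrightarrow> m = n" using le[of m n] le[of n m] m n by metis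
  then show "k \<boxtimes> m = k \<boxtimes> n \<longleftrightarrow> m = n" using m n k by (simp add: times_comm[of k])
qed

lemma times_eq_1: "m \<in> \<N> \<Longrightarrow> n \<in> \<N> \<Longrightarrow> m \<boxtimes> n = suc emp \<Longrightarrow> m = suc emp"
proof -
  assume *: "m \<in> \<N>" "n \<in> \<N>" "m \<boxtimes> n = suc emp"
  then have "m \<noteq> emp" "n \<noteq> emp" by auto
  then obtain a b where ab: "a \<in> \<N>" "b \<in> \<N>" "m = suc a" "n = suc b" using * N_cases by metis
  then have "a \<boxtimes> b \<boxplus> a \<boxplus> b = emp" using * by (simp add: suc_inj plus_ac)
  then show ?thesis using ab by (simp add: plus_eq_0)
qed

lemma division:
  assumes n: "n \<in> \<N>" and d: "d \<in> \<N>" "d \<noteq> emp"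
  obtains q r where "q \<in> \<N>" "r \<in> \<N>" "n = q \<boxtimes> d \<boxplus> r" "r \<epsilon> d"
proof -
  have "\<exists>q\<in>\<S>. \<exists>r\<in>\<S>. q \<in> \<N> \<and> r \<in> \<N> \<and> n = q \<boxtimes> d \<boxplus> r \<and> r \<epsilon> d"
  proof (rule N_induct[of "\<lambda>n. \<exists>q\<in>\<S>. \<exists>r\<in>\<S>. q \<in> \<N> \<and> r \<in> \<N> \<and> n = q \<boxtimes> d \<boxplus> r \<and> r \<epsilon> d", OF _ n])
    show "dfn False (\<lambda>v. \<exists>q\<in>\<S>. \<exists>r\<in>\<S>. q \<in> \<N> \<and> r \<in> \<N> \<and> v 0 = q \<boxtimes> d \<boxplus> r \<and> r \<epsilon> d)"
      by (intro dfn_intros N_S d)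
    show "\<exists>q\<in>\<S>. \<exists>r\<in>\<S>. q \<in> \<N> \<and> r \<in> \<N> \<and> emp = q \<boxtimes> d \<boxplus> r \<and> r \<epsilon> d"
      using N_emp_least[OF d(1)] d by (intro bexI[of _ emp]) simp_all
    fix m assume m: "m \<in> \<N>" "\<exists>q\<in>\<S>. \<exists>r\<in>\<S>. q \<in> \<N> \<and> r \<in> \<N> \<and> m = q \<boxtimes> d \<boxplus> r \<and> r \<epsilon> d"
    then obtain q r where qr: "q \<in> \<N>" "r \<in> \<N>" "m = q \<boxtimes> d \<boxplus> r" "r \<epsilon> d" by blast
    then consider "suc r \<epsilon> d" | "suc r = d" using N_suc_le[OF qr(2) d(1)] by blast
    then show "\<exists>q\<in>\<S>. \<exists>r\<in>\<S>. q \<in> \<N> \<and> r \<in> \<N> \<and> suc m = q \<boxtimes> d \<boxplus> r \<and> r \<epsilon> d"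
    proof cases
      case 1
      then show ?thesis using qr by (intro bexI[of _ q] bexI[of _ "suc r"]) simp_all
    next
      case 2
      have "suc m = q \<boxtimes> d \<boxplus> suc r" using qr by simp
      then have "suc m = suc q \<boxtimes> d \<boxplus> emp" using qr d(1) unfolding 2 by simp
      then show ?thesis using qr N_emp_least[OF d(1)] d by (intro bexI[of _ "suc q"] bexI[of _ emp]) simp_all
    qed
  qed
  then show ?thesis using that by blast
qed

definition ncoprime :: "'a \<Rightarrow> 'a \<Rightarrow> bool" where
  "ncoprime m d \<longleftrightarrow> (\<forall>c\<in>\<N>. \<forall>w\<in>\<N>. \<forall>v\<in>\<N>. m = c \<boxtimes> w \<and> d = c \<boxtimes> v \<longrightarrow> c = suc emp)"

text \<open>The reduced denominator is the least one; it divides all others by division with remainder.\<close>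

lemma reduced_ex:
  assumes m: "m \<in> \<N>" and d: "d \<in> \<N>" "d \<noteq> emp"
  obtains m' d' where "m' \<in> \<N>" "d' \<in> \<N>" "d' \<noteq> emp" "m \<boxtimes> d' = m' \<boxtimes> d" "ncoprime m' d'"
    "\<And>w e. w \<in> \<N> \<Longrightarrow> e \<in> \<N> \<Longrightarrow> m \<boxtimes> e = w \<boxtimes> d \<Longrightarrow> \<exists>c\<in>\<N>. e = c \<boxtimes> d' \<and> w = c \<boxtimes> m'"
proof -
  have df: "dfn False (\<lambda>v. v 0 \<noteq> emp \<and> (\<exists>w\<in>\<S>. w \<in> \<N> \<and> m \<boxtimes> v 0 = w \<boxtimes> d))"
    by (intro dfn_intros N_S m d emp_S)
  have d_ok: "d \<noteq> emp \<and> (\<exists>w\<in>\<S>. w \<in> \<N> \<and> m \<boxtimes> d = w \<boxtimes> d)" using m d by auto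
  obtain d' where d': "d' \<in> \<N>" "d' \<noteq> emp \<and> (\<exists>w\<in>\<S>. w \<in> \<N> \<and> m \<boxtimes> d' = w \<boxtimes> d)"
    and least: "\<And>k. k \<epsilon> d' \<Longrightarrow> \<not> (k \<noteq> emp \<and> (\<exists>w\<in>\<S>. w \<in> \<N> \<and> m \<boxtimes> k = w \<boxtimes> d))"
    by (rule N_least[of "\<lambda>e. e \<noteq> emp \<and> (\<exists>w\<in>\<S>. w \<in> \<N> \<and> m \<boxtimes> e = w \<boxtimes> d)", OF df d(1) d_ok])
      (rule that)
  then obtain m' where m': "m' \<in> \<N>" "m \<boxtimes> d' = m' \<boxtimes> d" by blast
  have univ: "\<exists>c\<in>\<N>. e = c \<boxtimes> d' \<and> w = c \<boxtimes> m'" if w: "w \<in> \<N>" and e: "e \<in> \<N>" and eq: "m \<boxtimes> e = w \<boxtimes> d" for w e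
  proof -
    obtain q r where qr: "q \<in> \<N>" "r \<in> \<N>" "e = q \<boxtimes> d' \<boxplus> r" "r \<epsilon> d'"
      using division[OF e d'(1)] d'(2) by blast
    have "m \<boxtimes> e = q \<boxtimes> (m \<boxtimes> d') \<boxplus> m \<boxtimes> r" unfolding qr(3) using qr m d' by (simp add: times_distrib times_lcomm)
    then have eq': "w \<boxtimes> d = (q \<boxtimes> m') \<boxtimes> d \<boxplus> m \<boxtimes> r" using eq m' qr(1) d by (simp add: times_assoc)
    have "\<exists>k\<in>\<N>. w = q \<boxtimes> m' \<boxplus> k"
    proof (rule ccontr)
      assume "\<not> ?thesis"
      then have "\<not> nle mem (q \<boxtimes> m') w" using nle_iff w by simp
      then have "nle mem w (q \<boxtimes> m')" and ne: "w \<noteq> q \<boxtimes> m'"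
        using N_linear[of "q \<boxtimes> m'" w] w unfolding nle_def by auto
      then obtain k where k: "k \<in> \<N>" "q \<boxtimes> m' = w \<boxplus> k" using nle_iff w by auto
      then have "k \<noteq> emp" using ne w by auto
      have "w \<boxtimes> d \<boxplus> emp = w \<boxtimes> d \<boxplus> (k \<boxtimes> d \<boxplus> m \<boxtimes> r)"
        using eq' d w unfolding k(2) by (simp add: times_distrib_right k plus_assoc)
      then have "k \<boxtimes> d \<boxplus> m \<boxtimes> r = emp" by (simp del: plus_0)
      then show False using \<open>k \<noteq> emp\<close> k d by (simp add: plus_eq_0 times_eq_0)
    qed
    then obtain k where k: "k \<in> \<N>" "w = q \<boxtimes> m' \<boxplus> k" by blast
    then have "m \<boxtimes> r = k \<boxtimes> d" using eq' d by (simp add: times_distrib_right)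
    then have "r = emp" using least[OF qr(4)] k by auto
    then have e': "e = q \<boxtimes> d'" using qr by simp
    then have "k \<boxtimes> d = emp" using \<open>m \<boxtimes> r = k \<boxtimes> d\<close> \<open>r = emp\<close> m by simp
    then have "k = emp" using k d by (simp add: times_eq_0)
    then show ?thesis using e' k qr by auto
  qed
  have "ncoprime m' d'" unfolding ncoprime_def
  proof (intro ballI impI)
    fix c w v assume *: "c \<in> \<N>" "w \<in> \<N>" "v \<in> \<N>" "m' = c \<boxtimes> w \<and> d' = c \<boxtimes> v"
    then have c0: "c \<noteq> emp" and v0: "v \<noteq> emp" using d' by auto
    have "c \<boxtimes> (m \<boxtimes> v) = c \<boxtimes> (w \<boxtimes> d)" using m'(2) * m d by (simp add: times_ac)
    then have "m \<boxtimes> v = w \<boxtimes> d" using times_cancel(2)[OF _ _ *(1) c0] by simp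
    from univ[OF *(2,3) this] obtain e where e: "e \<in> \<N>" "v = e \<boxtimes> d'" by blast
    then have "d' \<boxtimes> suc emp = d' \<boxtimes> (c \<boxtimes> e)" using * d' by (simp add: times_ac)
    then have "suc emp = c \<boxtimes> e" using times_cancel(2)[OF _ _ d'(1)] d'(2) by simp
    then show "c = suc emp" using times_eq_1 *(1) e(1) by metis
  qed
  then show ?thesis using that m' d' univ by blast
qed

lemma SN_plus [simp]: "m \<in> SN \<Longrightarrow> n \<in> SN \<Longrightarrow> m \<boxplus> n \<in> SN"
  by (rule SN_induct[of "\<lambda>n. m \<boxplus> n \<in> SN"]) (intro dfn_intros is_class_SN SN_S | simp)+

lemma SN_times [simp]: "m \<in> SN \<Longrightarrow> n \<in> SN \<Longrightarrow> m \<boxtimes> n \<in> SN"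
  by (rule SN_induct[of "\<lambda>n. m \<boxtimes> n \<in> SN"]) (intro dfn_intros is_class_SN SN_S | simp)+

lemma SN_le: "n \<in> SN \<Longrightarrow> m \<in> \<N> \<Longrightarrow> nle mem m n \<Longrightarrow> m \<in> SN"
  unfolding nle_def using SN_el by blast

lemma SN_factor:
  assumes "c \<boxtimes> d \<in> SN" "c \<in> \<N>" "d \<in> \<N>" "c \<noteq> emp"
  shows "d \<in> SN"
proof -
  obtain b where b: "b \<in> \<N>" "c = suc b" using assms N_cases by metis
  then have "c \<boxtimes> d = d \<boxplus> b \<boxtimes> d" using assms by (simp add: plus_comm)
  then have "nle mem d (c \<boxtimes> d)" using nle_iff[of d "c \<boxtimes> d"] assms by auto
  then show ?thesis using SN_le assms by blast
qed

section \<open>Ordered fields given by operations\<close>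

definition mkfield :: "'a \<Rightarrow> ('a \<Rightarrow> 'a \<Rightarrow> 'a) \<Rightarrow> ('a \<Rightarrow> 'a \<Rightarrow> 'a) \<Rightarrow> ('a \<Rightarrow> 'a \<Rightarrow> bool) \<Rightarrow> 'a ofield" where
  "mkfield X ad mu lq = \<lparr>
     Carr = X,
     Add = cls {pr (pr x y) (ad x y) | x y. x \<epsilon> X \<and> y \<epsilon> X},
     Mul = cls {pr (pr x y) (mu x y) | x y. x \<epsilon> X \<and> y \<epsilon> X},
     Leq = cls {pr x y | x y. x \<epsilon> X \<and> y \<epsilon> X \<and> lq x y}\<rparr>"

lemma mkfield_Carr [simp]: "Carr (mkfield X ad mu lq) = X"
  by (simp add: mkfield_def)

lemma is_class_graph2:
  assumes f: "\<And>x y. x \<epsilon> X \<Longrightarrow> y \<epsilon> X \<Longrightarrow> f x y \<in> \<S>"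
    and R: "dfn True (\<lambda>v. R (v 0) (v 1) (v 2))"
    and Rf: "\<And>x y z. x \<epsilon> X \<Longrightarrow> y \<epsilon> X \<Longrightarrow> z \<in> \<S> \<Longrightarrow> R x y z \<longleftrightarrow> z = f x y"
  shows "is_class {pr (pr x y) (f x y) | x y. x \<epsilon> X \<and> y \<epsilon> X}"
proof -
  have R': "\<And>t s r. dterm True t \<Longrightarrow> dterm True s \<Longrightarrow> dterm True r \<Longrightarrow> dfn True (\<lambda>v. R (t v) (s v) (r v))"
    by (rule dfn_subst3[OF R])
  have "is_class {t \<in> \<S>. \<exists>x\<in>\<S>. \<exists>y\<in>\<S>. \<exists>z\<in>\<S>. x \<epsilon> X \<and> y \<epsilon> X \<and> t = pr (pr x y) z \<and> R x y z}"
    by (rule comprehension) (intro dfn_intros R' par_True)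
  also have "{t \<in> \<S>. \<exists>x\<in>\<S>. \<exists>y\<in>\<S>. \<exists>z\<in>\<S>. x \<epsilon> X \<and> y \<epsilon> X \<and> t = pr (pr x y) z \<and> R x y z} =
      {pr (pr x y) (f x y) | x y. x \<epsilon> X \<and> y \<epsilon> X}" (is "?A = ?B")
  proof
    show "?A \<subseteq> ?B" using Rf by blast
    show "?B \<subseteq> ?A"
    proof
      fix t assume "t \<in> ?B"
      then obtain x y where xy: "x \<epsilon> X" "y \<epsilon> X" "t = pr (pr x y) (f x y)" by blast
      have "x \<in> \<S>" "y \<in> \<S>" "f x y \<in> \<S>" using xy f el_S by blast+
      moreover have "R x y (f x y)" using Rf[OF xy(1,2)] calculation by blast
      ultimately show "t \<in> ?A" using xy by simp blast
    qed
  qed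
  finally show ?thesis .
qed

lemma binop_graph:
  assumes f: "\<And>x y. x \<epsilon> X \<Longrightarrow> y \<epsilon> X \<Longrightarrow> f x y \<epsilon> X"
    and cl: "is_class {pr (pr x y) (f x y) | x y. x \<epsilon> X \<and> y \<epsilon> X}" (is "is_class ?A")
  shows "is_binop mem X (cls ?A)" "\<And>x y. x \<epsilon> X \<Longrightarrow> y \<epsilon> X \<Longrightarrow> app mem (cls ?A) (pr x y) = f x y"
proof -
  note e = el_cls[OF cl]
  have i: "t \<epsilon> cls ?A \<longleftrightarrow> (\<exists>x y. t = pr (pr x y) (f x y) \<and> x \<epsilon> X \<and> y \<epsilon> X)" for t
    using in_el[of t "cls ?A"] unfolding e by blast
  have S: "x \<in> \<S> \<and> y \<in> \<S> \<and> f x y \<in> \<S>" if "x \<epsilon> X" "y \<epsilon> X" for x y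
    using that f el_S by blast
  have p: "pr u z \<epsilon> cls ?A \<longleftrightarrow> (\<exists>x y. u = pr x y \<and> z = f x y \<and> x \<epsilon> X \<and> y \<epsilon> X)"
    if uz: "u \<in> \<S>" "z \<in> \<S>" for u z
  proof
    assume "pr u z \<epsilon> cls ?A"
    then obtain x y where xy: "pr u z = pr (pr x y) (f x y)" "x \<epsilon> X" "y \<epsilon> X" unfolding i by blast
    then have "u = pr x y \<and> z = f x y" using S[OF xy(2,3)] uz by (simp add: pr_inj)
    then show "\<exists>x y. u = pr x y \<and> z = f x y \<and> x \<epsilon> X \<and> y \<epsilon> X" using xy by blast
  qed (use i in blast)
  have u: "f x y = f x' y'" if "pr x y = pr x' y'" "x \<epsilon> X" "y \<epsilon> X" "x' \<epsilon> X" "y' \<epsilon> X" for x y x' y'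
    using that S[of x y] S[of x' y'] by (simp add: pr_inj)
  have fn: "is_function mem (cls ?A)" unfolding is_function_def
  proof (intro conjI ballI impI)
    fix t assume "t \<in> el (cls ?A)"
    then obtain x y where "t = pr (pr x y) (f x y)" "x \<epsilon> X" "y \<epsilon> X" unfolding e by blast
    then show "\<exists>x\<in>\<S>. \<exists>y\<in>\<S>. t = pr x y" using S pr_S by blast
  next
    fix x y z assume *: "x \<in> \<S>" "y \<in> \<S>" "z \<in> \<S>" "pr x y \<epsilon> cls ?A \<and> pr x z \<epsilon> cls ?A"
    then show "y = z" unfolding p[OF *(1,2)] p[OF *(1,3)] using u by blast
  qed
  have ap: "app mem (cls ?A) (pr x y) = f x y" if "x \<epsilon> X" "y \<epsilon> X" for x y
    by (rule app_eq[OF fn]) (use S[OF that] p[of "pr x y" "f x y"] that in auto)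
  have "dom_of mem (cls ?A) = {pr x y | x y. x \<epsilon> X \<and> y \<epsilon> X}" (is "_ = ?D")
  proof
    show "dom_of mem (cls ?A) \<subseteq> ?D" unfolding dom_of_def using p by blast
    show "?D \<subseteq> dom_of mem (cls ?A)"
    proof
      fix t assume "t \<in> ?D"
      then obtain x y where xy: "t = pr x y" "x \<epsilon> X" "y \<epsilon> X" by blast
      then have "t \<in> \<S>" "f x y \<in> \<S>" "pr t (f x y) \<epsilon> cls ?A" using S[OF xy(2,3)] p[of t "f x y"] by auto
      then show "t \<in> dom_of mem (cls ?A)" unfolding dom_of_def by blast
    qed
  qed
  then show "is_binop mem X (cls ?A)" unfolding is_binop_def using fn ap f by simp
  show "\<And>x y. x \<epsilon> X \<Longrightarrow> y \<epsilon> X \<Longrightarrow> app mem (cls ?A) (pr x y) = f x y" by (rule ap)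
qed

lemma is_class_rel2:
  assumes R: "dfn True (\<lambda>v. R (v 0) (v 1))" and Rf: "\<And>x y. x \<epsilon> X \<Longrightarrow> y \<epsilon> X \<Longrightarrow> R x y \<longleftrightarrow> lq x y"
  shows "is_class {pr x y | x y. x \<epsilon> X \<and> y \<epsilon> X \<and> lq x y}"
proof -
  have "is_class {t \<in> \<S>. \<exists>x\<in>\<S>. \<exists>y\<in>\<S>. x \<epsilon> X \<and> y \<epsilon> X \<and> t = pr x y \<and> R x y}"
    by (rule comprehension) (intro dfn_intros dfn2[OF R] par_True)
  also have "{t \<in> \<S>. \<exists>x\<in>\<S>. \<exists>y\<in>\<S>. x \<epsilon> X \<and> y \<epsilon> X \<and> t = pr x y \<and> R x y} =
      {pr x y | x y. x \<epsilon> X \<and> y \<epsilon> X \<and> lq x y}" (is "?A = ?B")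
  proof
    show "?A \<subseteq> ?B" using Rf by blast
    show "?B \<subseteq> ?A"
    proof
      fix t assume "t \<in> ?B"
      then obtain x y where xy: "x \<epsilon> X" "y \<epsilon> X" "t = pr x y" "lq x y" by blast
      have "x \<in> \<S>" "y \<in> \<S>" using xy el_S by blast+
      then show "t \<in> ?A" using xy Rf by simp blast
    qed
  qed
  finally show ?thesis .
qed

lemma rel_graph:
  assumes cl: "is_class {pr x y | x y. x \<epsilon> X \<and> y \<epsilon> X \<and> lq x y}" (is "is_class ?A")
    and xy: "x \<epsilon> X" "y \<epsilon> X"
  shows "pr x y \<epsilon> cls ?A \<longleftrightarrow> lq x y"
proof -
  have "pr x y \<epsilon> cls ?A \<longleftrightarrow> pr x y \<in> ?A" using in_el[of "pr x y" "cls ?A"] unfolding el_cls[OF cl] by blast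
  also have "\<dots> \<longleftrightarrow> lq x y"
  proof
    assume "pr x y \<in> ?A"
    then obtain x' y' where *: "pr x y = pr x' y'" "x' \<epsilon> X" "y' \<epsilon> X" "lq x' y'" by blast
    then have "x = x' \<and> y = y'" using xy el_S by (simp add: pr_inj[OF el_S el_S el_S el_S, OF xy *(2,3)])
    then show "lq x y" using * by simp
  qed (use xy in blast)
  finally show ?thesis .
qed

definition field_class :: "'a ofield \<Rightarrow> bool" where
  "field_class K \<longleftrightarrow> is_binop mem (Carr K) (Add K) \<and> is_binop mem (Carr K) (Mul K) \<and>
     el (Leq K) \<subseteq> {pr x y | x y. x \<epsilon> Carr K \<and> y \<epsilon> Carr K}"

lemma mkfield_class:
  assumes ad: "\<And>x y. x \<epsilon> X \<Longrightarrow> y \<epsilon> X \<Longrightarrow> ad x y \<epsilon> X" "dfn True (\<lambda>v. A (v 0) (v 1) (v 2))"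
      "\<And>x y z. x \<epsilon> X \<Longrightarrow> y \<epsilon> X \<Longrightarrow> z \<in> \<S> \<Longrightarrow> A x y z \<longleftrightarrow> z = ad x y"
    and mu: "\<And>x y. x \<epsilon> X \<Longrightarrow> y \<epsilon> X \<Longrightarrow> mu x y \<epsilon> X" "dfn True (\<lambda>v. M (v 0) (v 1) (v 2))"
      "\<And>x y z. x \<epsilon> X \<Longrightarrow> y \<epsilon> X \<Longrightarrow> z \<in> \<S> \<Longrightarrow> M x y z \<longleftrightarrow> z = mu x y"
    and le: "dfn True (\<lambda>v. L (v 0) (v 1))" "\<And>x y. x \<epsilon> X \<Longrightarrow> y \<epsilon> X \<Longrightarrow> L x y \<longleftrightarrow> lq x y"
  shows "field_class (mkfield X ad mu lq)"
    "\<And>x y. x \<epsilon> X \<Longrightarrow> y \<epsilon> X \<Longrightarrow> fadd mem (mkfield X ad mu lq) x y = ad x y"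
    "\<And>x y. x \<epsilon> X \<Longrightarrow> y \<epsilon> X \<Longrightarrow> fmul mem (mkfield X ad mu lq) x y = mu x y"
    "\<And>x y. x \<epsilon> X \<Longrightarrow> y \<epsilon> X \<Longrightarrow> fle mem (mkfield X ad mu lq) x y \<longleftrightarrow> lq x y"
proof -
  have ca: "is_class {pr (pr x y) (ad x y) | x y. x \<epsilon> X \<and> y \<epsilon> X}"
    by (rule is_class_graph2[OF _ ad(2,3)]) (use ad(1) el_S in blast)
  have cm: "is_class {pr (pr x y) (mu x y) | x y. x \<epsilon> X \<and> y \<epsilon> X}"
    by (rule is_class_graph2[OF _ mu(2,3)]) (use mu(1) el_S in blast)
  have cl: "is_class {pr x y | x y. x \<epsilon> X \<and> y \<epsilon> X \<and> lq x y}"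
    by (rule is_class_rel2[OF le])
  show "field_class (mkfield X ad mu lq)"
    unfolding field_class_def mkfield_def using binop_graph(1)[OF ad(1) ca] binop_graph(1)[OF mu(1) cm] el_cls[OF cl]
    by auto
  show "\<And>x y. x \<epsilon> X \<Longrightarrow> y \<epsilon> X \<Longrightarrow> fadd mem (mkfield X ad mu lq) x y = ad x y"
    unfolding fadd_def mkfield_def using binop_graph(2)[OF ad(1) ca] by simp
  show "\<And>x y. x \<epsilon> X \<Longrightarrow> y \<epsilon> X \<Longrightarrow> fmul mem (mkfield X ad mu lq) x y = mu x y"
    unfolding fmul_def mkfield_def using binop_graph(2)[OF mu(1) cm] by simp
  show "\<And>x y. x \<epsilon> X \<Longrightarrow> y \<epsilon> X \<Longrightarrow> fle mem (mkfield X ad mu lq) x y \<longleftrightarrow> lq x y"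
    unfolding fle_def mkfield_def using rel_graph[OF cl] by simp
qed

lemma ordered_fieldI:
  fixes K :: "'a ofield" and z o' :: 'a
  defines "F \<equiv> el (Carr K)" and "a \<equiv> fadd mem K" and "m \<equiv> fmul mem K" and "l \<equiv> fle mem K"
  assumes cls: "field_class K"
    and z: "z \<in> F" and o: "o' \<in> F" and zo: "z \<noteq> o'"
    and a_assoc: "\<And>x y w. x \<in> F \<Longrightarrow> y \<in> F \<Longrightarrow> w \<in> F \<Longrightarrow> a (a x y) w = a x (a y w)"
    and a_comm: "\<And>x y. x \<in> F \<Longrightarrow> y \<in> F \<Longrightarrow> a x y = a y x"
    and a_zero: "\<And>x. x \<in> F \<Longrightarrow> a z x = x"
    and a_neg: "\<And>x. x \<in> F \<Longrightarrow> \<exists>y\<in>F. a y x = z"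
    and m_assoc: "\<And>x y w. x \<in> F \<Longrightarrow> y \<in> F \<Longrightarrow> w \<in> F \<Longrightarrow> m (m x y) w = m x (m y w)"
    and m_comm: "\<And>x y. x \<in> F \<Longrightarrow> y \<in> F \<Longrightarrow> m x y = m y x"
    and m_one: "\<And>x. x \<in> F \<Longrightarrow> m o' x = x"
    and m_inv: "\<And>x. x \<in> F \<Longrightarrow> x \<noteq> z \<Longrightarrow> \<exists>y\<in>F. m x y = o'"
    and distr: "\<And>x y w. x \<in> F \<Longrightarrow> y \<in> F \<Longrightarrow> w \<in> F \<Longrightarrow> m (a x y) w = a (m x w) (m y w)"
    and refl: "\<And>x. x \<in> F \<Longrightarrow> l x x"
    and antisym: "\<And>x y. x \<in> F \<Longrightarrow> y \<in> F \<Longrightarrow> l x y \<Longrightarrow> l y x \<Longrightarrow> x = y"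
    and trans: "\<And>x y w. x \<in> F \<Longrightarrow> y \<in> F \<Longrightarrow> w \<in> F \<Longrightarrow> l x y \<Longrightarrow> l y w \<Longrightarrow> l x w"
    and linear: "\<And>x y. x \<in> F \<Longrightarrow> y \<in> F \<Longrightarrow> l x y \<or> l y x"
    and l_add: "\<And>x y w. x \<in> F \<Longrightarrow> y \<in> F \<Longrightarrow> w \<in> F \<Longrightarrow> l x y \<Longrightarrow> l (a x w) (a y w)"
    and l_mul: "\<And>x y. x \<in> F \<Longrightarrow> y \<in> F \<Longrightarrow> l z x \<Longrightarrow> l z y \<Longrightarrow> l z (m x y)"
  shows "ordered_field mem K" "zero (ring_of mem K) = z" "one (ring_of mem K) = o'"
proof -
  have acl: "\<And>x y. x \<in> F \<Longrightarrow> y \<in> F \<Longrightarrow> a x y \<in> F" and mcl: "\<And>x y. x \<in> F \<Longrightarrow> y \<in> F \<Longrightarrow> m x y \<in> F"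
    using cls unfolding field_class_def is_binop_def a_def m_def F_def fadd_def fmul_def by (auto simp del: ball_el)
  have "(THE e. e \<epsilon> Carr K \<and> (\<forall>x\<in>F. a e x = x)) = z"
  proof (rule the_equality)
    show "z \<epsilon> Carr K \<and> (\<forall>x\<in>F. a z x = x)" using z a_zero by (simp add: F_def)
    fix e assume e: "e \<epsilon> Carr K \<and> (\<forall>x\<in>F. a e x = x)"
    then have "e \<in> F" by (simp add: F_def)
    then show "e = z" using e a_comm[of e z] a_zero[of e] z by metis
  qed
  then show Z: "zero (ring_of mem K) = z" unfolding ring_of_def a_def F_def by simp
  have "(THE e. e \<epsilon> Carr K \<and> (\<forall>x\<in>F. m e x = x)) = o'"
  proof (rule the_equality)
    show "o' \<epsilon> Carr K \<and> (\<forall>x\<in>F. m o' x = x)" using o m_one by (simp add: F_def)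
    fix e assume e: "e \<epsilon> Carr K \<and> (\<forall>x\<in>F. m e x = x)"
    then have "e \<in> F" by (simp add: F_def)
    then show "e = o'" using e m_comm[of e o'] m_one[of e] o by metis
  qed
  then show O: "one (ring_of mem K) = o'" unfolding ring_of_def m_def F_def by simp
  define G where "G = ring_of mem K"
  have G: "carrier G = F" "add G = a" "monoid.mult G = m" "zero G = z" "one G = o'"
    using Z O unfolding G_def ring_of_def F_def a_def m_def by simp_all
  have "abelian_group G"
    by (rule abelian_groupI) (use acl z a_assoc a_comm a_zero a_neg in \<open>simp_all add: G\<close>)
  moreover have "Group.comm_monoid G"
    by (rule comm_monoidI) (use mcl o m_assoc m_comm m_one in \<open>simp_all add: G\<close>)
  ultimately have "cring G"
    by (rule cringI) (use distr in \<open>simp add: G\<close>)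
  then interpret cring G .
  have "field G"
  proof (rule cring_fieldI2)
    show "\<zero>\<^bsub>G\<^esub> \<noteq> \<one>\<^bsub>G\<^esub>" using zo by (simp add: G)
    show "\<And>x. x \<in> carrier G \<Longrightarrow> x \<noteq> \<zero>\<^bsub>G\<^esub> \<Longrightarrow> \<exists>y\<in>carrier G. x \<otimes>\<^bsub>G\<^esub> y = \<one>\<^bsub>G\<^esub>"
      using m_inv by (simp add: G)
  qed
  moreover have "linear_order_on F {(x, y). x \<epsilon> Carr K \<and> y \<epsilon> Carr K \<and> l x y}"
    unfolding linear_order_on_def partial_order_on_def preorder_on_def
  proof (intro conjI)
    show "{(x, y). x \<epsilon> Carr K \<and> y \<epsilon> Carr K \<and> l x y} \<subseteq> F \<times> F" by (auto simp: F_def)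
    show "refl_on F {(x, y). x \<epsilon> Carr K \<and> y \<epsilon> Carr K \<and> l x y}"
      using refl by (auto simp: refl_on_def F_def)
    show "Relation.trans {(x, y). x \<epsilon> Carr K \<and> y \<epsilon> Carr K \<and> l x y}"
      using trans unfolding Relation.trans_def F_def in_el by blast
    show "Relation.antisym {(x, y). x \<epsilon> Carr K \<and> y \<epsilon> Carr K \<and> l x y}"
      using antisym unfolding Relation.antisym_def F_def in_el by blast
    show "total_on F {(x, y). x \<epsilon> Carr K \<and> y \<epsilon> Carr K \<and> l x y}"
      using linear unfolding total_on_def F_def by auto
  qed
  ultimately show "ordered_field mem K"
    using cls l_add l_mul Z unfolding ordered_field_def field_class_def G_def F_def a_def m_def l_def
    by (simp del: ball_el)
qed

section \<open>Integers and rationals\<close>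

lemma pfst_pr [simp]: "x \<in> \<S> \<Longrightarrow> y \<in> \<S> \<Longrightarrow> pfst mem (pr x y) = x"
  unfolding pfst_def by (rule the_equality) (auto simp: pr_inj)

lemma psnd_pr [simp]: "x \<in> \<S> \<Longrightarrow> y \<in> \<S> \<Longrightarrow> psnd mem (pr x y) = y"
  unfolding psnd_def by (rule the_equality) (auto simp: pr_inj)

abbreviation "\<Z> \<equiv> integers mem"
abbreviation "zd \<equiv> zdiff mem"

lemma integersE:
  assumes "z \<in> \<Z>" obtains m n where "m \<in> \<N>" "n \<in> \<N>" "z = pr m n" "m = emp \<or> n = emp"
  using assms unfolding integers_def by blast

lemma int_comp [simp]: "z \<in> \<Z> \<Longrightarrow> pfst mem z \<in> \<N>" "z \<in> \<Z> \<Longrightarrow> psnd mem z \<in> \<N>"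
  by (auto elim!: integersE)

lemma N_diff:
  assumes "a \<in> \<N>" "b \<in> \<N>"
  shows "(\<exists>k\<in>\<N>. a = b \<boxplus> k) \<or> (\<exists>k\<in>\<N>. b = a \<boxplus> k)"
  using N_linear[OF assms] nle_iff[OF assms] nle_iff[OF assms(2,1)] unfolding nle_def by blast

lemma nplus_eq': "m \<in> \<N> \<Longrightarrow> n \<in> \<N> \<Longrightarrow> nadd mem m n = m \<boxplus> n"
  by (simp add: nplus_eq)

lemma ntimes_eq': "m \<in> \<N> \<Longrightarrow> n \<in> \<N> \<Longrightarrow> nmul mem m n = m \<boxtimes> n"
  by (simp add: ntimes_eq)

lemma zd_ex1:
  assumes a: "a \<in> \<N>" and b: "b \<in> \<N>"
  shows "\<exists>!z. z \<in> \<Z> \<and> nadd mem a (psnd mem z) = nadd mem b (pfst mem z)"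
proof -
  have ex: "\<exists>m n. m \<in> \<N> \<and> n \<in> \<N> \<and> (m = emp \<or> n = emp) \<and> a \<boxplus> n = b \<boxplus> m"
    using N_diff[OF a b] a b by (metis emp_N plus_0)
  then obtain m n where mn: "m \<in> \<N>" "n \<in> \<N>" "m = emp \<or> n = emp" "a \<boxplus> n = b \<boxplus> m" by blast
  have uniq: "x = m \<and> y = n" if xy: "x \<in> \<N>" "y \<in> \<N>" "x = emp \<or> y = emp" "a \<boxplus> y = b \<boxplus> x" for x y
  proof -
    have "(a \<boxplus> n) \<boxplus> (b \<boxplus> x) = (b \<boxplus> m) \<boxplus> (a \<boxplus> y)" using mn xy by simp
    then have "(a \<boxplus> b) \<boxplus> (n \<boxplus> x) = (a \<boxplus> b) \<boxplus> (m \<boxplus> y)" using a b mn(1,2) xy(1,2) by (simp add: plus_ac del: plus_cancel)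
    then have e: "n \<boxplus> x = m \<boxplus> y" using mn(1,2) xy(1,2) by simp
    consider "m = emp" | "n = emp" using mn by blast
    then show ?thesis
    proof cases
      case 1
      then have e': "n \<boxplus> x = y" using e xy by simp
      show ?thesis
      proof (cases "x = emp")
        case False
        then have "y = emp" using xy by blast
        then show ?thesis using e' 1 mn xy plus_eq_0 by metis
      qed (use e' 1 mn in simp)
    next
      case 2
      then have e': "x = m \<boxplus> y" using e xy by simp
      show ?thesis
      proof (cases "y = emp")
        case False
        then have "x = emp" using xy by blast
        then show ?thesis using e' 2 mn xy plus_eq_0 by metis
      qed (use e' 2 mn in simp)
    qed
  qed
  show ?thesis
  proof (rule ex1I)
    show "pr m n \<in> \<Z> \<and> nadd mem a (psnd mem (pr m n)) = nadd mem b (pfst mem (pr m n))"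
      using mn a b unfolding integers_def by (auto simp: nplus_eq')
    fix z assume z: "z \<in> \<Z> \<and> nadd mem a (psnd mem z) = nadd mem b (pfst mem z)"
    obtain x y where "x \<in> \<N>" "y \<in> \<N>" "z = pr x y" "x = emp \<or> y = emp"
      by (rule integersE[OF conjunct1[OF z]])
    then show "z = pr m n" using uniq[of x y] z a b by (simp add: nplus_eq')
  qed
qed

lemma zd_props:
  assumes a: "a \<in> \<N>" and b: "b \<in> \<N>"
  shows "zd a b \<in> \<Z>" "a \<boxplus> psnd mem (zd a b) = b \<boxplus> pfst mem (zd a b)"
proof -
  have *: "zd a b \<in> \<Z> \<and> nadd mem a (psnd mem (zd a b)) = nadd mem b (pfst mem (zd a b))"
    unfolding zdiff_def by (rule theI'[OF zd_ex1[OF a b]])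
  then show Z: "zd a b \<in> \<Z>" by blast
  show "a \<boxplus> psnd mem (zd a b) = b \<boxplus> pfst mem (zd a b)"
    using conjunct2[OF *] nplus_eq'[OF a int_comp(2)[OF Z]] nplus_eq'[OF b int_comp(1)[OF Z]] by simp
qed

lemma zd_eqI: "a \<in> \<N> \<Longrightarrow> b \<in> \<N> \<Longrightarrow> z \<in> \<Z> \<Longrightarrow> a \<boxplus> psnd mem z = b \<boxplus> pfst mem z \<Longrightarrow> zd a b = z"
  using zd_ex1[of a b] zd_props[of a b] by (metis int_comp nplus_eq)

lemma zd_pr: "m \<in> \<N> \<Longrightarrow> n \<in> \<N> \<Longrightarrow> m = emp \<or> n = emp \<Longrightarrow> zd m n = pr m n"
  by (rule zd_eqI) (auto simp: integers_def plus_comm)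

lemma cross_add:
  assumes N: "a \<in> \<N>" "b \<in> \<N>" "c \<in> \<N>" "d \<in> \<N>" "x \<in> \<N>" "y \<in> \<N>" and e: "a \<boxplus> y = b \<boxplus> x"
  shows "c \<boxplus> y = d \<boxplus> x \<longleftrightarrow> a \<boxplus> d = c \<boxplus> b"
proof -
  have "(c \<boxplus> y) \<boxplus> (b \<boxplus> x) = (a \<boxplus> y) \<boxplus> (d \<boxplus> x) \<longleftrightarrow> (c \<boxplus> b) \<boxplus> (x \<boxplus> y) = (a \<boxplus> d) \<boxplus> (x \<boxplus> y)"
    using N by (simp add: plus_ac del: plus_cancel)
  then show ?thesis using N unfolding e by (simp add: plus_comm[of "b \<boxplus> x"]) metis
qed

lemma zd_eq_iff:
  assumes "a \<in> \<N>" "b \<in> \<N>" "c \<in> \<N>" "d \<in> \<N>"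
  shows "zd a b = zd c d \<longleftrightarrow> a \<boxplus> d = c \<boxplus> b"
proof -
  note p = zd_props[OF assms(1,2)]
  have "zd a b = zd c d \<longleftrightarrow> c \<boxplus> psnd mem (zd a b) = d \<boxplus> pfst mem (zd a b)"
    using zd_props(2)[OF assms(3,4)] zd_eqI[OF assms(3,4) p(1)] by metis
  then show ?thesis using cross_add[OF assms _ _ p(2)] p(1) by simp
qed

lemma zadd_zd:
  assumes N: "a \<in> \<N>" "b \<in> \<N>" "c \<in> \<N>" "d \<in> \<N>"
  shows "zadd mem (zd a b) (zd c d) = zd (a \<boxplus> c) (b \<boxplus> d)"
proof -
  define a' b' c' d' where *: "a' = pfst mem (zd a b)" "b' = psnd mem (zd a b)" "c' = pfst mem (zd c d)" "d' = psnd mem (zd c d)"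
  have N': "a' \<in> \<N>" "b' \<in> \<N>" "c' \<in> \<N>" "d' \<in> \<N>" using zd_props(1) N by (simp_all add: *)
  have e: "a \<boxplus> b' = b \<boxplus> a'" "c \<boxplus> d' = d \<boxplus> c'" using zd_props(2) N by (simp_all add: *)
  have "zadd mem (zd a b) (zd c d) = zd (a' \<boxplus> c') (b' \<boxplus> d')"
    unfolding zadd_def using N' by (simp add: nplus_eq' flip: *)
  also have "\<dots> = zd (a \<boxplus> c) (b \<boxplus> d)"
  proof -
    have "(a' \<boxplus> c') \<boxplus> (b \<boxplus> d) = (b \<boxplus> a') \<boxplus> (d \<boxplus> c')" using N N' by (simp add: plus_ac del: plus_cancel)
    also have "\<dots> = (a \<boxplus> c) \<boxplus> (b' \<boxplus> d')" unfolding e[symmetric] using N N' by (simp add: plus_ac del: plus_cancel)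
    finally show ?thesis using N N' by (simp add: zd_eq_iff)
  qed
  finally show ?thesis .
qed

lemma zmul_zd:
  assumes N: "a \<in> \<N>" "b \<in> \<N>" "c \<in> \<N>" "d \<in> \<N>"
  shows "zmul mem (zd a b) (zd c d) = zd (a \<boxtimes> c \<boxplus> b \<boxtimes> d) (a \<boxtimes> d \<boxplus> b \<boxtimes> c)"
proof -
  define a' b' c' d' where *: "a' = pfst mem (zd a b)" "b' = psnd mem (zd a b)" "c' = pfst mem (zd c d)" "d' = psnd mem (zd c d)"
  have N': "a' \<in> \<N>" "b' \<in> \<N>" "c' \<in> \<N>" "d' \<in> \<N>" using zd_props(1) N by (simp_all add: *)
  have e: "a \<boxplus> b' = b \<boxplus> a'" "c \<boxplus> d' = d \<boxplus> c'" using zd_props(2) N by (simp_all add: *)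
  have "zmul mem (zd a b) (zd c d) = zd (a' \<boxtimes> c' \<boxplus> b' \<boxtimes> d') (a' \<boxtimes> d' \<boxplus> b' \<boxtimes> c')"
    unfolding zmul_def using N' by (simp add: nplus_eq' ntimes_eq' flip: *)
  also have "\<dots> = zd (a' \<boxtimes> c \<boxplus> b' \<boxtimes> d) (a' \<boxtimes> d \<boxplus> b' \<boxtimes> c)"
  proof -
    have "(a' \<boxtimes> c' \<boxplus> b' \<boxtimes> d') \<boxplus> (a' \<boxtimes> d \<boxplus> b' \<boxtimes> c) = a' \<boxtimes> (d \<boxplus> c') \<boxplus> b' \<boxtimes> (c \<boxplus> d')"
      using N N' by (simp add: times_distrib plus_ac del: plus_cancel)
    also have "\<dots> = a' \<boxtimes> (c \<boxplus> d') \<boxplus> b' \<boxtimes> (d \<boxplus> c')" unfolding e by simp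
    also have "\<dots> = (a' \<boxtimes> c \<boxplus> b' \<boxtimes> d) \<boxplus> (a' \<boxtimes> d' \<boxplus> b' \<boxtimes> c')"
      using N N' by (simp add: times_distrib plus_ac del: plus_cancel)
    finally show ?thesis using N N' by (simp add: zd_eq_iff)
  qed
  also have "\<dots> = zd (a \<boxtimes> c \<boxplus> b \<boxtimes> d) (a \<boxtimes> d \<boxplus> b \<boxtimes> c)"
  proof -
    have "(a' \<boxtimes> c \<boxplus> b' \<boxtimes> d) \<boxplus> (a \<boxtimes> d \<boxplus> b \<boxtimes> c) = (b \<boxplus> a') \<boxtimes> c \<boxplus> (a \<boxplus> b') \<boxtimes> d"
      using N N' by (simp add: times_distrib_right plus_ac del: plus_cancel)
    also have "\<dots> = (a \<boxplus> b') \<boxtimes> c \<boxplus> (b \<boxplus> a') \<boxtimes> d" unfolding e by simp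
    also have "\<dots> = (a \<boxtimes> c \<boxplus> b \<boxtimes> d) \<boxplus> (a' \<boxtimes> d \<boxplus> b' \<boxtimes> c)"
      using N N' by (simp add: times_distrib_right plus_ac del: plus_cancel)
    finally show ?thesis using N N' by (simp add: zd_eq_iff)
  qed
  finally show ?thesis .
qed

lemma nle_cancel:
  assumes "a \<in> \<N>" "b \<in> \<N>" "c \<in> \<N>"
  shows "nle mem (a \<boxplus> c) (b \<boxplus> c) \<longleftrightarrow> nle mem a b"
proof -
  have "b \<boxplus> c = a \<boxplus> c \<boxplus> k \<longleftrightarrow> b = a \<boxplus> k" if "k \<in> \<N>" for k
  proof -
    have "a \<boxplus> c \<boxplus> k = (a \<boxplus> k) \<boxplus> c" using assms that by (simp add: plus_ac del: plus_cancel)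
    then show ?thesis using assms that by simp
  qed
  then show ?thesis using assms by (simp add: nle_iff)
qed

lemma nle_refl [simp]: "nle mem a a"
  by (simp add: nle_def)

lemma nle_linear: "a \<in> \<N> \<Longrightarrow> b \<in> \<N> \<Longrightarrow> nle mem a b \<or> nle mem b a"
  using N_linear unfolding nle_def by blast

lemma nle_antisym: "a \<in> \<N> \<Longrightarrow> b \<in> \<N> \<Longrightarrow> nle mem a b \<Longrightarrow> nle mem b a \<Longrightarrow> a = b"
  unfolding nle_def using N_trans N_irrefl by blast

lemma nle_trans: "c \<in> \<N> \<Longrightarrow> nle mem a b \<Longrightarrow> nle mem b c \<Longrightarrow> nle mem a c"
  unfolding nle_def using N_trans by blast

lemma nle_times:
  assumes "a \<in> \<N>" "b \<in> \<N>" "c \<in> \<N>" "c \<noteq> emp"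
  shows "nle mem (a \<boxtimes> c) (b \<boxtimes> c) \<longleftrightarrow> nle mem a b"
proof -
  have mono: "nle mem (a \<boxtimes> c) (b \<boxtimes> c)" if "nle mem a b" "a \<in> \<N>" "b \<in> \<N>" for a b
    using that assms(3) by (auto simp: nle_iff times_distrib_right)
  show ?thesis
  proof
    assume l: "nle mem (a \<boxtimes> c) (b \<boxtimes> c)"
    show "nle mem a b"
    proof (rule ccontr)
      assume n: "\<not> nle mem a b"
      then have "nle mem b a" using nle_linear assms by blast
      then have "a \<boxtimes> c = b \<boxtimes> c" using mono[of b a] l nle_antisym assms by simp
      then show False using n times_cancel(1)[OF assms(1,2,3,4)] by simp
    qed
  qed (use mono assms in blast)
qed

definition zabs :: "'a \<Rightarrow> 'a" where
  "zabs z = pfst mem z \<boxplus> psnd mem z"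

lemma int_sign:
  assumes "z \<in> \<Z>" obtains n where "n \<in> \<N>" "z = zd n emp" | n where "n \<in> \<N>" "z = zd emp n"
  using assms by (elim integersE) (metis emp_N zd_pr)

lemma zabs_zd [simp]: "n \<in> \<N> \<Longrightarrow> zabs (zd n emp) = n" "n \<in> \<N> \<Longrightarrow> zabs (zd emp n) = n"
  by (simp_all add: zabs_def zd_pr)

lemma zabs_N [simp]: "zabs z \<in> \<N>"
  by (simp add: zabs_def)

lemma zabs_zmul:
  assumes "z \<in> \<Z>" "w \<in> \<Z>"
  shows "zabs (zmul mem z w) = zabs z \<boxtimes> zabs w"
  using assms by (elim int_sign) (simp_all add: zmul_zd)

lemma zcoprime_iff:
  assumes z: "z \<in> \<Z>" and d: "d \<in> \<N>"
  shows "zcoprime mem z (zd d emp) \<longleftrightarrow> ncoprime (zabs z) d"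
proof
  assume c: "zcoprime mem z (zd d emp)"
  show "ncoprime (zabs z) d" unfolding ncoprime_def
  proof (intro ballI impI)
    fix c w v assume *: "c \<in> \<N>" "w \<in> \<N>" "v \<in> \<N>" "zabs z = c \<boxtimes> w \<and> d = c \<boxtimes> v"
    have "\<exists>w\<in>\<Z>. z = zmul mem (zd c emp) w"
      using z
    proof (cases rule: int_sign)
      case (1 n)
      then show ?thesis using * zd_props(1)[of w emp] by (intro bexI[of _ "zd w emp"]) (simp_all add: zmul_zd)
    next
      case (2 n)
      then show ?thesis using * zd_props(1)[of emp w] by (intro bexI[of _ "zd emp w"]) (simp_all add: zmul_zd)
    qed
    moreover have "\<exists>w\<in>\<Z>. zd d emp = zmul mem (zd c emp) w"
      using * zd_props(1)[of v emp] by (intro bexI[of _ "zd v emp"]) (simp_all add: zmul_zd)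
    ultimately have "zd c emp = pr (suc emp) emp \<or> zd c emp = pr emp (suc emp)"
      using c zd_props(1)[OF *(1) emp_N] unfolding zcoprime_def by blast
    then show "c = suc emp" using * by (auto simp: zd_pr pr_inj)
  qed
next
  assume n: "ncoprime (zabs z) d"
  show "zcoprime mem z (zd d emp)" unfolding zcoprime_def
  proof (intro ballI impI)
    fix c assume c: "c \<in> \<Z>" "(\<exists>w\<in>\<Z>. z = zmul mem c w) \<and> (\<exists>w\<in>\<Z>. zd d emp = zmul mem c w)"
    then obtain w v where wv: "w \<in> \<Z>" "z = zmul mem c w" "v \<in> \<Z>" "zd d emp = zmul mem c v" by blast
    have "zabs z = zabs c \<boxtimes> zabs w" "d = zabs c \<boxtimes> zabs v"
      using wv c zabs_zmul[of c] zabs_zd(1)[OF d] by metis+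
    then have 1: "zabs c = suc emp" using n zabs_N unfolding ncoprime_def by blast
    show "c = pr (suc emp) emp \<or> c = pr emp (suc emp)"
      using c(1)
    proof (cases rule: int_sign)
      case (1 k)
      then have "k = suc emp" using \<open>zabs c = suc emp\<close> by simp
      then show ?thesis using 1 by (simp add: zd_pr)
    next
      case (2 k)
      then have "k = suc emp" using \<open>zabs c = suc emp\<close> by simp
      then show ?thesis using 2 by (simp add: zd_pr)
    qed
  qed
qed

abbreviation "\<Q> \<equiv> fractions mem"

definition frac :: "'a \<Rightarrow> 'a \<Rightarrow> 'a \<Rightarrow> 'a" where
  "frac a b d = qfrac mem (zd a b) (zd d emp)"

lemma fractions_iff:
  "q \<in> \<Q> \<longleftrightarrow> (\<exists>a\<in>\<N>. \<exists>b\<in>\<N>. \<exists>d\<in>\<N>. q = pr (pr a b) (pr d emp) \<and> (a = emp \<or> b = emp) \<and> d \<noteq> emp \<and> ncoprime (a \<boxplus> b) d)"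
proof
  assume "q \<in> \<Q>"
  then obtain z n where q: "q = pr z (pr n emp)" "z \<in> \<Z>" "n \<in> \<N>" "n \<noteq> emp" "zcoprime mem z (pr n emp)"
    unfolding fractions_def pos_integers_def by blast
  obtain a b where ab: "a \<in> \<N>" "b \<in> \<N>" "z = pr a b" "a = emp \<or> b = emp" by (rule integersE[OF q(2)])
  have "ncoprime (a \<boxplus> b) n" using q zcoprime_iff[OF q(2,3)] ab by (simp add: zd_pr zabs_def)
  then show "\<exists>a\<in>\<N>. \<exists>b\<in>\<N>. \<exists>d\<in>\<N>. q = pr (pr a b) (pr d emp) \<and> (a = emp \<or> b = emp) \<and> d \<noteq> emp \<and> ncoprime (a \<boxplus> b) d"
    using q ab by blast
next
  assume "\<exists>a\<in>\<N>. \<exists>b\<in>\<N>. \<exists>d\<in>\<N>. q = pr (pr a b) (pr d emp) \<and> (a = emp \<or> b = emp) \<and> d \<noteq> emp \<and> ncoprime (a \<boxplus> b) d"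
  then obtain a b d where q: "a \<in> \<N>" "b \<in> \<N>" "d \<in> \<N>" "q = pr (pr a b) (pr d emp)" "a = emp \<or> b = emp" "d \<noteq> emp" "ncoprime (a \<boxplus> b) d" by blast
  have "pr a b \<in> \<Z>" using q unfolding integers_def by blast
  moreover from this have "zcoprime mem (pr a b) (pr d emp)"
    using zcoprime_iff[of "pr a b" d] q by (simp add: zd_pr zabs_def)
  ultimately show "q \<in> \<Q>" unfolding fractions_def pos_integers_def using q by blast
qed

lemma qfrac_ex1:
  assumes N: "a \<in> \<N>" "b \<in> \<N>" "d \<in> \<N>" "d \<noteq> emp"
  shows "\<exists>!q. q \<in> \<Q> \<and> zmul mem (zd a b) (psnd mem q) = zmul mem (pfst mem q) (zd d emp)"
proof -
  define z where "z = zd a b"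
  have z: "z \<in> \<Z>" using zd_props N by (simp add: z_def)
  obtain m' d' where r: "m' \<in> \<N>" "d' \<in> \<N>" "d' \<noteq> emp" "zabs z \<boxtimes> d' = m' \<boxtimes> d" "ncoprime m' d'"
    and univ: "\<And>w e. w \<in> \<N> \<Longrightarrow> e \<in> \<N> \<Longrightarrow> zabs z \<boxtimes> e = w \<boxtimes> d \<Longrightarrow> \<exists>c\<in>\<N>. e = c \<boxtimes> d' \<and> w = c \<boxtimes> m'"
    by (rule reduced_ex[OF zabs_N N(3,4), of z]) (rule that)
  obtain x y where xy: "x \<in> \<N>" "y \<in> \<N>" "x = emp \<or> y = emp" "x \<boxplus> y = m'"
    "zmul mem z (zd d' emp) = zmul mem (zd x y) (zd d emp)"
    using z
  proof (cases rule: int_sign)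
    case (1 n)
    then show ?thesis using r N that[of m' emp] by (simp add: zmul_zd)
  next
    case (2 n)
    then show ?thesis using r N that[of emp m'] by (simp add: zmul_zd)
  qed
  have can: "zd u v = zd x y" if uv: "u \<in> \<N>" "v \<in> \<N>" "zmul mem z (zd d' emp) = zmul mem (zd u v) (zd d emp)" for u v
  proof -
    have "zmul mem (zd u v) (zd d emp) = zmul mem (zd x y) (zd d emp)" using uv xy by simp
    then have "(u \<boxplus> y) \<boxtimes> d = (x \<boxplus> v) \<boxtimes> d" using uv(1,2) xy(1,2) N by (simp add: zmul_zd zd_eq_iff times_distrib_right)
    then show ?thesis using uv(1,2) xy(1,2) N by (simp add: times_cancel zd_eq_iff)
  qed
  show ?thesis
  proof (rule ex1I)
    have "pr (pr x y) (pr d' emp) \<in> \<Q>" unfolding fractions_iff using xy r by blast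
    then show "pr (pr x y) (pr d' emp) \<in> \<Q> \<and> zmul mem (zd a b) (psnd mem (pr (pr x y) (pr d' emp))) =
        zmul mem (pfst mem (pr (pr x y) (pr d' emp))) (zd d emp)"
      using xy r by (simp flip: z_def add: zd_pr)
    fix q assume q: "q \<in> \<Q> \<and> zmul mem (zd a b) (psnd mem q) = zmul mem (pfst mem q) (zd d emp)"
    then obtain u v e where uv: "u \<in> \<N>" "v \<in> \<N>" "e \<in> \<N>" "q = pr (pr u v) (pr e emp)" "u = emp \<or> v = emp"
      "e \<noteq> emp" "ncoprime (u \<boxplus> v) e" unfolding fractions_iff by blast
    have eq: "zmul mem z (zd e emp) = zmul mem (zd u v) (zd d emp)"
      using q uv by (simp flip: z_def add: zd_pr)
    have "zabs z \<boxtimes> e = (u \<boxplus> v) \<boxtimes> d"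
    proof -
      have "zabs (zd u v) = u \<boxplus> v" using uv by (simp add: zd_pr zabs_def)
      then show ?thesis using arg_cong[OF eq, of zabs] z uv N zd_props(1) by (simp add: zabs_zmul)
    qed
    then obtain c where c: "c \<in> \<N>" "e = c \<boxtimes> d'" "u \<boxplus> v = c \<boxtimes> m'" using univ[of "u \<boxplus> v" e] uv by auto
    then have "c = suc emp" using uv(7) r unfolding ncoprime_def by blast
    then have e: "e = d'" using c r by simp
    then have "zd u v = zd x y" using can[OF uv(1,2)] eq by simp
    then show "q = pr (pr x y) (pr d' emp)" using uv xy e by (simp add: zd_pr)
  qed
qed

text \<open>
  Every fraction is \<open>frac a b d\<close>, with value \<open>(a - b) / d\<close>, for suitable naturals; all operations
  are computed on arbitrary, not necessarily reduced, representatives.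
\<close>

lemma frac_props:
  assumes N: "a \<in> \<N>" "b \<in> \<N>" "d \<in> \<N>" "d \<noteq> emp"
  shows "frac a b d \<in> \<Q>"
    "\<exists>x\<in>\<N>. \<exists>y\<in>\<N>. \<exists>e\<in>\<N>. e \<noteq> emp \<and> pfst mem (frac a b d) = zd x y \<and> psnd mem (frac a b d) = zd e emp \<and>
       frac a b d = pr (pr x y) (pr e emp) \<and> (x = emp \<or> y = emp) \<and> a \<boxtimes> e \<boxplus> y \<boxtimes> d = x \<boxtimes> d \<boxplus> b \<boxtimes> e"
proof -
  have *: "frac a b d \<in> \<Q> \<and> zmul mem (zd a b) (psnd mem (frac a b d)) = zmul mem (pfst mem (frac a b d)) (zd d emp)"
    unfolding frac_def qfrac_def by (rule theI'[OF qfrac_ex1[OF N]])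
  then show "frac a b d \<in> \<Q>" by blast
  then obtain x y e where q: "x \<in> \<N>" "y \<in> \<N>" "e \<in> \<N>" "frac a b d = pr (pr x y) (pr e emp)" "x = emp \<or> y = emp" "e \<noteq> emp"
    unfolding fractions_iff by blast
  then have p: "pfst mem (frac a b d) = zd x y" "psnd mem (frac a b d) = zd e emp" by (simp_all add: zd_pr)
  have "zmul mem (zd a b) (zd e emp) = zmul mem (zd x y) (zd d emp)" using * p by simp
  then have "a \<boxtimes> e \<boxplus> y \<boxtimes> d = x \<boxtimes> d \<boxplus> b \<boxtimes> e" using q N by (simp add: zmul_zd zd_eq_iff)
  then show "\<exists>x\<in>\<N>. \<exists>y\<in>\<N>. \<exists>e\<in>\<N>. e \<noteq> emp \<and> pfst mem (frac a b d) = zd x y \<and> psnd mem (frac a b d) = zd e emp \<and>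
       frac a b d = pr (pr x y) (pr e emp) \<and> (x = emp \<or> y = emp) \<and> a \<boxtimes> e \<boxplus> y \<boxtimes> d = x \<boxtimes> d \<boxplus> b \<boxtimes> e" using q p by blast
qed

lemma frac_eqI:
  assumes N: "a \<in> \<N>" "b \<in> \<N>" "d \<in> \<N>" "d \<noteq> emp"
    and q: "q \<in> \<Q>" "q = pr (pr x y) (pr e emp)" "x \<in> \<N>" "y \<in> \<N>" "e \<in> \<N>" "x = emp \<or> y = emp"
    and eq: "a \<boxtimes> e \<boxplus> y \<boxtimes> d = x \<boxtimes> d \<boxplus> b \<boxtimes> e"
  shows "frac a b d = q"
proof -
  have p: "pfst mem q = zd x y" "psnd mem q = zd e emp" using q by (simp_all add: zd_pr)
  have "zmul mem (zd a b) (psnd mem q) = zmul mem (pfst mem q) (zd d emp)"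
    unfolding p using N q(3-5) eq by (simp add: zmul_zd zd_eq_iff)
  then show ?thesis unfolding frac_def qfrac_def
    using q(1) the1_equality[OF qfrac_ex1[OF N], of q] by blast
qed

lemma frac_reduced:
  assumes "pr (pr x y) (pr e emp) \<in> \<Q>" "x \<in> \<N>" "y \<in> \<N>" "e \<in> \<N>"
  shows "frac x y e = pr (pr x y) (pr e emp)" "x = emp \<or> y = emp" "e \<noteq> emp"
proof -
  obtain x' y' e' where q: "x' \<in> \<N>" "y' \<in> \<N>" "e' \<in> \<N>" "pr (pr x y) (pr e emp) = pr (pr x' y') (pr e' emp)"
      "x' = emp \<or> y' = emp" "e' \<noteq> emp"
    using assms(1) unfolding fractions_iff by blast
  then show "x = emp \<or> y = emp" "e \<noteq> emp" using assms by (auto simp: pr_inj)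
  then show "frac x y e = pr (pr x y) (pr e emp)"
    by (intro frac_eqI[OF _ _ _ _ assms(1) refl]) (use assms in \<open>auto simp: plus_comm\<close>)
qed

lemma fractionE:
  assumes "q \<in> \<Q>" obtains a b d where "a \<in> \<N>" "b \<in> \<N>" "d \<in> \<N>" "d \<noteq> emp" "q = frac a b d"
  using assms frac_reduced unfolding fractions_iff by metis

lemma frac_eq_iff:
  assumes N: "a \<in> \<N>" "b \<in> \<N>" "d \<in> \<N>" "d \<noteq> emp" and N': "a' \<in> \<N>" "b' \<in> \<N>" "d' \<in> \<N>" "d' \<noteq> emp"
  shows "frac a b d = frac a' b' d' \<longleftrightarrow> a \<boxtimes> d' \<boxplus> b' \<boxtimes> d = a' \<boxtimes> d \<boxplus> b \<boxtimes> d'"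
proof -
  from frac_props(2)[OF N] obtain x y e where x: "x \<in> \<N>" "y \<in> \<N>" "e \<in> \<N>" "e \<noteq> emp"
    "frac a b d = pr (pr x y) (pr e emp)" "x = emp \<or> y = emp" "a \<boxtimes> e \<boxplus> y \<boxtimes> d = x \<boxtimes> d \<boxplus> b \<boxtimes> e" by blast
  have "frac a b d = frac a' b' d' \<longleftrightarrow> a' \<boxtimes> e \<boxplus> y \<boxtimes> d' = x \<boxtimes> d' \<boxplus> b' \<boxtimes> e"
  proof
    assume "frac a b d = frac a' b' d'"
    moreover from frac_props(2)[OF N'] obtain x' y' e' where x': "x' \<in> \<N>" "y' \<in> \<N>" "e' \<in> \<N>"
      "frac a' b' d' = pr (pr x' y') (pr e' emp)" "a' \<boxtimes> e' \<boxplus> y' \<boxtimes> d' = x' \<boxtimes> d' \<boxplus> b' \<boxtimes> e'" by blast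
    ultimately have "x = x'" "y = y'" "e = e'" using x by (simp_all add: pr_inj)
    then show "a' \<boxtimes> e \<boxplus> y \<boxtimes> d' = x \<boxtimes> d' \<boxplus> b' \<boxtimes> e" using x' by simp
  next
    assume "a' \<boxtimes> e \<boxplus> y \<boxtimes> d' = x \<boxtimes> d' \<boxplus> b' \<boxtimes> e"
    then have "frac a' b' d' = frac a b d"
      by (intro frac_eqI[OF N' frac_props(1)[OF N] x(5)]) (use x in auto)
    then show "frac a b d = frac a' b' d'" by simp
  qed
  also have "\<dots> \<longleftrightarrow> (a' \<boxtimes> e \<boxplus> y \<boxtimes> d') \<boxtimes> d = (x \<boxtimes> d' \<boxplus> b' \<boxtimes> e) \<boxtimes> d"
    using N N' x by (simp add: times_cancel)
  also have "\<dots> \<longleftrightarrow> (a' \<boxtimes> d \<boxtimes> e) \<boxplus> y \<boxtimes> d \<boxtimes> d' = (b' \<boxtimes> d \<boxtimes> e) \<boxplus> x \<boxtimes> d \<boxtimes> d'"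
    using N N' x by (simp add: nat_simps del: plus_cancel)
  also have "\<dots> \<longleftrightarrow> a \<boxtimes> e \<boxtimes> d' \<boxplus> b' \<boxtimes> d \<boxtimes> e = a' \<boxtimes> d \<boxtimes> e \<boxplus> b \<boxtimes> e \<boxtimes> d'"
  proof (rule cross_add)
    have "(a \<boxtimes> e \<boxplus> y \<boxtimes> d) \<boxtimes> d' = (x \<boxtimes> d \<boxplus> b \<boxtimes> e) \<boxtimes> d'" using x(7) by simp
    then show "a \<boxtimes> e \<boxtimes> d' \<boxplus> y \<boxtimes> d \<boxtimes> d' = b \<boxtimes> e \<boxtimes> d' \<boxplus> x \<boxtimes> d \<boxtimes> d'"
      using N N' x(1-3) by (simp add: times_distrib_right plus_comm[of "x \<boxtimes> d \<boxtimes> d'"] del: plus_cancel)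
  qed simp_all
  also have "\<dots> \<longleftrightarrow> (a \<boxtimes> d' \<boxplus> b' \<boxtimes> d) \<boxtimes> e = (a' \<boxtimes> d \<boxplus> b \<boxtimes> d') \<boxtimes> e"
    using N N' x(1-3) by (simp add: nat_simps del: plus_cancel)
  also have "\<dots> \<longleftrightarrow> a \<boxtimes> d' \<boxplus> b' \<boxtimes> d = a' \<boxtimes> d \<boxplus> b \<boxtimes> d'"
    using x by (simp add: times_cancel)
  finally show ?thesis .
qed

lemma frac_scale:
  assumes "a \<in> \<N>" "b \<in> \<N>" "d \<in> \<N>" "d \<noteq> emp" "k \<in> \<N>" "k \<noteq> emp"
  shows "frac (k \<boxtimes> a) (k \<boxtimes> b) (k \<boxtimes> d) = frac a b d"
  using assms by (subst frac_eq_iff) (simp_all add: times_eq_0 nat_simps del: plus_cancel)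

lemma qadd_frac:
  assumes N: "a \<in> \<N>" "b \<in> \<N>" "d \<in> \<N>" "d \<noteq> emp" and N': "a' \<in> \<N>" "b' \<in> \<N>" "d' \<in> \<N>" "d' \<noteq> emp"
  shows "qadd mem (frac a b d) (frac a' b' d') = frac (a \<boxtimes> d' \<boxplus> a' \<boxtimes> d) (b \<boxtimes> d' \<boxplus> b' \<boxtimes> d) (d \<boxtimes> d')"
proof -
  from frac_props(2)[OF N] obtain x y e where x: "x \<in> \<N>" "y \<in> \<N>" "e \<in> \<N>" "e \<noteq> emp"
    "pfst mem (frac a b d) = zd x y" "psnd mem (frac a b d) = zd e emp" "a \<boxtimes> e \<boxplus> y \<boxtimes> d = x \<boxtimes> d \<boxplus> b \<boxtimes> e" by blast
  from frac_props(2)[OF N'] obtain x' y' e' where x': "x' \<in> \<N>" "y' \<in> \<N>" "e' \<in> \<N>" "e' \<noteq> emp"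
    "pfst mem (frac a' b' d') = zd x' y'" "psnd mem (frac a' b' d') = zd e' emp" "a' \<boxtimes> e' \<boxplus> y' \<boxtimes> d' = x' \<boxtimes> d' \<boxplus> b' \<boxtimes> e'" by blast
  have "qadd mem (frac a b d) (frac a' b' d') = frac (x \<boxtimes> e' \<boxplus> x' \<boxtimes> e) (y \<boxtimes> e' \<boxplus> y' \<boxtimes> e) (e \<boxtimes> e')"
    unfolding qadd_def frac_def[of "x \<boxtimes> e' \<boxplus> x' \<boxtimes> e"] x(5,6) x'(5,6)
    using x(1-4) x'(1-4) by (simp add: zmul_zd zadd_zd)
  also have "\<dots> = frac (a \<boxtimes> d' \<boxplus> a' \<boxtimes> d) (b \<boxtimes> d' \<boxplus> b' \<boxtimes> d) (d \<boxtimes> d')"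
  proof -
    have "(x \<boxtimes> e' \<boxplus> x' \<boxtimes> e) \<boxtimes> (d \<boxtimes> d') \<boxplus> (b \<boxtimes> d' \<boxplus> b' \<boxtimes> d) \<boxtimes> (e \<boxtimes> e')
      = (x \<boxtimes> d \<boxplus> b \<boxtimes> e) \<boxtimes> (e' \<boxtimes> d') \<boxplus> (x' \<boxtimes> d' \<boxplus> b' \<boxtimes> e') \<boxtimes> (e \<boxtimes> d)"
      using N N' x(1-3) x'(1-3) by (simp add: nat_simps del: plus_cancel)
    also have "\<dots> = (a \<boxtimes> e \<boxplus> y \<boxtimes> d) \<boxtimes> (e' \<boxtimes> d') \<boxplus> (a' \<boxtimes> e' \<boxplus> y' \<boxtimes> d') \<boxtimes> (e \<boxtimes> d)"
      unfolding x(7) x'(7) ..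
    also have "\<dots> = (a \<boxtimes> d' \<boxplus> a' \<boxtimes> d) \<boxtimes> (e \<boxtimes> e') \<boxplus> (y \<boxtimes> e' \<boxplus> y' \<boxtimes> e) \<boxtimes> (d \<boxtimes> d')"
      using N N' x(1-3) x'(1-3) by (simp add: nat_simps del: plus_cancel)
    finally show ?thesis using N N' x(1-4) x'(1-4) by (simp add: frac_eq_iff times_eq_0 del: plus_cancel)
  qed
  finally show ?thesis .
qed

lemma frac_mult_cong:
  assumes N: "a \<in> \<N>" "b \<in> \<N>" "d \<in> \<N>" "d \<noteq> emp" "x \<in> \<N>" "y \<in> \<N>" "e \<in> \<N>" "e \<noteq> emp"
    and N': "a' \<in> \<N>" "b' \<in> \<N>" "d' \<in> \<N>" "d' \<noteq> emp" and eq: "a \<boxtimes> e \<boxplus> y \<boxtimes> d = x \<boxtimes> d \<boxplus> b \<boxtimes> e"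
  shows "frac (x \<boxtimes> a' \<boxplus> y \<boxtimes> b') (x \<boxtimes> b' \<boxplus> y \<boxtimes> a') (e \<boxtimes> d') = frac (a \<boxtimes> a' \<boxplus> b \<boxtimes> b') (a \<boxtimes> b' \<boxplus> b \<boxtimes> a') (d \<boxtimes> d')"
proof -
  have "(x \<boxtimes> a' \<boxplus> y \<boxtimes> b') \<boxtimes> (d \<boxtimes> d') \<boxplus> (a \<boxtimes> b' \<boxplus> b \<boxtimes> a') \<boxtimes> (e \<boxtimes> d')
     = d' \<boxtimes> (a' \<boxtimes> (x \<boxtimes> d \<boxplus> b \<boxtimes> e) \<boxplus> b' \<boxtimes> (a \<boxtimes> e \<boxplus> y \<boxtimes> d))"
    using N N' by (simp add: nat_simps del: plus_cancel)
  also have "\<dots> = d' \<boxtimes> (a' \<boxtimes> (a \<boxtimes> e \<boxplus> y \<boxtimes> d) \<boxplus> b' \<boxtimes> (x \<boxtimes> d \<boxplus> b \<boxtimes> e))"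
    unfolding eq ..
  also have "\<dots> = (a \<boxtimes> a' \<boxplus> b \<boxtimes> b') \<boxtimes> (e \<boxtimes> d') \<boxplus> (x \<boxtimes> b' \<boxplus> y \<boxtimes> a') \<boxtimes> (d \<boxtimes> d')"
    using N N' by (simp add: nat_simps del: plus_cancel)
  finally show ?thesis using N N' by (simp add: frac_eq_iff times_eq_0 del: plus_cancel)
qed

lemma qmul_frac:
  assumes N: "a \<in> \<N>" "b \<in> \<N>" "d \<in> \<N>" "d \<noteq> emp" and N': "a' \<in> \<N>" "b' \<in> \<N>" "d' \<in> \<N>" "d' \<noteq> emp"
  shows "qmul mem (frac a b d) (frac a' b' d') = frac (a \<boxtimes> a' \<boxplus> b \<boxtimes> b') (a \<boxtimes> b' \<boxplus> b \<boxtimes> a') (d \<boxtimes> d')"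
proof -
  from frac_props(2)[OF N] obtain x y e where x: "x \<in> \<N>" "y \<in> \<N>" "e \<in> \<N>" "e \<noteq> emp"
    "pfst mem (frac a b d) = zd x y" "psnd mem (frac a b d) = zd e emp" "a \<boxtimes> e \<boxplus> y \<boxtimes> d = x \<boxtimes> d \<boxplus> b \<boxtimes> e" by blast
  from frac_props(2)[OF N'] obtain x' y' e' where x': "x' \<in> \<N>" "y' \<in> \<N>" "e' \<in> \<N>" "e' \<noteq> emp"
    "pfst mem (frac a' b' d') = zd x' y'" "psnd mem (frac a' b' d') = zd e' emp" "a' \<boxtimes> e' \<boxplus> y' \<boxtimes> d' = x' \<boxtimes> d' \<boxplus> b' \<boxtimes> e'" by blast
  have "qmul mem (frac a b d) (frac a' b' d') = frac (x \<boxtimes> x' \<boxplus> y \<boxtimes> y') (x \<boxtimes> y' \<boxplus> y \<boxtimes> x') (e \<boxtimes> e')"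
    unfolding qmul_def frac_def[of "x \<boxtimes> x' \<boxplus> y \<boxtimes> y'"] x(5,6) x'(5,6)
    using x(1-4) x'(1-4) by (simp add: zmul_zd)
  also have "\<dots> = frac (a \<boxtimes> x' \<boxplus> b \<boxtimes> y') (a \<boxtimes> y' \<boxplus> b \<boxtimes> x') (d \<boxtimes> e')"
    by (rule frac_mult_cong[OF N x(1-4) x'(1-4) x(7)])
  also have "\<dots> = frac (x' \<boxtimes> a \<boxplus> y' \<boxtimes> b) (x' \<boxtimes> b \<boxplus> y' \<boxtimes> a) (e' \<boxtimes> d)"
    using N x'(1-3) by (simp add: plus_ac times_ac del: plus_cancel)
  also have "\<dots> = frac (a' \<boxtimes> a \<boxplus> b' \<boxtimes> b) (a' \<boxtimes> b \<boxplus> b' \<boxtimes> a) (d' \<boxtimes> d)"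
    by (rule frac_mult_cong[OF N' x'(1-4) N x'(7)])
  also have "\<dots> = frac (a \<boxtimes> a' \<boxplus> b \<boxtimes> b') (a \<boxtimes> b' \<boxplus> b \<boxtimes> a') (d \<boxtimes> d')"
    using N N' by (simp add: plus_ac times_ac del: plus_cancel)
  finally show ?thesis .
qed

lemma qle_frac:
  assumes N: "a \<in> \<N>" "b \<in> \<N>" "d \<in> \<N>" "d \<noteq> emp" and N': "a' \<in> \<N>" "b' \<in> \<N>" "d' \<in> \<N>" "d' \<noteq> emp"
  shows "qle mem (frac a b d) (frac a' b' d') \<longleftrightarrow> nle mem (a \<boxtimes> d' \<boxplus> b' \<boxtimes> d) (a' \<boxtimes> d \<boxplus> b \<boxtimes> d')"
proof -
  from frac_props(2)[OF N] obtain x y e where x: "x \<in> \<N>" "y \<in> \<N>" "e \<in> \<N>" "e \<noteq> emp"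
    "pfst mem (frac a b d) = zd x y" "psnd mem (frac a b d) = zd e emp" "a \<boxtimes> e \<boxplus> y \<boxtimes> d = x \<boxtimes> d \<boxplus> b \<boxtimes> e" by blast
  from frac_props(2)[OF N'] obtain x' y' e' where x': "x' \<in> \<N>" "y' \<in> \<N>" "e' \<in> \<N>" "e' \<noteq> emp"
    "pfst mem (frac a' b' d') = zd x' y'" "psnd mem (frac a' b' d') = zd e' emp" "a' \<boxtimes> e' \<boxplus> y' \<boxtimes> d' = x' \<boxtimes> d' \<boxplus> b' \<boxtimes> e'" by blast
  have zle: "zle mem (zd p q) (zd r s) \<longleftrightarrow> nle mem (p \<boxplus> s) (r \<boxplus> q)"
    if pq: "p \<in> \<N>" "q \<in> \<N>" "r \<in> \<N>" "s \<in> \<N>" for p q r s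
  proof -
    define p' q' r' s' where *: "p' = pfst mem (zd p q)" "q' = psnd mem (zd p q)" "r' = pfst mem (zd r s)" "s' = psnd mem (zd r s)"
    have M: "p' \<in> \<N>" "q' \<in> \<N>" "r' \<in> \<N>" "s' \<in> \<N>" using zd_props(1) pq by (simp_all add: *)
    have e: "p \<boxplus> q' = q \<boxplus> p'" "r \<boxplus> s' = s \<boxplus> r'" using zd_props(2) pq by (simp_all add: *)
    have "nle mem (p \<boxplus> s) (r \<boxplus> q) \<longleftrightarrow> nle mem (p \<boxplus> s \<boxplus> (q' \<boxplus> r')) (r \<boxplus> q \<boxplus> (q' \<boxplus> r'))"
      using pq M by (simp add: nle_cancel)
    also have "p \<boxplus> s \<boxplus> (q' \<boxplus> r') = (p \<boxplus> q') \<boxplus> (s \<boxplus> r')" using pq M by (simp add: plus_ac del: plus_cancel)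
    also have "\<dots> = (p' \<boxplus> s') \<boxplus> (q \<boxplus> r)" unfolding e(1) e(2)[symmetric] using pq M by (simp add: plus_ac del: plus_cancel)
    also have "r \<boxplus> q \<boxplus> (q' \<boxplus> r') = (r' \<boxplus> q') \<boxplus> (q \<boxplus> r)" using pq M by (simp add: plus_ac del: plus_cancel)
    also have "nle mem ((p' \<boxplus> s') \<boxplus> (q \<boxplus> r)) ((r' \<boxplus> q') \<boxplus> (q \<boxplus> r)) \<longleftrightarrow> nle mem (p' \<boxplus> s') (r' \<boxplus> q')"
      using pq M by (simp add: nle_cancel)
    finally show ?thesis unfolding zle_def using M by (simp add: nplus_eq' flip: *)
  qed
  have "qle mem (frac a b d) (frac a' b' d') \<longleftrightarrow> nle mem (x \<boxtimes> e' \<boxplus> y' \<boxtimes> e) (x' \<boxtimes> e \<boxplus> y \<boxtimes> e')"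
    unfolding qle_def x(5,6) x'(5,6) using x(1-4) x'(1-4) by (simp add: zmul_zd zle)
  also have "\<dots> \<longleftrightarrow> nle mem ((x \<boxtimes> e' \<boxplus> y' \<boxtimes> e) \<boxtimes> (d \<boxtimes> d')) ((x' \<boxtimes> e \<boxplus> y \<boxtimes> e') \<boxtimes> (d \<boxtimes> d'))"
    using N N' x(1-4) x'(1-4) by (simp add: nle_times times_eq_0)
  also have "\<dots> \<longleftrightarrow> nle mem ((x \<boxtimes> e' \<boxplus> y' \<boxtimes> e) \<boxtimes> (d \<boxtimes> d') \<boxplus> (b \<boxtimes> e \<boxtimes> (e' \<boxtimes> d') \<boxplus> a' \<boxtimes> e' \<boxtimes> (e \<boxtimes> d)))
      ((x' \<boxtimes> e \<boxplus> y \<boxtimes> e') \<boxtimes> (d \<boxtimes> d') \<boxplus> (b \<boxtimes> e \<boxtimes> (e' \<boxtimes> d') \<boxplus> a' \<boxtimes> e' \<boxtimes> (e \<boxtimes> d)))"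
    using N N' x(1-4) x'(1-4) by (simp add: nle_cancel)
  also have "(x \<boxtimes> e' \<boxplus> y' \<boxtimes> e) \<boxtimes> (d \<boxtimes> d') \<boxplus> (b \<boxtimes> e \<boxtimes> (e' \<boxtimes> d') \<boxplus> a' \<boxtimes> e' \<boxtimes> (e \<boxtimes> d)) =
      (x \<boxtimes> d \<boxplus> b \<boxtimes> e) \<boxtimes> (e' \<boxtimes> d') \<boxplus> (a' \<boxtimes> e' \<boxplus> y' \<boxtimes> d') \<boxtimes> (e \<boxtimes> d)"
    using N N' x(1-3) x'(1-3) by (simp add: nat_simps del: plus_cancel)
  also have "\<dots> = (a \<boxtimes> e \<boxplus> y \<boxtimes> d) \<boxtimes> (e' \<boxtimes> d') \<boxplus> (x' \<boxtimes> d' \<boxplus> b' \<boxtimes> e') \<boxtimes> (e \<boxtimes> d)" unfolding x(7) x'(7) ..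
  also have "\<dots> = (a \<boxtimes> d' \<boxplus> b' \<boxtimes> d) \<boxtimes> (e \<boxtimes> e') \<boxplus> (y \<boxtimes> d \<boxtimes> (e' \<boxtimes> d') \<boxplus> x' \<boxtimes> d' \<boxtimes> (e \<boxtimes> d))"
    using N N' x(1-3) x'(1-3) by (simp add: nat_simps del: plus_cancel)
  also have "(x' \<boxtimes> e \<boxplus> y \<boxtimes> e') \<boxtimes> (d \<boxtimes> d') \<boxplus> (b \<boxtimes> e \<boxtimes> (e' \<boxtimes> d') \<boxplus> a' \<boxtimes> e' \<boxtimes> (e \<boxtimes> d)) =
      (a' \<boxtimes> d \<boxplus> b \<boxtimes> d') \<boxtimes> (e \<boxtimes> e') \<boxplus> (y \<boxtimes> d \<boxtimes> (e' \<boxtimes> d') \<boxplus> x' \<boxtimes> d' \<boxtimes> (e \<boxtimes> d))"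
    using N N' x(1-3) x'(1-3) by (simp add: nat_simps del: plus_cancel)
  finally show ?thesis using N N' x(1-4) x'(1-4) by (simp add: nle_cancel nle_times times_eq_0)
qed

lemma dfn_nle [dfn_intros]: "dterm b t \<Longrightarrow> dterm b s \<Longrightarrow> dfn b (\<lambda>v. nle mem (t v) (s v))"
  unfolding nle_def by (intro dfn_intros)

lemma dfn_ncoprime [dfn_intros]:
  assumes "dterm b t" "dterm b s"
  shows "dfn b (\<lambda>v. ncoprime (t v) (s v))"
proof (rule dfn_subst2[of b "\<lambda>x y v. ncoprime x y", OF _ assms])
  have "dfn b (\<lambda>v. \<forall>c\<in>\<S>. \<forall>w\<in>\<S>. \<forall>u\<in>\<S>. c \<in> \<N> \<and> w \<in> \<N> \<and> u \<in> \<N> \<and> v 0 = c \<boxtimes> w \<and> v 1 = c \<boxtimes> u \<longrightarrow> c = suc emp)"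
    by (intro dfn_intros emp_S suc_S)
  then show "dfn b (\<lambda>v. ncoprime (v 0) (v 1))"
    by (rule dfn_back) (unfold ncoprime_def, meson N_S)
qed

lemma dfn_fractions [dfn_intros]:
  assumes "dterm b t"
  shows "dfn b (\<lambda>v. t v \<in> \<Q>)"
proof (rule dfn_subst[of b "\<lambda>x v. x \<in> \<Q>", OF _ assms])
  have "dfn b (\<lambda>v. \<exists>x\<in>\<S>. \<exists>y\<in>\<S>. \<exists>d\<in>\<S>. x \<in> \<N> \<and> y \<in> \<N> \<and> d \<in> \<N> \<and> v 0 = pr (pr x y) (pr d emp) \<and>
      (x = emp \<or> y = emp) \<and> d \<noteq> emp \<and> ncoprime (x \<boxplus> y) d)"
    by (intro dfn_intros emp_S)
  then show "dfn b (\<lambda>v. v 0 \<in> \<Q>)"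
    by (rule dfn_back) (unfold fractions_iff, meson N_S)
qed

lemma is_class_fractions: "is_class \<Q>"
proof -
  have "is_class {q \<in> \<S>. q \<in> \<Q>}" by (rule comprehension) (intro dfn_intros)
  moreover have "\<Q> \<subseteq> \<S>" by (auto simp: fractions_iff)
  then have "{q \<in> \<S>. q \<in> \<Q>} = \<Q>" by auto
  ultimately show ?thesis by simp
qed

lemma fractions_S: "q \<in> \<Q> \<Longrightarrow> q \<in> \<S>"
  by (auto simp: fractions_iff)

text \<open>First-order descriptions of the operations, by means of reduced representatives.\<close>

definition is_frac :: "'a \<Rightarrow> 'a \<Rightarrow> 'a \<Rightarrow> 'a \<Rightarrow> bool" where
  "is_frac q a b d \<longleftrightarrow> q \<in> \<Q> \<and> a \<in> \<N> \<and> b \<in> \<N> \<and> d \<in> \<N> \<and> q = pr (pr a b) (pr d emp)"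

lemma is_frac_ex: "q \<in> \<Q> \<Longrightarrow> \<exists>a\<in>\<S>. \<exists>b\<in>\<S>. \<exists>d\<in>\<S>. is_frac q a b d"
proof -
  assume q: "q \<in> \<Q>"
  then obtain a b d where "a \<in> \<N>" "b \<in> \<N>" "d \<in> \<N>" "q = pr (pr a b) (pr d emp)"
    unfolding fractions_iff by blast
  then show ?thesis unfolding is_frac_def using q N_S by blast
qed

lemma is_fracD: "is_frac q a b d \<Longrightarrow> a \<in> \<N> \<and> b \<in> \<N> \<and> d \<in> \<N> \<and> d \<noteq> emp \<and> q = frac a b d"
  unfolding is_frac_def using frac_reduced by metis

definition qle_fo :: "'a \<Rightarrow> 'a \<Rightarrow> bool" where
  "qle_fo p q \<longleftrightarrow> (\<exists>a\<in>\<S>. \<exists>b\<in>\<S>. \<exists>d\<in>\<S>. \<exists>a'\<in>\<S>. \<exists>b'\<in>\<S>. \<exists>d'\<in>\<S>. is_frac p a b d \<and> is_frac q a' b' d' \<and>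
     nle mem (a \<boxtimes> d' \<boxplus> b' \<boxtimes> d) (a' \<boxtimes> d \<boxplus> b \<boxtimes> d'))"

definition qop_fo :: "('a \<Rightarrow> 'a \<Rightarrow> 'a \<Rightarrow> 'a \<Rightarrow> 'a \<Rightarrow> 'a \<Rightarrow> 'a \<times> 'a) \<Rightarrow> 'a \<Rightarrow> 'a \<Rightarrow> 'a \<Rightarrow> bool" where
  "qop_fo f p q r \<longleftrightarrow> (\<exists>a\<in>\<S>. \<exists>b\<in>\<S>. \<exists>d\<in>\<S>. \<exists>a'\<in>\<S>. \<exists>b'\<in>\<S>. \<exists>d'\<in>\<S>. \<exists>x\<in>\<S>. \<exists>y\<in>\<S>. \<exists>e\<in>\<S>.
     is_frac p a b d \<and> is_frac q a' b' d' \<and> is_frac r x y e \<and>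
     fst (f a b d a' b' d') \<boxtimes> e \<boxplus> y \<boxtimes> (d \<boxtimes> d') = x \<boxtimes> (d \<boxtimes> d') \<boxplus> snd (f a b d a' b' d') \<boxtimes> e)"

definition qadd_fo :: "'a \<Rightarrow> 'a \<Rightarrow> 'a \<Rightarrow> bool" where
  "qadd_fo = qop_fo (\<lambda>a b d a' b' d'. (a \<boxtimes> d' \<boxplus> a' \<boxtimes> d, b \<boxtimes> d' \<boxplus> b' \<boxtimes> d))"

definition qmul_fo :: "'a \<Rightarrow> 'a \<Rightarrow> 'a \<Rightarrow> bool" where
  "qmul_fo = qop_fo (\<lambda>a b d a' b' d'. (a \<boxtimes> a' \<boxplus> b \<boxtimes> b', a \<boxtimes> b' \<boxplus> b \<boxtimes> a'))"

lemma dfn_qle_fo: "dfn b (\<lambda>v. qle_fo (v 0) (v 1))"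
  unfolding qle_fo_def is_frac_def by (intro dfn_intros emp_S)

lemma dfn_qadd_fo: "dfn b (\<lambda>v. qadd_fo (v 0) (v 1) (v 2))"
  unfolding qadd_fo_def qop_fo_def is_frac_def fst_conv snd_conv by (intro dfn_intros emp_S)

lemma dfn_qmul_fo: "dfn b (\<lambda>v. qmul_fo (v 0) (v 1) (v 2))"
  unfolding qmul_fo_def qop_fo_def is_frac_def fst_conv snd_conv by (intro dfn_intros emp_S)

lemma qle_fo: "p \<in> \<Q> \<Longrightarrow> q \<in> \<Q> \<Longrightarrow> qle_fo p q \<longleftrightarrow> qle mem p q"
proof
  assume "qle_fo p q"
  then obtain a b d a' b' d' where *: "is_frac p a b d" "is_frac q a' b' d'"
     "nle mem (a \<boxtimes> d' \<boxplus> b' \<boxtimes> d) (a' \<boxtimes> d \<boxplus> b \<boxtimes> d')" unfolding qle_fo_def by blast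
  then show "qle mem p q" using is_fracD[OF *(1)] is_fracD[OF *(2)] by (simp add: qle_frac)
next
  assume pq: "p \<in> \<Q>" "q \<in> \<Q>" and le: "qle mem p q"
  obtain a b d where p: "a \<in> \<S>" "b \<in> \<S>" "d \<in> \<S>" "is_frac p a b d" using is_frac_ex[OF pq(1)] by blast
  obtain a' b' d' where q: "a' \<in> \<S>" "b' \<in> \<S>" "d' \<in> \<S>" "is_frac q a' b' d'" using is_frac_ex[OF pq(2)] by blast
  have "nle mem (a \<boxtimes> d' \<boxplus> b' \<boxtimes> d) (a' \<boxtimes> d \<boxplus> b \<boxtimes> d')"
    using le is_fracD[OF p(4)] is_fracD[OF q(4)] by (simp add: qle_frac)
  then show "qle_fo p q" unfolding qle_fo_def using p q by blast
qed

lemma qop_fo: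
  assumes pq: "p \<in> \<Q>" "q \<in> \<Q>" and r: "r \<in> \<S>"
    and f: "\<And>a b d a' b' d'. fst (f a b d a' b' d') \<in> \<N> \<and> snd (f a b d a' b' d') \<in> \<N>"
    and ad: "\<And>a b d a' b' d'. a \<in> \<N> \<Longrightarrow> b \<in> \<N> \<Longrightarrow> d \<in> \<N> \<Longrightarrow> d \<noteq> emp \<Longrightarrow> a' \<in> \<N> \<Longrightarrow> b' \<in> \<N> \<Longrightarrow> d' \<in> \<N> \<Longrightarrow> d' \<noteq> emp \<Longrightarrow>
      ad (frac a b d) (frac a' b' d') = frac (fst (f a b d a' b' d')) (snd (f a b d a' b' d')) (d \<boxtimes> d')"
  shows "qop_fo f p q r \<longleftrightarrow> r = ad p q"
proof
  assume "qop_fo f p q r"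
  then obtain a b d a' b' d' x y e where *: "is_frac p a b d" "is_frac q a' b' d'" "is_frac r x y e"
     "fst (f a b d a' b' d') \<boxtimes> e \<boxplus> y \<boxtimes> (d \<boxtimes> d') = x \<boxtimes> (d \<boxtimes> d') \<boxplus> snd (f a b d a' b' d') \<boxtimes> e" unfolding qop_fo_def by blast
  have "ad p q = frac (fst (f a b d a' b' d')) (snd (f a b d a' b' d')) (d \<boxtimes> d')"
    using ad is_fracD[OF *(1)] is_fracD[OF *(2)] by simp
  also have "\<dots> = frac x y e"
    using f *(4) is_fracD[OF *(1)] is_fracD[OF *(2)] is_fracD[OF *(3)] by (simp add: frac_eq_iff times_eq_0)
  finally show "r = ad p q" using is_fracD[OF *(3)] by simp
next
  assume r: "r = ad p q"
  obtain a b d where p: "a \<in> \<S>" "b \<in> \<S>" "d \<in> \<S>" "is_frac p a b d" using is_frac_ex[OF pq(1)] by blast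
  obtain a' b' d' where q: "a' \<in> \<S>" "b' \<in> \<S>" "d' \<in> \<S>" "is_frac q a' b' d'" using is_frac_ex[OF pq(2)] by blast
  have eq: "ad p q = frac (fst (f a b d a' b' d')) (snd (f a b d a' b' d')) (d \<boxtimes> d')"
    using ad is_fracD[OF p(4)] is_fracD[OF q(4)] by simp
  then have "r \<in> \<Q>" unfolding r using frac_props(1) f is_fracD[OF p(4)] is_fracD[OF q(4)] by (simp add: times_eq_0)
  then obtain x y e where x: "x \<in> \<S>" "y \<in> \<S>" "e \<in> \<S>" "is_frac r x y e" using is_frac_ex by blast
  have "frac (fst (f a b d a' b' d')) (snd (f a b d a' b' d')) (d \<boxtimes> d') = frac x y e"
    using eq r is_fracD[OF x(4)] by simp
  then have "fst (f a b d a' b' d') \<boxtimes> e \<boxplus> y \<boxtimes> (d \<boxtimes> d') = x \<boxtimes> (d \<boxtimes> d') \<boxplus> snd (f a b d a' b' d') \<boxtimes> e"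
    using f is_fracD[OF p(4)] is_fracD[OF q(4)] is_fracD[OF x(4)] by (simp add: frac_eq_iff times_eq_0)
  then show "qop_fo f p q r" unfolding qop_fo_def using p q x by blast
qed

lemma qadd_fo: "p \<in> \<Q> \<Longrightarrow> q \<in> \<Q> \<Longrightarrow> r \<in> \<S> \<Longrightarrow> qadd_fo p q r \<longleftrightarrow> r = qadd mem p q"
  unfolding qadd_fo_def by (rule qop_fo) (simp_all add: qadd_frac)

lemma qmul_fo: "p \<in> \<Q> \<Longrightarrow> q \<in> \<Q> \<Longrightarrow> r \<in> \<S> \<Longrightarrow> qmul_fo p q r \<longleftrightarrow> r = qmul mem p q"
  unfolding qmul_fo_def by (rule qop_fo) (simp_all add: qmul_frac)

lemma qadd_Q: "p \<in> \<Q> \<Longrightarrow> q \<in> \<Q> \<Longrightarrow> qadd mem p q \<in> \<Q>"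
  by (elim fractionE) (simp add: qadd_frac frac_props(1) times_eq_0)

lemma qmul_Q: "p \<in> \<Q> \<Longrightarrow> q \<in> \<Q> \<Longrightarrow> qmul mem p q \<in> \<Q>"
  by (elim fractionE) (simp add: qmul_frac frac_props(1) times_eq_0)

lemma rationals_mkfield: "rationals mem = mkfield (cls \<Q>) (qadd mem) (qmul mem) (qle mem)"
  unfolding rationals_def mkfield_def using in_el[of _ "cls \<Q>"] el_cls[OF is_class_fractions] by simp

lemma in_cls_Q: "q \<epsilon> cls \<Q> \<longleftrightarrow> q \<in> \<Q>"
  using in_el[of q "cls \<Q>"] el_cls[OF is_class_fractions] by simp

lemma rationals_ops:
  shows "field_class (rationals mem)" "el (Carr (rationals mem)) = \<Q>"
    "\<And>x y. x \<in> \<Q> \<Longrightarrow> y \<in> \<Q> \<Longrightarrow> fadd mem (rationals mem) x y = qadd mem x y"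
    "\<And>x y. x \<in> \<Q> \<Longrightarrow> y \<in> \<Q> \<Longrightarrow> fmul mem (rationals mem) x y = qmul mem x y"
    "\<And>x y. x \<in> \<Q> \<Longrightarrow> y \<in> \<Q> \<Longrightarrow> fle mem (rationals mem) x y \<longleftrightarrow> qle mem x y"
  unfolding rationals_mkfield
  using mkfield_class[of "cls \<Q>" "qadd mem" qadd_fo "qmul mem" qmul_fo qle_fo "qle mem",
      OF _ dfn_qadd_fo _ _ dfn_qmul_fo _ dfn_qle_fo] el_cls[OF is_class_fractions]
  by (simp_all add: in_cls_Q qadd_Q qmul_Q qadd_fo qmul_fo qle_fo)

lemma frac_zero: "a \<in> \<N> \<Longrightarrow> b \<in> \<N> \<Longrightarrow> d \<in> \<N> \<Longrightarrow> d \<noteq> emp \<Longrightarrow> frac a b d = frac emp emp (suc emp) \<longleftrightarrow> a = b"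
  by (simp add: frac_eq_iff)

lemma rationals_field:
  shows "ordered_field mem (rationals mem)" "zero (ring_of mem (rationals mem)) = frac emp emp (suc emp)"
    "one (ring_of mem (rationals mem)) = frac (suc emp) emp (suc emp)"
proof -
  let ?K = "rationals mem"
  note s = qadd_frac qmul_frac qle_frac frac_props(1) times_eq_0 rationals_ops(3-5)
  have one: "suc emp \<in> \<N>" "suc emp \<noteq> emp" by simp_all
  have assoc: "\<And>x y w. x \<in> \<Q> \<Longrightarrow> y \<in> \<Q> \<Longrightarrow> w \<in> \<Q> \<Longrightarrow> fadd mem ?K (fadd mem ?K x y) w = fadd mem ?K x (fadd mem ?K y w)"
    by (elim fractionE) (simp add: s nat_simps del: plus_cancel)
  have comm: "\<And>x y. x \<in> \<Q> \<Longrightarrow> y \<in> \<Q> \<Longrightarrow> fadd mem ?K x y = fadd mem ?K y x"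
    by (elim fractionE) (simp add: s plus_comm times_comm)
  have zero: "\<And>x. x \<in> \<Q> \<Longrightarrow> fadd mem ?K (frac emp emp (suc emp)) x = x"
    by (elim fractionE) (simp add: s)
  have neg: "\<And>x. x \<in> \<Q> \<Longrightarrow> \<exists>y\<in>\<Q>. fadd mem ?K y x = frac emp emp (suc emp)"
  proof (elim fractionE)
    fix x a b d assume "x = frac a b d" and "a \<in> \<N>" "b \<in> \<N>" "d \<in> \<N>" "d \<noteq> emp"
    then show "\<exists>y\<in>\<Q>. fadd mem ?K y x = frac emp emp (suc emp)"
      by (intro bexI[of _ "frac b a d"]) (simp_all add: s frac_zero plus_comm)
  qed
  have massoc: "\<And>x y w. x \<in> \<Q> \<Longrightarrow> y \<in> \<Q> \<Longrightarrow> w \<in> \<Q> \<Longrightarrow> fmul mem ?K (fmul mem ?K x y) w = fmul mem ?K x (fmul mem ?K y w)"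
    by (elim fractionE) (simp add: s nat_simps del: plus_cancel)
  have mcomm: "\<And>x y. x \<in> \<Q> \<Longrightarrow> y \<in> \<Q> \<Longrightarrow> fmul mem ?K x y = fmul mem ?K y x"
    by (elim fractionE) (simp add: s plus_comm times_comm)
  have mone: "\<And>x. x \<in> \<Q> \<Longrightarrow> fmul mem ?K (frac (suc emp) emp (suc emp)) x = x"
    by (elim fractionE) (simp add: s)
  have minv: "\<And>x. x \<in> \<Q> \<Longrightarrow> x \<noteq> frac emp emp (suc emp) \<Longrightarrow> \<exists>y\<in>\<Q>. fmul mem ?K x y = frac (suc emp) emp (suc emp)"
  proof (elim fractionE)
    fix x a b d assume *: "a \<in> \<N>" "b \<in> \<N>" "d \<in> \<N>" "d \<noteq> emp" "x = frac a b d" "x \<noteq> frac emp emp (suc emp)"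
    then have "a \<noteq> b" by (simp add: frac_zero)
    from N_diff[OF *(1,2)] show "\<exists>y\<in>\<Q>. fmul mem ?K x y = frac (suc emp) emp (suc emp)"
    proof (elim disjE bexE)
      fix k assume k: "k \<in> \<N>" "a = b \<boxplus> k"
      then have "k \<noteq> emp" using * \<open>a \<noteq> b\<close> by auto
      then show ?thesis using * k
        by (intro bexI[of _ "frac d emp k"]) (simp_all add: s frac_eq_iff nat_simps del: plus_cancel)
    next
      fix k assume k: "k \<in> \<N>" "b = a \<boxplus> k"
      then have "k \<noteq> emp" using * \<open>a \<noteq> b\<close> by auto
      then show ?thesis using * k
        by (intro bexI[of _ "frac emp d k"]) (simp_all add: s frac_eq_iff nat_simps del: plus_cancel)
    qed
  qed
  have distr: "\<And>x y w. x \<in> \<Q> \<Longrightarrow> y \<in> \<Q> \<Longrightarrow> w \<in> \<Q> \<Longrightarrow>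
      fmul mem ?K (fadd mem ?K x y) w = fadd mem ?K (fmul mem ?K x w) (fmul mem ?K y w)"
  proof (elim fractionE)
    fix x y w a b d a' b' d' a'' b'' d''
    assume xyw: "x = frac a b d" "y = frac a' b' d'" "w = frac a'' b'' d''"
      and N: "a \<in> \<N>" "b \<in> \<N>" "d \<in> \<N>" "d \<noteq> emp" and N': "a' \<in> \<N>" "b' \<in> \<N>" "d' \<in> \<N>" "d' \<noteq> emp"
      and N'': "a'' \<in> \<N>" "b'' \<in> \<N>" "d'' \<in> \<N>" "d'' \<noteq> emp"
    have "fmul mem ?K (fadd mem ?K x y) w = frac ((a \<boxtimes> d' \<boxplus> a' \<boxtimes> d) \<boxtimes> a'' \<boxplus> (b \<boxtimes> d' \<boxplus> b' \<boxtimes> d) \<boxtimes> b'')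
       ((a \<boxtimes> d' \<boxplus> a' \<boxtimes> d) \<boxtimes> b'' \<boxplus> (b \<boxtimes> d' \<boxplus> b' \<boxtimes> d) \<boxtimes> a'') (d \<boxtimes> d' \<boxtimes> d'')" (is "_ = frac ?A ?B ?D")
      using N N' N'' unfolding xyw by (simp add: s)
    also have "\<dots> = frac (d'' \<boxtimes> ?A) (d'' \<boxtimes> ?B) (d'' \<boxtimes> ?D)" using N N' N'' by (simp add: frac_scale times_eq_0)
    also have "\<dots> = fadd mem ?K (fmul mem ?K x w) (fmul mem ?K y w)"
      using N N' N'' unfolding xyw by (simp add: s nat_simps del: plus_cancel)
    finally show "fmul mem ?K (fadd mem ?K x y) w = fadd mem ?K (fmul mem ?K x w) (fmul mem ?K y w)" .
  qed
  have lref: "\<And>x. x \<in> \<Q> \<Longrightarrow> fle mem ?K x x"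
    unfolding rationals_ops(5) by (elim fractionE) (simp add: qle_frac)
  have lanti: "\<And>x y. x \<in> \<Q> \<Longrightarrow> y \<in> \<Q> \<Longrightarrow> fle mem ?K x y \<Longrightarrow> fle mem ?K y x \<Longrightarrow> x = y"
  proof (elim fractionE)
    fix x y a b d a' b' d'
    assume xy: "x = frac a b d" "y = frac a' b' d'" and l: "fle mem ?K x y" "fle mem ?K y x"
      and N: "a \<in> \<N>" "b \<in> \<N>" "d \<in> \<N>" "d \<noteq> emp" and N': "a' \<in> \<N>" "b' \<in> \<N>" "d' \<in> \<N>" "d' \<noteq> emp"
    have "nle mem (a \<boxtimes> d' \<boxplus> b' \<boxtimes> d) (a' \<boxtimes> d \<boxplus> b \<boxtimes> d')" "nle mem (a' \<boxtimes> d \<boxplus> b \<boxtimes> d') (a \<boxtimes> d' \<boxplus> b' \<boxtimes> d)"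
      using l N N' unfolding xy by (simp_all add: s)
    then show "x = y" unfolding xy using N N' nle_antisym by (simp add: frac_eq_iff)
  qed
  have llin: "\<And>x y. x \<in> \<Q> \<Longrightarrow> y \<in> \<Q> \<Longrightarrow> fle mem ?K x y \<or> fle mem ?K y x"
    by (elim fractionE) (simp add: s nle_linear)
  have ltr: "\<And>x y w. x \<in> \<Q> \<Longrightarrow> y \<in> \<Q> \<Longrightarrow> w \<in> \<Q> \<Longrightarrow> fle mem ?K x y \<Longrightarrow> fle mem ?K y w \<Longrightarrow> fle mem ?K x w"
  proof (elim fractionE)
    fix x y w a b d a' b' d' a'' b'' d''
    assume xyw: "x = frac a b d" "y = frac a' b' d'" "w = frac a'' b'' d''"
      and l: "fle mem ?K x y" "fle mem ?K y w"
      and N: "a \<in> \<N>" "b \<in> \<N>" "d \<in> \<N>" "d \<noteq> emp" and N': "a' \<in> \<N>" "b' \<in> \<N>" "d' \<in> \<N>" "d' \<noteq> emp"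
      and N'': "a'' \<in> \<N>" "b'' \<in> \<N>" "d'' \<in> \<N>" "d'' \<noteq> emp"
    have "nle mem (a \<boxtimes> d' \<boxplus> b' \<boxtimes> d) (a' \<boxtimes> d \<boxplus> b \<boxtimes> d')" using l N N' unfolding xyw by (simp add: s)
    then have "nle mem ((a \<boxtimes> d' \<boxplus> b' \<boxtimes> d) \<boxtimes> d'') ((a' \<boxtimes> d \<boxplus> b \<boxtimes> d') \<boxtimes> d'')" using N'' by (simp add: nle_times)
    then have "nle mem ((a \<boxtimes> d' \<boxplus> b' \<boxtimes> d) \<boxtimes> d'' \<boxplus> b'' \<boxtimes> d \<boxtimes> d') ((a' \<boxtimes> d \<boxplus> b \<boxtimes> d') \<boxtimes> d'' \<boxplus> b'' \<boxtimes> d \<boxtimes> d')"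
      by (simp add: nle_cancel)
    also have "(a' \<boxtimes> d \<boxplus> b \<boxtimes> d') \<boxtimes> d'' \<boxplus> b'' \<boxtimes> d \<boxtimes> d' = (a' \<boxtimes> d'' \<boxplus> b'' \<boxtimes> d') \<boxtimes> d \<boxplus> b \<boxtimes> d' \<boxtimes> d''"
      using N N' N'' by (simp add: nat_simps del: plus_cancel)
    finally have 1: "nle mem ((a \<boxtimes> d' \<boxplus> b' \<boxtimes> d) \<boxtimes> d'' \<boxplus> b'' \<boxtimes> d \<boxtimes> d') ((a' \<boxtimes> d'' \<boxplus> b'' \<boxtimes> d') \<boxtimes> d \<boxplus> b \<boxtimes> d' \<boxtimes> d'')" .
    have "nle mem (a' \<boxtimes> d'' \<boxplus> b'' \<boxtimes> d') (a'' \<boxtimes> d' \<boxplus> b' \<boxtimes> d'')" using l N' N'' unfolding xyw by (simp add: s)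
    then have "nle mem ((a' \<boxtimes> d'' \<boxplus> b'' \<boxtimes> d') \<boxtimes> d \<boxplus> b \<boxtimes> d' \<boxtimes> d'') ((a'' \<boxtimes> d' \<boxplus> b' \<boxtimes> d'') \<boxtimes> d \<boxplus> b \<boxtimes> d' \<boxtimes> d'')"
      using N by (simp add: nle_times nle_cancel)
    then have "nle mem ((a \<boxtimes> d' \<boxplus> b' \<boxtimes> d) \<boxtimes> d'' \<boxplus> b'' \<boxtimes> d \<boxtimes> d') ((a'' \<boxtimes> d' \<boxplus> b' \<boxtimes> d'') \<boxtimes> d \<boxplus> b \<boxtimes> d' \<boxtimes> d'')"
      using 1 nle_trans nplus_N by blast
    also have "(a \<boxtimes> d' \<boxplus> b' \<boxtimes> d) \<boxtimes> d'' \<boxplus> b'' \<boxtimes> d \<boxtimes> d' = (a \<boxtimes> d'' \<boxplus> b'' \<boxtimes> d) \<boxtimes> d' \<boxplus> b' \<boxtimes> d \<boxtimes> d''"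
      using N N' N'' by (simp add: nat_simps del: plus_cancel)
    also have "(a'' \<boxtimes> d' \<boxplus> b' \<boxtimes> d'') \<boxtimes> d \<boxplus> b \<boxtimes> d' \<boxtimes> d'' = (a'' \<boxtimes> d \<boxplus> b \<boxtimes> d'') \<boxtimes> d' \<boxplus> b' \<boxtimes> d \<boxtimes> d''"
      using N N' N'' by (simp add: nat_simps del: plus_cancel)
    finally have "nle mem (a \<boxtimes> d'' \<boxplus> b'' \<boxtimes> d) (a'' \<boxtimes> d \<boxplus> b \<boxtimes> d'')" using N' by (simp add: nle_cancel nle_times)
    then show "fle mem ?K x w" unfolding xyw using N N'' by (simp add: s)
  qed
  have ladd: "\<And>x y w. x \<in> \<Q> \<Longrightarrow> y \<in> \<Q> \<Longrightarrow> w \<in> \<Q> \<Longrightarrow> fle mem ?K x y \<Longrightarrow> fle mem ?K (fadd mem ?K x w) (fadd mem ?K y w)"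
  proof (elim fractionE)
    fix x y w a b d a' b' d' a'' b'' d''
    assume xyw: "x = frac a b d" "y = frac a' b' d'" "w = frac a'' b'' d''"
      and l: "fle mem ?K x y"
      and N: "a \<in> \<N>" "b \<in> \<N>" "d \<in> \<N>" "d \<noteq> emp" and N': "a' \<in> \<N>" "b' \<in> \<N>" "d' \<in> \<N>" "d' \<noteq> emp"
      and N'': "a'' \<in> \<N>" "b'' \<in> \<N>" "d'' \<in> \<N>" "d'' \<noteq> emp"
    let ?C = "a'' \<boxtimes> d \<boxtimes> d' \<boxtimes> d'' \<boxplus> b'' \<boxtimes> d \<boxtimes> d' \<boxtimes> d''"
    have "nle mem (a \<boxtimes> d' \<boxplus> b' \<boxtimes> d) (a' \<boxtimes> d \<boxplus> b \<boxtimes> d')" using l N N' unfolding xyw by (simp add: s)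
    then have "nle mem ((a \<boxtimes> d' \<boxplus> b' \<boxtimes> d) \<boxtimes> (d'' \<boxtimes> d'') \<boxplus> ?C) ((a' \<boxtimes> d \<boxplus> b \<boxtimes> d') \<boxtimes> (d'' \<boxtimes> d'') \<boxplus> ?C)"
      using N'' by (simp add: nle_times nle_cancel times_eq_0)
    also have "(a \<boxtimes> d' \<boxplus> b' \<boxtimes> d) \<boxtimes> (d'' \<boxtimes> d'') \<boxplus> ?C =
       (a \<boxtimes> d'' \<boxplus> a'' \<boxtimes> d) \<boxtimes> (d' \<boxtimes> d'') \<boxplus> (b' \<boxtimes> d'' \<boxplus> b'' \<boxtimes> d') \<boxtimes> (d \<boxtimes> d'')"
      using N N' N'' by (simp add: nat_simps del: plus_cancel)
    also have "(a' \<boxtimes> d \<boxplus> b \<boxtimes> d') \<boxtimes> (d'' \<boxtimes> d'') \<boxplus> ?C =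
       (a' \<boxtimes> d'' \<boxplus> a'' \<boxtimes> d') \<boxtimes> (d \<boxtimes> d'') \<boxplus> (b \<boxtimes> d'' \<boxplus> b'' \<boxtimes> d) \<boxtimes> (d' \<boxtimes> d'')"
      using N N' N'' by (simp add: nat_simps del: plus_cancel)
    finally show "fle mem ?K (fadd mem ?K x w) (fadd mem ?K y w)" unfolding xyw using N N' N'' by (simp add: s)
  qed
  have lmul: "\<And>x y. x \<in> \<Q> \<Longrightarrow> y \<in> \<Q> \<Longrightarrow> fle mem ?K (frac emp emp (suc emp)) x \<Longrightarrow> fle mem ?K (frac emp emp (suc emp)) y \<Longrightarrow>
      fle mem ?K (frac emp emp (suc emp)) (fmul mem ?K x y)"
  proof (elim fractionE)
    fix x y a b d a' b' d'
    assume xy: "x = frac a b d" "y = frac a' b' d'" and l: "fle mem ?K (frac emp emp (suc emp)) x" "fle mem ?K (frac emp emp (suc emp)) y"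
      and N: "a \<in> \<N>" "b \<in> \<N>" "d \<in> \<N>" "d \<noteq> emp" and N': "a' \<in> \<N>" "b' \<in> \<N>" "d' \<in> \<N>" "d' \<noteq> emp"
    have "nle mem b a" "nle mem b' a'" using l N N' unfolding xy by (simp_all add: s)
    then obtain k k' where k: "k \<in> \<N>" "k' \<in> \<N>" "a = b \<boxplus> k" "a' = b' \<boxplus> k'" using N N' by (auto simp: nle_iff)
    have "a \<boxtimes> a' \<boxplus> b \<boxtimes> b' = (a \<boxtimes> b' \<boxplus> b \<boxtimes> a') \<boxplus> k \<boxtimes> k'"
      unfolding k(3,4) using N N' k(1,2) by (simp add: nat_simps del: plus_cancel)
    then have "nle mem (a \<boxtimes> b' \<boxplus> b \<boxtimes> a') (a \<boxtimes> a' \<boxplus> b \<boxtimes> b')" by (subst nle_iff) auto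
    then show "fle mem ?K (frac emp emp (suc emp)) (fmul mem ?K x y)" unfolding xy using N N' by (simp add: s)
  qed
  have z: "frac emp emp (suc emp) \<in> \<Q>" "frac (suc emp) emp (suc emp) \<in> \<Q>" by (simp_all add: frac_props(1))
  have ne: "frac emp emp (suc emp) \<noteq> frac (suc emp) emp (suc emp)" by (simp add: frac_eq_iff)
  note facts = rationals_ops(1) z ne assoc comm zero neg massoc mcomm mone minv distr lref lanti llin ladd lmul ltr
  note I = ordered_fieldI[of ?K "frac emp emp (suc emp)" "frac (suc emp) emp (suc emp)", unfolded rationals_ops(2)]
  show "ordered_field mem ?K" by (rule I(1); (rule facts; assumption))
  show "zero (ring_of mem ?K) = frac emp emp (suc emp)" by (rule I(2); (rule facts; assumption))
  show "one (ring_of mem ?K) = frac (suc emp) emp (suc emp)" by (rule I(3); (rule facts; assumption))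
qed

end

section \<open>Ordered fields\<close>

locale ord_field = field R for R (structure) +
  fixes lq :: "'a \<Rightarrow> 'a \<Rightarrow> bool" (infix "\<preceq>" 50)
  assumes lq_refl: "x \<in> carrier R \<Longrightarrow> x \<preceq> x"
    and lq_antisym: "x \<in> carrier R \<Longrightarrow> y \<in> carrier R \<Longrightarrow> x \<preceq> y \<Longrightarrow> y \<preceq> x \<Longrightarrow> x = y"
    and lq_trans: "x \<in> carrier R \<Longrightarrow> y \<in> carrier R \<Longrightarrow> z \<in> carrier R \<Longrightarrow> x \<preceq> y \<Longrightarrow> y \<preceq> z \<Longrightarrow> x \<preceq> z"
    and lq_linear: "x \<in> carrier R \<Longrightarrow> y \<in> carrier R \<Longrightarrow> x \<preceq> y \<or> y \<preceq> x"
    and lq_add: "x \<in> carrier R \<Longrightarrow> y \<in> carrier R \<Longrightarrow> z \<in> carrier R \<Longrightarrow> x \<preceq> y \<Longrightarrow> x \<oplus> z \<preceq> y \<oplus> z"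
    and lq_mult: "x \<in> carrier R \<Longrightarrow> y \<in> carrier R \<Longrightarrow> \<zero> \<preceq> x \<Longrightarrow> \<zero> \<preceq> y \<Longrightarrow> \<zero> \<preceq> x \<otimes> y"
begin

definition nn :: "'a \<Rightarrow> bool" where "nn x \<longleftrightarrow> x \<in> carrier R \<and> \<zero> \<preceq> x"
definition pos :: "'a \<Rightarrow> bool" where "pos x \<longleftrightarrow> nn x \<and> x \<noteq> \<zero>"

lemma pos_closed: "pos x \<Longrightarrow> x \<in> carrier R"
  and pos_nn: "pos x \<Longrightarrow> nn x"
  and pos_ne: "pos x \<Longrightarrow> x \<noteq> \<zero>"
  by (auto simp: nn_def pos_def)

lemma lq_iff: "x \<in> carrier R \<Longrightarrow> y \<in> carrier R \<Longrightarrow> x \<preceq> y \<longleftrightarrow> nn (y \<ominus> x)"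
proof
  assume c: "x \<in> carrier R" "y \<in> carrier R" and "x \<preceq> y"
  then have "x \<oplus> \<ominus> x \<preceq> y \<oplus> \<ominus> x" by (intro lq_add) auto
  then show "nn (y \<ominus> x)" using c by (simp add: nn_def a_minus_def r_neg)
next
  assume c: "x \<in> carrier R" "y \<in> carrier R" and "nn (y \<ominus> x)"
  then have "\<zero> \<oplus> x \<preceq> (y \<ominus> x) \<oplus> x" by (intro lq_add) (auto simp: nn_def)
  moreover have "(y \<ominus> x) \<oplus> x = y" using c by algebra
  ultimately show "x \<preceq> y" using c by simp
qed

lemma nn_add: "nn x \<Longrightarrow> nn y \<Longrightarrow> nn (x \<oplus> y)"
proof -
  assume xy: "nn x" "nn y"
  then have c: "x \<in> carrier R" "y \<in> carrier R" by (auto simp: nn_def)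
  have "\<zero> \<oplus> y \<preceq> x \<oplus> y" using xy c by (intro lq_add) (auto simp: nn_def)
  then have "y \<preceq> x \<oplus> y" using c by simp
  then show ?thesis using lq_trans[of \<zero> y "x \<oplus> y"] xy c by (auto simp: nn_def)
qed

lemma nn_antisym: "nn x \<Longrightarrow> nn (\<ominus> x) \<Longrightarrow> x = \<zero>"
proof -
  assume x: "nn x" "nn (\<ominus> x)"
  then have c: "x \<in> carrier R" by (auto simp: nn_def)
  have "x \<preceq> \<zero>" using x c by (simp add: lq_iff a_minus_def)
  then show ?thesis using x c lq_antisym by (auto simp: nn_def)
qed

lemma nn_or: "x \<in> carrier R \<Longrightarrow> nn x \<or> nn (\<ominus> x)"
  using lq_linear[of \<zero> x] by (auto simp: nn_def lq_iff[of x \<zero>] a_minus_def)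

lemma tricho: "x \<in> carrier R \<Longrightarrow> pos x \<or> x = \<zero> \<or> pos (\<ominus> x)"
  using nn_or[of x] unfolding pos_def by auto

lemma not_nn: "x \<in> carrier R \<Longrightarrow> \<not> nn x \<longleftrightarrow> pos (\<ominus> x)"
  using nn_or[of x] nn_antisym[of x] unfolding pos_def by auto

lemma pos_not_nn: "pos x \<Longrightarrow> \<not> nn (\<ominus> x)"
  using nn_antisym by (auto simp: pos_def)

lemma not_lq: "x \<in> carrier R \<Longrightarrow> y \<in> carrier R \<Longrightarrow> \<not> x \<preceq> y \<longleftrightarrow> pos (x \<ominus> y)"
proof -
  assume c: "x \<in> carrier R" "y \<in> carrier R"
  then have "\<ominus> (y \<ominus> x) = x \<ominus> y" by algebra
  then show ?thesis using c not_nn[of "y \<ominus> x"] by (simp add: lq_iff)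
qed

lemma pos_add: "pos x \<Longrightarrow> nn y \<Longrightarrow> pos (x \<oplus> y)" and pos_add': "nn y \<Longrightarrow> pos x \<Longrightarrow> pos (y \<oplus> x)"
proof -
  have *: "pos (x \<oplus> y)" if xy: "pos x" "nn y" for x y
  proof -
    have c: "x \<in> carrier R" "y \<in> carrier R" using xy by (auto simp: nn_def pos_def)
    have "x \<oplus> y \<noteq> \<zero>"
    proof
      assume "x \<oplus> y = \<zero>"
      then have "\<ominus> x = y" using c minus_equality by (metis add.m_comm)
      then show False using pos_not_nn[OF xy(1)] xy(2) by simp
    qed
    then show ?thesis using nn_add xy by (auto simp: pos_def)
  qed
  then show "pos x \<Longrightarrow> nn y \<Longrightarrow> pos (x \<oplus> y)" .
  show "nn y \<Longrightarrow> pos x \<Longrightarrow> pos (y \<oplus> x)" using *[of x y] a_comm[of x y] by (auto simp: nn_def pos_def)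
qed

lemma nn_mult: "nn x \<Longrightarrow> nn y \<Longrightarrow> nn (x \<otimes> y)"
  using lq_mult by (auto simp: nn_def)

lemma pos_mult: "pos x \<Longrightarrow> pos y \<Longrightarrow> pos (x \<otimes> y)"
  using nn_mult integral by (auto simp: pos_def nn_def)

lemma nn_zero: "nn \<zero>"
  by (simp add: nn_def lq_refl)

lemma pos_one: "pos \<one>"
proof -
  have "nn (\<ominus> \<one> \<otimes> \<ominus> \<one>) \<or> nn \<one>" using nn_or[of \<one>] nn_mult by auto
  moreover have "\<ominus> \<one> \<otimes> \<ominus> \<one> = \<one>" by algebra
  ultimately show ?thesis by (auto simp: pos_def)
qed

lemma pos_cancel: "pos k \<Longrightarrow> x \<in> carrier R \<Longrightarrow> pos (k \<otimes> x) \<Longrightarrow> pos x"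
proof -
  assume k: "pos k" and x: "x \<in> carrier R" and kx: "pos (k \<otimes> x)"
  have kc: "k \<in> carrier R" using k by (rule pos_closed)
  have "\<not> pos (\<ominus> x)"
  proof
    assume "pos (\<ominus> x)"
    then have "pos (k \<otimes> \<ominus> x)" using k pos_mult by blast
    moreover have "k \<otimes> \<ominus> x = \<ominus> (k \<otimes> x)" using kc x by algebra
    ultimately show False using pos_not_nn[OF kx] pos_nn by simp
  qed
  moreover have "x \<noteq> \<zero>" using kx kc by (auto simp: pos_def)
  ultimately show ?thesis using tricho[OF x] by blast
qed

lemma pos_cancel': "nn k \<Longrightarrow> x \<in> carrier R \<Longrightarrow> pos (k \<otimes> x) \<Longrightarrow> pos k \<and> pos x"
proof -
  assume k: "nn k" and x: "x \<in> carrier R" and kx: "pos (k \<otimes> x)"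
  have "k \<noteq> \<zero>" using kx x by (auto simp: pos_def)
  then show ?thesis using pos_cancel[of k x] k x kx by (auto simp: pos_def)
qed

lemma nn_cancel: "pos k \<Longrightarrow> x \<in> carrier R \<Longrightarrow> nn (k \<otimes> x) \<Longrightarrow> nn x"
proof -
  assume k: "pos k" and x: "x \<in> carrier R" and kx: "nn (k \<otimes> x)"
  show "nn x"
  proof (cases "k \<otimes> x = \<zero>")
    case True
    then have "x = \<zero>" using integral k x pos_closed pos_ne by blast
    then show ?thesis by (simp add: nn_zero)
  next
    case False
    then show ?thesis using pos_cancel[OF k x] kx by (auto simp: pos_def)
  qed
qed

lemma pos_inv: "pos x \<Longrightarrow> \<exists>y. pos y \<and> x \<otimes> y = \<one>"
proof -
  assume x: "pos x"
  then have U: "x \<in> Units R" using field_Units pos_closed pos_ne by auto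
  have "pos (x \<otimes> inv x)" using U pos_one by simp
  then have "pos (inv x)" using pos_cancel[OF x] U by simp
  then show ?thesis using U by (intro exI[of _ "inv x"]) simp
qed

lemma mult_cancel: "k \<in> carrier R \<Longrightarrow> k \<noteq> \<zero> \<Longrightarrow> x \<in> carrier R \<Longrightarrow> y \<in> carrier R \<Longrightarrow> k \<otimes> x = k \<otimes> y \<longleftrightarrow> x = y"
  using m_lcancel by blast

end

text \<open>
  The standard natural numbers are mapped into an ordered field by \<open>j\<close>. They need not be
  cofinal: \<open>bdd\<close> singles out the bounded elements, and \<open>far x y\<close> says that \<open>y - x\<close>
  is positive and not infinitesimal.
\<close>

locale rat_field = ord_field R lq for R (structure) and lq :: "'a \<Rightarrow> 'a \<Rightarrow> bool" (infix "\<preceq>" 50) +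
  fixes N :: "'n set" and ze :: 'n and on :: 'n and pl :: "'n \<Rightarrow> 'n \<Rightarrow> 'n" and ti :: "'n \<Rightarrow> 'n \<Rightarrow> 'n"
    and nl :: "'n \<Rightarrow> 'n \<Rightarrow> bool" and j :: "'n \<Rightarrow> 'a"
  assumes N_ze: "ze \<in> N" and N_on: "on \<in> N" and N_pl: "m \<in> N \<Longrightarrow> n \<in> N \<Longrightarrow> pl m n \<in> N"
    and N_ti: "m \<in> N \<Longrightarrow> n \<in> N \<Longrightarrow> ti m n \<in> N"
    and N_diff: "m \<in> N \<Longrightarrow> n \<in> N \<Longrightarrow> (\<exists>k\<in>N. m = pl n k) \<or> (\<exists>k\<in>N. n = pl m k)"
    and j_closed: "n \<in> N \<Longrightarrow> j n \<in> carrier R"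
    and j_ze: "j ze = \<zero>" and j_on: "j on = \<one>"
    and j_pl: "m \<in> N \<Longrightarrow> n \<in> N \<Longrightarrow> j (pl m n) = j m \<oplus> j n"
    and j_ti: "m \<in> N \<Longrightarrow> n \<in> N \<Longrightarrow> j (ti m n) = j m \<otimes> j n"
    and j_nl: "m \<in> N \<Longrightarrow> n \<in> N \<Longrightarrow> j m \<preceq> j n \<longleftrightarrow> nl m n"
    and j_ge1: "n \<in> N \<Longrightarrow> n = ze \<or> \<one> \<preceq> j n"
    and j_floor: "c \<in> carrier R \<Longrightarrow> \<zero> \<preceq> c \<Longrightarrow> k \<in> N \<Longrightarrow> c \<preceq> j k \<Longrightarrow>
      \<exists>m\<in>N. j m \<preceq> c \<and> \<not> j m \<oplus> \<one> \<preceq> c"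
begin

lemma j_ge1': "n \<in> N \<Longrightarrow> n \<noteq> ze \<Longrightarrow> nn (j n \<ominus> \<one>)"
  using j_ge1[of n] lq_iff[of \<one> "j n"] j_closed by auto

lemma j_pos: "n \<in> N \<Longrightarrow> n \<noteq> ze \<Longrightarrow> pos (j n)"
proof -
  assume n: "n \<in> N" "n \<noteq> ze"
  have "pos (\<one> \<oplus> (j n \<ominus> \<one>))" using pos_add[OF pos_one j_ge1'[OF n]] .
  moreover have "\<one> \<oplus> (j n \<ominus> \<one>) = j n" using j_closed[OF n(1)] by algebra
  ultimately show ?thesis by simp
qed

lemma j_nn: "n \<in> N \<Longrightarrow> nn (j n)"
  using j_pos[of n] pos_nn nn_zero j_ze by metis

lemma j_eq_0: "n \<in> N \<Longrightarrow> j n = \<zero> \<longleftrightarrow> n = ze"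
  using j_pos[of n] pos_ne j_ze by blast

definition rep :: "'a \<Rightarrow> 'n \<Rightarrow> 'n \<Rightarrow> 'n \<Rightarrow> bool" where
  "rep q a b c \<longleftrightarrow> q \<in> carrier R \<and> a \<in> N \<and> b \<in> N \<and> c \<in> N \<and> c \<noteq> ze \<and> j c \<otimes> q = j a \<ominus> j b"

definition Rat :: "'a set" where
  "Rat = {q. \<exists>a b c. rep q a b c}"

lemma Rat_closed: "q \<in> Rat \<Longrightarrow> q \<in> carrier R"
  by (auto simp: Rat_def rep_def)

lemma rep_ex: "a \<in> N \<Longrightarrow> b \<in> N \<Longrightarrow> c \<in> N \<Longrightarrow> c \<noteq> ze \<Longrightarrow> \<exists>q. rep q a b c"
proof -
  assume *: "a \<in> N" "b \<in> N" "c \<in> N" "c \<noteq> ze"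
  obtain d where d: "pos d" "j c \<otimes> d = \<one>" using pos_inv[OF j_pos[OF *(3,4)]] by blast
  have cl: "j a \<in> carrier R" "j b \<in> carrier R" "j c \<in> carrier R" "d \<in> carrier R"
    using * j_closed d pos_closed by blast+
  have "j c \<otimes> (d \<otimes> (j a \<ominus> j b)) = (j c \<otimes> d) \<otimes> (j a \<ominus> j b)" using cl by algebra
  then have "rep (d \<otimes> (j a \<ominus> j b)) a b c" unfolding rep_def using * cl d by simp
  then show ?thesis by blast
qed

lemma rep_unique: "rep q a b c \<Longrightarrow> rep q' a b c \<Longrightarrow> q = q'"
  unfolding rep_def using mult_cancel[of "j c" q q'] j_closed j_eq_0 by metis

lemma ti_ne: "m \<in> N \<Longrightarrow> n \<in> N \<Longrightarrow> m \<noteq> ze \<Longrightarrow> n \<noteq> ze \<Longrightarrow> ti m n \<noteq> ze"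
  using pos_mult[OF j_pos j_pos, of m n] pos_ne j_ti j_ze by metis

lemma rep_add:
  assumes "rep q a b c" "rep q' a' b' c'"
  shows "rep (q \<oplus> q') (pl (ti c' a) (ti c a')) (pl (ti c' b) (ti c b')) (ti c c')"
proof -
  have cl: "j a \<in> carrier R" "j b \<in> carrier R" "j c \<in> carrier R" "j a' \<in> carrier R" "j b' \<in> carrier R" "j c' \<in> carrier R"
    "q \<in> carrier R" "q' \<in> carrier R" and e: "j c \<otimes> q = j a \<ominus> j b" "j c' \<otimes> q' = j a' \<ominus> j b'"
    using assms j_closed by (auto simp: rep_def)
  have "j c \<otimes> j c' \<otimes> (q \<oplus> q') = j c' \<otimes> (j c \<otimes> q) \<oplus> j c \<otimes> (j c' \<otimes> q')" using cl by algebra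
  also have "\<dots> = (j c' \<otimes> j a \<oplus> j c \<otimes> j a') \<ominus> (j c' \<otimes> j b \<oplus> j c \<otimes> j b')" unfolding e using cl by algebra
  finally show ?thesis using assms cl by (simp add: rep_def j_pl j_ti N_pl N_ti ti_ne)
qed

lemma rep_mult:
  assumes "rep q a b c" "rep q' a' b' c'"
  shows "rep (q \<otimes> q') (pl (ti a a') (ti b b')) (pl (ti a b') (ti b a')) (ti c c')"
proof -
  have cl: "j a \<in> carrier R" "j b \<in> carrier R" "j c \<in> carrier R" "j a' \<in> carrier R" "j b' \<in> carrier R" "j c' \<in> carrier R"
    "q \<in> carrier R" "q' \<in> carrier R" and e: "j c \<otimes> q = j a \<ominus> j b" "j c' \<otimes> q' = j a' \<ominus> j b'"
    using assms j_closed by (auto simp: rep_def)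
  have "j c \<otimes> j c' \<otimes> (q \<otimes> q') = (j c \<otimes> q) \<otimes> (j c' \<otimes> q')" using cl by algebra
  also have "\<dots> = (j a \<otimes> j a' \<oplus> j b \<otimes> j b') \<ominus> (j a \<otimes> j b' \<oplus> j b \<otimes> j a')" unfolding e using cl by algebra
  finally show ?thesis using assms cl by (simp add: rep_def j_pl j_ti N_pl N_ti ti_ne)
qed

lemma rep_neg: "rep q a b c \<Longrightarrow> rep (\<ominus> q) b a c"
proof -
  assume r: "rep q a b c"
  then have cl: "j a \<in> carrier R" "j b \<in> carrier R" "j c \<in> carrier R" "q \<in> carrier R" and e: "j c \<otimes> q = j a \<ominus> j b"
    using j_closed by (auto simp: rep_def)
  have "j c \<otimes> \<ominus> q = \<ominus> (j c \<otimes> q)" using cl by algebra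
  also have "\<dots> = j b \<ominus> j a" unfolding e using cl by algebra
  finally show ?thesis using r cl by (simp add: rep_def)
qed

lemma on_ne: "on \<noteq> ze"
  using j_on j_ze by auto

lemma rep_j: "n \<in> N \<Longrightarrow> rep (j n) n ze on"
  using j_closed[of n] by (simp add: rep_def N_ze N_on on_ne j_on j_ze a_minus_def)

lemma rep_lq:
  assumes "rep q a b c" "rep q' a' b' c'"
  shows "q \<preceq> q' \<longleftrightarrow> nl (pl (ti c' a) (ti c b')) (pl (ti c a') (ti c' b))"
proof -
  have cl: "j a \<in> carrier R" "j b \<in> carrier R" "j c \<in> carrier R" "j a' \<in> carrier R" "j b' \<in> carrier R" "j c' \<in> carrier R"
    "q \<in> carrier R" "q' \<in> carrier R" and e: "j c \<otimes> q = j a \<ominus> j b" "j c' \<otimes> q' = j a' \<ominus> j b'"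
    and n: "a \<in> N" "b \<in> N" "c \<in> N" "a' \<in> N" "b' \<in> N" "c' \<in> N"
    using assms j_closed by (auto simp: rep_def)
  have k: "pos (j c \<otimes> j c')" using assms j_pos pos_mult by (simp add: rep_def)
  have "j c \<otimes> j c' \<otimes> (q' \<ominus> q) = j c \<otimes> (j c' \<otimes> q') \<ominus> j c' \<otimes> (j c \<otimes> q)" using cl by algebra
  also have "\<dots> = (j c \<otimes> j a' \<oplus> j c' \<otimes> j b) \<ominus> (j c' \<otimes> j a \<oplus> j c \<otimes> j b')" unfolding e using cl by algebra
  finally have eq: "j c \<otimes> j c' \<otimes> (q' \<ominus> q) = j (pl (ti c a') (ti c' b)) \<ominus> j (pl (ti c' a) (ti c b'))"
    using n by (simp add: j_pl j_ti N_pl N_ti)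
  have "q \<preceq> q' \<longleftrightarrow> nn (q' \<ominus> q)" using cl by (simp add: lq_iff)
  also have "\<dots> \<longleftrightarrow> nn (j c \<otimes> j c' \<otimes> (q' \<ominus> q))" using nn_cancel[OF k] nn_mult[OF pos_nn[OF k]] cl by (metis minus_closed)
  also have "\<dots> \<longleftrightarrow> j (pl (ti c' a) (ti c b')) \<preceq> j (pl (ti c a') (ti c' b))"
    unfolding eq using n j_closed by (subst lq_iff) (simp_all add: N_pl N_ti)
  finally show ?thesis using n by (simp add: j_nl N_pl N_ti)
qed

lemma RatI: "rep q a b c \<Longrightarrow> q \<in> Rat"
  by (auto simp: Rat_def)

lemma RatE: "q \<in> Rat \<Longrightarrow> (\<And>a b c. rep q a b c \<Longrightarrow> thesis) \<Longrightarrow> thesis"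
  by (auto simp: Rat_def)

lemma Rat_add: "q \<in> Rat \<Longrightarrow> q' \<in> Rat \<Longrightarrow> q \<oplus> q' \<in> Rat"
  by (elim RatE) (rule RatI[OF rep_add])

lemma Rat_mult: "q \<in> Rat \<Longrightarrow> q' \<in> Rat \<Longrightarrow> q \<otimes> q' \<in> Rat"
  by (elim RatE) (rule RatI[OF rep_mult])

lemma Rat_neg: "q \<in> Rat \<Longrightarrow> \<ominus> q \<in> Rat"
  by (elim RatE) (rule RatI[OF rep_neg])

lemma Rat_j: "n \<in> N \<Longrightarrow> j n \<in> Rat"
  by (rule RatI[OF rep_j])

lemma Rat_zero: "\<zero> \<in> Rat" and Rat_one: "\<one> \<in> Rat"
  using Rat_j[OF N_ze] Rat_j[OF N_on] j_ze j_on by simp_all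

lemma rep_num:
  assumes q: "q \<in> Rat"
  obtains c k where "c \<in> N" "k \<in> N" "c \<noteq> ze" "j c \<otimes> q = j k \<or> j c \<otimes> q = \<ominus> j k"
proof -
  obtain a b c where r: "rep q a b c" using q by (auto simp: Rat_def)
  then have n: "a \<in> N" "b \<in> N" "c \<in> N" "c \<noteq> ze" and e: "j c \<otimes> q = j a \<ominus> j b" by (auto simp: rep_def)
  from N_diff[OF n(1,2)] consider k where "k \<in> N" "a = pl b k" | k where "k \<in> N" "b = pl a k" by blast
  then show ?thesis
  proof cases
    case (1 k)
    have "j c \<otimes> q = (j b \<oplus> j k) \<ominus> j b" using e 1 n by (simp add: j_pl)
    also have "\<dots> = j k" using j_closed[OF n(2)] j_closed[OF 1(1)] by algebra
    finally show ?thesis using that[of c k] n 1 by simp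
  next
    case (2 k)
    have "j c \<otimes> q = j a \<ominus> (j a \<oplus> j k)" using e 2 n by (simp add: j_pl)
    also have "\<dots> = \<ominus> j k" using j_closed[OF n(1)] j_closed[OF 2(1)] by algebra
    finally show ?thesis using that[of c k] n 2 by simp
  qed
qed

lemma Rat_inv:
  assumes q: "q \<in> Rat" "q \<noteq> \<zero>" and y: "y \<in> carrier R" "q \<otimes> y = \<one>"
  shows "y \<in> Rat"
proof -
  obtain c k where ck: "c \<in> N" "k \<in> N" "c \<noteq> ze" "j c \<otimes> q = j k \<or> j c \<otimes> q = \<ominus> j k"
    using q(1) by (rule rep_num)
  have cl: "j c \<in> carrier R" "j k \<in> carrier R" "q \<in> carrier R" using ck j_closed Rat_closed q by auto
  have k0: "k \<noteq> ze"
  proof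
    assume "k = ze"
    then have "j c \<otimes> q = \<zero>" using ck j_ze by auto
    then show False using integral cl q ck j_eq_0 by blast
  qed
  have A: "j c = (j c \<otimes> q) \<otimes> y"
  proof -
    have "(j c \<otimes> q) \<otimes> y = j c \<otimes> (q \<otimes> y)" using cl y by algebra
    then show ?thesis using y cl by simp
  qed
  from ck(4) show ?thesis
  proof
    assume "j c \<otimes> q = j k"
    then have "rep y c ze k" unfolding rep_def using A ck k0 cl y N_ze by (simp add: j_ze a_minus_def)
    then show ?thesis by (auto simp: Rat_def)
  next
    assume e: "j c \<otimes> q = \<ominus> j k"
    have "j k \<otimes> y = \<ominus> (\<ominus> j k \<otimes> y)" using cl y by algebra
    then have "rep y ze c k" unfolding rep_def using A e ck k0 cl y N_ze by (simp add: j_ze a_minus_def)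
    then show ?thesis by (auto simp: Rat_def)
  qed
qed

definition bdd :: "'a \<Rightarrow> bool" where
  "bdd x \<longleftrightarrow> x \<in> carrier R \<and> (\<exists>n\<in>N. nn (j n \<ominus> x) \<and> nn (j n \<oplus> x))"

definition far :: "'a \<Rightarrow> 'a \<Rightarrow> bool" where
  "far x y \<longleftrightarrow> (\<exists>n\<in>N. pos (j n \<otimes> (y \<ominus> x) \<ominus> \<one>))"

definition near :: "'a \<Rightarrow> 'a \<Rightarrow> bool" where
  "near x y \<longleftrightarrow> \<not> far x y \<and> \<not> far y x"

lemma bdd_closed: "bdd x \<Longrightarrow> x \<in> carrier R"
  by (simp add: bdd_def)

lemma far_pos: "x \<in> carrier R \<Longrightarrow> y \<in> carrier R \<Longrightarrow> far x y \<Longrightarrow> pos (y \<ominus> x)"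
proof -
  assume c: "x \<in> carrier R" "y \<in> carrier R" and "far x y"
  then obtain n where n: "n \<in> N" "pos (j n \<otimes> (y \<ominus> x) \<ominus> \<one>)" by (auto simp: far_def)
  have "j n \<otimes> (y \<ominus> x) = (j n \<otimes> (y \<ominus> x) \<ominus> \<one>) \<oplus> \<one>" using c j_closed[OF n(1)] by algebra
  then have "pos (j n \<otimes> (y \<ominus> x))" using pos_add[OF n(2) pos_nn[OF pos_one]] by simp
  then show ?thesis using pos_cancel'[OF j_nn[OF n(1)]] c by simp
qed

lemma far_not_lq: "x \<in> carrier R \<Longrightarrow> y \<in> carrier R \<Longrightarrow> far x y \<Longrightarrow> \<not> y \<preceq> x"
  using far_pos not_lq by blast

lemma far_lq: "x \<in> carrier R \<Longrightarrow> y \<in> carrier R \<Longrightarrow> far x y \<Longrightarrow> x \<preceq> y"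
  using far_pos pos_nn lq_iff by blast

lemma far_lq_trans:
  assumes c: "x \<in> carrier R" "y \<in> carrier R" "z \<in> carrier R" and xy: "far x y" "y \<preceq> z"
  shows "far x z"
proof -
  obtain n where n: "n \<in> N" "pos (j n \<otimes> (y \<ominus> x) \<ominus> \<one>)" using xy by (auto simp: far_def)
  have "nn (j n \<otimes> (z \<ominus> y))" using nn_mult[OF j_nn[OF n(1)]] xy c by (simp add: lq_iff)
  from pos_add[OF n(2) this] have "pos ((j n \<otimes> (y \<ominus> x) \<ominus> \<one>) \<oplus> j n \<otimes> (z \<ominus> y))" .
  moreover have "(j n \<otimes> (y \<ominus> x) \<ominus> \<one>) \<oplus> j n \<otimes> (z \<ominus> y) = j n \<otimes> (z \<ominus> x) \<ominus> \<one>" using c j_closed[OF n(1)] by algebra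
  ultimately show ?thesis using n(1) unfolding far_def by auto
qed

lemma lq_far_trans:
  assumes c: "x \<in> carrier R" "y \<in> carrier R" "z \<in> carrier R" and xy: "x \<preceq> y" "far y z"
  shows "far x z"
proof -
  obtain n where n: "n \<in> N" "pos (j n \<otimes> (z \<ominus> y) \<ominus> \<one>)" using xy by (auto simp: far_def)
  have "nn (j n \<otimes> (y \<ominus> x))" using nn_mult[OF j_nn[OF n(1)]] xy c by (simp add: lq_iff)
  from pos_add[OF n(2) this] have "pos ((j n \<otimes> (z \<ominus> y) \<ominus> \<one>) \<oplus> j n \<otimes> (y \<ominus> x))" .
  moreover have "(j n \<otimes> (z \<ominus> y) \<ominus> \<one>) \<oplus> j n \<otimes> (y \<ominus> x) = j n \<otimes> (z \<ominus> x) \<ominus> \<one>" using c j_closed[OF n(1)] by algebra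
  ultimately show ?thesis using n(1) unfolding far_def by auto
qed

lemma far_trans: "x \<in> carrier R \<Longrightarrow> y \<in> carrier R \<Longrightarrow> z \<in> carrier R \<Longrightarrow> far x y \<Longrightarrow> far y z \<Longrightarrow> far x z"
  using far_lq_trans far_lq by blast

lemma far_add:
  assumes c: "x \<in> carrier R" "y \<in> carrier R" "z \<in> carrier R"
  shows "far (x \<oplus> z) (y \<oplus> z) \<longleftrightarrow> far x y"
proof -
  have "(y \<oplus> z) \<ominus> (x \<oplus> z) = y \<ominus> x" using c by algebra
  then show ?thesis by (simp add: far_def)
qed

lemma far_neg:
  assumes c: "x \<in> carrier R" "y \<in> carrier R"
  shows "far (\<ominus> y) (\<ominus> x) \<longleftrightarrow> far x y"
proof -
  have "(\<ominus> x) \<ominus> (\<ominus> y) = y \<ominus> x" using c by algebra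
  then show ?thesis by (simp add: far_def)
qed

lemma far_interp_aux: "e \<in> carrier R \<Longrightarrow> c \<in> carrier R \<Longrightarrow> m \<in> carrier R \<Longrightarrow>
  ((e \<oplus> e) \<oplus> (e \<oplus> e)) \<oplus> ((\<one> \<oplus> \<one>) \<oplus> (\<one> \<oplus> \<one>)) \<ominus> ((m \<oplus> \<one>) \<ominus> c) \<ominus> \<one> \<ominus> \<one> =
    ((e \<oplus> e) \<oplus> (e \<oplus> e)) \<oplus> (\<one> \<oplus> (c \<ominus> m))"
  by algebra

lemma far_interp:
  assumes x: "bdd x" and y: "y \<in> carrier R" and xy: "far x y"
  shows "\<exists>q\<in>Rat. far x q \<and> far q y"
proof -
  obtain n where n: "n \<in> N" "pos (j n \<otimes> (y \<ominus> x) \<ominus> \<one>)" using xy by (auto simp: far_def)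
  obtain M where M: "M \<in> N" "nn (j M \<ominus> x)" "nn (j M \<oplus> x)" using x by (auto simp: bdd_def)
  have xc: "x \<in> carrier R" using x by (rule bdd_closed)
  have n0: "n \<noteq> ze"
  proof
    assume "n = ze"
    moreover have "\<zero> \<otimes> (y \<ominus> x) \<ominus> \<one> = \<ominus> \<one>" using xc y by algebra
    ultimately have "pos (\<ominus> \<one>)" using n j_ze by simp
    then show False using pos_not_nn[OF pos_one] pos_nn by blast
  qed
  define K where "K = pl (pl n n) (pl n n)"
  have K: "K \<in> N" "j K = (j n \<oplus> j n) \<oplus> (j n \<oplus> j n)" using n by (simp_all add: K_def N_pl j_pl)
  have cl: "j n \<in> carrier R" "j M \<in> carrier R" "j K \<in> carrier R" using n M K j_closed by auto
  have "pos (j K)" unfolding K(2) using j_pos[OF n(1) n0] pos_add pos_nn by metis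
  then have K0: "K \<noteq> ze" using pos_ne j_ze by blast
  let ?c = "j K \<otimes> (j M \<oplus> x)"
  have c1: "nn ?c" using nn_mult[OF j_nn[OF K(1)] M(3)] .
  have c2: "?c \<preceq> j (ti K (pl M M))"
  proof -
    have "nn (j K \<otimes> (j M \<ominus> x))" using nn_mult[OF j_nn[OF K(1)] M(2)] .
    moreover have "j K \<otimes> (j M \<ominus> x) = j K \<otimes> (j M \<oplus> j M) \<ominus> ?c" using cl xc by algebra
    ultimately show ?thesis using K(1) M(1) cl xc by (simp add: lq_iff j_ti j_pl N_pl)
  qed
  obtain m where m: "m \<in> N" "j m \<preceq> ?c" "\<not> j m \<oplus> \<one> \<preceq> ?c"
    using j_floor[OF _ _ _ c2] c1 K(1) M(1) by (auto simp: nn_def N_ti N_pl)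
  have jm: "j m \<in> carrier R" using m j_closed by auto
  have m1: "nn (?c \<ominus> j m)" using m cl xc jm by (simp add: lq_iff)
  have m2: "pos ((j m \<oplus> \<one>) \<ominus> ?c)" using m cl xc jm by (simp add: not_lq)
  have N2: "pl (pl m on) on \<in> N" "ti K M \<in> N" using m K M by (simp_all add: N_pl N_ti N_on)
  obtain q where q: "rep q (pl (pl m on) on) (ti K M) K" using rep_ex[OF N2 K(1) K0] by blast
  then have qc: "q \<in> carrier R" and qe: "j K \<otimes> q = (j m \<oplus> \<one> \<oplus> \<one>) \<ominus> j K \<otimes> j M"
    using m K M by (auto simp: rep_def j_pl j_ti N_pl N_on j_on)
  have "j K \<otimes> (q \<ominus> x) \<ominus> \<one> = j K \<otimes> q \<ominus> j K \<otimes> x \<ominus> \<one>" using cl xc qc by algebra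
  also have "\<dots> = (j m \<oplus> \<one>) \<ominus> ?c" unfolding qe using cl xc jm by algebra
  finally have e1: "j K \<otimes> (q \<ominus> x) \<ominus> \<one> = (j m \<oplus> \<one>) \<ominus> ?c" .
  then have "pos (j K \<otimes> (q \<ominus> x) \<ominus> \<one>)" using m2 by simp
  then have f1: "far x q" using K(1) unfolding far_def by blast
  let ?e = "j n \<otimes> (y \<ominus> x) \<ominus> \<one>"
  have ec: "?e \<in> carrier R" using cl xc y by simp
  define d where "d = y \<ominus> x"
  define p where "p = q \<ominus> x"
  have dp: "d \<in> carrier R" "p \<in> carrier R" using xc y qc by (simp_all add: d_def p_def)
  have cc: "?c \<in> carrier R" using cl xc by simp
  have "y \<ominus> q = d \<ominus> p" unfolding d_def p_def using xc y qc by algebra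
  then have "j K \<otimes> (y \<ominus> q) \<ominus> \<one> = j K \<otimes> d \<ominus> (j K \<otimes> p \<ominus> \<one>) \<ominus> \<one> \<ominus> \<one>" using cl dp by simp algebra
  also have "\<dots> = j K \<otimes> d \<ominus> ((j m \<oplus> \<one>) \<ominus> ?c) \<ominus> \<one> \<ominus> \<one>" using e1 by (simp add: p_def)
  also have "j K \<otimes> d = ((?e \<oplus> ?e) \<oplus> (?e \<oplus> ?e)) \<oplus> ((\<one> \<oplus> \<one>) \<oplus> (\<one> \<oplus> \<one>))"
    unfolding K(2) d_def[symmetric] using cl(1) dp by algebra
  also have "((?e \<oplus> ?e) \<oplus> (?e \<oplus> ?e)) \<oplus> ((\<one> \<oplus> \<one>) \<oplus> (\<one> \<oplus> \<one>)) \<ominus> ((j m \<oplus> \<one>) \<ominus> ?c) \<ominus> \<one> \<ominus> \<one> =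
      ((?e \<oplus> ?e) \<oplus> (?e \<oplus> ?e)) \<oplus> (\<one> \<oplus> (?c \<ominus> j m))"
    using far_interp_aux[OF ec cc jm] .
  finally have e: "j K \<otimes> (y \<ominus> q) \<ominus> \<one> = ((?e \<oplus> ?e) \<oplus> (?e \<oplus> ?e)) \<oplus> (\<one> \<oplus> (?c \<ominus> j m))" .
  have "pos (((?e \<oplus> ?e) \<oplus> (?e \<oplus> ?e)) \<oplus> (\<one> \<oplus> (?c \<ominus> j m)))"
    using n(2) pos_one m1 pos_add pos_nn nn_add by meson
  then have "pos (j K \<otimes> (y \<ominus> q) \<ominus> \<one>)" unfolding e .
  then have "far q y" using K(1) unfolding far_def by blast
  then show ?thesis using f1 q by (auto simp: Rat_def)
qed

lemma not_far_trans:
  assumes b: "bdd x" "bdd y" "bdd z" and "\<not> far y x" "\<not> far z y"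
  shows "\<not> far z x"
proof
  assume "far z x"
  have c: "x \<in> carrier R" "y \<in> carrier R" "z \<in> carrier R" using b bdd_closed by auto
  obtain q where q: "q \<in> Rat" "far z q" "far q x" using far_interp[OF b(3) c(1) \<open>far z x\<close>] by blast
  have "q \<preceq> y \<or> y \<preceq> q" using lq_linear c Rat_closed q by blast
  then show False using far_lq_trans[of z q y] lq_far_trans[of y q x] c Rat_closed[OF q(1)] q assms by blast
qed

lemma near_refl: "bdd x \<Longrightarrow> near x x"
  using far_not_lq[of x x] lq_refl bdd_closed unfolding near_def by blast

lemma near_trans: "bdd x \<Longrightarrow> bdd y \<Longrightarrow> bdd z \<Longrightarrow> near x y \<Longrightarrow> near y z \<Longrightarrow> near x z"
  unfolding near_def using not_far_trans by blast

lemma near_add: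
  "bdd x \<Longrightarrow> bdd x' \<Longrightarrow> bdd y \<Longrightarrow> near x x' \<Longrightarrow> near (x \<oplus> y) (x' \<oplus> y)"
  unfolding near_def using far_add bdd_closed by blast

lemma bdd_add: "bdd x \<Longrightarrow> bdd y \<Longrightarrow> bdd (x \<oplus> y)"
proof -
  assume x: "bdd x" and y: "bdd y"
  obtain m where m: "m \<in> N" "nn (j m \<ominus> x)" "nn (j m \<oplus> x)" using x by (auto simp: bdd_def)
  obtain n where n: "n \<in> N" "nn (j n \<ominus> y)" "nn (j n \<oplus> y)" using y by (auto simp: bdd_def)
  have c: "x \<in> carrier R" "y \<in> carrier R" "j m \<in> carrier R" "j n \<in> carrier R" using x y m n bdd_closed j_closed by auto
  have "(j m \<oplus> j n) \<ominus> (x \<oplus> y) = (j m \<ominus> x) \<oplus> (j n \<ominus> y)" "(j m \<oplus> j n) \<oplus> (x \<oplus> y) = (j m \<oplus> x) \<oplus> (j n \<oplus> y)"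
    using c by algebra+
  then have "nn (j (pl m n) \<ominus> (x \<oplus> y))" "nn (j (pl m n) \<oplus> (x \<oplus> y))" using m n nn_add by (simp_all add: j_pl)
  then show ?thesis unfolding bdd_def using c m n N_pl by blast
qed

lemma bdd_neg: "bdd x \<Longrightarrow> bdd (\<ominus> x)"
proof -
  assume x: "bdd x"
  then obtain m where m: "m \<in> N" "nn (j m \<ominus> x)" "nn (j m \<oplus> x)" by (auto simp: bdd_def)
  have c: "x \<in> carrier R" "j m \<in> carrier R" using x m bdd_closed j_closed by auto
  have "j m \<ominus> (\<ominus> x) = j m \<oplus> x" "j m \<oplus> (\<ominus> x) = j m \<ominus> x" using c by algebra+
  then have "nn (j m \<ominus> (\<ominus> x))" "nn (j m \<oplus> (\<ominus> x))" using m by simp_all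
  then show ?thesis unfolding bdd_def using c m(1) by blast
qed

lemma bdd_mult: "bdd x \<Longrightarrow> bdd y \<Longrightarrow> bdd (x \<otimes> y)"
proof -
  assume x: "bdd x" and y: "bdd y"
  obtain m where m: "m \<in> N" "nn (j m \<ominus> x)" "nn (j m \<oplus> x)" using x by (auto simp: bdd_def)
  obtain n where n: "n \<in> N" "nn (j n \<ominus> y)" "nn (j n \<oplus> y)" using y by (auto simp: bdd_def)
  have c: "x \<in> carrier R" "y \<in> carrier R" "j m \<in> carrier R" "j n \<in> carrier R" using x y m n bdd_closed j_closed by auto
  have two: "pos (\<one> \<oplus> \<one>)" using pos_add pos_one pos_nn by blast
  have e: "(\<one> \<oplus> \<one>) \<otimes> (j m \<otimes> j n \<ominus> x \<otimes> y) = (j m \<ominus> x) \<otimes> (j n \<oplus> y) \<oplus> (j m \<oplus> x) \<otimes> (j n \<ominus> y)"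
    "(\<one> \<oplus> \<one>) \<otimes> (j m \<otimes> j n \<oplus> x \<otimes> y) = (j m \<ominus> x) \<otimes> (j n \<ominus> y) \<oplus> (j m \<oplus> x) \<otimes> (j n \<oplus> y)"
    using c by algebra+
  have h: "nn ((\<one> \<oplus> \<one>) \<otimes> (j m \<otimes> j n \<ominus> x \<otimes> y))" "nn ((\<one> \<oplus> \<one>) \<otimes> (j m \<otimes> j n \<oplus> x \<otimes> y))"
    unfolding e using nn_add[OF nn_mult[OF m(2) n(3)] nn_mult[OF m(3) n(2)]] nn_add[OF nn_mult[OF m(2) n(2)] nn_mult[OF m(3) n(3)]] by blast+
  have "nn (j (ti m n) \<ominus> x \<otimes> y)" "nn (j (ti m n) \<oplus> x \<otimes> y)"
    unfolding j_ti[OF m(1) n(1)] using nn_cancel[OF two _ h(1)] nn_cancel[OF two _ h(2)] c by blast+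
  then show ?thesis unfolding bdd_def using c m n N_ti by blast
qed

lemma bdd_j: "n \<in> N \<Longrightarrow> bdd (j n)"
proof -
  assume n: "n \<in> N"
  have "j n \<ominus> j n = \<zero>" using j_closed[OF n] by algebra
  then have "nn (j n \<ominus> j n)" "nn (j n \<oplus> j n)" using nn_zero nn_add j_nn[OF n] by simp_all
  then show ?thesis unfolding bdd_def using n j_closed by blast
qed

lemma bdd_zero: "bdd \<zero>" and bdd_one: "bdd \<one>"
  using bdd_j[OF N_ze] bdd_j[OF N_on] j_ze j_on by simp_all

lemma bdd_Rat: "q \<in> Rat \<Longrightarrow> bdd q"
proof -
  assume "q \<in> Rat"
  then obtain a b c where r: "rep q a b c" by (auto simp: Rat_def)
  then have n: "a \<in> N" "b \<in> N" "c \<in> N" "c \<noteq> ze" and e: "j c \<otimes> q = j a \<ominus> j b" and q: "q \<in> carrier R" by (auto simp: rep_def)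
  have cl: "j a \<in> carrier R" "j b \<in> carrier R" "j c \<in> carrier R" using n j_closed by auto
  have c1: "nn (j c \<ominus> \<one>)" using j_ge1'[OF n(3,4)] .
  have p: "nn ((j c \<ominus> \<one>) \<otimes> (j a \<oplus> j b))" using nn_mult[OF c1] nn_add j_nn n by simp
  have "j c \<otimes> ((j a \<oplus> j b) \<ominus> q) = j c \<otimes> (j a \<oplus> j b) \<ominus> j c \<otimes> q" using cl q by algebra
  also have "\<dots> = (j c \<ominus> \<one>) \<otimes> (j a \<oplus> j b) \<oplus> (j b \<oplus> j b)" unfolding e using cl by algebra
  finally have "nn (j c \<otimes> ((j a \<oplus> j b) \<ominus> q))" using nn_add p j_nn n by simp
  then have 1: "nn ((j a \<oplus> j b) \<ominus> q)" using nn_cancel[OF j_pos[OF n(3,4)]] cl q by simp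
  have "j c \<otimes> ((j a \<oplus> j b) \<oplus> q) = j c \<otimes> (j a \<oplus> j b) \<oplus> j c \<otimes> q" using cl q by algebra
  also have "\<dots> = (j c \<ominus> \<one>) \<otimes> (j a \<oplus> j b) \<oplus> (j a \<oplus> j a)" unfolding e using cl by algebra
  finally have "nn (j c \<otimes> ((j a \<oplus> j b) \<oplus> q))" using nn_add p j_nn n by simp
  then have "nn ((j a \<oplus> j b) \<oplus> q)" using nn_cancel[OF j_pos[OF n(3,4)]] cl q by simp
  then show ?thesis unfolding bdd_def using 1 n q by (intro conjI bexI[of _ "pl a b"]) (simp_all add: j_pl N_pl)
qed

lemma far_mult:
  assumes c: "x \<in> carrier R" "x' \<in> carrier R" and y: "bdd y" and f: "far (x \<otimes> y) (x' \<otimes> y)"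
  shows "far x x' \<or> far x' x"
proof -
  obtain n where n: "n \<in> N" "pos (j n \<otimes> (x' \<otimes> y \<ominus> x \<otimes> y) \<ominus> \<one>)" using f by (auto simp: far_def)
  obtain m where m: "m \<in> N" "nn (j m \<ominus> y)" "nn (j m \<oplus> y)" using y by (auto simp: bdd_def)
  have cl: "j n \<in> carrier R" "j m \<in> carrier R" "y \<in> carrier R" using n m y bdd_closed j_closed by auto
  have "j n \<otimes> (x' \<otimes> y \<ominus> x \<otimes> y) = (j n \<otimes> (x' \<otimes> y \<ominus> x \<otimes> y) \<ominus> \<one>) \<oplus> \<one>" using c cl by algebra
  then have p: "pos (j n \<otimes> (x' \<otimes> y \<ominus> x \<otimes> y))" using pos_add[OF n(2) pos_nn[OF pos_one]] by simp
  from tricho[OF cl(3)] show ?thesis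
  proof (elim disjE)
    assume "pos y"
    have "j n \<otimes> (x' \<otimes> y \<ominus> x \<otimes> y) = y \<otimes> (j n \<otimes> (x' \<ominus> x))" using c cl by algebra
    then have "pos (j n \<otimes> (x' \<ominus> x))" using p pos_cancel[OF \<open>pos y\<close>] c cl by simp
    then have "nn ((j n \<otimes> (x' \<ominus> x)) \<otimes> (j m \<ominus> y))" using nn_mult m pos_nn by blast
    from pos_add[OF n(2) this] have "pos ((j n \<otimes> (x' \<otimes> y \<ominus> x \<otimes> y) \<ominus> \<one>) \<oplus> (j n \<otimes> (x' \<ominus> x)) \<otimes> (j m \<ominus> y))" .
    moreover have "(j n \<otimes> (x' \<otimes> y \<ominus> x \<otimes> y) \<ominus> \<one>) \<oplus> (j n \<otimes> (x' \<ominus> x)) \<otimes> (j m \<ominus> y) = j n \<otimes> j m \<otimes> (x' \<ominus> x) \<ominus> \<one>"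
      using c cl by algebra
    ultimately have "far x x'" unfolding far_def using n m by (intro bexI[of _ "ti n m"]) (simp_all add: j_ti N_ti)
    then show ?thesis by blast
  next
    assume "y = \<zero>"
    then have "pos (j n \<otimes> (x' \<otimes> \<zero> \<ominus> x \<otimes> \<zero>))" using p by simp
    moreover have "j n \<otimes> (x' \<otimes> \<zero> \<ominus> x \<otimes> \<zero>) = \<zero>" using c cl by algebra
    ultimately have "pos \<zero>" by simp
    then show ?thesis using pos_ne by blast
  next
    assume ny: "pos (\<ominus> y)"
    have "j n \<otimes> (x' \<otimes> y \<ominus> x \<otimes> y) = (\<ominus> y) \<otimes> (j n \<otimes> (x \<ominus> x'))" using c cl by algebra
    then have "pos (j n \<otimes> (x \<ominus> x'))" using p pos_cancel[OF ny] c cl by simp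
    then have "nn ((j n \<otimes> (x \<ominus> x')) \<otimes> (j m \<oplus> y))" using nn_mult m pos_nn by blast
    from pos_add[OF n(2) this] have "pos ((j n \<otimes> (x' \<otimes> y \<ominus> x \<otimes> y) \<ominus> \<one>) \<oplus> (j n \<otimes> (x \<ominus> x')) \<otimes> (j m \<oplus> y))" .
    moreover have "(j n \<otimes> (x' \<otimes> y \<ominus> x \<otimes> y) \<ominus> \<one>) \<oplus> (j n \<otimes> (x \<ominus> x')) \<otimes> (j m \<oplus> y) = j n \<otimes> j m \<otimes> (x \<ominus> x') \<ominus> \<one>"
      using c cl by algebra
    ultimately have "far x' x" unfolding far_def using n m by (intro bexI[of _ "ti n m"]) (simp_all add: j_ti N_ti)
    then show ?thesis by blast
  qed
qed

lemma near_mult: "bdd x \<Longrightarrow> bdd x' \<Longrightarrow> bdd y \<Longrightarrow> near x x' \<Longrightarrow> near (x \<otimes> y) (x' \<otimes> y)"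
  unfolding near_def using far_mult[of x x' y] far_mult[of x' x y] bdd_closed by blast

lemma near_inv:
  assumes x: "bdd x" "\<not> near x \<zero>"
  shows "\<exists>y. bdd y \<and> x \<otimes> y = \<one>"
proof -
  have *: "\<exists>y. bdd y \<and> x \<otimes> y = \<one>" if x: "bdd x" "far \<zero> x" for x
  proof -
    have xc: "x \<in> carrier R" using x bdd_closed by blast
    obtain n where n: "n \<in> N" "pos (j n \<otimes> (x \<ominus> \<zero>) \<ominus> \<one>)" using x by (auto simp: far_def)
    have nc: "j n \<in> carrier R" using n j_closed by blast
    have "x \<ominus> \<zero> = x" using xc by algebra
    then have nx: "pos (j n \<otimes> x \<ominus> \<one>)" and "pos x" using n far_pos[OF _ xc x(2)] by simp_all
    then obtain y where y: "pos y" "x \<otimes> y = \<one>" using pos_inv by blast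
    have yc: "y \<in> carrier R" using y pos_closed by blast
    have "(j n \<otimes> x \<ominus> \<one>) \<otimes> y = j n \<otimes> (x \<otimes> y) \<ominus> y" using xc yc nc by algebra
    then have "nn (j n \<ominus> y)" using pos_mult[OF nx y(1)] pos_nn y nc by simp
    moreover have "nn (j n \<oplus> y)" using nn_add j_nn n y pos_nn by blast
    ultimately show ?thesis using y yc n by (auto simp: bdd_def)
  qed
  have xc: "x \<in> carrier R" using x bdd_closed by blast
  from x(2) consider "far \<zero> x" | "far x \<zero>" by (auto simp: near_def)
  then show ?thesis
  proof cases
    case 1
    then show ?thesis using * x by blast
  next
    case 2
    then have "far (\<ominus> \<zero>) (\<ominus> x)" using far_neg[of x \<zero>] xc by simp
    then obtain y where y: "bdd y" "\<ominus> x \<otimes> y = \<one>" using *[OF bdd_neg[OF x(1)]] by auto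
    have "x \<otimes> \<ominus> y = \<ominus> x \<otimes> y" using xc bdd_closed[OF y(1)] by algebra
    then show ?thesis using y bdd_neg by auto
  qed
qed

lemma not_far_mult:
  assumes x: "bdd x" "\<not> far x \<zero>" and y: "bdd y" "\<not> far y \<zero>"
  shows "\<not> far (x \<otimes> y) \<zero>"
proof
  assume f: "far (x \<otimes> y) \<zero>"
  have *: "far x \<zero>" if x: "bdd x" and y: "bdd y" and f: "far (x \<otimes> y) \<zero>" and ny: "pos y" for x y
  proof -
    have c: "x \<in> carrier R" "y \<in> carrier R" using x y bdd_closed by auto
    have "far (x \<otimes> y) (\<zero> \<otimes> y)" using f c by simp
    then have "far x \<zero> \<or> far \<zero> x" using far_mult[OF c(1) zero_closed y] by blast
    moreover have False if "far \<zero> x"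
    proof -
      have "x \<ominus> \<zero> = x" using c by algebra
      then have "pos x" using far_pos[OF zero_closed c(1) that] by simp
      then have "pos (x \<otimes> y)" using pos_mult ny by blast
      moreover have "\<zero> \<ominus> x \<otimes> y = \<ominus> (x \<otimes> y)" using c by algebra
      then have "pos (\<ominus> (x \<otimes> y))" using far_pos[OF _ zero_closed f] c by simp
      ultimately show False using pos_not_nn pos_nn by blast
    qed
    ultimately show ?thesis by blast
  qed
  have c: "x \<in> carrier R" "y \<in> carrier R" using x y bdd_closed by auto
  have "\<zero> \<ominus> x \<otimes> y = \<ominus> (x \<otimes> y)" using c by algebra
  then have p: "pos (\<ominus> (x \<otimes> y))" using far_pos[OF _ zero_closed f] c by simp
  from tricho[OF c(2)] show False
  proof (elim disjE)
    assume "pos y"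
    then show False using *[OF x(1) y(1) f] x by blast
  next
    assume "y = \<zero>"
    then have "pos \<zero>" using p c by simp
    then show False using pos_ne by blast
  next
    assume ny: "pos (\<ominus> y)"
    have "\<ominus> (x \<otimes> y) = \<ominus> y \<otimes> x" using c by algebra
    then have "pos x" using p pos_cancel[OF ny c(1)] by simp
    moreover have "far (y \<otimes> x) \<zero>" using f m_comm[OF c] by simp
    ultimately show False using *[OF y(1) x(1)] y by blast
  qed
qed

lemma far_01: "far \<zero> \<one>"
proof -
  have "(\<one> \<oplus> \<one>) \<otimes> (\<one> \<ominus> \<zero>) \<ominus> \<one> = \<one>" by algebra
  then have "pos (j (pl on on) \<otimes> (\<one> \<ominus> \<zero>) \<ominus> \<one>)" using pos_one by (simp add: j_pl N_on j_on)
  then show ?thesis unfolding far_def using N_pl N_on by blast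
qed

lemma far_add_one: "x \<in> carrier R \<Longrightarrow> far x (x \<oplus> \<one>)"
  using far_add[of \<zero> \<one> x] far_01 a_comm[of x \<one>] by simp

definition arch :: bool where
  "arch \<longleftrightarrow> (\<forall>x\<in>carrier R. \<exists>n\<in>N. x \<preceq> j n)"

lemma arch_bdd:
  assumes arch and x: "x \<in> carrier R"
  shows "bdd x"
proof -
  obtain m where m: "m \<in> N" "x \<preceq> j m" using assms by (auto simp: arch_def)
  obtain n where n: "n \<in> N" "\<ominus> x \<preceq> j n" using assms by (auto simp: arch_def)
  have c: "j m \<in> carrier R" "j n \<in> carrier R" using m n j_closed by auto
  have 1: "nn ((j m \<ominus> x) \<oplus> j n)" using nn_add m c x j_nn[OF n(1)] by (simp add: lq_iff)
  have 2: "nn (j m \<oplus> (j n \<ominus> (\<ominus> x)))" using nn_add n c x j_nn[OF m(1)] by (simp add: lq_iff)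
  have "(j m \<ominus> x) \<oplus> j n = (j m \<oplus> j n) \<ominus> x" "j m \<oplus> (j n \<ominus> (\<ominus> x)) = (j m \<oplus> j n) \<oplus> x" using c x by algebra+
  then have "nn (j (pl m n) \<ominus> x)" "nn (j (pl m n) \<oplus> x)" using 1 2 m n by (simp_all add: j_pl)
  then show ?thesis unfolding bdd_def using x N_pl[OF m(1) n(1)] by blast
qed

lemma arch_far:
  assumes arch and c: "x \<in> carrier R" "y \<in> carrier R" and p: "pos (y \<ominus> x)"
  shows "far x y"
proof -
  obtain i where i: "pos i" "(y \<ominus> x) \<otimes> i = \<one>" using pos_inv[OF p] by blast
  have ic: "i \<in> carrier R" using i pos_closed by blast
  obtain n where n: "n \<in> N" "i \<preceq> j n" using assms ic by (auto simp: arch_def)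
  have nc: "j n \<in> carrier R" using n j_closed by blast
  have "pos ((y \<ominus> x) \<otimes> (j n \<ominus> i) \<oplus> (y \<ominus> x))"
    using pos_add'[OF nn_mult[OF pos_nn[OF p]] p] n nc ic by (simp add: lq_iff)
  moreover have "(y \<ominus> x) \<otimes> (j n \<ominus> i) \<oplus> (y \<ominus> x) = (j n \<oplus> \<one>) \<otimes> (y \<ominus> x) \<ominus> (y \<ominus> x) \<otimes> i" using c nc ic by algebra
  ultimately have "pos (j (pl n on) \<otimes> (y \<ominus> x) \<ominus> \<one>)" using i n by (simp add: j_pl N_on j_on)
  then show ?thesis unfolding far_def using N_pl[OF n(1) N_on] by blast
qed

lemma arch_dense:
  assumes arch and c: "x \<in> carrier R" "y \<in> carrier R" and "\<not> y \<preceq> x"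
  shows "\<exists>q\<in>Rat. \<not> q \<preceq> x \<and> \<not> y \<preceq> q"
proof -
  have "far x y" using assms arch_far not_lq by blast
  then obtain q where "q \<in> Rat" "far x q" "far q y" using far_interp[OF arch_bdd] assms by blast
  then show ?thesis using far_not_lq c Rat_closed by blast
qed

end

section \<open>Transfer between two fields\<close>

locale rat_pair = K: rat_field R lq N ze on pl ti nl j + L: rat_field S lr N ze on pl ti nl k
  for R :: "('a, 'x) ring_scheme" (structure) and lq :: "'a \<Rightarrow> 'a \<Rightarrow> bool" (infix "\<preceq>" 50)
    and S :: "('b, 'y) ring_scheme" (structure) and lr :: "'b \<Rightarrow> 'b \<Rightarrow> bool" (infix "\<sqsubseteq>''" 50)
    and N :: "'n set" and ze on pl ti nl j k
begin

definition E :: "'a \<Rightarrow> 'b \<Rightarrow> bool" where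
  "E q r \<longleftrightarrow> (\<exists>a b c. K.rep q a b c \<and> L.rep r a b c)"

lemma E_Rat: "E q r \<Longrightarrow> q \<in> K.Rat \<and> r \<in> L.Rat"
  by (auto simp: E_def K.Rat_def L.Rat_def)

lemma E_closed: "E q r \<Longrightarrow> q \<in> carrier R" "E q r \<Longrightarrow> r \<in> carrier S"
  using E_Rat K.Rat_closed L.Rat_closed by blast+

lemma E_ex: "q \<in> K.Rat \<Longrightarrow> \<exists>r. E q r"
proof -
  assume "q \<in> K.Rat"
  then obtain a b c where r: "K.rep q a b c" by (auto simp: K.Rat_def)
  then have "a \<in> N" "b \<in> N" "c \<in> N" "c \<noteq> ze" by (auto simp: K.rep_def)
  then obtain r where "L.rep r a b c" using L.rep_ex by blast
  then show ?thesis using r by (auto simp: E_def)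
qed

lemma E_ex': "r \<in> L.Rat \<Longrightarrow> \<exists>q. E q r"
proof -
  assume "r \<in> L.Rat"
  then obtain a b c where r: "L.rep r a b c" by (auto simp: L.Rat_def)
  then have "a \<in> N" "b \<in> N" "c \<in> N" "c \<noteq> ze" by (auto simp: L.rep_def)
  then obtain q where "K.rep q a b c" using K.rep_ex by blast
  then show ?thesis using r by (auto simp: E_def)
qed

lemma EI: "K.rep q a b c \<Longrightarrow> L.rep r a b c \<Longrightarrow> E q r"
  by (auto simp: E_def)

lemma EE: "E q r \<Longrightarrow> (\<And>a b c. K.rep q a b c \<Longrightarrow> L.rep r a b c \<Longrightarrow> thesis) \<Longrightarrow> thesis"
  by (auto simp: E_def)

lemma E_lq: "E q r \<Longrightarrow> E q' r' \<Longrightarrow> q \<preceq> q' \<longleftrightarrow> lr r r'"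
  by (elim EE) (simp only: K.rep_lq L.rep_lq)

lemma E_eq: "E q r \<Longrightarrow> E q' r' \<Longrightarrow> q = q' \<longleftrightarrow> r = r'"
  using E_lq[of q r q' r'] E_lq[of q' r' q r] E_closed K.lq_refl L.lq_refl K.lq_antisym L.lq_antisym by metis

lemma E_add: "E q r \<Longrightarrow> E q' r' \<Longrightarrow> E (q \<oplus>\<^bsub>R\<^esub> q') (r \<oplus>\<^bsub>S\<^esub> r')"
  by (elim EE) (rule EI[OF K.rep_add L.rep_add])

lemma E_mult: "E q r \<Longrightarrow> E q' r' \<Longrightarrow> E (q \<otimes>\<^bsub>R\<^esub> q') (r \<otimes>\<^bsub>S\<^esub> r')"
  by (elim EE) (rule EI[OF K.rep_mult L.rep_mult])

lemma E_neg: "E q r \<Longrightarrow> E (\<ominus>\<^bsub>R\<^esub> q) (\<ominus>\<^bsub>S\<^esub> r)"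
  by (elim EE) (rule EI[OF K.rep_neg L.rep_neg])

lemma E_zero: "E \<zero>\<^bsub>R\<^esub> \<zero>\<^bsub>S\<^esub>"
  using EI[OF K.rep_j[OF K.N_ze] L.rep_j[OF K.N_ze]] by (simp only: K.j_ze L.j_ze)

end

locale arch_pair = rat_pair R lq S lr N ze on pl ti nl j k
  for R :: "('a, 'x) ring_scheme" (structure) and lq :: "'a \<Rightarrow> 'a \<Rightarrow> bool" (infix "\<preceq>" 50)
    and S :: "('b, 'y) ring_scheme" (structure) and lr :: "'b \<Rightarrow> 'b \<Rightarrow> bool" (infix "\<sqsubseteq>''" 50)
    and N :: "'n set" and ze on pl ti nl j k +
  assumes archK: "K.arch" and archL: "L.arch"
begin

text \<open>The graph of the order isomorphism: \<open>x\<close> and \<open>y\<close> make the same cut in the rationals.\<close>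

definition Fr :: "'a \<Rightarrow> 'b \<Rightarrow> bool" where
  "Fr x y \<longleftrightarrow> x \<in> carrier R \<and> y \<in> carrier S \<and>
     (\<forall>q r. E q r \<longrightarrow> (lq q x \<longrightarrow> lr r y) \<and> (lq x q \<longrightarrow> lr y r))"

lemma FrD:
  assumes "Fr x y"
  shows "x \<in> carrier R" "y \<in> carrier S" "E q r \<Longrightarrow> lq q x \<Longrightarrow> lr r y" "E q r \<Longrightarrow> lq x q \<Longrightarrow> lr y r"
  using assms unfolding Fr_def by blast+

lemma Fr_mono:
  assumes f: "Fr x y" "Fr x' y'" and le: "lq x x'"
  shows "lr y y'"
proof (rule ccontr)
  assume n: "\<not> lr y y'"
  obtain r where r: "r \<in> L.Rat" "\<not> lr r y'" "\<not> lr y r"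
    using L.arch_dense[OF archL FrD(2)[OF f(2)] FrD(2)[OF f(1)] n] by blast
  obtain q where q: "E q r" using E_ex'[OF r(1)] by blast
  have "\<not> lq q x'" using FrD(3)[OF f(2) q] r by blast
  then have "lq x' q" using K.lq_linear E_closed(1)[OF q] FrD(1)[OF f(2)] by blast
  then have "lq x q" using K.lq_trans[OF FrD(1)[OF f(1)] FrD(1)[OF f(2)] E_closed(1)[OF q] le] by blast
  then show False using FrD(4)[OF f(1) q] r by blast
qed

lemma Fr_unique: "Fr x y \<Longrightarrow> Fr x y' \<Longrightarrow> y = y'"
  using Fr_mono[of x y x y'] Fr_mono[of x y' x y] L.lq_antisym FrD K.lq_refl by metis

lemma K_neg: "x \<in> carrier R \<Longrightarrow> y \<in> carrier R \<Longrightarrow> lq x (\<ominus>\<^bsub>R\<^esub> y) \<longleftrightarrow> lq y (\<ominus>\<^bsub>R\<^esub> x)"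
proof -
  assume c: "x \<in> carrier R" "y \<in> carrier R"
  then have "\<ominus>\<^bsub>R\<^esub> y \<ominus>\<^bsub>R\<^esub> x = \<ominus>\<^bsub>R\<^esub> x \<ominus>\<^bsub>R\<^esub> y" by algebra
  then show ?thesis using c by (simp add: K.lq_iff)
qed

lemma Fr_supI:
  assumes c: "x \<in> carrier R" "y \<in> carrier S" and ub: "\<And>q r. E q r \<Longrightarrow> lq q x \<Longrightarrow> lr r y"
    and least: "\<And>b. b \<in> carrier S \<Longrightarrow> (\<And>q r. E q r \<Longrightarrow> lq q x \<Longrightarrow> lr r b) \<Longrightarrow> lr y b"
  shows "Fr x y"
  unfolding Fr_def
proof (intro conjI allI impI c)
  fix q r assume e: "E q r"
  show "lq q x \<Longrightarrow> lr r y" using ub e by blast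
  assume xq: "lq x q"
  show "lr y r"
  proof (rule least)
    fix q' r' assume e': "E q' r'" "lq q' x"
    then have "lq q' q" using K.lq_trans[OF E_closed(1)[OF e'(1)] c(1) E_closed(1)[OF e] _ xq] by blast
    then show "lr r' r" using E_lq e' e by blast
  qed (use E_closed e in blast)
qed

lemma lower_bounded:
  assumes x: "x \<in> carrier R"
  shows "\<exists>q r. E q r \<and> lq q x" "\<exists>b\<in>carrier S. \<forall>q r. E q r \<and> lq q x \<longrightarrow> lr r b"
proof -
  have e: "E (j n) (k n)" if "n \<in> N" for n using EI[OF K.rep_j[OF that] L.rep_j[OF that]] .
  obtain m where m: "m \<in> N" "lq (\<ominus>\<^bsub>R\<^esub> x) (j m)" using archK x unfolding K.arch_def by auto
  then have "lq (\<ominus>\<^bsub>R\<^esub> j m) x" using K_neg[of "\<ominus>\<^bsub>R\<^esub> x" "\<ominus>\<^bsub>R\<^esub> j m"] x K.j_closed by simp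
  then show "\<exists>q r. E q r \<and> lq q x" using E_neg[OF e[OF m(1)]] by blast
  obtain n where n: "n \<in> N" "lq x (j n)" using archK x unfolding K.arch_def by auto
  have "lr r (k n)" if "E q r" "lq q x" for q r
    using that E_lq[OF that(1) e[OF n(1)]] K.lq_trans[OF E_closed(1)[OF that(1)] x K.j_closed[OF n(1)] that(2) n(2)] by blast
  then show "\<exists>b\<in>carrier S. \<forall>q r. E q r \<and> lq q x \<longrightarrow> lr r b" using L.j_closed[OF n(1)] by blast
qed

lemma Fr_dual:
  assumes f: "Fr x y" and e: "E q r"
  shows "lr r y \<Longrightarrow> lq q x" "lr y r \<Longrightarrow> lq x q"
proof -
  note c = FrD(1,2)[OF f] E_closed[OF e]
  show "lq q x" if y: "lr r y"
  proof (rule ccontr)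
    assume "\<not> lq q x"
    then obtain p where p: "p \<in> K.Rat" "\<not> lq p x" "\<not> lq q p" using K.arch_dense[OF archK c(1,3)] by blast
    obtain s where s: "E p s" using E_ex[OF p(1)] by blast
    have "lr y s" using FrD(4)[OF f s] K.lq_linear c(1) p E_closed(1)[OF s] by blast
    then have "lr r s" using L.lq_trans[OF c(4,2) E_closed(2)[OF s] y] by blast
    then show False using E_lq[OF e s] p(3) by blast
  qed
  show "lq x q" if y: "lr y r"
  proof (rule ccontr)
    assume "\<not> lq x q"
    then obtain p where p: "p \<in> K.Rat" "\<not> lq p q" "\<not> lq x p" using K.arch_dense[OF archK c(3,1)] by blast
    obtain s where s: "E p s" using E_ex[OF p(1)] by blast
    have "lr s y" using FrD(3)[OF f s] K.lq_linear c(1) p E_closed(1)[OF s] by blast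
    then have "lr s r" using L.lq_trans[OF E_closed(2)[OF s] c(2,4) _ y] by blast
    then show False using E_lq[OF s e] p(2) by blast
  qed
qed

end

context arch_pair
begin

interpretation swap: arch_pair S lr R lq N ze on pl ti nl k j
  by unfold_locales (rule archL archK)+

lemma swap_E: "swap.E r q \<longleftrightarrow> E q r"
  by (auto simp: swap.E_def E_def)

lemma swap_Fr: "swap.Fr y x \<longleftrightarrow> Fr x y"
  using Fr_dual[of x y] swap.Fr_dual[of y x] FrD(1,2)[of x y] swap.FrD(1,2)[of y x]
  unfolding swap.Fr_def[of y x] Fr_def[of x y] swap_E by blast

lemmas Fr_mono' = swap.Fr_mono[unfolded swap_Fr]
  and Fr_inj = swap.Fr_unique[unfolded swap_Fr]
  and Fr_supI' = swap.Fr_supI[unfolded swap_Fr swap_E]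
  and lower_bounded' = swap.lower_bounded[unfolded swap_E]
  and L_neg = swap.K_neg

lemma Fr_E: "E q r \<Longrightarrow> Fr q r"
  unfolding Fr_def using E_closed E_lq by blast

lemma Fr_neg:
  assumes f: "Fr x y"
  shows "Fr (\<ominus>\<^bsub>R\<^esub> x) (\<ominus>\<^bsub>S\<^esub> y)"
  unfolding Fr_def
proof (intro conjI allI impI)
  note c = FrD(1,2)[OF f]
  show "\<ominus>\<^bsub>R\<^esub> x \<in> carrier R" "\<ominus>\<^bsub>S\<^esub> y \<in> carrier S" using c by simp_all
  fix q r assume e: "E q r"
  note d = E_closed[OF e]
  { assume "lq q (\<ominus>\<^bsub>R\<^esub> x)"
    then have "lq x (\<ominus>\<^bsub>R\<^esub> q)" using K_neg c d by blast
    then have "lr y (\<ominus>\<^bsub>S\<^esub> r)" using FrD(4)[OF f E_neg[OF e]] by blast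
    then show "lr r (\<ominus>\<^bsub>S\<^esub> y)" using L_neg c d by blast }
  { assume "lq (\<ominus>\<^bsub>R\<^esub> x) q"
    then have "lq (\<ominus>\<^bsub>R\<^esub> q) x" using K_neg[of "\<ominus>\<^bsub>R\<^esub> x" "\<ominus>\<^bsub>R\<^esub> q"] c d by simp
    then have "lr (\<ominus>\<^bsub>S\<^esub> r) y" using FrD(3)[OF f E_neg[OF e]] by blast
    then show "lr (\<ominus>\<^bsub>S\<^esub> y) r" using L_neg[of "\<ominus>\<^bsub>S\<^esub> r" "\<ominus>\<^bsub>S\<^esub> y"] c d by simp }
qed

lemma Fr_add_half:
  assumes f: "Fr x y" "Fr x' y'" and e: "E q r" and le: "lq q (x \<oplus>\<^bsub>R\<^esub> x')"
  shows "lr r (y \<oplus>\<^bsub>S\<^esub> y')"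
proof (rule ccontr)
  note c = FrD(1)[OF f(1)] FrD(1)[OF f(2)] FrD(2)[OF f(1)] FrD(2)[OF f(2)] E_closed[OF e]
  assume n: "\<not> lr r (y \<oplus>\<^bsub>S\<^esub> y')"
  have "r \<ominus>\<^bsub>S\<^esub> (y \<oplus>\<^bsub>S\<^esub> y') = (r \<ominus>\<^bsub>S\<^esub> y') \<ominus>\<^bsub>S\<^esub> y" using c by algebra
  then have "\<not> lr (r \<ominus>\<^bsub>S\<^esub> y') y" using n c by (simp add: L.not_lq)
  then obtain r1 where r1: "r1 \<in> L.Rat" "\<not> lr r1 y" "\<not> lr (r \<ominus>\<^bsub>S\<^esub> y') r1"
    using L.arch_dense[OF archL c(3)] c by (meson L.minus_closed)
  obtain q1 where q1: "E q1 r1" using E_ex'[OF r1(1)] by blast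
  note d = E_closed[OF q1]
  have e2: "E (q \<oplus>\<^bsub>R\<^esub> \<ominus>\<^bsub>R\<^esub> q1) (r \<oplus>\<^bsub>S\<^esub> \<ominus>\<^bsub>S\<^esub> r1)" using E_add[OF e E_neg[OF q1]] .
  have "(r \<oplus>\<^bsub>S\<^esub> \<ominus>\<^bsub>S\<^esub> r1) \<ominus>\<^bsub>S\<^esub> y' = (r \<ominus>\<^bsub>S\<^esub> y') \<ominus>\<^bsub>S\<^esub> r1" using c d by algebra
  then have "\<not> lr (r \<oplus>\<^bsub>S\<^esub> \<ominus>\<^bsub>S\<^esub> r1) y'" using r1 c d by (simp add: L.not_lq)
  then have "\<not> lq (q \<oplus>\<^bsub>R\<^esub> \<ominus>\<^bsub>R\<^esub> q1) x'" using FrD(3)[OF f(2) e2] by blast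
  then have p1: "K.pos ((q \<oplus>\<^bsub>R\<^esub> \<ominus>\<^bsub>R\<^esub> q1) \<ominus>\<^bsub>R\<^esub> x')" using c d by (simp add: K.not_lq)
  have "\<not> lq q1 x" using FrD(3)[OF f(1) q1] r1 by blast
  then have p2: "K.pos (q1 \<ominus>\<^bsub>R\<^esub> x)" using c d by (simp add: K.not_lq)
  have "((q \<oplus>\<^bsub>R\<^esub> \<ominus>\<^bsub>R\<^esub> q1) \<ominus>\<^bsub>R\<^esub> x') \<oplus>\<^bsub>R\<^esub> (q1 \<ominus>\<^bsub>R\<^esub> x) = q \<ominus>\<^bsub>R\<^esub> (x \<oplus>\<^bsub>R\<^esub> x')" using c d by algebra
  then have "K.pos (q \<ominus>\<^bsub>R\<^esub> (x \<oplus>\<^bsub>R\<^esub> x'))" using K.pos_add[OF p1 K.pos_nn[OF p2]] by simp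
  then show False using le K.not_lq[of q "x \<oplus>\<^bsub>R\<^esub> x'"] c by blast
qed

lemma Fr_add:
  assumes f: "Fr x y" "Fr x' y'"
  shows "Fr (x \<oplus>\<^bsub>R\<^esub> x') (y \<oplus>\<^bsub>S\<^esub> y')"
  unfolding Fr_def
proof (intro conjI allI impI)
  note c = FrD(1)[OF f(1)] FrD(1)[OF f(2)] FrD(2)[OF f(1)] FrD(2)[OF f(2)]
  show "x \<oplus>\<^bsub>R\<^esub> x' \<in> carrier R" "y \<oplus>\<^bsub>S\<^esub> y' \<in> carrier S" using c by simp_all
  fix q r assume e: "E q r"
  note d = E_closed[OF e]
  show "lq q (x \<oplus>\<^bsub>R\<^esub> x') \<Longrightarrow> lr r (y \<oplus>\<^bsub>S\<^esub> y')" using Fr_add_half[OF f e] .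
  assume "lq (x \<oplus>\<^bsub>R\<^esub> x') q"
  then have "lq (\<ominus>\<^bsub>R\<^esub> q) (\<ominus>\<^bsub>R\<^esub> (x \<oplus>\<^bsub>R\<^esub> x'))" using K_neg[of "x \<oplus>\<^bsub>R\<^esub> x'" "\<ominus>\<^bsub>R\<^esub> q"] c d by simp
  moreover have "\<ominus>\<^bsub>R\<^esub> (x \<oplus>\<^bsub>R\<^esub> x') = \<ominus>\<^bsub>R\<^esub> x \<oplus>\<^bsub>R\<^esub> \<ominus>\<^bsub>R\<^esub> x'" using c by algebra
  ultimately have "lr (\<ominus>\<^bsub>S\<^esub> r) (\<ominus>\<^bsub>S\<^esub> y \<oplus>\<^bsub>S\<^esub> \<ominus>\<^bsub>S\<^esub> y')"
    using Fr_add_half[OF Fr_neg[OF f(1)] Fr_neg[OF f(2)] E_neg[OF e]] by simp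
  moreover have "\<ominus>\<^bsub>S\<^esub> y \<oplus>\<^bsub>S\<^esub> \<ominus>\<^bsub>S\<^esub> y' = \<ominus>\<^bsub>S\<^esub> (y \<oplus>\<^bsub>S\<^esub> y')" using c by algebra
  ultimately show "lr (y \<oplus>\<^bsub>S\<^esub> y') r" using L_neg[of "\<ominus>\<^bsub>S\<^esub> r" "y \<oplus>\<^bsub>S\<^esub> y'"] c d by simp
qed

lemma K_zero_lq: "x \<in> carrier R \<Longrightarrow> lq \<zero>\<^bsub>R\<^esub> x \<longleftrightarrow> K.nn x" and L_zero_lq: "y \<in> carrier S \<Longrightarrow> lr \<zero>\<^bsub>S\<^esub> y \<longleftrightarrow> L.nn y"
  by (simp_all add: K.nn_def L.nn_def)

lemma Fr_nn: "Fr x y \<Longrightarrow> K.nn x \<longleftrightarrow> L.nn y"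
  using Fr_mono[OF Fr_E[OF E_zero], of x y] Fr_mono'[OF Fr_E[OF E_zero], of x y] K_zero_lq L_zero_lq FrD by metis

lemma Fr_zero: "Fr x y \<Longrightarrow> x = \<zero>\<^bsub>R\<^esub> \<longleftrightarrow> y = \<zero>\<^bsub>S\<^esub>"
  using Fr_unique Fr_inj Fr_E[OF E_zero] by metis

lemma Fr_pos: "Fr x y \<Longrightarrow> K.pos x \<longleftrightarrow> L.pos y"
  using Fr_nn Fr_zero unfolding K.pos_def L.pos_def by blast

lemma Fr_mult_pos:
  assumes f: "Fr x y" "Fr x' y'" and p: "K.pos x" "K.pos x'"
  shows "Fr (x \<otimes>\<^bsub>R\<^esub> x') (y \<otimes>\<^bsub>S\<^esub> y')"
  unfolding Fr_def
proof (intro conjI allI impI)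
  note c = FrD(1)[OF f(1)] FrD(1)[OF f(2)] FrD(2)[OF f(1)] FrD(2)[OF f(2)]
  have py: "L.pos y" "L.pos y'" using p Fr_pos f by blast+
  show "x \<otimes>\<^bsub>R\<^esub> x' \<in> carrier R" "y \<otimes>\<^bsub>S\<^esub> y' \<in> carrier S" using c by simp_all
  fix q r assume e: "E q r"
  note d = E_closed[OF e]
  obtain i where i: "L.pos i" "y' \<otimes>\<^bsub>S\<^esub> i = \<one>\<^bsub>S\<^esub>" using L.pos_inv[OF py(2)] by blast
  have ic: "i \<in> carrier S" using i L.pos_closed by blast
  have split: "\<exists>q1 q2 i1. E q1 r1 \<and> i1 \<in> carrier S \<and> L.pos i1 \<and> r1 \<otimes>\<^bsub>S\<^esub> i1 = \<one>\<^bsub>S\<^esub> \<and> E q2 (r \<otimes>\<^bsub>S\<^esub> i1) \<and> q = q1 \<otimes>\<^bsub>R\<^esub> q2"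
    if r1: "r1 \<in> L.Rat" "L.pos r1" for r1
  proof -
    obtain i1 where i1: "L.pos i1" "r1 \<otimes>\<^bsub>S\<^esub> i1 = \<one>\<^bsub>S\<^esub>" using L.pos_inv[OF r1(2)] by blast
    have i1c: "i1 \<in> carrier S" "r1 \<in> carrier S" using i1 r1 L.pos_closed by blast+
    have "i1 \<in> L.Rat" using L.Rat_inv[OF r1(1) L.pos_ne[OF r1(2)] i1c(1) i1(2)] .
    then have "r \<otimes>\<^bsub>S\<^esub> i1 \<in> L.Rat" using L.Rat_mult E_Rat[OF e] by blast
    then obtain q1 q2 where q: "E q1 r1" "E q2 (r \<otimes>\<^bsub>S\<^esub> i1)" using E_ex' r1 by blast
    have "r1 \<otimes>\<^bsub>S\<^esub> (r \<otimes>\<^bsub>S\<^esub> i1) = r \<otimes>\<^bsub>S\<^esub> (r1 \<otimes>\<^bsub>S\<^esub> i1)" using d i1c by algebra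
    then have "q = q1 \<otimes>\<^bsub>R\<^esub> q2" using E_eq[OF e E_mult[OF q]] i1 d by simp
    then show ?thesis using q i1 i1c by blast
  qed
  { assume le: "lq q (x \<otimes>\<^bsub>R\<^esub> x')"
    show "lr r (y \<otimes>\<^bsub>S\<^esub> y')"
    proof (rule ccontr)
      assume "\<not> lr r (y \<otimes>\<^bsub>S\<^esub> y')"
      then have "L.pos (r \<ominus>\<^bsub>S\<^esub> y \<otimes>\<^bsub>S\<^esub> y')" using c d by (simp add: L.not_lq)
      then have "L.pos ((r \<ominus>\<^bsub>S\<^esub> y \<otimes>\<^bsub>S\<^esub> y') \<otimes>\<^bsub>S\<^esub> i)" using L.pos_mult i by blast
      moreover have "(r \<ominus>\<^bsub>S\<^esub> y \<otimes>\<^bsub>S\<^esub> y') \<otimes>\<^bsub>S\<^esub> i = r \<otimes>\<^bsub>S\<^esub> i \<ominus>\<^bsub>S\<^esub> y \<otimes>\<^bsub>S\<^esub> (y' \<otimes>\<^bsub>S\<^esub> i)" using c d ic by algebra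
      ultimately have "L.pos (r \<otimes>\<^bsub>S\<^esub> i \<ominus>\<^bsub>S\<^esub> y)" using i c by simp
      then have "\<not> lr (r \<otimes>\<^bsub>S\<^esub> i) y" using L.not_lq d ic c by simp
      then obtain r1 where r1: "r1 \<in> L.Rat" "\<not> lr r1 y" "\<not> lr (r \<otimes>\<^bsub>S\<^esub> i) r1"
        using L.arch_dense[OF archL c(3)] d ic by (meson L.m_closed)
      have r1c: "r1 \<in> carrier S" using r1 L.Rat_closed by blast
      have a: "L.pos (r1 \<ominus>\<^bsub>S\<^esub> y)" "L.pos (r \<otimes>\<^bsub>S\<^esub> i \<ominus>\<^bsub>S\<^esub> r1)" using r1 r1c c d ic by (simp_all add: L.not_lq)
      have "(r1 \<ominus>\<^bsub>S\<^esub> y) \<oplus>\<^bsub>S\<^esub> y = r1" using r1c c by algebra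
      then have r1p: "L.pos r1" using L.pos_add[OF a(1) L.pos_nn[OF py(1)]] by simp
      from split[OF r1(1) this] obtain q1 q2 i1 where s: "E q1 r1" "i1 \<in> carrier S" "L.pos i1"
        "r1 \<otimes>\<^bsub>S\<^esub> i1 = \<one>\<^bsub>S\<^esub>" "E q2 (r \<otimes>\<^bsub>S\<^esub> i1)" "q = q1 \<otimes>\<^bsub>R\<^esub> q2" by blast
      have "((r \<otimes>\<^bsub>S\<^esub> i \<ominus>\<^bsub>S\<^esub> r1) \<otimes>\<^bsub>S\<^esub> y') \<otimes>\<^bsub>S\<^esub> i1 = r \<otimes>\<^bsub>S\<^esub> (y' \<otimes>\<^bsub>S\<^esub> i) \<otimes>\<^bsub>S\<^esub> i1 \<ominus>\<^bsub>S\<^esub> y' \<otimes>\<^bsub>S\<^esub> (r1 \<otimes>\<^bsub>S\<^esub> i1)"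
        using c d ic r1c s(2) by algebra
      then have "L.pos (r \<otimes>\<^bsub>S\<^esub> i1 \<ominus>\<^bsub>S\<^esub> y')" using L.pos_mult[OF L.pos_mult[OF a(2) py(2)] s(3)] i s(4) c d by simp
      then have "\<not> lr (r \<otimes>\<^bsub>S\<^esub> i1) y'" using L.not_lq c d s(2) by simp
      then have "\<not> lq q2 x'" using FrD(3)[OF f(2) s(5)] by blast
      moreover have "\<not> lq q1 x" using FrD(3)[OF f(1) s(1)] r1 by blast
      moreover note g = E_closed(1)[OF s(1)] E_closed(1)[OF s(5)]
      ultimately have b: "K.pos (q2 \<ominus>\<^bsub>R\<^esub> x')" "K.pos (q1 \<ominus>\<^bsub>R\<^esub> x)" using c by (simp_all add: K.not_lq)
      have "(q2 \<ominus>\<^bsub>R\<^esub> x') \<oplus>\<^bsub>R\<^esub> x' = q2" using g c by algebra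
      then have "K.pos q2" using K.pos_add[OF b(1) K.pos_nn[OF p(2)]] by simp
      then have "K.pos ((q1 \<ominus>\<^bsub>R\<^esub> x) \<otimes>\<^bsub>R\<^esub> q2 \<oplus>\<^bsub>R\<^esub> x \<otimes>\<^bsub>R\<^esub> (q2 \<ominus>\<^bsub>R\<^esub> x'))"
        using K.pos_add K.pos_mult K.pos_nn b p by blast
      moreover have "(q1 \<ominus>\<^bsub>R\<^esub> x) \<otimes>\<^bsub>R\<^esub> q2 \<oplus>\<^bsub>R\<^esub> x \<otimes>\<^bsub>R\<^esub> (q2 \<ominus>\<^bsub>R\<^esub> x') = q1 \<otimes>\<^bsub>R\<^esub> q2 \<ominus>\<^bsub>R\<^esub> x \<otimes>\<^bsub>R\<^esub> x'" using g c by algebra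
      ultimately have "\<not> lq q (x \<otimes>\<^bsub>R\<^esub> x')" unfolding s(6) using K.not_lq g c by simp
      then show False using le by blast
    qed }
  { assume le: "lq (x \<otimes>\<^bsub>R\<^esub> x') q"
    have "K.nn q"
    proof -
      have "K.nn ((q \<ominus>\<^bsub>R\<^esub> x \<otimes>\<^bsub>R\<^esub> x') \<oplus>\<^bsub>R\<^esub> x \<otimes>\<^bsub>R\<^esub> x')"
        using K.nn_add K.pos_nn[OF K.pos_mult[OF p]] le c d by (simp add: K.lq_iff)
      moreover have "(q \<ominus>\<^bsub>R\<^esub> x \<otimes>\<^bsub>R\<^esub> x') \<oplus>\<^bsub>R\<^esub> x \<otimes>\<^bsub>R\<^esub> x' = q" using c d by algebra
      ultimately show ?thesis by simp
    qed
    then have rn: "L.nn r" using Fr_nn[OF Fr_E[OF e]] by blast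
    show "lr (y \<otimes>\<^bsub>S\<^esub> y') r"
    proof (rule ccontr)
      assume "\<not> lr (y \<otimes>\<^bsub>S\<^esub> y') r"
      then have "L.pos (y \<otimes>\<^bsub>S\<^esub> y' \<ominus>\<^bsub>S\<^esub> r)" using c d by (simp add: L.not_lq)
      then have "L.pos ((y \<otimes>\<^bsub>S\<^esub> y' \<ominus>\<^bsub>S\<^esub> r) \<otimes>\<^bsub>S\<^esub> i)" using L.pos_mult i by blast
      moreover have "(y \<otimes>\<^bsub>S\<^esub> y' \<ominus>\<^bsub>S\<^esub> r) \<otimes>\<^bsub>S\<^esub> i = y \<otimes>\<^bsub>S\<^esub> (y' \<otimes>\<^bsub>S\<^esub> i) \<ominus>\<^bsub>S\<^esub> r \<otimes>\<^bsub>S\<^esub> i" using c d ic by algebra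
      ultimately have "L.pos (y \<ominus>\<^bsub>S\<^esub> r \<otimes>\<^bsub>S\<^esub> i)" using i c by simp
      then have "\<not> lr y (r \<otimes>\<^bsub>S\<^esub> i)" using L.not_lq d ic c by simp
      then obtain r1 where r1: "r1 \<in> L.Rat" "\<not> lr r1 (r \<otimes>\<^bsub>S\<^esub> i)" "\<not> lr y r1"
        using L.arch_dense[OF archL _ c(3)] d ic by (meson L.m_closed)
      have r1c: "r1 \<in> carrier S" using r1 L.Rat_closed by blast
      have a: "L.pos (y \<ominus>\<^bsub>S\<^esub> r1)" "L.pos (r1 \<ominus>\<^bsub>S\<^esub> r \<otimes>\<^bsub>S\<^esub> i)" using r1 r1c c d ic by (simp_all add: L.not_lq)
      have "(r1 \<ominus>\<^bsub>S\<^esub> r \<otimes>\<^bsub>S\<^esub> i) \<oplus>\<^bsub>S\<^esub> r \<otimes>\<^bsub>S\<^esub> i = r1" using r1c d ic by algebra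
      then have r1p: "L.pos r1" using L.pos_add[OF a(2) L.nn_mult[OF rn L.pos_nn[OF i(1)]]] by simp
      from split[OF r1(1) this] obtain q1 q2 i1 where s: "E q1 r1" "i1 \<in> carrier S" "L.pos i1"
        "r1 \<otimes>\<^bsub>S\<^esub> i1 = \<one>\<^bsub>S\<^esub>" "E q2 (r \<otimes>\<^bsub>S\<^esub> i1)" "q = q1 \<otimes>\<^bsub>R\<^esub> q2" by blast
      have "((r1 \<ominus>\<^bsub>S\<^esub> r \<otimes>\<^bsub>S\<^esub> i) \<otimes>\<^bsub>S\<^esub> y') \<otimes>\<^bsub>S\<^esub> i1 = y' \<otimes>\<^bsub>S\<^esub> (r1 \<otimes>\<^bsub>S\<^esub> i1) \<ominus>\<^bsub>S\<^esub> r \<otimes>\<^bsub>S\<^esub> (y' \<otimes>\<^bsub>S\<^esub> i) \<otimes>\<^bsub>S\<^esub> i1"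
        using c d ic r1c s(2) by algebra
      then have "L.pos (y' \<ominus>\<^bsub>S\<^esub> r \<otimes>\<^bsub>S\<^esub> i1)" using L.pos_mult[OF L.pos_mult[OF a(2) py(2)] s(3)] i s(4) c d by simp
      then have "\<not> lr y' (r \<otimes>\<^bsub>S\<^esub> i1)" using L.not_lq c d s(2) by simp
      then have "\<not> lq x' q2" using FrD(4)[OF f(2) s(5)] by blast
      moreover have "\<not> lq x q1" using FrD(4)[OF f(1) s(1)] r1 by blast
      moreover note g = E_closed(1)[OF s(1)] E_closed(1)[OF s(5)]
      ultimately have b: "K.pos (x' \<ominus>\<^bsub>R\<^esub> q2)" "K.pos (x \<ominus>\<^bsub>R\<^esub> q1)" using c by (simp_all add: K.not_lq)
      have "K.nn q1" using Fr_nn[OF Fr_E[OF s(1)]] r1p L.pos_nn by blast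
      then have "K.pos ((x \<ominus>\<^bsub>R\<^esub> q1) \<otimes>\<^bsub>R\<^esub> x' \<oplus>\<^bsub>R\<^esub> q1 \<otimes>\<^bsub>R\<^esub> (x' \<ominus>\<^bsub>R\<^esub> q2))"
        using K.pos_add[OF K.pos_mult[OF b(2) p(2)] K.nn_mult[OF _ K.pos_nn[OF b(1)]]] by blast
      moreover have "(x \<ominus>\<^bsub>R\<^esub> q1) \<otimes>\<^bsub>R\<^esub> x' \<oplus>\<^bsub>R\<^esub> q1 \<otimes>\<^bsub>R\<^esub> (x' \<ominus>\<^bsub>R\<^esub> q2) = x \<otimes>\<^bsub>R\<^esub> x' \<ominus>\<^bsub>R\<^esub> q1 \<otimes>\<^bsub>R\<^esub> q2" using g c by algebra
      ultimately have "\<not> lq (x \<otimes>\<^bsub>R\<^esub> x') q" unfolding s(6) using K.not_lq g c by simp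
      then show False using le by blast
    qed }
qed

lemma Fr_mult_neg_right:
  assumes f: "Fr x y" "Fr x' y'" and m: "Fr (x \<otimes>\<^bsub>R\<^esub> (\<ominus>\<^bsub>R\<^esub> x')) (y \<otimes>\<^bsub>S\<^esub> (\<ominus>\<^bsub>S\<^esub> y'))"
  shows "Fr (x \<otimes>\<^bsub>R\<^esub> x') (y \<otimes>\<^bsub>S\<^esub> y')"
proof -
  note c = FrD(1)[OF f(1)] FrD(1)[OF f(2)] FrD(2)[OF f(1)] FrD(2)[OF f(2)]
  have "\<ominus>\<^bsub>R\<^esub> (x \<otimes>\<^bsub>R\<^esub> (\<ominus>\<^bsub>R\<^esub> x')) = x \<otimes>\<^bsub>R\<^esub> x'" "\<ominus>\<^bsub>S\<^esub> (y \<otimes>\<^bsub>S\<^esub> (\<ominus>\<^bsub>S\<^esub> y')) = y \<otimes>\<^bsub>S\<^esub> y'"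
    using c by algebra+
  then show ?thesis using Fr_neg[OF m] by simp
qed

lemma Fr_mult_pos_left:
  assumes f: "Fr x y" "Fr x' y'" and p: "K.pos x"
  shows "Fr (x \<otimes>\<^bsub>R\<^esub> x') (y \<otimes>\<^bsub>S\<^esub> y')"
proof -
  note c = FrD(1)[OF f(1)] FrD(1)[OF f(2)] FrD(2)[OF f(1)] FrD(2)[OF f(2)]
  from K.tricho[OF c(2)] show ?thesis
  proof (elim disjE)
    assume "K.pos x'"
    then show ?thesis using Fr_mult_pos f p by blast
  next
    assume "x' = \<zero>\<^bsub>R\<^esub>"
    then have "x' = \<zero>\<^bsub>R\<^esub>" "y' = \<zero>\<^bsub>S\<^esub>" using Fr_zero f by blast+
    then show ?thesis using c Fr_E[OF E_zero] by simp
  next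
    assume "K.pos (\<ominus>\<^bsub>R\<^esub> x')"
    then show ?thesis using Fr_mult_neg_right[OF f] Fr_mult_pos[OF f(1) Fr_neg[OF f(2)] p] by blast
  qed
qed

lemma Fr_mult:
  assumes f: "Fr x y" "Fr x' y'"
  shows "Fr (x \<otimes>\<^bsub>R\<^esub> x') (y \<otimes>\<^bsub>S\<^esub> y')"
proof -
  note c = FrD(1)[OF f(1)] FrD(1)[OF f(2)] FrD(2)[OF f(1)] FrD(2)[OF f(2)]
  have comm: "x' \<otimes>\<^bsub>R\<^esub> x = x \<otimes>\<^bsub>R\<^esub> x'" "y' \<otimes>\<^bsub>S\<^esub> y = y \<otimes>\<^bsub>S\<^esub> y'"
    "x' \<otimes>\<^bsub>R\<^esub> (\<ominus>\<^bsub>R\<^esub> x) = (\<ominus>\<^bsub>R\<^esub> x) \<otimes>\<^bsub>R\<^esub> x'" "y' \<otimes>\<^bsub>S\<^esub> (\<ominus>\<^bsub>S\<^esub> y) = (\<ominus>\<^bsub>S\<^esub> y) \<otimes>\<^bsub>S\<^esub> y'"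
    using c by algebra+
  from K.tricho[OF c(1)] show ?thesis
  proof (elim disjE)
    assume "K.pos x"
    then show ?thesis using Fr_mult_pos_left f by blast
  next
    assume "x = \<zero>\<^bsub>R\<^esub>"
    then have "x = \<zero>\<^bsub>R\<^esub>" "y = \<zero>\<^bsub>S\<^esub>" using Fr_zero f by blast+
    then show ?thesis using c Fr_E[OF E_zero] by simp
  next
    assume "K.pos (\<ominus>\<^bsub>R\<^esub> x)"
    from Fr_mult_pos_left[OF Fr_neg[OF f(1)] f(2) this]
    have "Fr (x' \<otimes>\<^bsub>R\<^esub> (\<ominus>\<^bsub>R\<^esub> x)) (y' \<otimes>\<^bsub>S\<^esub> (\<ominus>\<^bsub>S\<^esub> y))" unfolding comm .
    from Fr_mult_neg_right[OF f(2,1) this] show ?thesis unfolding comm .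
  qed
qed

end

section \<open>Ordered fields that are classes\<close>

context ths begin

lemma dterm_partial1:
  assumes A: "is_class A" and f: "\<And>x. x \<in> A \<Longrightarrow> f x \<in> \<S>" and R: "dfn True (\<lambda>v. R (v 0) (v 1))"
    and Rf: "\<And>x z. x \<in> A \<Longrightarrow> z \<in> \<S> \<Longrightarrow> R x z \<longleftrightarrow> z = f x" and t: "dterm True t"
  shows "dterm True (\<lambda>v. if t v \<in> A then f (t v) else emp)"
proof (rule dterm_subst1[OF _ t, of "\<lambda>x. if x \<in> A then f x else emp"])
  have "dfn True (\<lambda>v. (v 1 \<in> A \<and> R (v 1) (v 0)) \<or> (v 1 \<notin> A \<and> v 0 = emp))"
    by (intro dfn_intros emp_S A dfn2[OF R])
  then have "dfn True (\<lambda>v. v 0 = (if v 1 \<in> A then f (v 1) else emp))"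
  proof (rule dfn_back)
    fix v :: "nat \<Rightarrow> 'a" assume v: "range v \<subseteq> \<S>"
    show "(v 1 \<in> A \<and> R (v 1) (v 0)) \<or> (v 1 \<notin> A \<and> v 0 = emp) \<longleftrightarrow> v 0 = (if v 1 \<in> A then f (v 1) else emp)"
      using Rf[of "v 1" "v 0"] envS[OF v, of 0] by auto
  qed
  then show "dterm True (\<lambda>v. if v 0 \<in> A then f (v 0) else emp)"
    unfolding dterm_def by (simp only: One_nat_def) (simp add: f)
qed

lemma dterm_partial2:
  assumes A: "is_class A" and f: "\<And>x y. x \<in> A \<Longrightarrow> y \<in> A \<Longrightarrow> f x y \<in> \<S>" and R: "dfn True (\<lambda>v. R (v 0) (v 1) (v 2))"
    and Rf: "\<And>x y z. x \<in> A \<Longrightarrow> y \<in> A \<Longrightarrow> z \<in> \<S> \<Longrightarrow> R x y z \<longleftrightarrow> z = f x y" and t: "dterm True t" "dterm True s"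
  shows "dterm True (\<lambda>v. if t v \<in> A \<and> s v \<in> A then f (t v) (s v) else emp)"
proof (rule dterm_subst2[OF _ t, of "\<lambda>x y. if x \<in> A \<and> y \<in> A then f x y else emp"])
  have "dfn True (\<lambda>v. (v 1 \<in> A \<and> v 2 \<in> A \<and> R (v 1) (v 2) (v 0)) \<or> (\<not> (v 1 \<in> A \<and> v 2 \<in> A) \<and> v 0 = emp))"
    by (intro dfn_intros emp_S A dfn_subst3[OF R])
  then have "dfn True (\<lambda>v. v 0 = (if v 1 \<in> A \<and> v 2 \<in> A then f (v 1) (v 2) else emp))"
  proof (rule dfn_back)
    fix v :: "nat \<Rightarrow> 'a" assume v: "range v \<subseteq> \<S>"
    show "(v 1 \<in> A \<and> v 2 \<in> A \<and> R (v 1) (v 2) (v 0)) \<or> (\<not> (v 1 \<in> A \<and> v 2 \<in> A) \<and> v 0 = emp) \<longleftrightarrow>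
        v 0 = (if v 1 \<in> A \<and> v 2 \<in> A then f (v 1) (v 2) else emp)"
      using Rf[of "v 1" "v 2" "v 0"] envS[OF v, of 0] by auto
  qed
  then show "dterm True (\<lambda>v. if v 0 \<in> A \<and> v 1 \<in> A then f (v 0) (v 1) else emp)"
    unfolding dterm_def by (simp only: numeral_2_eq_2 One_nat_def) (simp add: f)
qed

lemma binop_graph_iff:
  assumes F: "is_binop mem X F" and x: "x \<epsilon> X" "y \<epsilon> X" "z \<in> \<S>"
  shows "pr (pr x y) z \<epsilon> F \<longleftrightarrow> z = app mem F (pr x y)"
proof -
  have f: "is_function mem F" and d: "pr x y \<in> dom_of mem F" using F x by (auto simp: is_binop_def)
  have "pr x y \<in> \<S>" using x el_S by simp
  then show ?thesis using app_in[OF f d] app_eq[OF f _ x(3)] by blast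
qed

end

locale kfield = ths mem for mem :: "'a \<Rightarrow> 'a \<Rightarrow> bool" (infix "\<epsilon>" 50) +
  fixes K :: "'a ofield" and R :: "'a ring" (structure)
  assumes K: "ordered_field mem K" and R: "R = ring_of mem K"
begin

lemma carrier_R: "carrier R = el (Carr K)"
  and add_R: "x \<oplus> y = fadd mem K x y"
  and mult_R: "x \<otimes> y = fmul mem K x y"
  by (simp_all add: R ring_of_def)

lemma carrier_iff: "x \<epsilon> Carr K \<longleftrightarrow> x \<in> carrier R"
  by (simp add: carrier_R)

lemma carrier_S: "x \<in> carrier R \<Longrightarrow> x \<in> \<S>"
  using el_S by (simp add: carrier_R)

lemma is_class_carrier: "is_class (carrier R)"
  by (simp add: carrier_R)

sublocale ord_field R "fle mem K"
proof -
  have f: "field R" using K by (simp add: ordered_field_def R)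
  interpret field R by (rule f)
  have lin: "linear_order_on (carrier R) {(x, y). x \<in> carrier R \<and> y \<in> carrier R \<and> fle mem K x y}" (is "linear_order_on _ ?r")
    using K by (simp add: ordered_field_def carrier_R)
  have r: "refl_on (carrier R) ?r" "trans ?r" "antisym ?r" "total_on (carrier R) ?r"
    using lin by (simp_all add: linear_order_on_def partial_order_on_def preorder_on_def)
  show "ord_field R (fle mem K)"
  proof
    show "fle mem K x x" if "x \<in> carrier R" for x using r(1) that by (auto simp: refl_on_def)
    then show "fle mem K x y \<or> fle mem K y x" if "x \<in> carrier R" "y \<in> carrier R" for x y
      using r(4) that by (cases "x = y") (auto simp: total_on_def)
    show "x = y" if "x \<in> carrier R" "y \<in> carrier R" "fle mem K x y" "fle mem K y x" for x y
      using r(3) that by (auto simp: antisym_def)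
    show "fle mem K x z" if "x \<in> carrier R" "y \<in> carrier R" "z \<in> carrier R" "fle mem K x y" "fle mem K y z" for x y z
      using transD[OF r(2), of x y z] that by auto
    show "fle mem K (x \<oplus> z) (y \<oplus> z)" if "x \<in> carrier R" "y \<in> carrier R" "z \<in> carrier R" "fle mem K x y" for x y z
      using K that by (auto simp: ordered_field_def carrier_R add_R)
    show "fle mem K \<zero> (x \<otimes> y)" if "x \<in> carrier R" "y \<in> carrier R" "fle mem K \<zero> x" "fle mem K \<zero> y" for x y
      using K that unfolding ordered_field_def mult_R R[symmetric] carrier_R[symmetric] by blast
  qed
qed

lemma zero_S: "\<zero> \<in> \<S>" and one_S: "\<one> \<in> \<S>"
  using carrier_S by simp_all

definition ad :: "'a \<Rightarrow> 'a \<Rightarrow> 'a" where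
  "ad x y = (if x \<in> carrier R \<and> y \<in> carrier R then x \<oplus> y else emp)"

definition mu :: "'a \<Rightarrow> 'a \<Rightarrow> 'a" where
  "mu x y = (if x \<in> carrier R \<and> y \<in> carrier R then x \<otimes> y else emp)"

lemma ad_eq: "x \<in> carrier R \<Longrightarrow> y \<in> carrier R \<Longrightarrow> ad x y = x \<oplus> y"
  and mu_eq: "x \<in> carrier R \<Longrightarrow> y \<in> carrier R \<Longrightarrow> mu x y = x \<otimes> y"
  by (simp_all add: ad_def mu_def)

lemma dfn_lq [dfn_intros]: "dterm True t \<Longrightarrow> dterm True s \<Longrightarrow> dfn True (\<lambda>v. fle mem K (t v) (s v))"
  unfolding fle_def by (intro dfn_intros par_True)

lemma add_graph: "x \<in> carrier R \<Longrightarrow> y \<in> carrier R \<Longrightarrow> z \<in> \<S> \<Longrightarrow> pr (pr x y) z \<epsilon> Add K \<longleftrightarrow> z = x \<oplus> y"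
  and mult_graph: "x \<in> carrier R \<Longrightarrow> y \<in> carrier R \<Longrightarrow> z \<in> \<S> \<Longrightarrow> pr (pr x y) z \<epsilon> Mul K \<longleftrightarrow> z = x \<otimes> y"
proof -
  have "is_binop mem (Carr K) (Add K)" "is_binop mem (Carr K) (Mul K)" using K by (simp_all add: ordered_field_def)
  note * = this[THEN binop_graph_iff]
  show "x \<in> carrier R \<Longrightarrow> y \<in> carrier R \<Longrightarrow> z \<in> \<S> \<Longrightarrow> pr (pr x y) z \<epsilon> Add K \<longleftrightarrow> z = x \<oplus> y"
    "x \<in> carrier R \<Longrightarrow> y \<in> carrier R \<Longrightarrow> z \<in> \<S> \<Longrightarrow> pr (pr x y) z \<epsilon> Mul K \<longleftrightarrow> z = x \<otimes> y"
    using * by (simp_all add: carrier_R add_R mult_R fadd_def fmul_def)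
qed

lemma dfn_add_graph: "dfn True (\<lambda>v. pr (pr (v 0) (v 1)) (v 2) \<epsilon> Add K)"
  and dfn_mult_graph: "dfn True (\<lambda>v. pr (pr (v 0) (v 1)) (v 2) \<epsilon> Mul K)"
  by (intro dfn_intros par_True)+

lemma dterm_ad [dfn_intros]: "dterm True t \<Longrightarrow> dterm True s \<Longrightarrow> dterm True (\<lambda>v. ad (t v) (s v))"
  unfolding ad_def by (rule dterm_partial2[OF is_class_carrier _ dfn_add_graph]) (simp_all add: add_graph carrier_S)

lemma dterm_mu [dfn_intros]: "dterm True t \<Longrightarrow> dterm True s \<Longrightarrow> dterm True (\<lambda>v. mu (t v) (s v))"
  unfolding mu_def by (rule dterm_partial2[OF is_class_carrier _ dfn_mult_graph]) (simp_all add: mult_graph carrier_S)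

definition j :: "'a \<Rightarrow> 'a" where
  "j n = (if n \<in> SN then nrec mem \<zero> (\<lambda>x. x \<oplus> \<one>) n else emp)"

lemma j_rec:
  shows "j emp = \<zero>" "n \<in> SN \<Longrightarrow> j (suc n) = j n \<oplus> \<one>" "n \<in> SN \<Longrightarrow> j n \<in> carrier R"
    "n \<in> SN \<Longrightarrow> k \<in> \<S> \<Longrightarrow> (\<exists>f\<in>\<S>. rec_fun (\<lambda>y. y \<in> carrier R) (\<lambda>y z. z = ad y \<one>) \<zero> f n \<and> pr n k \<epsilon> f) \<longleftrightarrow>
      k = nrec mem \<zero> (\<lambda>x. x \<oplus> \<one>) n"
proof -
  have dA: "dfn True (\<lambda>v. v 0 \<in> carrier R)" and dH: "dfn True (\<lambda>v. v (Suc 0) = ad (v 0) \<one>)"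
    by (intro dfn_intros is_class_carrier one_S)+
  interpret N: nat_rec mem "\<lambda>y. y \<in> carrier R" "\<lambda>y z. z = ad y \<one>" \<zero> "\<lambda>x. x \<oplus> \<one>" True SN
  proof (unfold_locales)
    fix P n assume "dfn True (\<lambda>v. P (v 0))" "n \<in> SN" "P emp" "\<And>m. m \<in> SN \<Longrightarrow> P m \<Longrightarrow> P (suc m)"
    then show "P n" by (rule SN_induct)
  qed (simp_all add: dA dH ad_eq carrier_S)
  show "j emp = \<zero>" "n \<in> SN \<Longrightarrow> j (suc n) = j n \<oplus> \<one>" "n \<in> SN \<Longrightarrow> j n \<in> carrier R"
    unfolding j_def by (simp_all only: N.nrec_0 N.nrec_suc N.nrec_A emp_SN suc_SN if_True)
  show "n \<in> SN \<Longrightarrow> k \<in> \<S> \<Longrightarrow> (\<exists>f\<in>\<S>. rec_fun (\<lambda>y. y \<in> carrier R) (\<lambda>y z. z = ad y \<one>) \<zero> f n \<and> pr n k \<epsilon> f) \<longleftrightarrow>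
      k = nrec mem \<zero> (\<lambda>x. x \<oplus> \<one>) n"
    using N.nrec_iff by blast
qed

lemma dterm_j [dfn_intros]: "dterm True t \<Longrightarrow> dterm True (\<lambda>v. j (t v))"
  unfolding j_def
proof (rule dterm_partial1[OF is_class_SN])
  show "dfn True (\<lambda>v. \<exists>f\<in>\<S>. rec_fun (\<lambda>y. y \<in> carrier R) (\<lambda>y z. z = ad y \<one>) \<zero> f (v 0) \<and> pr (v 0) (v 1) \<epsilon> f)"
    unfolding rec_fun_def by (intro dfn_intros is_class_carrier zero_S one_S pr_S emp_S)
  show "x \<in> SN \<Longrightarrow> nrec mem \<zero> (\<lambda>x. x \<oplus> \<one>) x \<in> \<S>" for x using j_rec(3)[of x] carrier_S by (simp add: j_def)
qed (rule j_rec(4))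

lemma SN_diff: "m \<in> SN \<Longrightarrow> n \<in> SN \<Longrightarrow> (\<exists>k\<in>SN. m = n \<boxplus> k) \<or> (\<exists>k\<in>SN. n = m \<boxplus> k)"
proof -
  assume mn: "m \<in> SN" "n \<in> SN"
  have "k \<in> SN" if "l \<in> SN" "i \<in> SN" "k \<in> \<N>" "l = i \<boxplus> k" for l i k
    using SN_le[OF that(1,3)] that plus_comm[of i k] by (auto simp: nle_iff)
  then show ?thesis using N_diff[of m n] mn by (meson SN_N)
qed

lemma SN_cases:
  assumes n: "n \<in> SN" obtains "n = emp" | m where "m \<in> SN" "n = suc m"
proof (rule N_cases[OF SN_N[OF n]])
  fix m assume m: "m \<in> \<N>" "n = suc m"
  then have "m \<in> SN" using SN_el[OF n] in_suc_self by blast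
  then show thesis using that m by blast
qed

lemma j_plus: "m \<in> SN \<Longrightarrow> n \<in> SN \<Longrightarrow> j (m \<boxplus> n) = j m \<oplus> j n"
proof -
  assume m: "m \<in> SN" and n: "n \<in> SN"
  have "j (m \<boxplus> n) = ad (j m) (j n)"
  proof (rule SN_induct[of "\<lambda>n. j (m \<boxplus> n) = ad (j m) (j n)", OF _ n])
    show "dfn True (\<lambda>v. j (m \<boxplus> v 0) = ad (j m) (j (v 0)))"
      by (intro dfn_intros SN_S m)
    show "j (m \<boxplus> emp) = ad (j m) (j emp)" using m by (simp add: j_rec ad_eq)
    show "j (m \<boxplus> suc k) = ad (j m) (j (suc k))" if "k \<in> SN" "j (m \<boxplus> k) = ad (j m) (j k)" for k
      using m that by (simp add: j_rec ad_eq a_assoc)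
  qed
  then show ?thesis using m n by (simp add: j_rec ad_eq)
qed

lemma j_times: "m \<in> SN \<Longrightarrow> n \<in> SN \<Longrightarrow> j (m \<boxtimes> n) = j m \<otimes> j n"
proof -
  assume m: "m \<in> SN" and n: "n \<in> SN"
  have "j (m \<boxtimes> n) = mu (j m) (j n)"
  proof (rule SN_induct[of "\<lambda>n. j (m \<boxtimes> n) = mu (j m) (j n)", OF _ n])
    show "dfn True (\<lambda>v. j (m \<boxtimes> v 0) = mu (j m) (j (v 0)))"
      by (intro dfn_intros SN_S m)
    show "j (m \<boxtimes> emp) = mu (j m) (j emp)" using m by (simp add: j_rec mu_eq)
    show "j (m \<boxtimes> suc k) = mu (j m) (j (suc k))" if "k \<in> SN" "j (m \<boxtimes> k) = mu (j m) (j k)" for k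
      using m that by (simp add: j_rec mu_eq j_plus r_distr)
  qed
  then show ?thesis using m n by (simp add: j_rec mu_eq)
qed

lemma nn_j: "n \<in> SN \<Longrightarrow> nn (j n)"
proof -
  assume n: "n \<in> SN"
  have "fle mem K \<zero> (j n)"
  proof (rule SN_induct[of "\<lambda>n. fle mem K \<zero> (j n)", OF _ n])
    show "dfn True (\<lambda>v. fle mem K \<zero> (j (v 0)))"
      by (intro dfn_intros zero_S)
    show "fle mem K \<zero> (j emp)" by (simp add: j_rec lq_refl)
    show "fle mem K \<zero> (j (suc k))" if "k \<in> SN" "fle mem K \<zero> (j k)" for k
      using nn_add[of "j k" \<one>] that pos_nn[OF pos_one] by (simp add: j_rec nn_def)
  qed
  then show ?thesis using n by (simp add: nn_def j_rec)
qed

lemma one_lq_j: "n \<in> SN \<Longrightarrow> n = emp \<or> fle mem K \<one> (j n)"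
proof -
  assume n: "n \<in> SN"
  show ?thesis
  proof (rule SN_cases[OF n])
    fix m assume m: "m \<in> SN" "n = suc m"
    have "j m \<oplus> \<one> \<ominus> \<one> = j m" using j_rec(3)[OF m(1)] by algebra
    then show ?thesis using m nn_j[OF m(1)] by (simp add: lq_iff j_rec)
  qed simp
qed

lemma j_lq: "m \<in> SN \<Longrightarrow> n \<in> SN \<Longrightarrow> fle mem K (j m) (j n) \<longleftrightarrow> nle mem m n"
proof -
  assume mn: "m \<in> SN" "n \<in> SN"
  have d: "j (m \<boxplus> k) \<ominus> j m = j k" if "m \<in> SN" "k \<in> SN" for m k
  proof -
    have "(j m \<oplus> j k) \<ominus> j m = j k" using j_rec(3)[OF that(1)] j_rec(3)[OF that(2)] by algebra
    then show ?thesis using that by (simp add: j_plus)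
  qed
  have up: "fle mem K (j m) (j (m \<boxplus> k))" if "m \<in> SN" "k \<in> SN" for m k
    using d[OF that] nn_j that by (simp add: lq_iff j_rec)
  from SN_diff[OF mn] show ?thesis
  proof
    assume "\<exists>k\<in>SN. n = m \<boxplus> k"
    then show ?thesis using up mn nle_iff[of m n] by auto
  next
    assume "\<exists>k\<in>SN. m = n \<boxplus> k"
    then obtain k where k: "k \<in> SN" "m = n \<boxplus> k" by blast
    show ?thesis
    proof (cases "k = emp")
      case True
      then show ?thesis using k mn by (simp add: lq_refl j_rec)
    next
      case False
      have "\<not> nle mem m n" using nle_antisym[of m n] N_lt_plus[of n k] N_irrefl[of n] k mn False by (auto simp: nle_def)
      moreover have "fle mem K \<one> (j k)" using one_lq_j[OF k(1)] False by blast
      then have "j k \<noteq> \<zero>" using lq_antisym[of \<zero> \<one>] pos_one by (auto simp: pos_def nn_def)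
      then have "pos (j m \<ominus> j n)" using d[OF mn(2) k(1)] k nn_j by (simp add: pos_def)
      then have "\<not> fle mem K (j m) (j n)" using not_lq[of "j m" "j n"] mn by (simp add: j_rec)
      ultimately show ?thesis by blast
    qed
  qed
qed

lemma j_floor_ex:
  assumes c: "c \<in> carrier R" "fle mem K \<zero> c" and k: "k \<in> SN" "fle mem K c (j k)"
  shows "\<exists>m\<in>SN. fle mem K (j m) c \<and> \<not> fle mem K (j m \<oplus> \<one>) c"
proof (rule ccontr)
  assume n: "\<not> ?thesis"
  have s: "suc k \<in> SN" using k by simp
  have "fle mem K (j (suc k)) c"
  proof (rule SN_induct[of "\<lambda>n. fle mem K (j n) c", OF _ s])
    show "dfn True (\<lambda>v. fle mem K (j (v 0)) c)"
      by (intro dfn_intros carrier_S[OF c(1)])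
    show "fle mem K (j emp) c" using c by (simp add: j_rec)
    show "fle mem K (j (suc m)) c" if "m \<in> SN" "fle mem K (j m) c" for m using n that by (auto simp: j_rec)
  qed
  then have "fle mem K (j (suc k)) (j k)" using lq_trans[of "j (suc k)" c "j k"] k c by (simp add: j_rec(3))
  then have "nle mem (suc k) k" using j_lq[OF s k(1)] by simp
  then show False using nle_antisym[of k "suc k"] N_irrefl[of k] in_suc_self[of k] k by (auto simp: nle_def)
qed

sublocale rat_field R "fle mem K" SN emp "suc emp" "(\<boxplus>)" "(\<boxtimes>)" "nle mem" j
  by unfold_locales
    (use SN_diff j_rec j_plus j_times j_lq one_lq_j j_floor_ex in \<open>simp_all add: j_rec(2)[OF emp_SN]\<close>)

lemma rep_iff: "rep q a b c \<longleftrightarrow> q \<in> carrier R \<and> a \<in> SN \<and> b \<in> SN \<and> c \<in> SN \<and> c \<noteq> emp \<and> ad (mu (j c) q) (j b) = j a"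
proof -
  have "j c \<otimes> q = j a \<ominus> j b \<longleftrightarrow> j c \<otimes> q \<oplus> j b = j a" if "q \<in> carrier R" "a \<in> SN" "b \<in> SN" "c \<in> SN"
  proof -
    note c = that(1) that(2-4)[THEN j_rec(3)]
    have "(j a \<ominus> j b) \<oplus> j b = j a" "(j c \<otimes> q \<oplus> j b) \<ominus> j b = j c \<otimes> q" using c by algebra+
    then show ?thesis by metis
  qed
  then show ?thesis unfolding rep_def by (auto simp: ad_eq mu_eq j_rec)
qed

lemma dfn_rep [dfn_intros]:
  "dterm True t \<Longrightarrow> dterm True a \<Longrightarrow> dterm True b \<Longrightarrow> dterm True c \<Longrightarrow> dfn True (\<lambda>v. rep (t v) (a v) (b v) (c v))"
  unfolding rep_iff by (intro dfn_intros is_class_carrier is_class_SN emp_S)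

lemma thin_Rat: "thin_class Rat"
proof -
  define A where "A = {p \<in> \<S>. \<exists>a\<in>{p \<in> \<S>. \<exists>a\<in>SN. \<exists>b\<in>SN. p = pr a b}. \<exists>c\<in>SN. p = pr a c}"
  have A: "thin_class A" unfolding A_def by (intro thin_times thin_SN)
  have "thin_class {q \<in> \<S>. \<exists>i\<in>A. \<exists>a\<in>\<S>. \<exists>b\<in>\<S>. \<exists>c\<in>\<S>. i = pr (pr a b) c \<and> rep q a b c}"
  proof (rule thin_image[OF A])
    show "dfn True (\<lambda>v. \<exists>a\<in>\<S>. \<exists>b\<in>\<S>. \<exists>c\<in>\<S>. v 0 = pr (pr a b) c \<and> rep (v 1) a b c)"
      by (intro dfn_intros)
    show "\<exists>a\<in>\<S>. \<exists>b\<in>\<S>. \<exists>c\<in>\<S>. i = pr (pr a b) c \<and> rep y a b c \<Longrightarrow>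
        \<exists>a\<in>\<S>. \<exists>b\<in>\<S>. \<exists>c\<in>\<S>. i = pr (pr a b) c \<and> rep z a b c \<Longrightarrow> y = z" for i y z
      using rep_unique by (auto simp: pr_inj)
  qed
  also have "{q \<in> \<S>. \<exists>i\<in>A. \<exists>a\<in>\<S>. \<exists>b\<in>\<S>. \<exists>c\<in>\<S>. i = pr (pr a b) c \<and> rep q a b c} = Rat"
  proof -
    have "pr (pr a b) c \<in> A" "q \<in> \<S>" "a \<in> \<S>" "b \<in> \<S>" "c \<in> \<S>" if r: "rep q a b c" for q a b c
    proof -
      have n: "a \<in> SN" "b \<in> SN" "c \<in> SN" "q \<in> carrier R" using r by (auto simp: rep_def)
      show "pr (pr a b) c \<in> A" unfolding A_def using n(1-3) pr_S SN_S by blast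
      show "q \<in> \<S>" "a \<in> \<S>" "b \<in> \<S>" "c \<in> \<S>" using n carrier_S by simp_all
    qed
    note d = this
    show ?thesis
    proof (rule Set.set_eqI, rule iffI)
      fix q assume "q \<in> Rat"
      then obtain a b c where r: "rep q a b c" by (rule RatE)
      then show "q \<in> {q \<in> \<S>. \<exists>i\<in>A. \<exists>a\<in>\<S>. \<exists>b\<in>\<S>. \<exists>c\<in>\<S>. i = pr (pr a b) c \<and> rep q a b c}"
        using d[OF r] by (intro CollectI conjI bexI[of _ "pr (pr a b) c"] bexI[of _ a] bexI[of _ b] bexI[of _ c] refl)
    qed (auto intro: RatI)
  qed
  finally show ?thesis .
qed

lemma is_class_Rat: "is_class Rat"
  using thin_Rat by (rule thin_class_class)

lemma far_iff: "x \<in> carrier R \<Longrightarrow> y \<in> carrier R \<Longrightarrow> far x y \<longleftrightarrow> (\<exists>n\<in>SN. \<not> fle mem K (mu (j n) y) (ad (mu (j n) x) \<one>))"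
proof -
  assume c: "x \<in> carrier R" "y \<in> carrier R"
  have "pos (j n \<otimes> (y \<ominus> x) \<ominus> \<one>) \<longleftrightarrow> \<not> fle mem K (j n \<otimes> y) (j n \<otimes> x \<oplus> \<one>)" if "n \<in> SN" for n
  proof -
    have "j n \<otimes> (y \<ominus> x) \<ominus> \<one> = j n \<otimes> y \<ominus> (j n \<otimes> x \<oplus> \<one>)" using c j_rec(3)[OF that] by algebra
    then show ?thesis using not_lq[of "j n \<otimes> y" "j n \<otimes> x \<oplus> \<one>"] c j_rec(3)[OF that] by simp
  qed
  then show ?thesis unfolding far_def using c by (simp add: mu_eq ad_eq j_rec)
qed

lemma dfn_far [dfn_intros]:
  assumes "dterm True t" "dterm True s"
  shows "dfn True (\<lambda>v. t v \<in> carrier R \<and> s v \<in> carrier R \<and> far (t v) (s v))"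
proof -
  have "dfn True (\<lambda>v. t v \<in> carrier R \<and> s v \<in> carrier R \<and> (\<exists>n\<in>SN. \<not> fle mem K (mu (j n) (s v)) (ad (mu (j n) (t v)) \<one>)))"
    by (intro dfn_intros is_class_carrier is_class_SN one_S assms[THEN dterm_shift] assms)
  then show ?thesis by (rule dfn_back) (auto simp: far_iff)
qed

lemma is_class_bdd: "is_class {x. bdd x}"
proof -
  have "is_class {x \<in> \<S>. x \<in> carrier R \<and> (\<exists>n\<in>SN. fle mem K x (j n) \<and> fle mem K \<zero> (ad (j n) x))}"
    by (rule comprehension) (intro dfn_intros is_class_carrier is_class_SN zero_S)
  also have "\<dots> = {x. bdd x}"
  proof -
    have "fle mem K x (j n) \<and> fle mem K \<zero> (ad (j n) x) \<longleftrightarrow> nn (j n \<ominus> x) \<and> nn (j n \<oplus> x)"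
      if "x \<in> carrier R" "n \<in> SN" for x n
      using that lq_iff[of x "j n"] j_rec(3)[of n] by (simp add: ad_eq nn_def)
    then show ?thesis unfolding bdd_def using carrier_S by blast
  qed
  finally show ?thesis .
qed

end

section \<open>Isomorphisms and the prime field\<close>

context ths begin

lemma isomorphic_graphI:
  assumes G: "dfn True (\<lambda>v. G (v 0) (v 1))"
    and dom: "\<And>x y. G x y \<Longrightarrow> x \<epsilon> Carr K \<and> y \<epsilon> Carr L"
    and total: "\<And>x. x \<epsilon> Carr K \<Longrightarrow> \<exists>y. G x y" and onto: "\<And>y. y \<epsilon> Carr L \<Longrightarrow> \<exists>x. G x y"
    and unique: "\<And>x y y'. G x y \<Longrightarrow> G x y' \<Longrightarrow> y = y'" and inj: "\<And>x x' y. G x y \<Longrightarrow> G x' y \<Longrightarrow> x = x'"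
    and hom: "\<And>x y x' y'. G x y \<Longrightarrow> G x' y' \<Longrightarrow> G (fadd mem K x x') (fadd mem L y y')"
      "\<And>x y x' y'. G x y \<Longrightarrow> G x' y' \<Longrightarrow> G (fmul mem K x x') (fmul mem L y y')"
      "\<And>x y x' y'. G x y \<Longrightarrow> G x' y' \<Longrightarrow> fle mem K x x' \<longleftrightarrow> fle mem L y y'"
  shows "isomorphic mem K L"
proof -
  define F where "F = cls {p \<in> \<S>. \<exists>x\<in>\<S>. \<exists>y\<in>\<S>. p = pr x y \<and> G x y}"
  have GS: "x \<in> \<S> \<and> y \<in> \<S>" if "G x y" for x y using dom[OF that] el_S by blast
  have "is_class {p \<in> \<S>. \<exists>x\<in>\<S>. \<exists>y\<in>\<S>. p = pr x y \<and> G x y}"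
    by (rule comprehension) (intro dfn_intros dfn2[OF G])
  then have elF: "el F = {p \<in> \<S>. \<exists>x\<in>\<S>. \<exists>y\<in>\<S>. p = pr x y \<and> G x y}" unfolding F_def by (rule el_cls)
  then have inF: "p \<epsilon> F \<longleftrightarrow> p \<in> \<S> \<and> (\<exists>x\<in>\<S>. \<exists>y\<in>\<S>. p = pr x y \<and> G x y)" for p using in_el[of p F] by simp
  have prF: "pr x y \<epsilon> F \<longleftrightarrow> G x y" if "x \<in> \<S>" "y \<in> \<S>" for x y
    using that by (auto simp: inF pr_inj)
  have f: "is_function mem F"
    unfolding is_function_def elF using unique by (auto simp: prF)
  have d: "dom_of mem F = el (Carr K)"
  proof (rule Set.set_eqI, rule iffI)
    fix x assume "x \<in> dom_of mem F"
    then obtain y where "x \<in> \<S>" "y \<in> \<S>" "pr x y \<epsilon> F" by (auto simp: dom_of_def)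
    then show "x \<in> el (Carr K)" using prF dom by simp
  next
    fix x assume "x \<in> el (Carr K)"
    then obtain y where y: "G x y" using total by auto
    note s = GS[OF y]
    then show "x \<in> dom_of mem F" using y prF[of x y] unfolding dom_of_def by (intro CollectI conjI bexI[of _ y]) simp_all
  qed
  have app: "app mem F x = y" if "G x y" for x y
    using app_eq[OF f, of x y] GS[OF that] prF[of x y] that by simp
  have G': "G x (app mem F x)" if "x \<epsilon> Carr K" for x using total[OF that] app by blast
  show ?thesis
    unfolding isomorphic_def
  proof (intro exI[of _ F] conjI f d ballI)
    show "bij_betw (app mem F) (el (Carr K)) (el (Carr L))"
      unfolding bij_betw_def
    proof (intro conjI inj_onI Set.set_eqI iffI)
      fix x x' assume "x \<in> el (Carr K)" "x' \<in> el (Carr K)" "app mem F x = app mem F x'"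
      then show "x = x'" using G'[of x] G'[of x'] inj by simp
    next
      fix y assume "y \<in> app mem F ` el (Carr K)"
      then obtain x where "x \<epsilon> Carr K" "y = app mem F x" by auto
      then show "y \<in> el (Carr L)" using dom[OF G'[of x]] by simp
    next
      fix y assume "y \<in> el (Carr L)"
      then obtain x where "G x y" using onto by auto
      then show "y \<in> app mem F ` el (Carr K)" using app dom by (intro image_eqI[of _ _ x]) auto
    qed
    fix x x' assume "x \<in> el (Carr K)" "x' \<in> el (Carr K)"
    then have g: "G x (app mem F x)" "G x' (app mem F x')" using G' by simp_all
    show "app mem F (fadd mem K x x') = fadd mem L (app mem F x) (app mem F x')"
      "app mem F (fmul mem K x x') = fmul mem L (app mem F x) (app mem F x')"
      "fle mem K x x' \<longleftrightarrow> fle mem L (app mem F x) (app mem F x')"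
      using app[OF hom(1)[OF g]] app[OF hom(2)[OF g]] hom(3)[OF g] by simp_all
  qed
qed

end

context kfield begin

lemma substructure_ops:
  assumes P: "el P \<subseteq> carrier R" and c: "\<And>x y. x \<epsilon> P \<Longrightarrow> y \<epsilon> P \<Longrightarrow> x \<oplus> y \<epsilon> P" "\<And>x y. x \<epsilon> P \<Longrightarrow> y \<epsilon> P \<Longrightarrow> x \<otimes> y \<epsilon> P"
  shows "Carr (substructure mem K P) = P"
    "x \<epsilon> P \<Longrightarrow> y \<epsilon> P \<Longrightarrow> fadd mem (substructure mem K P) x y = x \<oplus> y"
    "x \<epsilon> P \<Longrightarrow> y \<epsilon> P \<Longrightarrow> fmul mem (substructure mem K P) x y = x \<otimes> y"
    "x \<epsilon> P \<Longrightarrow> y \<epsilon> P \<Longrightarrow> fle mem (substructure mem K P) x y \<longleftrightarrow> fle mem K x y"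
proof -
  have e: "substructure mem K P = mkfield P (\<lambda>x y. x \<oplus> y) (\<lambda>x y. x \<otimes> y) (fle mem K)"
    unfolding substructure_def mkfield_def add_R mult_R by simp
  have PR: "x \<in> carrier R" if "x \<epsilon> P" for x using P that by auto
  have L: "dfn True (\<lambda>v. fle mem K (v 0) (v 1))" by (intro dfn_intros)
  show "Carr (substructure mem K P) = P" by (simp add: e)
  note M = mkfield_class[of P "\<lambda>x y. x \<oplus> y" "\<lambda>x y z. pr (pr x y) z \<epsilon> Add K" "\<lambda>x y. x \<otimes> y" "\<lambda>x y z. pr (pr x y) z \<epsilon> Mul K" "fle mem K" "fle mem K",
      OF c(1) dfn_add_graph add_graph c(2) dfn_mult_graph mult_graph L refl, folded e]
  show "x \<epsilon> P \<Longrightarrow> y \<epsilon> P \<Longrightarrow> fadd mem (substructure mem K P) x y = x \<oplus> y"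
    "x \<epsilon> P \<Longrightarrow> y \<epsilon> P \<Longrightarrow> fmul mem (substructure mem K P) x y = x \<otimes> y"
    "x \<epsilon> P \<Longrightarrow> y \<epsilon> P \<Longrightarrow> fle mem (substructure mem K P) x y \<longleftrightarrow> fle mem K x y"
    using M(2-4) PR by blast+
qed

lemma in_cls_Rat: "q \<epsilon> cls Rat \<longleftrightarrow> q \<in> Rat"
  using el_cls[OF is_class_Rat] in_el[of q "cls Rat"] by simp

lemma Rat_substructure:
  shows "Carr (substructure mem K (cls Rat)) = cls Rat"
    "x \<in> Rat \<Longrightarrow> y \<in> Rat \<Longrightarrow> fadd mem (substructure mem K (cls Rat)) x y = x \<oplus> y"
    "x \<in> Rat \<Longrightarrow> y \<in> Rat \<Longrightarrow> fmul mem (substructure mem K (cls Rat)) x y = x \<otimes> y"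
    "x \<in> Rat \<Longrightarrow> y \<in> Rat \<Longrightarrow> fle mem (substructure mem K (cls Rat)) x y \<longleftrightarrow> fle mem K x y"
proof -
  have "el (cls Rat) \<subseteq> carrier R" using Rat_closed by (auto simp: in_cls_Rat)
  note * = substructure_ops[OF this, unfolded in_cls_Rat, OF Rat_add Rat_mult]
  show "Carr (substructure mem K (cls Rat)) = cls Rat"
    "x \<in> Rat \<Longrightarrow> y \<in> Rat \<Longrightarrow> fadd mem (substructure mem K (cls Rat)) x y = x \<oplus> y"
    "x \<in> Rat \<Longrightarrow> y \<in> Rat \<Longrightarrow> fmul mem (substructure mem K (cls Rat)) x y = x \<otimes> y"
    "x \<in> Rat \<Longrightarrow> y \<in> Rat \<Longrightarrow> fle mem (substructure mem K (cls Rat)) x y \<longleftrightarrow> fle mem K x y"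
    using * by blast+
qed

lemma prime_subfield_Rat: "prime_subfield mem K (cls Rat)"
  unfolding prime_subfield_def R[symmetric] el_cls[OF is_class_Rat]
proof (intro conjI allI impI)
  show "subfield Rat R"
  proof (rule subfieldI')
    show "subring Rat R"
      by (rule subringI) (use Rat_closed Rat_one Rat_neg Rat_mult Rat_add in blast)+
    fix k assume "k \<in> Rat - {\<zero>}"
    then have k: "k \<in> Rat" "k \<noteq> \<zero>" "k \<in> carrier R" using Rat_closed by auto
    then have "k \<in> Units R" using field_Units by simp
    then show "inv k \<in> Rat" using Rat_inv[OF k(1,2), of "inv k"] by simp
  qed
  fix Q assume Q: "subfield (el Q) R"
  note sub = subringE[OF subfieldE(1)[OF Q]]
  have jQ: "j n \<in> el Q" if n: "n \<in> SN" for n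
  proof (rule SN_induct[of "\<lambda>n. j n \<in> el Q", OF _ n])
    show "dfn True (\<lambda>v. j (v 0) \<in> el Q)" by (intro dfn_intros is_class_el)
    show "j emp \<in> el Q" using sub(2) by (simp add: j_rec)
    show "j (suc m) \<in> el Q" if "m \<in> SN" "j m \<in> el Q" for m using sub(3) sub(7)[of "j m" \<one>] that by (simp add: j_rec)
  qed
  show "Rat \<subseteq> el Q"
  proof
    fix q assume "q \<in> Rat"
    then obtain a b c where r: "rep q a b c" by (rule RatE)
    then have n: "a \<in> SN" "b \<in> SN" "c \<in> SN" "c \<noteq> emp" and q: "q \<in> carrier R" and e: "j c \<otimes> q = j a \<oplus> \<ominus> j b"
      by (auto simp: rep_def a_minus_def)
    have "j c \<otimes> q \<in> el Q" unfolding e using sub(5,7) jQ n by blast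
    moreover have "j c \<in> el Q - {\<zero>}" using jQ n j_eq_0 by blast
    ultimately show "q \<in> el Q" using subfield_m_inv_simprule[OF Q] q by blast
  qed
qed

lemma dense_Rat: "arch \<Longrightarrow> dense_in mem K (cls Rat)"
  unfolding dense_in_def el_cls[OF is_class_Rat]
proof (intro ballI impI)
  fix x y assume a: arch and x: "x \<in> el (Carr K)" "y \<in> el (Carr K)" and xy: "fle mem K x y \<and> x \<noteq> y"
  have c: "x \<in> carrier R" "y \<in> carrier R" using x by (simp_all add: carrier_R)
  then have "\<not> fle mem K y x" using xy lq_antisym by blast
  then obtain q where q: "q \<in> Rat" "\<not> fle mem K q x" "\<not> fle mem K y q" using arch_dense[OF a c] by blast
  then show "\<exists>q\<in>Rat. fle mem K x q \<and> x \<noteq> q \<and> fle mem K q y \<and> q \<noteq> y"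
    using lq_linear lq_refl c Rat_closed[OF q(1)] by (intro bexI[of _ q]) blast+
qed

lemma sup_ex:
  assumes r: "real_field mem K" and X: "is_class X" "X \<subseteq> carrier R" "x \<in> X"
    and b: "b \<in> carrier R" "\<And>x. x \<in> X \<Longrightarrow> fle mem K x b"
  obtains s where "s \<in> carrier R" "\<And>x. x \<in> X \<Longrightarrow> fle mem K x s"
    "\<And>b. b \<in> carrier R \<Longrightarrow> (\<And>x. x \<in> X \<Longrightarrow> fle mem K x b) \<Longrightarrow> fle mem K s b"
proof -
  have eX: "el (cls X) = X" using X(1) by (rule el_cls)
  have ub: "is_upper_bound mem K (cls X) b \<longleftrightarrow> b \<in> carrier R \<and> (\<forall>x\<in>X. fle mem K x b)" for b
    unfolding is_upper_bound_def eX carrier_iff by blast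
  have "\<exists>s. is_supremum mem K (cls X) s"
    using r X b ub unfolding real_field_def carrier_R[symmetric] by (metis eX empty_iff)
  then show thesis using that unfolding is_supremum_def ub by blast
qed

lemma real_arch:
  assumes r: "real_field mem K"
  shows arch
proof (rule ccontr)
  assume "\<not> arch"
  then obtain b where b: "b \<in> carrier R" "\<And>n. n \<in> SN \<Longrightarrow> \<not> fle mem K b (j n)" by (auto simp: arch_def)
  define X where "X = {y \<in> \<S>. \<exists>n\<in>SN. y = j n}"
  have X: "is_class X" unfolding X_def by (rule comprehension) (intro dfn_intros is_class_SN)
  have jX: "j n \<in> X" if "n \<in> SN" for n using that j_rec(3) carrier_S by (auto simp: X_def)
  have XR: "X \<subseteq> carrier R" using j_rec(3) by (auto simp: X_def)
  have Xb: "fle mem K x b" if "x \<in> X" for x using that b lq_linear[of x b] XR by (auto simp: X_def)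
  obtain s where s: "s \<in> carrier R" "\<And>x. x \<in> X \<Longrightarrow> fle mem K x s"
    "\<And>b. b \<in> carrier R \<Longrightarrow> (\<And>x. x \<in> X \<Longrightarrow> fle mem K x b) \<Longrightarrow> fle mem K s b"
    using sup_ex[OF r X XR jX[OF emp_SN] b(1) Xb] by blast
  have "fle mem K x (s \<ominus> \<one>)" if x: "x \<in> X" for x
  proof -
    obtain n where n: "n \<in> SN" "x = j n" using x by (auto simp: X_def)
    then have "fle mem K (j n \<oplus> \<one>) s" using s(2)[OF jX[of "suc n"]] by (simp add: j_rec)
    moreover have "s \<ominus> (j n \<oplus> \<one>) = (s \<ominus> \<one>) \<ominus> j n" using s(1) j_rec(3)[OF n(1)] by algebra
    ultimately show ?thesis using s(1) j_rec(3)[OF n(1)] n by (simp add: lq_iff)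
  qed
  then have "fle mem K s (s \<ominus> \<one>)" using s by simp
  moreover have "(s \<ominus> \<one>) \<ominus> s = \<ominus> \<one>" using s(1) by algebra
  ultimately show False using s(1) pos_not_nn[OF pos_one] by (simp add: lq_iff)
qed

end

context ths begin

theorem real_fields_isomorphic:
  assumes K: "real_field mem K" and L: "real_field mem L"
  shows "isomorphic mem K L"
proof -
  interpret A: kfield mem K "ring_of mem K" using K by unfold_locales (simp_all add: real_field_def)
  interpret B: kfield mem L "ring_of mem L" using L by unfold_locales (simp_all add: real_field_def)
  interpret P: arch_pair "ring_of mem K" "fle mem K" "ring_of mem L" "fle mem L" SN emp "suc emp" "(\<boxplus>)" "(\<boxtimes>)" "nle mem" A.j B.j
    by unfold_locales (rule A.real_arch[OF K] B.real_arch[OF L])+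
  have E: "dfn True (\<lambda>v. P.E (t v) (s v))" if "dterm True t" "dterm True s" for t s
  proof -
    have "dfn True (\<lambda>v. \<exists>a\<in>SN. \<exists>b\<in>SN. \<exists>c\<in>SN. A.rep (t v) a b c \<and> B.rep (s v) a b c)"
      by (intro dfn_intros is_class_SN that dterm_shift)
    then show ?thesis by (rule dfn_back) (auto simp: P.E_def A.rep_def)
  qed
  have ES: "q \<in> \<S>" "r \<in> \<S>" if "P.E q r" for q r using P.E_closed[OF that] A.carrier_S B.carrier_S by blast+
  show ?thesis
  proof (rule isomorphic_graphI)
    have "dfn True (\<lambda>v. v 0 \<in> carrier (ring_of mem K) \<and> v 1 \<in> carrier (ring_of mem L) \<and>
      (\<forall>q\<in>\<S>. \<forall>r\<in>\<S>. P.E q r \<longrightarrow> (fle mem K q (v 0) \<longrightarrow> fle mem L r (v 1)) \<and> (fle mem K (v 0) q \<longrightarrow> fle mem L (v 1) r)))"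
      by (intro dfn_intros E A.is_class_carrier B.is_class_carrier)
    then show "dfn True (\<lambda>v. P.Fr (v 0) (v 1))" by (rule dfn_back) (use ES in \<open>unfold P.Fr_def, blast\<close>)
    show "P.Fr x y \<Longrightarrow> x \<epsilon> Carr K \<and> y \<epsilon> Carr L" for x y
      using P.FrD(1,2)[of x y] by (simp add: A.carrier_R B.carrier_R)
    show "\<exists>y. P.Fr x y" if "x \<epsilon> Carr K" for x
    proof -
      have x: "x \<in> carrier (ring_of mem K)" using that by (simp add: A.carrier_R)
      define X where "X = {r \<in> \<S>. \<exists>q\<in>\<S>. P.E q r \<and> fle mem K q x}"
      have cl: "is_class X" unfolding X_def by (rule comprehension) (intro dfn_intros E A.carrier_S[OF x])
      have Xi: "r \<in> X" if "P.E q r" "fle mem K q x" for q r using that ES[OF that(1)] by (auto simp: X_def)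
      have XL: "X \<subseteq> carrier (ring_of mem L)" using P.E_closed by (auto simp: X_def)
      obtain q0 r0 where 0: "P.E q0 r0" "fle mem K q0 x" using P.lower_bounded(1)[OF x] by blast
      obtain b where b: "b \<in> carrier (ring_of mem L)" "\<And>r. r \<in> X \<Longrightarrow> fle mem L r b"
        using P.lower_bounded(2)[OF x] unfolding X_def by blast
      obtain s where s: "s \<in> carrier (ring_of mem L)" "\<And>r. r \<in> X \<Longrightarrow> fle mem L r s"
        "\<And>b. b \<in> carrier (ring_of mem L) \<Longrightarrow> (\<And>x. x \<in> X \<Longrightarrow> fle mem L x b) \<Longrightarrow> fle mem L s b"
        using B.sup_ex[OF L cl XL Xi[OF 0] b] by blast
      have "P.Fr x s"
      proof (rule P.Fr_supI[OF x s(1)])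
        show "fle mem L s b" if "b \<in> carrier (ring_of mem L)" "\<And>q r. P.E q r \<Longrightarrow> fle mem K q x \<Longrightarrow> fle mem L r b" for b
          using s(3)[OF that(1)] that(2) unfolding X_def by blast
      qed (use s(2) Xi in blast)
      then show ?thesis by blast
    qed
    show "\<exists>x. P.Fr x y" if "y \<epsilon> Carr L" for y
    proof -
      have y: "y \<in> carrier (ring_of mem L)" using that by (simp add: B.carrier_R)
      define X where "X = {q \<in> \<S>. \<exists>r\<in>\<S>. P.E q r \<and> fle mem L r y}"
      have cl: "is_class X" unfolding X_def by (rule comprehension) (intro dfn_intros E B.carrier_S[OF y])
      have Xi: "q \<in> X" if "P.E q r" "fle mem L r y" for q r using that ES[OF that(1)] by (auto simp: X_def)
      have XK: "X \<subseteq> carrier (ring_of mem K)" using P.E_closed by (auto simp: X_def)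
      obtain q0 r0 where 0: "P.E q0 r0" "fle mem L r0 y" using P.lower_bounded'(1)[OF y] by blast
      obtain b where b: "b \<in> carrier (ring_of mem K)" "\<And>q. q \<in> X \<Longrightarrow> fle mem K q b"
        using P.lower_bounded'(2)[OF y] unfolding X_def by blast
      obtain s where s: "s \<in> carrier (ring_of mem K)" "\<And>q. q \<in> X \<Longrightarrow> fle mem K q s"
        "\<And>b. b \<in> carrier (ring_of mem K) \<Longrightarrow> (\<And>x. x \<in> X \<Longrightarrow> fle mem K x b) \<Longrightarrow> fle mem K s b"
        using A.sup_ex[OF K cl XK Xi[OF 0] b] by blast
      have "P.Fr s y"
      proof (rule P.Fr_supI'[OF y s(1)])
        show "fle mem K s b" if "b \<in> carrier (ring_of mem K)" "\<And>r q. P.E q r \<Longrightarrow> fle mem L r y \<Longrightarrow> fle mem K q b" for b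
          using s(3)[OF that(1)] that(2) unfolding X_def by blast
      qed (use s(2) Xi in blast)
      then show ?thesis by blast
    qed
    show "P.Fr x y \<Longrightarrow> P.Fr x y' \<Longrightarrow> y = y'" for x y y' by (rule P.Fr_unique)
    show "P.Fr x y \<Longrightarrow> P.Fr x' y \<Longrightarrow> x = x'" for x x' y by (rule P.Fr_inj)
    fix x y x' y' assume f: "P.Fr x y" "P.Fr x' y'"
    show "P.Fr (fadd mem K x x') (fadd mem L y y')" using P.Fr_add[OF f] by (simp add: A.add_R B.add_R)
    show "P.Fr (fmul mem K x x') (fmul mem L y y')" using P.Fr_mult[OF f] by (simp add: A.mult_R B.mult_R)
    show "fle mem K x x' \<longleftrightarrow> fle mem L y y'" using P.Fr_mono[OF f] P.Fr_mono'[OF f] by blast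
  qed
qed

lemma kfield_rationals: "kfield mem (rationals mem) (ring_of mem (rationals mem))"
  by unfold_locales (simp_all add: rationals_field)

interpretation Q: kfield mem "rationals mem" "ring_of mem (rationals mem)"
  by (rule kfield_rationals)

lemma rationals_ring:
  shows "carrier (ring_of mem (rationals mem)) = \<Q>"
    "p \<in> \<Q> \<Longrightarrow> q \<in> \<Q> \<Longrightarrow> Q.ad p q = qadd mem p q"
    "p \<in> \<Q> \<Longrightarrow> q \<in> \<Q> \<Longrightarrow> Q.mu p q = qmul mem p q"
  by (simp_all add: Q.carrier_R rationals_ops Q.ad_def Q.mu_def Q.add_R Q.mult_R)

lemma frac_nat: "n \<in> \<N> \<Longrightarrow> frac n emp (suc emp) = pr (pr n emp) (pr (suc emp) emp)"
proof -
  assume n: "n \<in> \<N>"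
  have "ncoprime (n \<boxplus> emp) (suc emp)" unfolding ncoprime_def using times_eq_1 by metis
  then have "pr (pr n emp) (pr (suc emp) emp) \<in> \<Q>" unfolding fractions_iff using n by (intro bexI[of _ n] bexI[of _ emp] bexI[of _ "suc emp"]) simp_all
  then show ?thesis using frac_reduced(1) n by simp
qed

lemma rationals_j: "n \<in> SN \<Longrightarrow> Q.j n = frac n emp (suc emp)"
proof -
  assume n: "n \<in> SN"
  have "Q.j n = pr (pr n emp) (pr (suc emp) emp)"
  proof (rule SN_induct[of "\<lambda>n. Q.j n = pr (pr n emp) (pr (suc emp) emp)", OF _ n])
    show "dfn True (\<lambda>v. Q.j (v 0) = pr (pr (v 0) emp) (pr (suc emp) emp))"
      by (intro dfn_intros pr_S suc_S emp_S)
    show "Q.j emp = pr (pr emp emp) (pr (suc emp) emp)"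
      by (simp add: Q.j_rec(1) rationals_field(2) frac_nat)
    fix m assume m: "m \<in> SN" "Q.j m = pr (pr m emp) (pr (suc emp) emp)"
    have Q: "frac m emp (suc emp) \<in> \<Q>" "frac (suc emp) emp (suc emp) \<in> \<Q>" using m by (simp_all add: frac_props(1))
    have "Q.j (suc m) = Q.ad (frac m emp (suc emp)) (frac (suc emp) emp (suc emp))"
      using m Q by (simp add: Q.j_rec(2) frac_nat[symmetric] rationals_field(3)[symmetric] Q.ad_eq rationals_ring(1) del: Q.one_closed)
    also have "\<dots> = frac (suc m) emp (suc emp)" using m Q by (simp add: rationals_ring qadd_frac)
    finally show "Q.j (suc m) = pr (pr (suc m) emp) (pr (suc emp) emp)" using m by (simp add: frac_nat)
  qed
  then show ?thesis using n by (simp add: frac_nat)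
qed

lemma rationals_rep: "Q.rep q a b c \<longleftrightarrow> a \<in> SN \<and> b \<in> SN \<and> c \<in> SN \<and> c \<noteq> emp \<and> q = frac a b c"
proof -
  have r: "Q.rep (frac a b c) a b c" if "a \<in> SN" "b \<in> SN" "c \<in> SN" "c \<noteq> emp" for a b c
  proof -
    note N = that(1-3)[THEN SN_N] that(4)
    have "Q.mu (frac c emp (suc emp)) (frac a b c) = frac (c \<boxtimes> a) (c \<boxtimes> b) c"
      using N by (simp add: rationals_ring frac_props(1) qmul_frac)
    moreover have "Q.ad (frac (c \<boxtimes> a) (c \<boxtimes> b) c) (frac b emp (suc emp)) = frac (c \<boxtimes> a \<boxplus> b \<boxtimes> c) (c \<boxtimes> b) c"
      using N by (simp add: rationals_ring frac_props(1) qadd_frac)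
    moreover have "frac (c \<boxtimes> a \<boxplus> b \<boxtimes> c) (c \<boxtimes> b) c = frac a emp (suc emp)"
      using N by (simp add: frac_eq_iff nat_simps del: plus_cancel)
    ultimately show ?thesis unfolding Q.rep_iff using that by (simp add: rationals_ring frac_props(1) rationals_j)
  qed
  show ?thesis
  proof
    assume q: "Q.rep q a b c"
    then have "a \<in> SN \<and> b \<in> SN \<and> c \<in> SN \<and> c \<noteq> emp" by (simp add: Q.rep_def)
    then show "a \<in> SN \<and> b \<in> SN \<and> c \<in> SN \<and> c \<noteq> emp \<and> q = frac a b c" using Q.rep_unique[OF q r] by blast
  qed (use r in blast)
qed

lemma std_frac:
  assumes k: "k \<in> SN" and c: "c \<in> SN" "c \<noteq> emp"
  shows "frac k emp c \<in> std_sets mem" "frac emp k c \<in> std_sets mem"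
proof -
  obtain m d where md: "m \<in> \<N>" "d \<in> \<N>" "d \<noteq> emp" "k \<boxtimes> d = m \<boxtimes> c" "ncoprime m d"
    and f: "\<And>w e. w \<in> \<N> \<Longrightarrow> e \<in> \<N> \<Longrightarrow> k \<boxtimes> e = w \<boxtimes> c \<Longrightarrow> \<exists>x\<in>\<N>. e = x \<boxtimes> d \<and> w = x \<boxtimes> m"
    by (rule reduced_ex[OF SN_N[OF k] SN_N[OF c(1)] c(2)]) (rule that)
  obtain x where x: "x \<in> \<N>" "c = x \<boxtimes> d" "k = x \<boxtimes> m" using f[of k c] k c by auto
  have "x \<noteq> emp" using x c md by auto
  moreover have "x \<boxtimes> m \<in> SN" "x \<boxtimes> d \<in> SN" using k c(1) x(2,3) by simp_all
  ultimately have "m \<in> SN" "d \<in> SN" using SN_factor[of x m] SN_factor[of x d] x(1) md(1,2) by blast+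
  then have std: "pr (pr m emp) (pr d emp) \<in> std_sets mem" "pr (pr emp m) (pr d emp) \<in> std_sets mem"
    by (simp_all add: std_pr SN_std std_emp)
  have Q: "pr (pr m emp) (pr d emp) \<in> \<Q>"
    unfolding fractions_iff by (rule bexI[of _ m], rule bexI[of _ emp], rule bexI[of _ d]) (simp_all add: md)
  have Q': "pr (pr emp m) (pr d emp) \<in> \<Q>"
    unfolding fractions_iff by (rule bexI[of _ emp], rule bexI[of _ m], rule bexI[of _ d]) (simp_all add: md)
  have "frac k emp c = frac m emp d" "frac emp k c = frac emp m d" using k c md by (simp_all add: frac_eq_iff)
  then show "frac k emp c \<in> std_sets mem" "frac emp k c \<in> std_sets mem"
    using frac_reduced(1)[OF Q] frac_reduced(1)[OF Q'] std md by simp_all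
qed

lemma rationals_Rat: "Q.Rat = \<Q> \<inter> std_sets mem"
proof (intro Set.set_eqI iffI)
  fix q assume "q \<in> Q.Rat"
  then obtain a b c where n: "a \<in> SN" "b \<in> SN" "c \<in> SN" "c \<noteq> emp" and q: "q = frac a b c"
    by (auto elim!: Q.RatE simp: rationals_rep)
  from Q.SN_diff[OF n(1,2)] have "\<exists>k\<in>SN. q = frac k emp c \<or> q = frac emp k c"
  proof
    assume "\<exists>k\<in>SN. a = b \<boxplus> k"
    then obtain k where "k \<in> SN" "a = b \<boxplus> k" by blast
    then have "q = frac k emp c" unfolding q using n by (simp add: frac_eq_iff nat_simps del: plus_cancel)
    then show ?thesis using \<open>k \<in> SN\<close> by blast
  next
    assume "\<exists>k\<in>SN. b = a \<boxplus> k"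
    then obtain k where "k \<in> SN" "b = a \<boxplus> k" by blast
    then have "q = frac emp k c" unfolding q using n by (simp add: frac_eq_iff nat_simps del: plus_cancel)
    then show ?thesis using \<open>k \<in> SN\<close> by blast
  qed
  then show "q \<in> \<Q> \<inter> std_sets mem" using std_frac n q frac_props(1)[of a b c] by auto
next
  fix q assume q: "q \<in> \<Q> \<inter> std_sets mem"
  then obtain a b d where n: "a \<in> \<N>" "b \<in> \<N>" "d \<in> \<N>" "d \<noteq> emp" "q = pr (pr a b) (pr d emp)" by (auto simp: fractions_iff)
  then have "a \<in> SN" "b \<in> SN" "d \<in> SN" using q std_N_SN by (auto simp: std_pr)
  moreover have "frac a b d = q" using frac_reduced(1)[of a b d] n q by simp
  ultimately have "Q.rep q a b d" using n by (simp add: rationals_rep)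
  then show "q \<in> Q.Rat" by (rule Q.RatI)
qed

theorem prime_subfield_dense:
  assumes K: "real_field mem K"
  shows "\<exists>P. prime_subfield mem K P \<and> isomorphic mem (substructure mem K P) (std_rationals mem) \<and> dense_in mem K P"
proof -
  interpret A: kfield mem K "ring_of mem K" using K by unfold_locales (simp_all add: real_field_def)
  interpret P: rat_pair "ring_of mem K" "fle mem K" "ring_of mem (rationals mem)" "fle mem (rationals mem)"
    SN emp "suc emp" "(\<boxplus>)" "(\<boxtimes>)" "nle mem" A.j Q.j
    by unfold_locales
  have std: "std_rationals mem = substructure mem (rationals mem) (cls Q.Rat)" by (simp add: std_rationals_def rationals_Rat)
  have "isomorphic mem (substructure mem K (cls A.Rat)) (std_rationals mem)" unfolding std
  proof (rule isomorphic_graphI)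
    have "dfn True (\<lambda>v. \<exists>a\<in>SN. \<exists>b\<in>SN. \<exists>c\<in>SN. A.rep (v 0) a b c \<and> Q.rep (v 1) a b c)"
      by (intro dfn_intros is_class_SN)
    then show "dfn True (\<lambda>v. P.E (v 0) (v 1))" by (rule dfn_back) (auto simp: P.E_def A.rep_def)
    show "P.E x y \<Longrightarrow> x \<epsilon> Carr (substructure mem K (cls A.Rat)) \<and> y \<epsilon> Carr (substructure mem (rationals mem) (cls Q.Rat))" for x y
      using P.E_Rat by (simp add: A.Rat_substructure(1) Q.Rat_substructure(1) A.in_cls_Rat Q.in_cls_Rat)
    show "x \<epsilon> Carr (substructure mem K (cls A.Rat)) \<Longrightarrow> \<exists>y. P.E x y" for x
      using P.E_ex by (simp add: A.Rat_substructure(1) A.in_cls_Rat)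
    show "y \<epsilon> Carr (substructure mem (rationals mem) (cls Q.Rat)) \<Longrightarrow> \<exists>x. P.E x y" for y
      using P.E_ex' by (simp add: Q.Rat_substructure(1) Q.in_cls_Rat)
    show "P.E x y \<Longrightarrow> P.E x y' \<Longrightarrow> y = y'" "P.E x y \<Longrightarrow> P.E x' y \<Longrightarrow> x = x'" for x y x' y'
      using P.E_eq by blast+
    fix x y x' y' assume e: "P.E x y" "P.E x' y'"
    note r = P.E_Rat[OF e(1)] P.E_Rat[OF e(2)]
    show "P.E (fadd mem (substructure mem K (cls A.Rat)) x x') (fadd mem (substructure mem (rationals mem) (cls Q.Rat)) y y')"
      "P.E (fmul mem (substructure mem K (cls A.Rat)) x x') (fmul mem (substructure mem (rationals mem) (cls Q.Rat)) y y')"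
      "fle mem (substructure mem K (cls A.Rat)) x x' \<longleftrightarrow> fle mem (substructure mem (rationals mem) (cls Q.Rat)) y y'"
      using P.E_add[OF e] P.E_mult[OF e] P.E_lq[OF e] r by (simp_all add: A.Rat_substructure(2-4) Q.Rat_substructure(2-4))
  qed
  then show ?thesis using A.prime_subfield_Rat A.dense_Rat[OF A.real_arch[OF K]] by blast
qed

end

section \<open>Existence of a thin field of real numbers\<close>

locale reals = kfield mem K R for mem :: "'a \<Rightarrow> 'a \<Rightarrow> bool" (infix "\<epsilon>" 50) and K and R (structure) +
  fixes C0 :: "'a set"
  assumes thin_C0: "thin_class C0" and C0_ex1: "\<And>y. y \<in> \<S> \<Longrightarrow> \<exists>!r. r \<in> C0 \<and> el r \<inter> Rat = el y \<inter> Rat"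
    and sep: "\<And>q x. q \<in> carrier R \<Longrightarrow> x \<in> \<S> \<Longrightarrow> is_set {b \<in> el x. b \<in> carrier R \<and> fle mem K q b}"
      "\<And>q x. q \<in> carrier R \<Longrightarrow> x \<in> \<S> \<Longrightarrow> is_set {b \<in> el x. b \<in> carrier R \<and> fle mem K b q}"
begin

text \<open>The members of \<open>C0\<close> code the subclasses of \<open>Rat\<close>; \<open>code r b\<close> says that \<open>r\<close> codes the cut made by \<open>b\<close>.\<close>

definition code :: "'a \<Rightarrow> 'a \<Rightarrow> bool" where
  "code r b \<longleftrightarrow> bdd b \<and> r \<in> C0 \<and> (\<forall>q\<in>Rat. q \<epsilon> r \<longleftrightarrow> far q b)"

lemma codeD: "code r b \<Longrightarrow> bdd b" "code r b \<Longrightarrow> b \<in> carrier R" "code r b \<Longrightarrow> r \<in> C0"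
  "code r b \<Longrightarrow> q \<in> Rat \<Longrightarrow> q \<epsilon> r \<longleftrightarrow> far q b"
  using bdd_closed by (auto simp: code_def)

lemma C0_S: "r \<in> C0 \<Longrightarrow> r \<in> \<S>"
  using is_class_sub_S[OF thin_class_class[OF thin_C0]] by blast

lemma code_S: "code r b \<Longrightarrow> r \<in> \<S>" "code r b \<Longrightarrow> b \<in> \<S>"
  using C0_S codeD(2,3) carrier_S by blast+

lemma dfn_code [dfn_intros]:
  assumes "dterm True t" "dterm True s"
  shows "dfn True (\<lambda>v. code (t v) (s v))"
proof -
  have "dfn True (\<lambda>v. s v \<in> {b. bdd b} \<and> t v \<in> C0 \<and>
      (\<forall>q\<in>Rat. q \<epsilon> t v \<longleftrightarrow> q \<in> carrier R \<and> s v \<in> carrier R \<and> far q (s v)))"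
    by (intro dfn_intros is_class_bdd is_class_Rat thin_class_class[OF thin_C0] assms dterm_shift)
  then show ?thesis by (rule dfn_back) (use bdd_closed Rat_closed in \<open>auto simp: code_def\<close>)
qed

lemma code_ex: "bdd b \<Longrightarrow> \<exists>r. code r b"
proof -
  assume b: "bdd b"
  have bc: "b \<in> carrier R" using b by (rule bdd_closed)
  define Y where "Y = {q \<in> \<S>. q \<in> Rat \<and> q \<in> carrier R \<and> b \<in> carrier R \<and> far q b}"
  have cl: "is_class Y" unfolding Y_def by (rule comprehension) (intro dfn_intros is_class_Rat carrier_S[OF bc])
  obtain y where y: "y \<in> \<S>" "el y \<inter> Rat = Y" using thin_trace[OF thin_Rat cl] unfolding Y_def by blast
  obtain r where r: "r \<in> C0" "el r \<inter> Rat = el y \<inter> Rat" using C0_ex1[OF y(1)] by blast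
  have "q \<epsilon> r \<longleftrightarrow> far q b" if "q \<in> Rat" for q
  proof -
    have "q \<epsilon> r \<longleftrightarrow> q \<in> el r \<inter> Rat" using that by simp
    also have "\<dots> \<longleftrightarrow> far q b" unfolding r(2) y(2) Y_def using that Rat_closed bc carrier_S by blast
    finally show ?thesis .
  qed
  then show ?thesis using b r(1) unfolding code_def by blast
qed

lemma code_near:
  assumes r: "code r b" and b': "bdd b'" "near b b'"
  shows "code r b'"
proof -
  have "far q b \<longleftrightarrow> far q b'" if "q \<in> Rat" for q
    using not_far_trans[OF codeD(1)[OF r] b'(1) bdd_Rat[OF that]] not_far_trans[OF b'(1) codeD(1)[OF r] bdd_Rat[OF that]] b'(2)
    unfolding near_def by blast
  then show ?thesis using r b' unfolding code_def by blast
qed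

lemma code_eq:
  assumes r: "code r b" and s: "code s b'"
  shows "r = s \<longleftrightarrow> near b b'"
proof
  assume rs: "r = s"
  have "\<not> far x y" if c: "code r x" "code r y" for x y
  proof
    assume "far x y"
    then obtain q where q: "q \<in> Rat" "far x q" "far q y"
      using far_interp[OF codeD(1)[OF c(1)] codeD(2)[OF c(2)]] by blast
    then have "far q x" using codeD(4)[OF c(1)] codeD(4)[OF c(2)] by blast
    then show False using q far_trans[of x q x] far_not_lq[of x x] lq_refl codeD(2)[OF c(1)] Rat_closed by blast
  qed
  then show "near b b'" using r s rs unfolding near_def by blast
next
  assume "near b b'"
  then have "code r b'" using code_near[OF r codeD(1)[OF s]] by blast
  then have "el r \<inter> Rat = el s \<inter> Rat" using s by (auto simp: code_def)
  then show "r = s" using C0_ex1[OF code_S(1)[OF s]] codeD(3)[OF r] codeD(3)[OF s] by blast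
qed

definition Codes :: "'a set" where
  "Codes = {r \<in> \<S>. \<exists>b\<in>\<S>. code r b}"

lemma CodesI: "code r b \<Longrightarrow> r \<in> Codes"
  using code_S by (auto simp: Codes_def)

lemma CodesE: "r \<in> Codes \<Longrightarrow> (\<And>b. code r b \<Longrightarrow> thesis) \<Longrightarrow> thesis"
  by (auto simp: Codes_def)

lemma thin_Codes: "thin_class Codes"
proof (rule thin_class_subset[OF thin_C0])
  show "is_class Codes" unfolding Codes_def by (rule comprehension) (intro dfn_intros)
  show "Codes \<subseteq> C0" using codeD(3) by (auto simp: Codes_def)
qed

lemma in_Codes: "x \<epsilon> cls Codes \<longleftrightarrow> x \<in> Codes"
  using el_cls[OF thin_class_class[OF thin_Codes]] in_el[of x "cls Codes"] by simp

definition lift2 :: "('a \<Rightarrow> 'a \<Rightarrow> 'a) \<Rightarrow> 'a \<Rightarrow> 'a \<Rightarrow> 'a \<Rightarrow> bool" where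
  "lift2 f r s t \<longleftrightarrow> (\<exists>b\<in>\<S>. \<exists>b'\<in>\<S>. code r b \<and> code s b' \<and> code t (f b b'))"

definition op2 :: "('a \<Rightarrow> 'a \<Rightarrow> 'a) \<Rightarrow> 'a \<Rightarrow> 'a \<Rightarrow> 'a" where
  "op2 f r s = (THE t. lift2 f r s t)"

lemma lift2:
  assumes f: "\<And>x y. bdd x \<Longrightarrow> bdd y \<Longrightarrow> bdd (f x y)"
    and fn: "\<And>x x' y. bdd x \<Longrightarrow> bdd x' \<Longrightarrow> bdd y \<Longrightarrow> near x x' \<Longrightarrow> near (f x y) (f x' y)"
    and fc: "\<And>x y. bdd x \<Longrightarrow> bdd y \<Longrightarrow> f x y = f y x"
    and rs: "code r b" "code s b'"
  shows "code (op2 f r s) (f b b')" "lift2 f r s t \<longleftrightarrow> t = op2 f r s"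
proof -
  have iff: "lift2 f r s t \<longleftrightarrow> code t (f b b')" for t
  proof
    assume "lift2 f r s t"
    then obtain c c' where c: "code r c" "code s c'" "code t (f c c')" by (auto simp: lift2_def)
    note B = codeD(1)[OF rs(1)] codeD(1)[OF rs(2)] codeD(1)[OF c(1)] codeD(1)[OF c(2)]
    have n: "near c b" "near c' b'" using code_eq[OF c(1) rs(1)] code_eq[OF c(2) rs(2)] by simp_all
    have "near (f c c') (f b c')" using fn[OF B(3,1,4) n(1)] .
    moreover have "near (f b c') (f b b')" using fn[OF B(4,2,1) n(2)] fc B by simp
    ultimately have "near (f c c') (f b b')" using near_trans[OF f f f] B by blast
    then show "code t (f b b')" using code_near[OF c(3)] f B by blast
  next
    assume "code t (f b b')"
    then show "lift2 f r s t" unfolding lift2_def using rs code_S(2) by blast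
  qed
  have "bdd (f b b')" using f rs codeD(1) by blast
  then have "\<exists>!t. lift2 f r s t" unfolding iff using code_ex code_eq near_refl by blast
  then show "code (op2 f r s) (f b b')" "lift2 f r s t \<longleftrightarrow> t = op2 f r s"
    unfolding iff[symmetric] op2_def by (metis theI')+
qed

definition leq :: "'a \<Rightarrow> 'a \<Rightarrow> bool" where
  "leq r s \<longleftrightarrow> (\<exists>b\<in>\<S>. \<exists>b'\<in>\<S>. code r b \<and> code s b' \<and> \<not> (b' \<in> carrier R \<and> b \<in> carrier R \<and> far b' b))"

lemma leq:
  assumes rs: "code r b" "code s b'"
  shows "leq r s \<longleftrightarrow> \<not> far b' b"
proof
  assume "leq r s"
  then obtain c c' where c: "code r c" "code s c'" "\<not> far c' c" using codeD(2) by (auto simp: leq_def)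
  note B = codeD(1)[OF rs(1)] codeD(1)[OF rs(2)] codeD(1)[OF c(1)] codeD(1)[OF c(2)]
  have n: "near c b" "near c' b'" using code_eq[OF c(1) rs(1)] code_eq[OF c(2) rs(2)] by simp_all
  have "\<not> far c' b" using not_far_trans[OF B(1,3,4)] n c(3) by (simp add: near_def)
  then show "\<not> far b' b" using not_far_trans[OF B(1,4,2)] n by (simp add: near_def)
next
  assume "\<not> far b' b"
  then show "leq r s" unfolding leq_def using rs code_S(2) by blast
qed

definition real_K :: "'a ofield" where
  "real_K = mkfield (cls Codes) (op2 ad) (op2 mu) leq"

lemma bdd_ad: "bdd x \<Longrightarrow> bdd y \<Longrightarrow> bdd (ad x y)"
  and near_ad: "bdd x \<Longrightarrow> bdd x' \<Longrightarrow> bdd y \<Longrightarrow> near x x' \<Longrightarrow> near (ad x y) (ad x' y)"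
  and ad_comm: "bdd x \<Longrightarrow> bdd y \<Longrightarrow> ad x y = ad y x"
  and bdd_mu: "bdd x \<Longrightarrow> bdd y \<Longrightarrow> bdd (mu x y)"
  and near_mu: "bdd x \<Longrightarrow> bdd x' \<Longrightarrow> bdd y \<Longrightarrow> near x x' \<Longrightarrow> near (mu x y) (mu x' y)"
  and mu_comm: "bdd x \<Longrightarrow> bdd y \<Longrightarrow> mu x y = mu y x"
  using bdd_add bdd_mult near_add near_mult bdd_closed a_comm m_comm by (simp_all add: ad_eq mu_eq)

lemma lift_ad: "code r b \<Longrightarrow> code s b' \<Longrightarrow> code (op2 ad r s) (ad b b')"
    "code r b \<Longrightarrow> code s b' \<Longrightarrow> lift2 ad r s t \<longleftrightarrow> t = op2 ad r s"
  and lift_mu: "code r b \<Longrightarrow> code s b' \<Longrightarrow> code (op2 mu r s) (mu b b')"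
    "code r b \<Longrightarrow> code s b' \<Longrightarrow> lift2 mu r s t \<longleftrightarrow> t = op2 mu r s"
  using lift2[of ad r b s b'] lift2[of mu r b s b'] bdd_ad near_ad ad_comm bdd_mu near_mu mu_comm by blast+

lemma real_K_ops:
  shows "field_class real_K" "el (Carr real_K) = Codes"
    "code r b \<Longrightarrow> code s b' \<Longrightarrow> code (fadd mem real_K r s) (b \<oplus> b')"
    "code r b \<Longrightarrow> code s b' \<Longrightarrow> code (fmul mem real_K r s) (b \<otimes> b')"
    "code r b \<Longrightarrow> code s b' \<Longrightarrow> fle mem real_K r s \<longleftrightarrow> \<not> far b' b"
proof -
  have D: "dfn True (\<lambda>v. lift2 ad (v 0) (v 1) (v 2))" "dfn True (\<lambda>v. lift2 mu (v 0) (v 1) (v 2))" "dfn True (\<lambda>v. leq (v 0) (v 1))"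
    unfolding lift2_def leq_def by (intro dfn_intros is_class_carrier)+
  have cl: "op2 ad r s \<epsilon> cls Codes" "op2 mu r s \<epsilon> cls Codes" if "r \<epsilon> cls Codes" "s \<epsilon> cls Codes" for r s
    using that lift_ad(1) lift_mu(1) unfolding in_Codes by (meson CodesE CodesI)+
  have li: "lift2 ad r s t \<longleftrightarrow> t = op2 ad r s" "lift2 mu r s t \<longleftrightarrow> t = op2 mu r s" if c: "r \<epsilon> cls Codes" "s \<epsilon> cls Codes" for r s t
  proof -
    obtain b b' where b: "code r b" "code s b'" using c unfolding in_Codes by (metis CodesE)
    show "lift2 ad r s t \<longleftrightarrow> t = op2 ad r s" "lift2 mu r s t \<longleftrightarrow> t = op2 mu r s"
      by (rule lift_ad(2)[OF b] lift_mu(2)[OF b])+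
  qed
  note M = mkfield_class[of "cls Codes" "op2 ad" "lift2 ad" "op2 mu" "lift2 mu" leq leq, OF cl(1) D(1) li(1) cl(2) D(2) li(2) D(3) refl, folded real_K_def]
  show "field_class real_K" using M(1) by blast
  show "el (Carr real_K) = Codes" by (auto simp: real_K_def in_Codes)
  assume rs: "code r b" "code s b'"
  have C: "r \<epsilon> cls Codes" "s \<epsilon> cls Codes" unfolding in_Codes using rs CodesI by blast+
  have c: "b \<in> carrier R" "b' \<in> carrier R" using rs codeD(2) by blast+
  have e: "fadd mem real_K r s = op2 ad r s" "fmul mem real_K r s = op2 mu r s" "fle mem real_K r s \<longleftrightarrow> leq r s"
    using M(2-4) C by blast+
  show "code (fadd mem real_K r s) (b \<oplus> b')" using e lift_ad(1)[OF rs] c by (simp add: ad_eq)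
  show "code (fmul mem real_K r s) (b \<otimes> b')" using e lift_mu(1)[OF rs] c by (simp add: mu_eq)
  show "fle mem real_K r s \<longleftrightarrow> \<not> far b' b" using e leq[OF rs] by simp
qed

lemma real_K_field: "ordered_field mem real_K"
proof -
  obtain z o' where z: "code z \<zero>" and o: "code o' \<one>" using code_ex bdd_zero bdd_one by blast
  note add = real_K_ops(3) and mul = real_K_ops(4) and le = real_K_ops(5)
  have eq: "r = s" if "code r b" "code s b'" "b = b'" for r s b b'
    using code_eq[OF that(1,2)] near_refl codeD(1)[OF that(1)] that(3) by simp
  note c = codeD(2)
  show ?thesis
  proof (rule ordered_fieldI(1)[of real_K z o', unfolded real_K_ops(2)])
    show "field_class real_K" by (rule real_K_ops)
    show "z \<in> Codes" "o' \<in> Codes" using z o CodesI by blast+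
    show "z \<noteq> o'" using code_eq[OF z o] far_01 by (simp add: near_def)
  next
    fix x assume x: "x \<in> Codes"
    then obtain b where b: "code x b" by (rule CodesE)
    note bc = c[OF b]
    show "fadd mem real_K z x = x" by (rule eq[OF add[OF z b] b]) (simp add: bc)
    show "fmul mem real_K o' x = x" by (rule eq[OF mul[OF o b] b]) (simp add: bc)
    show "fle mem real_K x x" using le[OF b b] far_not_lq[OF bc bc] lq_refl[OF bc] by blast
    obtain y where y: "code y (\<ominus> b)" using code_ex bdd_neg[OF codeD(1)[OF b]] by blast
    have "fadd mem real_K y x = z" by (rule eq[OF add[OF y b] z]) (simp add: bc l_neg)
    then show "\<exists>y\<in>Codes. fadd mem real_K y x = z" using CodesI[OF y] by blast
    assume "x \<noteq> z"
    then have "\<not> near b \<zero>" using code_eq[OF b z] by simp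
    then obtain w where w: "bdd w" "b \<otimes> w = \<one>" using near_inv[OF codeD(1)[OF b]] by blast
    obtain u where u: "code u w" using code_ex w by blast
    have "fmul mem real_K x u = o'" by (rule eq[OF mul[OF b u] o w(2)])
    then show "\<exists>y\<in>Codes. fmul mem real_K x y = o'" using CodesI[OF u] by blast
  next
    fix x y assume "x \<in> Codes" "y \<in> Codes"
    then obtain a b where b: "code x a" "code y b" by (metis CodesE)
    note bc = c[OF b(1)] c[OF b(2)]
    show "fadd mem real_K x y = fadd mem real_K y x" by (rule eq[OF add[OF b] add[OF b(2,1)]]) (rule a_comm[OF bc])
    show "fmul mem real_K x y = fmul mem real_K y x" by (rule eq[OF mul[OF b] mul[OF b(2,1)]]) (rule m_comm[OF bc])
    show "fle mem real_K x y \<or> fle mem real_K y x"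
      unfolding le[OF b] le[OF b(2,1)] using far_not_lq far_lq lq_linear bc by metis
    show "fle mem real_K x y \<Longrightarrow> fle mem real_K y x \<Longrightarrow> x = y"
      unfolding le[OF b] le[OF b(2,1)] code_eq[OF b] near_def by blast
    show "fle mem real_K z x \<Longrightarrow> fle mem real_K z y \<Longrightarrow> fle mem real_K z (fmul mem real_K x y)"
      unfolding le[OF z b(1)] le[OF z b(2)] le[OF z mul[OF b]] using not_far_mult codeD(1)[OF b(1)] codeD(1)[OF b(2)] by blast
  next
    fix x y w assume "x \<in> Codes" "y \<in> Codes" "w \<in> Codes"
    then obtain a b d where b: "code x a" "code y b" "code w d" by (metis CodesE)
    note bc = c[OF b(1)] c[OF b(2)] c[OF b(3)]
    show "fadd mem real_K (fadd mem real_K x y) w = fadd mem real_K x (fadd mem real_K y w)"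
      by (rule eq[OF add[OF add[OF b(1,2)] b(3)] add[OF b(1) add[OF b(2,3)]]]) (rule a_assoc[OF bc])
    show "fmul mem real_K (fmul mem real_K x y) w = fmul mem real_K x (fmul mem real_K y w)"
      by (rule eq[OF mul[OF mul[OF b(1,2)] b(3)] mul[OF b(1) mul[OF b(2,3)]]]) (rule m_assoc[OF bc])
    show "fmul mem real_K (fadd mem real_K x y) w = fadd mem real_K (fmul mem real_K x w) (fmul mem real_K y w)"
      by (rule eq[OF mul[OF add[OF b(1,2)] b(3)] add[OF mul[OF b(1,3)] mul[OF b(2,3)]]]) (rule l_distr[OF bc])
    show "fle mem real_K x y \<Longrightarrow> fle mem real_K y w \<Longrightarrow> fle mem real_K x w"
      unfolding le[OF b(1,2)] le[OF b(2,3)] le[OF b(1,3)] using not_far_trans b codeD(1) by blast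
    show "fle mem real_K x y \<Longrightarrow> fle mem real_K (fadd mem real_K x w) (fadd mem real_K y w)"
      unfolding le[OF b(1,2)] le[OF add[OF b(1,3)] add[OF b(2,3)]] using far_add bc by simp
  qed
qed

lemma bdd_between:
  assumes b: "bdd x" "bdd y" and z: "z \<in> carrier R" "fle mem K x z" "fle mem K z y"
  shows "bdd z"
proof -
  obtain m where m: "m \<in> SN" "nn (j m \<oplus> x)" using b(1) by (auto simp: bdd_def)
  obtain n where n: "n \<in> SN" "nn (j n \<ominus> y)" using b(2) by (auto simp: bdd_def)
  note c = bdd_closed[OF b(1)] bdd_closed[OF b(2)] z(1) j_rec(3)[OF m(1)] j_rec(3)[OF n(1)]
  have d: "nn (y \<ominus> z)" "nn (z \<ominus> x)" using z c by (simp_all add: lq_iff)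
  have e: "(j m \<oplus> j n) \<ominus> z = j m \<oplus> ((j n \<ominus> y) \<oplus> (y \<ominus> z))" "(j m \<oplus> j n) \<oplus> z = j n \<oplus> ((j m \<oplus> x) \<oplus> (z \<ominus> x))"
    using c by algebra+
  have "nn (j (m \<boxplus> n) \<ominus> z)" "nn (j (m \<boxplus> n) \<oplus> z)"
    unfolding j_plus[OF m(1) n(1)] e using nn_add nn_j m n d by blast+
  then show ?thesis unfolding bdd_def using z(1) SN_plus[OF m(1) n(1)] by blast
qed

lemma real_K_complete:
  assumes X: "is_class X" "X \<subseteq> Codes" "X \<noteq> {}" and u: "u \<in> Codes" "\<And>x. x \<in> X \<Longrightarrow> fle mem real_K x u"
  shows "\<exists>s\<in>Codes. (\<forall>x\<in>X. fle mem real_K x s) \<and> (\<forall>v\<in>Codes. (\<forall>x\<in>X. fle mem real_K x v) \<longrightarrow> fle mem real_K s v)"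
proof -
  define Y where "Y = {q \<in> \<S>. q \<in> Rat \<and> (\<exists>x\<in>X. q \<epsilon> x)}"
  have Ycl: "is_class Y" unfolding Y_def by (rule comprehension) (intro dfn_intros is_class_Rat X)
  have Y: "q \<in> Y \<longleftrightarrow> q \<in> Rat \<and> (\<exists>x\<in>X. q \<epsilon> x)" for q unfolding Y_def using Rat_closed carrier_S by blast
  have YI: "q \<in> Y" if "x \<in> X" "code x b" "q \<in> Rat" "far q b" for q x b
    using that codeD(4) Y by blast
  have YE: "\<exists>x b. x \<in> X \<and> code x b \<and> far q b" if "q \<in> Y" for q
    using that X(2) codeD(4) unfolding Y by (meson CodesE subsetD)
  have YR: "q \<in> Rat" "q \<in> carrier R" if "q \<in> Y" for q using that Y Rat_closed by blast+
  obtain d where d: "code u d" using u(1) by (rule CodesE)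
  obtain q0 where q0: "q0 \<in> Y"
  proof -
    obtain x b where x: "x \<in> X" "code x b" using X(2,3) CodesE by blast
    have b: "bdd b" "b \<in> carrier R" using codeD[OF x(2)] by blast+
    have "bdd (b \<oplus> \<ominus> \<one>)" using bdd_add bdd_neg b bdd_one by blast
    moreover have "far (b \<oplus> \<ominus> \<one>) b"
    proof -
      have "(b \<oplus> \<ominus> \<one>) \<oplus> \<one> = b" using b by algebra
      then show ?thesis using far_add_one[of "b \<oplus> \<ominus> \<one>"] b by simp
    qed
    ultimately obtain q where "q \<in> Rat" "far q b" using far_interp b by blast
    then show thesis using that YI x by blast
  qed
  obtain q1 where q1: "q1 \<in> Rat" "q1 \<notin> Y"
  proof -
    have b: "bdd d" "d \<in> carrier R" using codeD[OF d] by blast+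
    obtain q where q: "q \<in> Rat" "far d q" using far_interp[OF b(1), of "d \<oplus> \<one>"] far_add_one[OF b(2)] b by auto
    have "q \<notin> Y"
    proof
      assume "q \<in> Y"
      then obtain x b' where x: "x \<in> X" "code x b'" "far q b'" using YE by blast
      then have "far d b'" using far_trans[of d q b'] q b Rat_closed codeD(2) by blast
      then show False using u(2)[OF x(1)] real_K_ops(5)[OF x(2) d] by blast
    qed
    then show thesis using that q by blast
  qed
  obtain U where U: "U \<in> \<S>" "Rat \<subseteq> el U" using thin_subset_set[OF thin_Rat] by blast
  have down: "fle mem K b q" if "b \<in> Y" "q \<in> Rat" "q \<notin> Y" for b q
  proof -
    obtain x b' where x: "x \<in> X" "code x b'" "far b b'" using YE \<open>b \<in> Y\<close> by blast
    have c: "b \<in> carrier R" "q \<in> carrier R" "b' \<in> carrier R" using that YR Rat_closed codeD(2) x by blast+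
    have "\<not> fle mem K q b" using lq_far_trans[of q b b'] c x YI[of x b' q] that by blast
    then show ?thesis using lq_linear c by blast
  qed
  define B where "B q b \<longleftrightarrow> b \<in> carrier R \<and> (q \<in> Y \<longrightarrow> fle mem K q b) \<and> (q \<notin> Y \<longrightarrow> fle mem K b q)" for q b
  have "\<exists>b\<in>el U. \<forall>q\<in>Rat. B q b"
  proof (rule thin_compact[OF thin_Rat U(1)])
    show "dfn True (\<lambda>v. B (v 0) (v 1))"
      unfolding B_def by (intro dfn_intros Ycl is_class_carrier)
    show "is_set {b \<in> el U. B q b}" if "q \<in> Rat" for q
      using sep[of q U] U(1) Rat_closed[OF that] unfolding B_def by (cases "q \<in> Y") simp_all
    fix x assume x: "small mem x" "el x \<subseteq> Rat"
    have "\<exists>b\<in>Y. \<forall>q\<in>el x. q \<in> Y \<longrightarrow> fle mem K q b"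
    proof (rule small_induct[of "\<lambda>x. \<exists>b\<in>Y. \<forall>q\<in>el x. q \<in> Y \<longrightarrow> fle mem K q b", OF _ x(1)])
      show "dfn True (\<lambda>v. \<exists>b\<in>Y. \<forall>q\<in>el (v 0). q \<in> Y \<longrightarrow> fle mem K q b)"
        by (intro dfn_intros Ycl)
      show "\<exists>b\<in>Y. \<forall>q\<in>el emp. q \<in> Y \<longrightarrow> fle mem K q b" using q0 by auto
      fix y a assume y: "y \<in> \<S>" "el y \<subseteq> el x" "a \<epsilon> x" and IH: "\<exists>b\<in>Y. \<forall>q\<in>el y. q \<in> Y \<longrightarrow> fle mem K q b"
      then obtain b where b: "b \<in> Y" "\<And>q. q \<epsilon> y \<Longrightarrow> q \<in> Y \<Longrightarrow> fle mem K q b" by auto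
      have aR: "a \<in> Rat" "a \<in> carrier R" using y(3) x(2) Rat_closed by auto
      have eA: "el (adj y a) = insert a (el y)" using el_adj y(1) el_S[OF y(3)] by blast
      show "\<exists>b\<in>Y. \<forall>q\<in>el (adj y a). q \<in> Y \<longrightarrow> fle mem K q b"
      proof (cases "a \<in> Y \<and> \<not> fle mem K a b")
        case True
        then have "fle mem K b a" using lq_linear aR YR(2)[OF b(1)] by blast
        then have "\<forall>q\<in>el (adj y a). q \<in> Y \<longrightarrow> fle mem K q a"
          unfolding eA using b lq_refl[OF aR(2)] lq_trans[of _ b a] YR(2) aR by auto
        then show ?thesis using True by blast
      next
        case False
        then have "\<forall>q\<in>el (adj y a). q \<in> Y \<longrightarrow> fle mem K q b" unfolding eA using b by auto
        then show ?thesis using b(1) by blast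
      qed
    qed
    then obtain b where b: "b \<in> Y" "\<forall>q\<in>el x. q \<in> Y \<longrightarrow> fle mem K q b" by blast
    have "b \<in> el U" using YR(1)[OF b(1)] U by blast
    moreover have "\<forall>q\<in>el x. B q b" unfolding B_def using b down YR(2) x(2) by blast
    ultimately show "\<exists>a\<in>el U. \<forall>i\<in>el x. B i a" by blast
  qed
  then obtain b where b: "\<And>q. q \<in> Rat \<Longrightarrow> B q b" by blast
  have bc: "b \<in> carrier R" using b[OF q1(1)] by (simp add: B_def)
  have b0: "fle mem K q b" if "q \<in> Y" for q using b[OF YR(1)[OF that]] that by (simp add: B_def)
  have b1: "fle mem K b q" if "q \<in> Rat" "q \<notin> Y" for q using b that by (simp add: B_def)
  have "bdd b" using bdd_between[OF bdd_Rat[OF YR(1)[OF q0]] bdd_Rat[OF q1(1)] bc b0[OF q0] b1[OF q1]] .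
  then obtain s where s: "code s b" using code_ex by blast
  have "fle mem real_K x s" if x: "x \<in> X" for x
  proof -
    obtain a where a: "code x a" using X(2) x CodesE by blast
    have "\<not> far b a"
    proof
      assume "far b a"
      then obtain q where q: "q \<in> Rat" "far b q" "far q a" using far_interp[OF \<open>bdd b\<close> codeD(2)[OF a]] by blast
      then have "fle mem K q b" using YI[OF x a] b0 by blast
      then show False using far_not_lq[OF bc Rat_closed] q by blast
    qed
    then show ?thesis using real_K_ops(5)[OF a s] by blast
  qed
  moreover have "fle mem real_K s v" if v: "v \<in> Codes" "\<And>x. x \<in> X \<Longrightarrow> fle mem real_K x v" for v
  proof -
    obtain e where e: "code v e" using v(1) by (rule CodesE)
    have "\<not> far e b"
    proof
      assume "far e b"
      then obtain q where q: "q \<in> Rat" "far e q" "far q b" using far_interp[OF codeD(1)[OF e] bc] by blast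
      then have "q \<in> Y" using far_not_lq[OF Rat_closed bc] b1 by blast
      then obtain x a where x: "x \<in> X" "code x a" "far q a" using YE by blast
      then have "far e a" using far_trans[of e q a] q codeD(2) e Rat_closed by blast
      then show False using v(2)[OF x(1)] real_K_ops(5)[OF x(2) e] by blast
    qed
    then show ?thesis using real_K_ops(5)[OF s e] by blast
  qed
  ultimately show ?thesis using CodesI[OF s] by blast
qed

theorem real_K: "thin mem (Carr real_K)" "real_field mem real_K"
proof -
  show "thin mem (Carr real_K)" unfolding thin_iff real_K_ops(2) by (rule thin_Codes)
  have inC: "x \<epsilon> Carr real_K \<longleftrightarrow> x \<in> Codes" for x using real_K_ops(2) in_el[of x "Carr real_K"] by simp
  show "real_field mem real_K"
    unfolding real_field_def
  proof (intro conjI allI impI real_K_field)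
    fix X assume X: "el X \<subseteq> el (Carr real_K) \<and> el X \<noteq> {} \<and> (\<exists>b. is_upper_bound mem real_K X b)"
    then obtain u where u: "u \<in> Codes" "\<And>x. x \<in> el X \<Longrightarrow> fle mem real_K x u"
      unfolding is_upper_bound_def inC by blast
    have "\<exists>s\<in>Codes. (\<forall>x\<in>el X. fle mem real_K x s) \<and> (\<forall>v\<in>Codes. (\<forall>x\<in>el X. fle mem real_K x v) \<longrightarrow> fle mem real_K s v)"
      using real_K_complete[OF is_class_el _ _ u] X unfolding real_K_ops(2) by blast
    then show "\<exists>s. is_supremum mem real_K X s" unfolding is_supremum_def is_upper_bound_def inC by blast
  qed
qed

end

context ths begin

theorem ex_thin_real_field: "\<exists>K. thin mem (Carr K) \<and> real_field mem K"
proof -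
  interpret Q: kfield mem "rationals mem" "ring_of mem (rationals mem)" by (rule kfield_rationals)
  obtain C0 where C0: "thin_class C0" "\<And>y. y \<in> \<S> \<Longrightarrow> \<exists>!r. r \<in> C0 \<and> el r \<inter> Q.Rat = el y \<inter> Q.Rat"
    using thin_power[OF Q.thin_Rat] Q.Rat_zero by blast
  interpret L: reals mem "rationals mem" "ring_of mem (rationals mem)" C0
  proof (unfold_locales; (fact C0)?)
    fix q x assume qx: "q \<in> carrier (ring_of mem (rationals mem))" "x \<in> \<S>"
    note q = qx(1)[unfolded rationals_ring(1)]
    have "is_set {b \<in> el x. b \<in> \<Q> \<and> qle_fo q b}" "is_set {b \<in> el x. b \<in> \<Q> \<and> qle_fo b q}"
      by (intro separation dfn_intros is_set_el qx(2) dfn2[OF dfn_qle_fo] fractions_S[OF q])+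
    moreover have "qle_fo q b \<longleftrightarrow> fle mem (rationals mem) q b" "qle_fo b q \<longleftrightarrow> fle mem (rationals mem) b q" if "b \<in> \<Q>" for b
      using that q by (simp_all add: qle_fo rationals_ops)
    ultimately show "is_set {b \<in> el x. b \<in> carrier (ring_of mem (rationals mem)) \<and> fle mem (rationals mem) q b}"
      "is_set {b \<in> el x. b \<in> carrier (ring_of mem (rationals mem)) \<and> fle mem (rationals mem) b q}"
      unfolding rationals_ring(1) by (simp_all cong: conj_cong)
  qed
  show ?thesis using L.real_K by blast
qed

end

theorem theorem5:
  fixes mem :: "'a \<Rightarrow> 'a \<Rightarrow> bool"
  assumes "THS mem"
  shows "(\<exists>K. thin mem (Carr K) \<and> real_field mem K) \<and>
         (\<forall>K. real_field mem K \<longrightarrow>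
            (\<exists>P. prime_subfield mem K P \<and>
                 isomorphic mem (substructure mem K P) (std_rationals mem) \<and>
                 dense_in mem K P)) \<and>
         (\<forall>K L. real_field mem K \<and> real_field mem L \<longrightarrow> isomorphic mem K L)"
proof -
  interpret ths mem by unfold_locales (rule assms)
  show ?thesis using ex_thin_real_field prime_subfield_dense real_fields_isomorphic by blast
qed

end
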